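(* Let $X$ be a compact Hausdorff space and let $\Gamma$ be a discrete group acting on $X$ by homeomorphisms. For any irreducible representation $\pi: C(X)\rtimes\Gamma\to B(H)$ on a Hilbert space $H$, we have $\dim H_\Gamma\leq 1$. If $H_\Gamma\neq 0$, then there exists a unique ergodic $\Gamma$-invariant state $\varphi$ on $C(X)$ (equivalently, a unique ergodic $\Gamma$-invariant regular Borel probability measure on $X$) such that $\pi$ is unitarily equivalent to $\rho_\varphi$.
   Context: Let $A=C(X)$ with the action $\alpha$ of $\Gamma$ on $A$ by automorphisms induced from the action on $X$, $\alpha_s(f)(x)=f(s^{-1}x)$. $A\rtimes\Gamma$ is the full crossed product $C^*$-algebra: the universal $C^*$-completion of the $*$-algebra $C_c(\Gamma,A)$ of finite sums $\sum_{s} a_su_s$ ($a_s\in A$), where the $u_s$ ($s\in\Gamma$) are unitaries with $u_su_t=u_{st}$ and $u_sau_s^*=\alpha_s(a)$. A representation is a $*$-homomorphism into $B(H)$; it is irreducible if its commutant consists of scalar multiples of the identity. Unitary equivalence means intertwining by a surjective isometry of the Hilbert spaces. For a representation $\pi:A\rtimes\Gamma\to B(H)$, $H_\Gamma=\{x\in H: \pi(u_s)x=x\text{ for all }s\in\Gamma\}$. A state $\varphi$ on $A$ is $\Gamma$-invariant if $\varphi(\alpha_s(a))=\varphi(a)$ for all $s\in\Gamma$, $a\in A$; it is ergodic if it is an extreme point of the convex set of $\Gamma$-invariant states. States on $C(X)$ correspond to regular Borel probability measures $\mu$ on $X$ via $\varphi(f)=\int_X f\,d\mu$, and $\mu$ is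 called ergodic $\Gamma$-invariant when $\varphi$ is. For a $\Gamma$-invariant state $\varphi$, let $\pi_\varphi:A\to B(L^2(A,\varphi))$ be the GNS representation, with $\hat a$ the image of $a\in A$ in $L^2(A,\varphi)$, and let $U_\varphi$ be the unitary representation of $\Gamma$ with $U_\varphi(s)\hat a=\widehat{\alpha_s(a)}$. Then $\rho_\varphi$ is the representation of $A\rtimes\Gamma$ on $L^2(A,\varphi)$ determined by $\rho_\varphi(\sum_s a_su_s)=\sum_s\pi_\varphi(a_s)U_\varphi(s)$. *)

theory Defs
  imports
    "HOL-Probability.Probability_Measure"
    "HOL-Library.Extended_Nat"
    "HOL-Analysis.Bounded_Continuous_Function"
    "HOL-Algebra.Module"
    "HOL-Algebra.Group_Action"
begin

section \<open>Hilbert spaces\<close>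

definition complex_ring :: "complex ring" where
  "complex_ring = \<lparr>carrier = UNIV, mult = (*), one = 1, zero = 0, add = (+)\<rparr>"

text \<open>
  The space \<open>L\<^sup>2(A, \<phi>)\<close> depends on the state \<open>\<phi>\<close>, so Hilbert spaces are carrier-based complex
  modules with an inner product. The fields \<open>mult\<close> and \<open>one\<close> inherited from the ring record play
  no role. Inner products are linear in the first argument.
\<close>

record 'h inner_module = "(complex, 'h) module" +
  hinner :: "'h \<Rightarrow> 'h \<Rightarrow> complex"

definition hnorm :: "('h, 'm) inner_module_scheme \<Rightarrow> 'h \<Rightarrow> real" where
  "hnorm H x = sqrt (Re (hinner H x x))"

locale hilbert_space = Module.module complex_ring H for H (structure) +
  assumes hinner_commute:
      "\<lbrakk>x \<in> carrier H; y \<in> carrier H\<rbrakk> \<Longrightarrow> hinner H x y = cnj (hinner H y x)"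
    and hinner_add_left:
      "\<lbrakk>x \<in> carrier H; y \<in> carrier H; z \<in> carrier H\<rbrakk> \<Longrightarrow>
        hinner H (x \<oplus>\<^bsub>H\<^esub> y) z = hinner H x z + hinner H y z"
    and hinner_smult_left:
      "\<lbrakk>x \<in> carrier H; y \<in> carrier H\<rbrakk> \<Longrightarrow> hinner H (c \<odot>\<^bsub>H\<^esub> x) y = c * hinner H x y"
    and hinner_nonneg: "x \<in> carrier H \<Longrightarrow> 0 \<le> Re (hinner H x x)"
    and hinner_definite: "\<lbrakk>x \<in> carrier H; hinner H x x = 0\<rbrakk> \<Longrightarrow> x = \<zero>\<^bsub>H\<^esub>"
    and hcomplete:
      "\<lbrakk>\<And>n. X n \<in> carrier H;
        \<And>e. e > 0 \<Longrightarrow> \<exists>N. \<forall>m\<ge>N. \<forall>n\<ge>N. hnorm H (X m \<ominus>\<^bsub>H\<^esub> X n) < e\<rbrakk> \<Longrightarrow>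
        \<exists>x\<in>carrier H. (\<lambda>n. hnorm H (X n \<ominus>\<^bsub>H\<^esub> x)) \<longlonglongrightarrow> 0"

definition linear_map ::
  "('h, 'm) inner_module_scheme \<Rightarrow> ('k, 'n) inner_module_scheme \<Rightarrow> ('h \<Rightarrow> 'k) \<Rightarrow> bool" where
  "linear_map H K T \<longleftrightarrow>
     T \<in> carrier H \<rightarrow> carrier K \<and>
     (\<forall>x\<in>carrier H. \<forall>y\<in>carrier H. T (x \<oplus>\<^bsub>H\<^esub> y) = T x \<oplus>\<^bsub>K\<^esub> T y) \<and>
     (\<forall>c. \<forall>x\<in>carrier H. T (c \<odot>\<^bsub>H\<^esub> x) = c \<odot>\<^bsub>K\<^esub> T x)"

definition bounded_operator :: "('h, 'm) inner_module_scheme \<Rightarrow> ('h \<Rightarrow> 'h) \<Rightarrow> bool" where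
  "bounded_operator H T \<longleftrightarrow>
     linear_map H H T \<and> (\<exists>K. \<forall>x\<in>carrier H. hnorm H (T x) \<le> K * hnorm H x)"

definition hspan :: "('h, 'm) inner_module_scheme \<Rightarrow> 'h set \<Rightarrow> 'h set" where
  "hspan H B = \<Inter> {S. submodule S complex_ring H \<and> B \<subseteq> S}"

text \<open>Vector space dimension of a subspace \<open>S\<close>; it is \<open>\<infinity>\<close> if there is no finite spanning set.\<close>

definition hdim :: "('h, 'm) inner_module_scheme \<Rightarrow> 'h set \<Rightarrow> enat" where
  "hdim H S = Inf {enat (card B) | B. finite B \<and> B \<subseteq> S \<and> S \<subseteq> hspan H B}"


section \<open>Complex star-algebras and their representations\<close>

record 'b star_algebra = "(complex, 'b) module" +
  star :: "'b \<Rightarrow> 'b"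

text \<open>
  A \<open>*\<close>-homomorphism into the bounded operators on \<open>H\<close>. The clause \<open>\<pi>(x\<^sup>*) = \<pi>(x)\<^sup>*\<close> is written
  with the defining relation of the adjoint. A \<open>*\<close>-homomorphism need not preserve the unit.
\<close>

definition representation ::
  "('b, 'a) star_algebra_scheme \<Rightarrow> ('h, 'm) inner_module_scheme \<Rightarrow> ('b \<Rightarrow> 'h \<Rightarrow> 'h) \<Rightarrow> bool" where
  "representation B H \<pi> \<longleftrightarrow>
     (\<forall>x\<in>carrier B. bounded_operator H (\<pi> x)) \<and>
     (\<forall>x\<in>carrier B. \<forall>y\<in>carrier B. \<forall>\<xi>\<in>carrier H. \<pi> (x \<oplus>\<^bsub>B\<^esub> y) \<xi> = \<pi> x \<xi> \<oplus>\<^bsub>H\<^esub> \<pi> y \<xi>) \<and>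
     (\<forall>c. \<forall>x\<in>carrier B. \<forall>\<xi>\<in>carrier H. \<pi> (c \<odot>\<^bsub>B\<^esub> x) \<xi> = c \<odot>\<^bsub>H\<^esub> \<pi> x \<xi>) \<and>
     (\<forall>x\<in>carrier B. \<forall>y\<in>carrier B. \<forall>\<xi>\<in>carrier H. \<pi> (x \<otimes>\<^bsub>B\<^esub> y) \<xi> = \<pi> x (\<pi> y \<xi>)) \<and>
     (\<forall>x\<in>carrier B. \<forall>\<xi>\<in>carrier H. \<forall>\<eta>\<in>carrier H.
        hinner H (\<pi> x \<xi>) \<eta> = hinner H \<xi> (\<pi> (star B x) \<eta>))"

definition commutant ::
  "('b, 'a) star_algebra_scheme \<Rightarrow> ('h, 'm) inner_module_scheme \<Rightarrow> ('b \<Rightarrow> 'h \<Rightarrow> 'h) \<Rightarrow> ('h \<Rightarrow> 'h) set"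
  where
  "commutant B H \<pi> =
     {T. bounded_operator H T \<and> (\<forall>x\<in>carrier B. \<forall>\<xi>\<in>carrier H. T (\<pi> x \<xi>) = \<pi> x (T \<xi>))}"

definition irreducible_rep ::
  "('b, 'a) star_algebra_scheme \<Rightarrow> ('h, 'm) inner_module_scheme \<Rightarrow> ('b \<Rightarrow> 'h \<Rightarrow> 'h) \<Rightarrow> bool" where
  "irreducible_rep B H \<pi> \<longleftrightarrow>
     representation B H \<pi> \<and>
     (\<forall>T\<in>commutant B H \<pi>. \<exists>c. \<forall>\<xi>\<in>carrier H. T \<xi> = c \<odot>\<^bsub>H\<^esub> \<xi>)"

definition unitarily_equivalent ::
  "('b, 'a) star_algebra_scheme \<Rightarrow> ('h, 'm) inner_module_scheme \<Rightarrow> ('b \<Rightarrow> 'h \<Rightarrow> 'h) \<Rightarrow>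
   ('k, 'n) inner_module_scheme \<Rightarrow> ('b \<Rightarrow> 'k \<Rightarrow> 'k) \<Rightarrow> bool" where
  "unitarily_equivalent B H \<pi> K \<rho> \<longleftrightarrow>
     (\<exists>W. linear_map H K W \<and> W ` carrier H = carrier K \<and>
          (\<forall>\<xi>\<in>carrier H. hnorm K (W \<xi>) = hnorm H \<xi>) \<and>
          (\<forall>x\<in>carrier B. \<forall>\<xi>\<in>carrier H. W (\<pi> x \<xi>) = \<rho> x (W \<xi>)))"


section \<open>Completions\<close>

text \<open>
  Hausdorff completion of \<open>V\<close> with respect to a pseudometric \<open>d\<close>: Cauchy sequences modulo
  sequences at distance tending to 0.
\<close>

definition cauchy_seqs :: "'v set \<Rightarrow> ('v \<Rightarrow> 'v \<Rightarrow> real) \<Rightarrow> (nat \<Rightarrow> 'v) set" where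
  "cauchy_seqs V d =
     {X. (\<forall>n. X n \<in> V) \<and> (\<forall>e>0. \<exists>N. \<forall>m\<ge>N. \<forall>n\<ge>N. d (X m) (X n) < e)}"

definition cauchy_rel :: "'v set \<Rightarrow> ('v \<Rightarrow> 'v \<Rightarrow> real) \<Rightarrow> ((nat \<Rightarrow> 'v) \<times> (nat \<Rightarrow> 'v)) set" where
  "cauchy_rel V d =
     {(X, Y). X \<in> cauchy_seqs V d \<and> Y \<in> cauchy_seqs V d \<and> (\<lambda>n. d (X n) (Y n)) \<longlonglongrightarrow> 0}"

definition completion :: "'v set \<Rightarrow> ('v \<Rightarrow> 'v \<Rightarrow> real) \<Rightarrow> (nat \<Rightarrow> 'v) set set" where
  "completion V d = cauchy_seqs V d // cauchy_rel V d"

definition to_completion :: "'v set \<Rightarrow> ('v \<Rightarrow> 'v \<Rightarrow> real) \<Rightarrow> 'v \<Rightarrow> (nat \<Rightarrow> 'v) set" where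
  "to_completion V d v = cauchy_rel V d `` {\<lambda>n. v}"

definition completion_map1 ::
  "'v set \<Rightarrow> ('v \<Rightarrow> 'v \<Rightarrow> real) \<Rightarrow> ('v \<Rightarrow> 'v) \<Rightarrow> (nat \<Rightarrow> 'v) set \<Rightarrow> (nat \<Rightarrow> 'v) set" where
  "completion_map1 V d f P = (\<Union>X\<in>P. cauchy_rel V d `` {\<lambda>n. f (X n)})"

definition completion_map2 ::
  "'v set \<Rightarrow> ('v \<Rightarrow> 'v \<Rightarrow> real) \<Rightarrow> ('v \<Rightarrow> 'v \<Rightarrow> 'v) \<Rightarrow>
   (nat \<Rightarrow> 'v) set \<Rightarrow> (nat \<Rightarrow> 'v) set \<Rightarrow> (nat \<Rightarrow> 'v) set" where
  "completion_map2 V d f P Q = (\<Union>X\<in>P. \<Union>Y\<in>Q. cauchy_rel V d `` {\<lambda>n. f (X n) (Y n)})"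


section \<open>The universal C*-completion of a star-algebra\<close>

definition cstar_seminorm :: "('b, 'a) star_algebra_scheme \<Rightarrow> ('b \<Rightarrow> real) \<Rightarrow> bool" where
  "cstar_seminorm B p \<longleftrightarrow>
     (\<forall>x\<in>carrier B. 0 \<le> p x) \<and>
     (\<forall>x\<in>carrier B. \<forall>y\<in>carrier B. p (x \<oplus>\<^bsub>B\<^esub> y) \<le> p x + p y) \<and>
     (\<forall>c. \<forall>x\<in>carrier B. p (c \<odot>\<^bsub>B\<^esub> x) = cmod c * p x) \<and>
     (\<forall>x\<in>carrier B. \<forall>y\<in>carrier B. p (x \<otimes>\<^bsub>B\<^esub> y) \<le> p x * p y) \<and>
     (\<forall>x\<in>carrier B. p (star B x \<otimes>\<^bsub>B\<^esub> x) = (p x)\<^sup>2)"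

text \<open>
  The largest C*-seminorm, i.e. the supremum of the operator norms over all representations:
  every C*-seminorm is the operator norm in a faithful representation of its completion. The
  supremum is finite for the algebra \<open>C\<^sub>c(\<Gamma>, A)\<close> below, which is spanned by the products of
  an element of the C*-algebra \<open>A\<close> with a unitary.
\<close>

definition universal_seminorm :: "('b, 'a) star_algebra_scheme \<Rightarrow> 'b \<Rightarrow> real" where
  "universal_seminorm B x = (SUP p\<in>{p. cstar_seminorm B p}. p x)"

definition universal_dist :: "('b, 'a) star_algebra_scheme \<Rightarrow> 'b \<Rightarrow> 'b \<Rightarrow> real" where
  "universal_dist B x y = universal_seminorm B (x \<ominus>\<^bsub>B\<^esub> y)"

definition cstar_embed :: "('b, 'a) star_algebra_scheme \<Rightarrow> 'b \<Rightarrow> (nat \<Rightarrow> 'b) set" where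
  "cstar_embed B = to_completion (carrier B) (universal_dist B)"

definition cstar_completion ::
  "('b, 'a) star_algebra_scheme \<Rightarrow> (nat \<Rightarrow> 'b) set star_algebra" where
  "cstar_completion B =
     \<lparr>carrier = completion (carrier B) (universal_dist B),
      mult = completion_map2 (carrier B) (universal_dist B) (mult B),
      one = cstar_embed B (one B),
      zero = cstar_embed B (zero B),
      add = completion_map2 (carrier B) (universal_dist B) (add B),
      smult = (\<lambda>c. completion_map1 (carrier B) (universal_dist B) (smult B c)),
      star = completion_map1 (carrier B) (universal_dist B) (star B)\<rparr>"


section \<open>The crossed product\<close>

text \<open>
  For compact \<open>X\<close>, the type \<open>'x \<Rightarrow>\<^sub>C complex\<close> of bounded continuous functions is the
  C*-algebra \<open>C(X)\<close>.
\<close>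

definition cfun_mult ::
  "('x::topological_space \<Rightarrow>\<^sub>C complex) \<Rightarrow> ('x \<Rightarrow>\<^sub>C complex) \<Rightarrow> ('x \<Rightarrow>\<^sub>C complex)" where
  "cfun_mult f g = Bcontfun (\<lambda>x. apply_bcontfun f x * apply_bcontfun g x)"

lemma apply_cfun_mult [simp]:
  "apply_bcontfun (cfun_mult f g) x = apply_bcontfun f x * apply_bcontfun g x"
proof -
  obtain a b where a: "\<And>x. cmod (apply_bcontfun f x) \<le> a" and b: "\<And>x. cmod (apply_bcontfun g x) \<le> b"
    using bounded_apply_bcontfun[of f] bounded_apply_bcontfun[of g] by (auto simp: bounded_iff)
  have "cmod (apply_bcontfun f x * apply_bcontfun g x) \<le> a * b" for x
    unfolding norm_mult by (intro mult_mono a b norm_ge_zero order_trans[OF norm_ge_zero a])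
  then have "(\<lambda>x. apply_bcontfun f x * apply_bcontfun g x) \<in> bcontfun"
    by (auto simp: bcontfun_def bounded_iff intro!: continuous_intros)
  then show ?thesis
    by (simp add: cfun_mult_def Bcontfun_inverse)
qed

definition cfun_cnj :: "('x::topological_space \<Rightarrow>\<^sub>C complex) \<Rightarrow> ('x \<Rightarrow>\<^sub>C complex)" where
  "cfun_cnj f = Bcontfun (\<lambda>x. cnj (apply_bcontfun f x))"

lemma apply_cfun_cnj [simp]: "apply_bcontfun (cfun_cnj f) x = cnj (apply_bcontfun f x)"
proof -
  have "(\<lambda>x. cnj (apply_bcontfun f x)) \<in> bcontfun"
    using bounded_apply_bcontfun[of f]
    by (auto simp: bcontfun_def bounded_iff intro!: continuous_intros)
  then show ?thesis
    by (simp add: cfun_cnj_def Bcontfun_inverse)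
qed

definition cfun_scale ::
  "complex \<Rightarrow> ('x::topological_space \<Rightarrow>\<^sub>C complex) \<Rightarrow> ('x \<Rightarrow>\<^sub>C complex)" where
  "cfun_scale c f = cfun_mult (const_bcontfun c) f"

definition acts_by_homeomorphisms ::
  "('g, 'a) monoid_scheme \<Rightarrow> ('g \<Rightarrow> 'x::topological_space \<Rightarrow> 'x) \<Rightarrow> bool" where
  "acts_by_homeomorphisms \<Gamma> act \<longleftrightarrow>
     group_action \<Gamma> UNIV act \<and>
     (\<forall>s\<in>carrier \<Gamma>. \<exists>h. homeomorphism UNIV UNIV (act s) h)"

definition translate ::
  "('g, 'a) monoid_scheme \<Rightarrow> ('g \<Rightarrow> 'x::topological_space \<Rightarrow> 'x) \<Rightarrow> 'g \<Rightarrow>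
   ('x \<Rightarrow>\<^sub>C complex) \<Rightarrow> ('x \<Rightarrow>\<^sub>C complex)" where
  "translate \<Gamma> act s f = Bcontfun (\<lambda>x. apply_bcontfun f (act (inv\<^bsub>\<Gamma>\<^esub> s) x))"

text \<open>
  The \<open>*\<close>-algebra \<open>C\<^sub>c(\<Gamma>, A)\<close>: a finite sum \<open>\<Sum>s. a\<^sub>s u\<^sub>s\<close> is encoded by its coefficient function
  \<open>s \<mapsto> a\<^sub>s\<close>. Product and involution are dictated by \<open>(a u\<^sub>s) (b u\<^sub>t) = a \<alpha>\<^sub>s(b) u\<^sub>s\<^sub>t\<close> and
  \<open>(a u\<^sub>s)\<^sup>* = \<alpha>\<^sub>t(a\<^sup>*) u\<^sub>t\<close> for \<open>t\<close> the inverse of \<open>s\<close>.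
\<close>

definition crossed_alg ::
  "('g, 'a) monoid_scheme \<Rightarrow> ('g \<Rightarrow> 'x::topological_space \<Rightarrow> 'x) \<Rightarrow>
   ('g \<Rightarrow> ('x \<Rightarrow>\<^sub>C complex)) star_algebra" where
  "crossed_alg \<Gamma> act =
     \<lparr>carrier = {f. finite {s. f s \<noteq> 0} \<and> {s. f s \<noteq> 0} \<subseteq> carrier \<Gamma>},
      mult = (\<lambda>f g r. if r \<in> carrier \<Gamma>
        then \<Sum>s\<in>{s. f s \<noteq> 0}. cfun_mult (f s) (translate \<Gamma> act s (g (inv\<^bsub>\<Gamma>\<^esub> s \<otimes>\<^bsub>\<Gamma>\<^esub> r)))
        else 0),
      one = (\<lambda>r. if r = \<one>\<^bsub>\<Gamma>\<^esub> then const_bcontfun 1 else 0),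
      zero = (\<lambda>r. 0),
      add = (\<lambda>f g r. f r + g r),
      smult = (\<lambda>c f r. cfun_scale c (f r)),
      star = (\<lambda>f r. if r \<in> carrier \<Gamma>
        then translate \<Gamma> act r (cfun_cnj (f (inv\<^bsub>\<Gamma>\<^esub> r)))
        else 0)\<rparr>"

definition crossed_product ::
  "('g, 'a) monoid_scheme \<Rightarrow> ('g \<Rightarrow> 'x::topological_space \<Rightarrow> 'x) \<Rightarrow>
   (nat \<Rightarrow> 'g \<Rightarrow> ('x \<Rightarrow>\<^sub>C complex)) set star_algebra" where
  "crossed_product \<Gamma> act = cstar_completion (crossed_alg \<Gamma> act)"

definition group_unitary ::
  "('g, 'a) monoid_scheme \<Rightarrow> ('g \<Rightarrow> 'x::topological_space \<Rightarrow> 'x) \<Rightarrow> 'g \<Rightarrow>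
   (nat \<Rightarrow> 'g \<Rightarrow> ('x \<Rightarrow>\<^sub>C complex)) set" where
  "group_unitary \<Gamma> act s =
     cstar_embed (crossed_alg \<Gamma> act) (\<lambda>r. if r = s then const_bcontfun 1 else 0)"

definition fixed_vectors ::
  "('g, 'a) monoid_scheme \<Rightarrow> ('g \<Rightarrow> 'x::topological_space \<Rightarrow> 'x) \<Rightarrow>
   ('h, 'm) inner_module_scheme \<Rightarrow>
   ((nat \<Rightarrow> 'g \<Rightarrow> ('x \<Rightarrow>\<^sub>C complex)) set \<Rightarrow> 'h \<Rightarrow> 'h) \<Rightarrow> 'h set" where
  "fixed_vectors \<Gamma> act H \<pi> =
     {\<xi> \<in> carrier H. \<forall>s\<in>carrier \<Gamma>. \<pi> (group_unitary \<Gamma> act s) \<xi> = \<xi>}"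


section \<open>Invariant and ergodic states\<close>

definition state :: "(('x::topological_space \<Rightarrow>\<^sub>C complex) \<Rightarrow> complex) \<Rightarrow> bool" where
  "state \<phi> \<longleftrightarrow>
     (\<forall>a b. \<phi> (a + b) = \<phi> a + \<phi> b) \<and>
     (\<forall>c a. \<phi> (cfun_scale c a) = c * \<phi> a) \<and>
     (\<forall>a. \<phi> (cfun_mult (cfun_cnj a) a) \<in> \<real> \<and> 0 \<le> Re (\<phi> (cfun_mult (cfun_cnj a) a))) \<and>
     \<phi> (const_bcontfun 1) = 1"

definition invariant_states ::
  "('g, 'a) monoid_scheme \<Rightarrow> ('g \<Rightarrow> 'x::topological_space \<Rightarrow> 'x) \<Rightarrow>
   (('x \<Rightarrow>\<^sub>C complex) \<Rightarrow> complex) set" where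
  "invariant_states \<Gamma> act =
     {\<phi>. state \<phi> \<and> (\<forall>s\<in>carrier \<Gamma>. \<forall>a. \<phi> (translate \<Gamma> act s a) = \<phi> a)}"

text \<open>
  An extreme point of the invariant states. The library's \<open>extreme_point_of\<close> needs a real vector
  space as ambient type, which this function type is not.
\<close>

definition ergodic_state ::
  "('g, 'a) monoid_scheme \<Rightarrow> ('g \<Rightarrow> 'x::topological_space \<Rightarrow> 'x) \<Rightarrow>
   (('x \<Rightarrow>\<^sub>C complex) \<Rightarrow> complex) \<Rightarrow> bool" where
  "ergodic_state \<Gamma> act \<phi> \<longleftrightarrow>
     \<phi> \<in> invariant_states \<Gamma> act \<and>
     (\<forall>\<psi>\<^sub>1\<in>invariant_states \<Gamma> act. \<forall>\<psi>\<^sub>2\<in>invariant_states \<Gamma> act. \<forall>t::real.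
        0 < t \<and> t < 1 \<and>
        (\<forall>a. \<phi> a = complex_of_real t * \<psi>\<^sub>1 a + complex_of_real (1 - t) * \<psi>\<^sub>2 a) \<longrightarrow>
        \<psi>\<^sub>1 = \<phi> \<and> \<psi>\<^sub>2 = \<phi>)"

definition regular_borel_prob :: "'x::topological_space measure \<Rightarrow> bool" where
  "regular_borel_prob \<mu> \<longleftrightarrow>
     prob_space \<mu> \<and> sets \<mu> = sets borel \<and>
     (\<forall>E\<in>sets \<mu>.
        emeasure \<mu> E = (SUP K\<in>{K. compact K \<and> K \<subseteq> E}. emeasure \<mu> K) \<and>
        emeasure \<mu> E = (INF V\<in>{V. open V \<and> E \<subseteq> V}. emeasure \<mu> V))"

definition integral_state ::
  "'x::topological_space measure \<Rightarrow> ('x \<Rightarrow>\<^sub>C complex) \<Rightarrow> complex" where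
  "integral_state \<mu> f = (LINT x|\<mu>. apply_bcontfun f x)"


section \<open>The representation associated with an invariant state\<close>

definition gns_dist ::
  "(('x::topological_space \<Rightarrow>\<^sub>C complex) \<Rightarrow> complex) \<Rightarrow>
   ('x \<Rightarrow>\<^sub>C complex) \<Rightarrow> ('x \<Rightarrow>\<^sub>C complex) \<Rightarrow> real" where
  "gns_dist \<phi> a b = sqrt (Re (\<phi> (cfun_mult (cfun_cnj (a - b)) (a - b))))"

definition gns_space ::
  "(('x::topological_space \<Rightarrow>\<^sub>C complex) \<Rightarrow> complex) \<Rightarrow>
   (nat \<Rightarrow> ('x \<Rightarrow>\<^sub>C complex)) set inner_module" where
  "gns_space \<phi> =
     \<lparr>carrier = completion UNIV (gns_dist \<phi>),
      mult = undefined,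
      one = undefined,
      zero = to_completion UNIV (gns_dist \<phi>) 0,
      add = completion_map2 UNIV (gns_dist \<phi>) (+),
      smult = (\<lambda>c. completion_map1 UNIV (gns_dist \<phi>) (cfun_scale c)),
      hinner = (\<lambda>P Q. THE l. \<forall>a\<in>P. \<forall>b\<in>Q.
        (\<lambda>n. \<phi> (cfun_mult (cfun_cnj (b n)) (a n))) \<longlonglongrightarrow> l)\<rparr>"

text \<open>
  The operators \<open>\<pi>\<^sub>\<phi>(a)\<close> and \<open>U\<^sub>\<phi>(s)\<close> are the continuous extensions of \<open>b \<mapsto> a b\<close> and
  \<open>b \<mapsto> \<alpha>\<^sub>s(b)\<close> from \<open>A\<close> to its completion.
\<close>

definition gns_rep ::
  "(('x::topological_space \<Rightarrow>\<^sub>C complex) \<Rightarrow> complex) \<Rightarrow> ('x \<Rightarrow>\<^sub>C complex) \<Rightarrow>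
   (nat \<Rightarrow> ('x \<Rightarrow>\<^sub>C complex)) set \<Rightarrow> (nat \<Rightarrow> ('x \<Rightarrow>\<^sub>C complex)) set" where
  "gns_rep \<phi> a = completion_map1 UNIV (gns_dist \<phi>) (cfun_mult a)"

definition gns_unitary ::
  "('g, 'a) monoid_scheme \<Rightarrow> ('g \<Rightarrow> 'x::topological_space \<Rightarrow> 'x) \<Rightarrow>
   (('x \<Rightarrow>\<^sub>C complex) \<Rightarrow> complex) \<Rightarrow> 'g \<Rightarrow>
   (nat \<Rightarrow> ('x \<Rightarrow>\<^sub>C complex)) set \<Rightarrow> (nat \<Rightarrow> ('x \<Rightarrow>\<^sub>C complex)) set" where
  "gns_unitary \<Gamma> act \<phi> s = completion_map1 UNIV (gns_dist \<phi>) (translate \<Gamma> act s)"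

text \<open>
  A representation of the crossed product is automatically contractive, hence determined by its
  values on the dense subalgebra \<open>C\<^sub>c(\<Gamma>, A)\<close>. The extensionality clause only fixes values outside
  the carriers, so that the description below is definite.
\<close>

definition koopman_rep ::
  "('g, 'a) monoid_scheme \<Rightarrow> ('g \<Rightarrow> 'x::topological_space \<Rightarrow> 'x) \<Rightarrow>
   (('x \<Rightarrow>\<^sub>C complex) \<Rightarrow> complex) \<Rightarrow>
   (nat \<Rightarrow> 'g \<Rightarrow> ('x \<Rightarrow>\<^sub>C complex)) set \<Rightarrow>
   (nat \<Rightarrow> ('x \<Rightarrow>\<^sub>C complex)) set \<Rightarrow> (nat \<Rightarrow> ('x \<Rightarrow>\<^sub>C complex)) set" where
  "koopman_rep \<Gamma> act \<phi> =
     (THE \<rho>.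
        \<rho> \<in> carrier (crossed_product \<Gamma> act) \<rightarrow>\<^sub>E
              (carrier (gns_space \<phi>) \<rightarrow>\<^sub>E carrier (gns_space \<phi>)) \<and>
        representation (crossed_product \<Gamma> act) (gns_space \<phi>) \<rho> \<and>
        (\<forall>f\<in>carrier (crossed_alg \<Gamma> act). \<forall>\<xi>\<in>carrier (gns_space \<phi>).
           \<rho> (cstar_embed (crossed_alg \<Gamma> act) f) \<xi> =
             finsum (gns_space \<phi>) (\<lambda>s. gns_rep \<phi> (f s) (gns_unitary \<Gamma> act \<phi> s \<xi>))
               {s. f s \<noteq> 0}))"

end

theory Submission
  imports Defs "HOL-Library.Function_Algebras"
begin

text \<open>
  A fixed vector \<open>\<xi>\<close> of an irreducible \<open>\<pi>\<close> is cyclic, and \<open>\<pi>(\<Sum>s. a\<^sub>s u\<^sub>s) \<xi> = \<pi>(\<Sum>s. a\<^sub>s) \<xi>\<close>, so it is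
  already cyclic for \<open>A = C(X)\<close>. Given two linearly independent fixed vectors \<open>\<xi>\<close> and \<open>\<eta>\<close>, Schur's lemma
  for \<open>\<pi> \<oplus> \<pi>\<close> shows that the pairs \<open>(a \<xi>, a \<eta>)\<close> are dense in \<open>H \<oplus> H\<close>, which is impossible as \<open>A\<close>
  consists of commuting normal operators. Hence \<open>dim H\<^sub>\<Gamma> \<le> 1\<close>. For a unit fixed vector \<open>\<xi>\<close> put
  \<open>\<phi>(a) = \<langle>\<pi>(a) \<xi>, \<xi>\<rangle>\<close>. An invariant state \<open>\<psi>\<close> dominated by a multiple of \<open>\<phi>\<close> has the form
  \<open>\<psi>(a) = \<langle>\<pi>(a) \<xi>, \<zeta>\<rangle>\<close> with a fixed vector \<open>\<zeta>\<close>, which is a multiple of \<open>\<xi>\<close>; so \<open>\<psi> = \<phi>\<close> and \<open>\<phi>\<close> is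
  ergodic. The map \<open>\<pi>(a) \<xi> \<mapsto> a\<close> extends to an equivalence of \<open>\<pi>\<close> and \<open>\<rho>\<^sub>\<phi>\<close>. Conversely, an
  equivalence with \<open>\<rho>\<^sub>\<psi>\<close> sends a unit fixed vector of \<open>\<pi>\<close> to the class of \<open>1\<close>, which recovers \<open>\<psi>\<close>.
  Values of a representation on the completion are controlled by its values on \<open>C\<^sub>c(\<Gamma>, A)\<close> because
  representations are automatically continuous, and states are turned into measures by the
  Riesz representation theorem.
\<close>

section \<open>Hilbert spaces\<close>

text \<open>Irreducibility is given through the commutant, so invariant subspaces enter only as
  orthogonal projections: a subspace is turned into an operator that commutes with \<pi>, and this
  operator must be a scalar. For two fixed vectors the same is done in the double of H, where the
  matrix entries of the projection are the scalars. A representation is algebraic data: each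
  operator is bounded, but nothing relates its size to the norm of the completion, and the unit may
  act as a proper projection. Yet the Schur argument, the equivalence with
  \<open>\<rho>\<^sub>\<phi>\<close> and the very meaning of \<open>\<rho>\<^sub>\<phi>\<close> need
  limits of elements of C_c(\<Gamma>, A). The missing continuity comes from invertibility: if x has
  norm below 1, then 1 - x^* x is invertible by a Neumann series, which keeps the norm of \<pi>(x)
  from being exactly 1, and scaling then excludes every larger value. The universal norm is finite
  because a real function with values in [-1, 1] is the mean of two unitaries of C(X), on which
  every C*-seminorm is at most 1.\<close>

lemma complex_ring_simps [simp]:
  "carrier complex_ring = UNIV" "a \<otimes>\<^bsub>complex_ring\<^esub> b = a * b" "\<one>\<^bsub>complex_ring\<^esub> = 1"
  "\<zero>\<^bsub>complex_ring\<^esub> = 0" "a \<oplus>\<^bsub>complex_ring\<^esub> b = a + b"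
  by (simp_all add: complex_ring_def)

lemma cring_complex_ring: "cring complex_ring"
proof (rule cringI)
  show "abelian_group complex_ring"
    by (rule abelian_groupI) (auto simp: algebra_simps intro: exI[of _ "- x" for x] add.left_inverse)
  show "Group.comm_monoid complex_ring"
    by (rule comm_monoidI) auto
qed (simp add: algebra_simps)

lemma a_inv_complex_ring [simp]: "\<ominus>\<^bsub>complex_ring\<^esub> c = - c"
proof -
  interpret cring complex_ring by (rule cring_complex_ring)
  show ?thesis by (rule minus_equality) auto
qed

text \<open>Not assumed closed: the subspace of interest is the orbit of a vector under C(X), and
  its closure is taken separately.\<close>

definition subspace_of :: "('h, 'm) inner_module_scheme \<Rightarrow> 'h set \<Rightarrow> bool" where
  "subspace_of H V \<longleftrightarrow> V \<subseteq> carrier H \<and> \<zero>\<^bsub>H\<^esub> \<in> V \<and> (\<forall>x\<in>V. \<forall>y\<in>V. x \<oplus>\<^bsub>H\<^esub> y \<in> V) \<and>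
     (\<forall>c. \<forall>x\<in>V. c \<odot>\<^bsub>H\<^esub> x \<in> V)"

definition hclosure :: "('h, 'm) inner_module_scheme \<Rightarrow> 'h set \<Rightarrow> 'h set" where
  "hclosure H V = {x \<in> carrier H. \<forall>e>0. \<exists>v\<in>V. hnorm H (x \<ominus>\<^bsub>H\<^esub> v) < e}"

definition hconv :: "('h, 'm) inner_module_scheme \<Rightarrow> (nat \<Rightarrow> 'h) \<Rightarrow> 'h \<Rightarrow> bool" where
  "hconv H X x \<longleftrightarrow> (\<lambda>n. hnorm H (X n \<ominus>\<^bsub>H\<^esub> x)) \<longlonglongrightarrow> 0"

section \<open>Inner product calculus, convergence, Riesz vectors and projections in a Hilbert
  space\<close>

context hilbert_space
begin

lemma smul_carrier [simp, intro]: "x \<in> carrier H \<Longrightarrow> c \<odot> x \<in> carrier H"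
  using smult_closed by simp

lemma smult_0 [simp]: "x \<in> carrier H \<Longrightarrow> 0 \<odot> x = \<zero>"
  using smult_l_null[of x] by simp

lemma smult_1 [simp]: "x \<in> carrier H \<Longrightarrow> 1 \<odot> x = x"
  using smult_one[of x] by simp

lemma hneg_eq: "x \<in> carrier H \<Longrightarrow> \<ominus> x = (-1) \<odot> x"
  using smult_l_minus[of 1 x] smult_one[of x] by simp

lemma hminus_eq: "\<lbrakk>x \<in> carrier H; y \<in> carrier H\<rbrakk> \<Longrightarrow> x \<ominus> y = x \<oplus> (-1) \<odot> y"
  by (simp add: a_minus_def hneg_eq)

lemma hinner_add_right:
  "\<lbrakk>x \<in> carrier H; y \<in> carrier H; z \<in> carrier H\<rbrakk> \<Longrightarrow> hinner H z (x \<oplus> y) = hinner H z x + hinner H z y"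
  using hinner_commute[of z "x \<oplus> y"] hinner_commute[of z x] hinner_commute[of z y]
  by (simp add: hinner_add_left)

lemma hinner_smult_right:
  "\<lbrakk>x \<in> carrier H; y \<in> carrier H\<rbrakk> \<Longrightarrow> hinner H x (c \<odot> y) = cnj c * hinner H x y"
  using hinner_commute[of x "c \<odot> y"] hinner_commute[of x y]
  by (simp add: hinner_smult_left)

lemma hinner_minus_left:
  "\<lbrakk>x \<in> carrier H; y \<in> carrier H; z \<in> carrier H\<rbrakk> \<Longrightarrow> hinner H (x \<ominus> y) z = hinner H x z - hinner H y z"
  by (simp add: hminus_eq hinner_add_left hinner_smult_left)

lemma hinner_minus_right:
  "\<lbrakk>x \<in> carrier H; y \<in> carrier H; z \<in> carrier H\<rbrakk> \<Longrightarrow> hinner H z (x \<ominus> y) = hinner H z x - hinner H z y"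
  by (simp add: hminus_eq hinner_add_right hinner_smult_right)

lemma hinner_zero [simp]: "x \<in> carrier H \<Longrightarrow> hinner H \<zero> x = 0" "x \<in> carrier H \<Longrightarrow> hinner H x \<zero> = 0"
  using hinner_add_left[of \<zero> \<zero> x] hinner_add_right[of \<zero> \<zero> x] by simp_all

lemmas hinner_simps = hinner_add_left hinner_add_right hinner_smult_left hinner_smult_right
  hinner_minus_left hinner_minus_right

text \<open>The device for most vector identities below: pairing with an arbitrary vector turns them
  into identities of complex numbers that \<open>hinner_simps\<close> settles, which spares
  normalising module terms.\<close>

lemma hinner_ext:
  assumes "x \<in> carrier H" "y \<in> carrier H" "\<And>z. z \<in> carrier H \<Longrightarrow> hinner H x z = hinner H y z"
  shows "x = y"
proof -
  have "hinner H (x \<ominus> y) (x \<ominus> y) = 0"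
    using assms by (simp add: hinner_minus_left)
  then have "x \<ominus> y = \<zero>" using assms(1,2) by (intro hinner_definite) auto
  then show ?thesis using minus_equality[of x "\<ominus> y"] assms(1,2) by (simp add: a_minus_def)
qed

lemma hnorm_nonneg [simp]: "x \<in> carrier H \<Longrightarrow> 0 \<le> hnorm H x"
  by (simp add: hnorm_def hinner_nonneg)

lemma hinner_self: "x \<in> carrier H \<Longrightarrow> hinner H x x = of_real ((hnorm H x)\<^sup>2)"
  using hinner_commute[of x x] hinner_nonneg[of x]
  by (simp add: complex_eq_iff hnorm_def)

lemma hnorm_sq: "x \<in> carrier H \<Longrightarrow> (hnorm H x)\<^sup>2 = Re (hinner H x x)"
  by (simp add: hinner_self)

lemma hnorm_zero [simp]: "hnorm H \<zero> = 0"
  by (simp add: hnorm_def)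

lemma hnorm_eq_zero: "x \<in> carrier H \<Longrightarrow> hnorm H x = 0 \<longleftrightarrow> x = \<zero>"
  using hinner_self[of x] hinner_definite[of x] by auto

lemma hminus_eq_zero: "\<lbrakk>x \<in> carrier H; y \<in> carrier H\<rbrakk> \<Longrightarrow> x \<ominus> y = \<zero> \<longleftrightarrow> x = y"
  using minus_equality[of x "\<ominus> y"] by (auto simp: a_minus_def r_neg)

lemma hnorm_minus_eq_zero: "\<lbrakk>x \<in> carrier H; y \<in> carrier H\<rbrakk> \<Longrightarrow> hnorm H (x \<ominus> y) = 0 \<longleftrightarrow> x = y"
  by (simp add: hnorm_eq_zero hminus_eq_zero)

lemma hnorm_smult [simp]: "x \<in> carrier H \<Longrightarrow> hnorm H (c \<odot> x) = cmod c * hnorm H x"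
proof -
  assume x: "x \<in> carrier H"
  have "hinner H (c \<odot> x) (c \<odot> x) = of_real ((cmod c)\<^sup>2 * (hnorm H x)\<^sup>2)"
    unfolding of_real_mult complex_norm_square using x by (simp add: hinner_simps hinner_self[of x])
  then have "(hnorm H (c \<odot> x))\<^sup>2 = (cmod c * hnorm H x)\<^sup>2"
    using x by (simp add: hnorm_sq power_mult_distrib del: of_real_mult of_real_power)
  then show ?thesis using x by (simp add: power2_eq_iff_nonneg)
qed

lemma cauchy_schwarz:
  assumes [simp]: "x \<in> carrier H" "y \<in> carrier H"
  shows "cmod (hinner H x y) \<le> hnorm H x * hnorm H y"
proof (cases "y = \<zero>")
  case False
  define b where "b = (hnorm H y)\<^sup>2"
  define d where "d = hinner H x y"
  have b: "b > 0" using False by (simp add: b_def hnorm_eq_zero)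
  \<comment> \<open>This is b times the component of x orthogonal to y, so there is no division; its
    squared norm is b (b ||x||^2 - |d|^2).\<close>
  let ?z = "of_real b \<odot> x \<ominus> d \<odot> y"
  have yx: "hinner H y x = cnj d" unfolding d_def by (rule hinner_commute) auto
  have "hinner H ?z ?z = of_real b * (of_real b * of_real ((hnorm H x)\<^sup>2) - d * cnj d)"
    by (simp add: hinner_simps hinner_self[of x] hinner_self[of y] yx flip: d_def b_def del: of_real_power add: algebra_simps)
  also have "d * cnj d = of_real ((cmod d)\<^sup>2)" by (rule complex_norm_square[symmetric])
  also have "of_real b * (of_real b * of_real ((hnorm H x)\<^sup>2) - of_real ((cmod d)\<^sup>2)) =
      complex_of_real (b * (b * (hnorm H x)\<^sup>2 - (cmod d)\<^sup>2))" by simp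
  finally have "hinner H ?z ?z = complex_of_real (b * (b * (hnorm H x)\<^sup>2 - (cmod d)\<^sup>2))" .
  then have "0 \<le> b * (b * (hnorm H x)\<^sup>2 - (cmod d)\<^sup>2)"
    using hinner_nonneg[of ?z] by simp
  then have "(cmod d)\<^sup>2 \<le> (hnorm H x * hnorm H y)\<^sup>2"
    using b by (simp add: zero_le_mult_iff b_def power_mult_distrib mult.commute)
  then show ?thesis unfolding d_def by (rule power2_le_imp_le) simp
qed simp

lemma Re_hinner_le:
  "\<lbrakk>x \<in> carrier H; y \<in> carrier H\<rbrakk> \<Longrightarrow> Re (hinner H x y) \<le> hnorm H x * hnorm H y"
  by (rule order_trans[OF complex_Re_le_cmod cauchy_schwarz])

lemma hnorm_triangle:
  assumes [simp]: "x \<in> carrier H" "y \<in> carrier H"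
  shows "hnorm H (x \<oplus> y) \<le> hnorm H x + hnorm H y"
proof (rule power2_le_imp_le)
  have "(hnorm H (x \<oplus> y))\<^sup>2 = (hnorm H x)\<^sup>2 + (hnorm H y)\<^sup>2 + 2 * Re (hinner H x y)"
  proof -
    have "hinner H y x = cnj (hinner H x y)" by (rule hinner_commute) auto
    then have "Re (hinner H y x) = Re (hinner H x y)" by simp
    then show ?thesis by (simp add: hnorm_sq hinner_add_left hinner_add_right)
  qed
  also have "Re (hinner H x y) \<le> hnorm H x * hnorm H y"
    by (rule Re_hinner_le) auto
  finally show "(hnorm H (x \<oplus> y))\<^sup>2 \<le> (hnorm H x + hnorm H y)\<^sup>2"
    by (simp add: power2_sum)
qed simp

lemma hnorm_minus_commute: "\<lbrakk>x \<in> carrier H; y \<in> carrier H\<rbrakk> \<Longrightarrow> hnorm H (x \<ominus> y) = hnorm H (y \<ominus> x)"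
proof -
  assume [simp]: "x \<in> carrier H" "y \<in> carrier H"
  have "x \<ominus> y = (-1) \<odot> (y \<ominus> x)"
    by (rule hinner_ext) (auto simp: hinner_simps)
  then show ?thesis by simp
qed

lemma hnorm_triangle_minus:
  assumes [simp]: "x \<in> carrier H" "y \<in> carrier H" "z \<in> carrier H"
  shows "hnorm H (x \<ominus> z) \<le> hnorm H (x \<ominus> y) + hnorm H (y \<ominus> z)"
proof -
  have "x \<ominus> z = (x \<ominus> y) \<oplus> (y \<ominus> z)"
    by (rule hinner_ext) (auto simp: hinner_simps)
  then show ?thesis using hnorm_triangle[of "x \<ominus> y" "y \<ominus> z"] by simp
qed

lemma hnorm_le_add: "\<lbrakk>x \<in> carrier H; y \<in> carrier H\<rbrakk> \<Longrightarrow> hnorm H x \<le> hnorm H y + hnorm H (x \<ominus> y)"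
proof -
  assume [simp]: "x \<in> carrier H" "y \<in> carrier H"
  have "x = y \<oplus> (x \<ominus> y)"
    by (rule hinner_ext) (auto simp: hinner_simps)
  then show ?thesis using hnorm_triangle[of y "x \<ominus> y"] by simp
qed

lemma parallelogram:
  assumes [simp]: "x \<in> carrier H" "y \<in> carrier H"
  shows "(hnorm H (x \<oplus> y))\<^sup>2 + (hnorm H (x \<ominus> y))\<^sup>2 = 2 * (hnorm H x)\<^sup>2 + 2 * (hnorm H y)\<^sup>2"
  by (simp add: hnorm_sq hinner_simps)

lemma hconv_hinner:
  assumes "\<And>n. X n \<in> carrier H" "x \<in> carrier H" "y \<in> carrier H" "hconv H X x"
  shows "(\<lambda>n. hinner H (X n) y) \<longlonglongrightarrow> hinner H x y"
proof -
  have "cmod (hinner H (X n) y - hinner H x y) \<le> hnorm H (X n \<ominus> x) * hnorm H y" for n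
    using cauchy_schwarz[of "X n \<ominus> x" y] assms by (simp add: hinner_simps)
  moreover have "(\<lambda>n. hnorm H (X n \<ominus> x) * hnorm H y) \<longlonglongrightarrow> 0"
    using tendsto_mult_left_zero assms(4) unfolding hconv_def by blast
  ultimately have "(\<lambda>n. hinner H (X n) y - hinner H x y) \<longlonglongrightarrow> 0"
    by (rule Lim_null_comparison[OF always_eventually[OF allI]])
  then show ?thesis by (rule LIM_zero_cancel)
qed

lemma hconv_hinner2:
  assumes "\<And>n. X n \<in> carrier H" "x \<in> carrier H" "hconv H X x"
    and "\<And>n. Y n \<in> carrier H" "y \<in> carrier H" "hconv H Y y"
  shows "(\<lambda>n. hinner H (X n) (Y n)) \<longlonglongrightarrow> hinner H x y"
proof -
  have 1: "(\<lambda>n. hinner H (X n) y) \<longlonglongrightarrow> hinner H x y" by (rule hconv_hinner) (use assms in auto)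
  have bd: "hnorm H (X n) \<le> hnorm H x + hnorm H (X n \<ominus> x)" for n
    using hnorm_le_add assms by blast
  have "cmod (hinner H (X n) (Y n) - hinner H (X n) y) \<le> (hnorm H x + hnorm H (X n \<ominus> x)) * hnorm H (Y n \<ominus> y)" for n
  proof -
    have "cmod (hinner H (X n) (Y n) - hinner H (X n) y) \<le> hnorm H (X n) * hnorm H (Y n \<ominus> y)"
      using cauchy_schwarz[of "X n" "Y n \<ominus> y"] assms by (simp add: hinner_simps)
    also have "\<dots> \<le> (hnorm H x + hnorm H (X n \<ominus> x)) * hnorm H (Y n \<ominus> y)"
      using bd assms by (intro mult_right_mono) auto
    finally show ?thesis .
  qed
  moreover have "(\<lambda>n. (hnorm H x + hnorm H (X n \<ominus> x)) * hnorm H (Y n \<ominus> y)) \<longlonglongrightarrow> (hnorm H x + 0) * 0"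
    using assms(3,6) unfolding hconv_def by (intro tendsto_intros)
  ultimately have "(\<lambda>n. hinner H (X n) (Y n) - hinner H (X n) y) \<longlonglongrightarrow> 0"
    by - (rule Lim_null_comparison[OF always_eventually], auto)
  from tendsto_add[OF this 1] show ?thesis by simp
qed

lemma hconv_hnorm:
  assumes "\<And>n. X n \<in> carrier H" "x \<in> carrier H" "hconv H X x"
  shows "(\<lambda>n. hnorm H (X n)) \<longlonglongrightarrow> hnorm H x"
  unfolding hnorm_def by (intro tendsto_intros hconv_hinner2 assms)

lemma hconv_unique:
  assumes "\<And>n. X n \<in> carrier H" "x \<in> carrier H" "y \<in> carrier H" "hconv H X x" "hconv H X y"
  shows "x = y"
proof (rule hinner_ext)
  fix z assume z: "z \<in> carrier H"
  show "hinner H x z = hinner H y z"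
    using hconv_hinner[OF assms(1,2) z assms(4)] hconv_hinner[OF assms(1,3) z assms(5)]
    by (rule LIMSEQ_unique)
qed (use assms in auto)

lemma hconv_const: "x \<in> carrier H \<Longrightarrow> hconv H (\<lambda>n. x) x"
  by (simp add: hconv_def a_minus_def r_neg)

lemma hconv_add:
  assumes [simp]: "\<And>n. X n \<in> carrier H" "x \<in> carrier H" "\<And>n. Y n \<in> carrier H" "y \<in> carrier H"
    and "hconv H X x" "hconv H Y y"
  shows "hconv H (\<lambda>n. X n \<oplus> Y n) (x \<oplus> y)"
proof -
  have "(X n \<oplus> Y n) \<ominus> (x \<oplus> y) = (X n \<ominus> x) \<oplus> (Y n \<ominus> y)" for n
    by (rule hinner_ext) (auto simp: hinner_simps)
  then have "hnorm H ((X n \<oplus> Y n) \<ominus> (x \<oplus> y)) \<le> hnorm H (X n \<ominus> x) + hnorm H (Y n \<ominus> y)" for n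
    using hnorm_triangle[of "X n \<ominus> x" "Y n \<ominus> y"] by simp
  moreover have "(\<lambda>n. hnorm H (X n \<ominus> x) + hnorm H (Y n \<ominus> y)) \<longlonglongrightarrow> 0"
    using assms(5,6) unfolding hconv_def by (auto intro: tendsto_add_zero)
  ultimately show ?thesis unfolding hconv_def
    by - (rule Lim_null_comparison[OF always_eventually], auto)
qed

lemma linear_mapD:
  assumes "linear_map H K T"
  shows "x \<in> carrier H \<Longrightarrow> T x \<in> carrier K"
    and "\<lbrakk>x \<in> carrier H; y \<in> carrier H\<rbrakk> \<Longrightarrow> T (x \<oplus> y) = T x \<oplus>\<^bsub>K\<^esub> T y"
    and "x \<in> carrier H \<Longrightarrow> T (c \<odot> x) = c \<odot>\<^bsub>K\<^esub> T x"
  using assms by (auto simp: linear_map_def)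

lemma linear_map_minus:
  assumes "hilbert_space K" "linear_map H K T" "x \<in> carrier H" "y \<in> carrier H"
  shows "T (x \<ominus> y) = T x \<ominus>\<^bsub>K\<^esub> T y"
  using assms linear_mapD[OF assms(2)] by (simp add: hminus_eq hilbert_space.hminus_eq)

lemma bounded_operatorD:
  assumes "bounded_operator H T"
  shows "linear_map H H T" and "\<exists>K\<ge>0. \<forall>x\<in>carrier H. hnorm H (T x) \<le> K * hnorm H x"
proof -
  show "linear_map H H T" using assms by (simp add: bounded_operator_def)
  obtain K where K: "\<forall>x\<in>carrier H. hnorm H (T x) \<le> K * hnorm H x"
    using assms by (auto simp: bounded_operator_def)
  have "hnorm H (T x) \<le> max K 0 * hnorm H x" if "x \<in> carrier H" for x
    using K that by (meson hnorm_nonneg max.cobounded1 mult_right_mono order_trans)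
  then show "\<exists>K\<ge>0. \<forall>x\<in>carrier H. hnorm H (T x) \<le> K * hnorm H x"
    by (intro exI[of _ "max K 0"]) auto
qed

lemma hconv_lipschitz_map:
  assumes K: "hilbert_space K" and T: "linear_map H K T" "\<forall>x\<in>carrier H. hnorm K (T x) \<le> C * hnorm H x"
    and [simp]: "\<And>n. X n \<in> carrier H" "x \<in> carrier H" and "hconv H X x"
  shows "hconv K (\<lambda>n. T (X n)) (T x)"
proof -
  have "hnorm K (T (X n) \<ominus>\<^bsub>K\<^esub> T x) \<le> C * hnorm H (X n \<ominus> x)" for n
    using T(2) linear_map_minus[OF K T(1), of "X n" x, symmetric] by simp
  moreover have "0 \<le> hnorm K (T (X n) \<ominus>\<^bsub>K\<^esub> T x)" for n
    using linear_map_minus[OF K T(1), of "X n" x, symmetric] linear_mapD(1)[OF T(1)]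
    by (simp add: hilbert_space.hnorm_nonneg[OF K])
  moreover have "(\<lambda>n. C * hnorm H (X n \<ominus> x)) \<longlonglongrightarrow> 0"
    using assms(6) tendsto_mult_right_zero unfolding hconv_def by blast
  ultimately show ?thesis unfolding hconv_def
    by - (rule Lim_null_comparison[OF always_eventually], auto)
qed

lemma hconv_bounded:
  assumes T: "bounded_operator H T" and [simp]: "\<And>n. X n \<in> carrier H" "x \<in> carrier H" and "hconv H X x"
  shows "hconv H (\<lambda>n. T (X n)) (T x)"
  using bounded_operatorD[OF T] assms hconv_lipschitz_map[OF hilbert_space_axioms] by blast

lemma hconv_smult:
  assumes [simp]: "\<And>n. X n \<in> carrier H" "x \<in> carrier H" and "hconv H X x"
  shows "hconv H (\<lambda>n. c \<odot> X n) (c \<odot> x)"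
proof -
  have "c \<odot> X n \<ominus> c \<odot> x = c \<odot> (X n \<ominus> x)" for n
    by (rule hinner_ext) (auto simp: hinner_simps algebra_simps)
  then have "hnorm H (c \<odot> X n \<ominus> c \<odot> x) = cmod c * hnorm H (X n \<ominus> x)" for n by simp
  then show ?thesis using assms(3) unfolding hconv_def by (simp add: tendsto_mult_right_zero)
qed

lemma hclosureE:
  assumes "x \<in> hclosure H V" and V: "V \<subseteq> carrier H"
  obtains X where "\<And>n. X n \<in> V" "hconv H X x" "x \<in> carrier H"
proof -
  have "\<forall>n. \<exists>v. v \<in> V \<and> hnorm H (x \<ominus> v) < inverse (real (Suc n))"
  proof
    fix n have "inverse (real (Suc n)) > 0" by simp
    then show "\<exists>v. v \<in> V \<and> hnorm H (x \<ominus> v) < inverse (real (Suc n))"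
      using assms(1) unfolding hclosure_def by blast
  qed
  then obtain X where X: "\<And>n. X n \<in> V" "\<And>n. hnorm H (x \<ominus> X n) < inverse (real (Suc n))" by metis
  have x: "x \<in> carrier H" using assms by (simp add: hclosure_def)
  have "hconv H X x"
  proof -
    have "norm (hnorm H (X n \<ominus> x)) \<le> inverse (real (Suc n))" for n
      using X[of n] V x hnorm_minus_commute[of x "X n"] by (auto simp: subset_iff less_imp_le)
    then show ?thesis unfolding hconv_def
      by (intro Lim_null_comparison[OF _ LIMSEQ_inverse_real_of_nat]) auto
  qed
  then show ?thesis using that X x by blast
qed

lemma hconv_hclosure:
  assumes "\<And>n. X n \<in> V" "V \<subseteq> carrier H" "hconv H X x" "x \<in> carrier H"
  shows "x \<in> hclosure H V"
proof -
  have "\<exists>v\<in>V. hnorm H (x \<ominus> v) < e" if "e > 0" for e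
  proof -
    obtain n where "norm (hnorm H (X n \<ominus> x)) < e"
      using LIMSEQ_D[OF assms(3)[unfolded hconv_def]] \<open>e > 0\<close> by auto
    then show ?thesis using assms hnorm_minus_commute[of x "X n"]
      by (intro bexI[of _ "X n"]) (auto simp: subset_iff)
  qed
  then show ?thesis using assms(4) by (simp add: hclosure_def)
qed

lemma hclosure_superset: "V \<subseteq> carrier H \<Longrightarrow> V \<subseteq> hclosure H V"
  using hconv_hclosure[OF _ _ hconv_const] by blast

lemma hclosure_idem:
  assumes V: "V \<subseteq> carrier H" shows "hclosure H (hclosure H V) \<subseteq> hclosure H V"
proof
  fix x assume x: "x \<in> hclosure H (hclosure H V)"
  then have [simp]: "x \<in> carrier H" by (simp add: hclosure_def)
  have "\<exists>v\<in>V. hnorm H (x \<ominus> v) < e" if "e > 0" for e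
  proof -
    obtain y where y: "y \<in> hclosure H V" "hnorm H (x \<ominus> y) < e / 2"
      using x \<open>e > 0\<close> unfolding hclosure_def[of H "hclosure H V"] by (auto dest: half_gt_zero)
    then obtain v where v: "v \<in> V" "hnorm H (y \<ominus> v) < e / 2"
      using \<open>e > 0\<close> unfolding hclosure_def by (auto dest: half_gt_zero)
    have "y \<in> carrier H" "v \<in> carrier H" using y v V by (auto simp: hclosure_def)
    then show ?thesis using hnorm_triangle_minus[of x y v] y v by (intro bexI[of _ v]) auto
  qed
  then show "x \<in> hclosure H V" by (simp add: hclosure_def)
qed

text \<open>The minimisers of \<open>\<parallel>v\<parallel>\<^sup>2 - 2 Re (f v)\<close> over \<open>V\<close> converge to the representing vector.\<close>

lemma riesz_on_subspace:
  assumes V: "subspace_of H V"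
    and f_add: "\<And>v w. v \<in> V \<Longrightarrow> w \<in> V \<Longrightarrow> f (v \<oplus> w) = f v + f w"
    and f_smult: "\<And>c v. v \<in> V \<Longrightarrow> f (c \<odot> v) = c * f v"
    and f_bd: "\<And>v. v \<in> V \<Longrightarrow> cmod (f v) \<le> C * hnorm H v"
  shows "\<exists>\<zeta>\<in>hclosure H V. \<forall>v\<in>V. f v = hinner H v \<zeta>"
proof -
  have VC: "v \<in> V \<Longrightarrow> v \<in> carrier H" for v using V by (auto simp: subspace_of_def)
  have V_add: "v \<in> V \<Longrightarrow> w \<in> V \<Longrightarrow> v \<oplus> w \<in> V" and V_smult: "v \<in> V \<Longrightarrow> c \<odot> v \<in> V"
    and V0: "\<zero> \<in> V" for v w c
    using V by (auto simp: subspace_of_def)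
  define G where "G v = (hnorm H v)\<^sup>2 - 2 * Re (f v)" for v
  have G_lower: "- C\<^sup>2 \<le> G v" if "v \<in> V" for v
  proof -
    have "Re (f v) \<le> C * hnorm H v" by (rule order_trans[OF complex_Re_le_cmod f_bd[OF that]])
    moreover have "0 \<le> (hnorm H v - C)\<^sup>2" by simp
    ultimately show ?thesis by (simp add: G_def power2_diff mult.commute)
  qed
  define m where "m = Inf (G ` V)"
  have bdd: "bdd_below (G ` V)" using G_lower by (auto intro!: bdd_belowI2)
  have m_le: "m \<le> G v" if "v \<in> V" for v unfolding m_def using that bdd by (auto intro: cInf_lower)
  have "\<exists>v\<in>V. G v < m + inverse (real (Suc n))" for n
    using cInf_lessD[of "G ` V" "m + inverse (real (Suc n))"] V0 by (auto simp: m_def)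
  then obtain X where XV: "\<And>n. X n \<in> V" and GX: "\<And>n. G (X n) < m + inverse (real (Suc n))"
    by metis
  have XC [simp]: "X n \<in> carrier H" for n using XV VC by blast
  \<comment> \<open>The linear part of G cancels in the parallelogram law: ||u - v||^2 = 2 G u + 2 G
    v - 4 G ((u + v)/2), and the last value is at least m. Hence near-minimisers are close to each
    other.\<close>
  have dist: "(hnorm H (u \<ominus> v))\<^sup>2 \<le> 2 * (G u - m) + 2 * (G v - m)" if "u \<in> V" "v \<in> V" for u v
  proof -
    have [simp]: "u \<in> carrier H" "v \<in> carrier H" using that VC by auto
    let ?w = "(1/2) \<odot> (u \<oplus> v)"
    have w: "?w \<in> V" using that V_add V_smult by blast
    have fw: "f ?w = (1/2) * (f u + f v)" using that f_add f_smult V_add by simp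
    have "4 * (hnorm H ?w)\<^sup>2 = (hnorm H (u \<oplus> v))\<^sup>2"
      by (simp add: power_divide)
    then have "(hnorm H (u \<ominus> v))\<^sup>2 = 2 * (hnorm H u)\<^sup>2 + 2 * (hnorm H v)\<^sup>2 - 4 * (hnorm H ?w)\<^sup>2"
      using parallelogram[of u v] by simp
    also have "\<dots> = 2 * G u + 2 * G v - 4 * G ?w"
      by (simp only: G_def fw) (simp add: algebra_simps)
    finally show ?thesis using m_le[OF w] by simp
  qed
  have cau: "\<exists>N. \<forall>m\<ge>N. \<forall>n\<ge>N. hnorm H (X m \<ominus> X n) < e" if "e > 0" for e
  proof -
    obtain N where N: "inverse (real (Suc N)) < e\<^sup>2 / 4"
      using reals_Archimedean[of "e\<^sup>2/4"] \<open>e > 0\<close> by auto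
    have "hnorm H (X p \<ominus> X n) < e" if "p \<ge> N" "n \<ge> N" for p n
    proof -
      have "inverse (real (Suc p)) \<le> inverse (real (Suc N))" "inverse (real (Suc n)) \<le> inverse (real (Suc N))"
        using that by (auto intro!: le_imp_inverse_le)
      then have "inverse (real (Suc p)) < e\<^sup>2 / 4" "inverse (real (Suc n)) < e\<^sup>2 / 4"
        using le_less_trans[OF _ N] by blast+
      then have "G (X p) - m < e\<^sup>2 / 4" "G (X n) - m < e\<^sup>2 / 4"
        using GX[of p] GX[of n] by linarith+
      then have "2 * (G (X p) - m) + 2 * (G (X n) - m) < e\<^sup>2"
        by (simp add: field_simps)
      then have "(hnorm H (X p \<ominus> X n))\<^sup>2 < e\<^sup>2"
        by (rule le_less_trans[OF dist[OF XV XV]])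
      then show ?thesis using \<open>e > 0\<close> by (simp add: power2_less_imp_less)
    qed
    then show ?thesis by blast
  qed
  obtain \<zeta> where \<zeta>: "\<zeta> \<in> carrier H" "hconv H X \<zeta>"
    using hcomplete[of X] cau unfolding hconv_def by auto
  have "f v = hinner H v \<zeta>" if v: "v \<in> V" for v
  proof -
    have [simp]: "v \<in> carrier H" using v VC by blast
    define d where "d n = hinner H v (X n) - f v" for n
    define t where "t = inverse (1 + (hnorm H v)\<^sup>2)"
    have t: "0 < t" "t * (hnorm H v)\<^sup>2 \<le> 1"
      by (simp_all add: t_def field_simps add_pos_nonneg)
    have bd: "(cmod (d n))\<^sup>2 \<le> inverse (real (Suc n)) / t" for n
    proof -
      \<comment> \<open>A step from \<open>X n\<close> against the derivative of G along v. Since t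
        ||v||^2 \<le> 1, the quadratic term costs at most half of the linear gain, so G drops by at
        least t |d n|^2; but \<open>X n\<close> is within 1/(n+1) of the infimum, which forces d to
        0. The 1 in the denominator of t covers v = 0.\<close>
      define s where "s = - of_real t * cnj (d n)"
      have "m \<le> G (X n \<oplus> s \<odot> v)" using XV v V_add V_smult m_le by blast
      also have "G (X n \<oplus> s \<odot> v) = G (X n) + (cmod s)\<^sup>2 * (hnorm H v)\<^sup>2 + 2 * Re (s * d n)"
      proof -
        have "hinner H (X n) (s \<odot> v) = cnj (hinner H (s \<odot> v) (X n))" by (rule hinner_commute) auto
        then have "(hnorm H (X n \<oplus> s \<odot> v))\<^sup>2 =
            (hnorm H (X n))\<^sup>2 + (hnorm H (s \<odot> v))\<^sup>2 + 2 * Re (hinner H (s \<odot> v) (X n))"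
          by (simp add: hnorm_sq hinner_add_left hinner_add_right del: hnorm_smult)
        then show ?thesis
          using XV v f_add f_smult V_smult
          by (simp add: G_def d_def hinner_simps power_mult_distrib algebra_simps)
      qed
      also have "s * d n = of_real (- t * (cmod (d n))\<^sup>2)"
        by (simp add: s_def complex_norm_square mult.commute del: of_real_power)
      also have "(cmod s)\<^sup>2 = t\<^sup>2 * (cmod (d n))\<^sup>2"
        using t by (simp add: s_def norm_mult power_mult_distrib)
      finally have "t * (cmod (d n))\<^sup>2 * (2 - t * (hnorm H v)\<^sup>2) \<le> inverse (real (Suc n))"
        using GX[of n] by (simp add: algebra_simps power2_eq_square)
      moreover have "t * (cmod (d n))\<^sup>2 * 1 \<le> t * (cmod (d n))\<^sup>2 * (2 - t * (hnorm H v)\<^sup>2)"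
        using t by (intro mult_left_mono) auto
      ultimately have "t * (cmod (d n))\<^sup>2 * 1 \<le> inverse (real (Suc n))"
        by (rule order_trans[rotated])
      then show ?thesis by (simp only: pos_le_divide_eq[OF t(1)] mult_1_right mult.commute)
    qed
    have "(\<lambda>n. inverse (real (Suc n)) / t) \<longlonglongrightarrow> 0 / t"
      by (intro tendsto_divide LIMSEQ_inverse_real_of_nat) (use t in auto)
    then have "(\<lambda>n. (cmod (d n))\<^sup>2) \<longlonglongrightarrow> 0"
      by - (rule Lim_null_comparison[OF always_eventually], use bd in auto)
    then have "(\<lambda>n. sqrt ((cmod (d n))\<^sup>2)) \<longlonglongrightarrow> sqrt 0" by (intro tendsto_intros)
    then have d0: "d \<longlonglongrightarrow> 0" by (simp add: tendsto_norm_zero_iff)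
    have "(\<lambda>n. hinner H v (X n)) \<longlonglongrightarrow> hinner H v \<zeta>"
      by (intro hconv_hinner2 hconv_const) (use \<zeta> in auto)
    then have "d \<longlonglongrightarrow> hinner H v \<zeta> - f v" unfolding d_def by (intro tendsto_intros)
    with d0 show ?thesis using LIMSEQ_unique by fastforce
  qed
  moreover have "\<zeta> \<in> hclosure H V"
    by (rule hconv_hclosure[of X]) (use XV VC \<zeta> in auto)
  ultimately show ?thesis by blast
qed

lemma hclosure_orthogonal:
  assumes "V \<subseteq> carrier H" "x \<in> carrier H" "\<forall>v\<in>V. hinner H x v = 0" "y \<in> hclosure H V"
  shows "hinner H x y = 0"
proof -
  obtain X where X: "\<And>n. X n \<in> V" "hconv H X y" "y \<in> carrier H"
    by (rule hclosureE[OF assms(4,1)]) (rule that)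
  have "(\<lambda>n. hinner H x (X n)) \<longlonglongrightarrow> hinner H x y"
    by (intro hconv_hinner2 hconv_const) (use X assms in auto)
  then show ?thesis using assms(3) X(1) by (simp add: LIMSEQ_const_iff)
qed

lemma subspace_of_hclosure:
  assumes V: "subspace_of H V" shows "subspace_of H (hclosure H V)"
proof -
  have VC: "V \<subseteq> carrier H" using V by (auto simp: subspace_of_def)
  have "x \<oplus> y \<in> hclosure H V" if "x \<in> hclosure H V" "y \<in> hclosure H V" for x y
  proof -
    obtain X where "\<And>n. X n \<in> V" "hconv H X x" "x \<in> carrier H"
      by (rule hclosureE[OF \<open>x \<in> hclosure H V\<close> VC]) (rule that)
    moreover obtain Y where "\<And>n. Y n \<in> V" "hconv H Y y" "y \<in> carrier H"
      by (rule hclosureE[OF \<open>y \<in> hclosure H V\<close> VC]) (rule that)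
    ultimately show ?thesis using V VC
      by (intro hconv_hclosure[of "\<lambda>n. X n \<oplus> Y n"] hconv_add) (auto simp: subspace_of_def)
  qed
  moreover have "c \<odot> x \<in> hclosure H V" if "x \<in> hclosure H V" for x c
  proof -
    obtain X where X: "\<And>n. X n \<in> V" "hconv H X x" "x \<in> carrier H"
      by (rule hclosureE[OF \<open>x \<in> hclosure H V\<close> VC]) (rule that)
    have "hconv H (\<lambda>n. c \<odot> X n) (c \<odot> x)" by (rule hconv_smult[OF _ X(3,2)]) (use X(1) VC in blast)
    then show ?thesis using V VC X
      by (intro hconv_hclosure[of "\<lambda>n. c \<odot> X n"]) (auto simp: subspace_of_def)
  qed
  ultimately show ?thesis using V hclosure_superset[OF VC]
    by (auto simp: subspace_of_def hclosure_def)
qed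

text \<open>The Riesz vector of v \<mapsto> <v, x> on V is the projection of x. This is why
  \<open>riesz_on_subspace\<close> places its vector in the closure of V.\<close>

lemma projection_exists:
  assumes V: "subspace_of H V"
  shows "\<exists>Q. \<forall>x\<in>carrier H. Q x \<in> hclosure H V \<and> (\<forall>v\<in>hclosure H V. hinner H (x \<ominus> Q x) v = 0)"
proof -
  have VC: "V \<subseteq> carrier H" using V by (auto simp: subspace_of_def)
  have "\<exists>z\<in>hclosure H V. \<forall>v\<in>hclosure H V. hinner H (x \<ominus> z) v = 0" if [simp]: "x \<in> carrier H" for x
  proof -
    have "\<exists>\<zeta>\<in>hclosure H V. \<forall>v\<in>V. hinner H v x = hinner H v \<zeta>"
      using VC cauchy_schwarz[of _ x]
      by (intro riesz_on_subspace[OF V, where C="hnorm H x"]) (auto simp: hinner_simps subset_iff mult.commute)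
    then obtain z where z: "z \<in> hclosure H V" "\<And>v. v \<in> V \<Longrightarrow> hinner H v x = hinner H v z" by blast
    then have [simp]: "z \<in> carrier H" by (simp add: hclosure_def)
    have "hinner H (x \<ominus> z) v = 0" if "v \<in> V" for v
    proof -
      have [simp]: "v \<in> carrier H" using that VC by auto
      show ?thesis
        using z(2)[OF that] hinner_commute[of x v] hinner_commute[of z v] by (simp add: hinner_simps)
    qed
    then show ?thesis using z(1) hclosure_orthogonal[OF VC, of "x \<ominus> z"] by auto
  qed
  then show ?thesis by metis
qed

text \<open>Q commutes with \<pi> because the star maps the algebra to itself, so that the
  orthogonal complement is invariant along with the closure. Invariance is demanded only with values
  in the closure of V, since an element of the completion acts as a limit and may move V out of
  itself.\<close>

lemma projection_in_commutant:
  assumes V: "subspace_of H V" and rep: "representation B H \<pi>"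
    and inv: "\<And>x v. x \<in> carrier B \<Longrightarrow> v \<in> V \<Longrightarrow> \<pi> x v \<in> hclosure H V"
    and star: "\<And>x. x \<in> carrier B \<Longrightarrow> star B x \<in> carrier B"
  obtains Q where "Q \<in> commutant B H \<pi>" "\<And>x. x \<in> carrier H \<Longrightarrow> Q x \<in> hclosure H V"
    "\<And>x. x \<in> hclosure H V \<Longrightarrow> Q x = x"
proof -
  have VC: "V \<subseteq> carrier H" using V by (auto simp: subspace_of_def)
  have cl: "subspace_of H (hclosure H V)" by (rule subspace_of_hclosure[OF V])
  have clC: "x \<in> hclosure H V \<Longrightarrow> x \<in> carrier H" for x by (simp add: hclosure_def)
  obtain Q where Q: "\<And>x. x \<in> carrier H \<Longrightarrow> Q x \<in> hclosure H V"
    "\<And>x v. x \<in> carrier H \<Longrightarrow> v \<in> hclosure H V \<Longrightarrow> hinner H (x \<ominus> Q x) v = 0"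
    using projection_exists[OF V] by blast
  have QC [simp]: "x \<in> carrier H \<Longrightarrow> Q x \<in> carrier H" for x using Q clC by blast
  \<comment> \<open>Q x - y lies in the closure and is orthogonal to it. Linearity of Q and its
    commutation with \<pi> are both obtained by exhibiting a candidate for the projection.\<close>
  have uniq: "Q x = y" if [simp]: "x \<in> carrier H" and y: "y \<in> hclosure H V"
    and o: "\<And>v. v \<in> hclosure H V \<Longrightarrow> hinner H (x \<ominus> y) v = 0" for x y
  proof -
    have [simp]: "y \<in> carrier H" using y clC by blast
    have eq: "Q x \<ominus> y = (x \<ominus> y) \<ominus> (x \<ominus> Q x)"
      by (rule hinner_ext) (auto simp: hinner_simps)
    have "Q x \<oplus> (-1) \<odot> y \<in> hclosure H V" using cl y Q(1) by (auto simp: subspace_of_def)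
    then have d: "Q x \<ominus> y \<in> hclosure H V" by (simp add: hminus_eq)
    have "hinner H ((x \<ominus> y) \<ominus> (x \<ominus> Q x)) (Q x \<ominus> y) = 0"
      using o[OF d] Q(2)[OF _ d, of x] by (simp add: hinner_minus_left[of "x \<ominus> y" "x \<ominus> Q x"])
    then have "hinner H (Q x \<ominus> y) (Q x \<ominus> y) = 0" by (simp flip: eq)
    then have "hnorm H (Q x \<ominus> y) = 0" by (simp add: hnorm_def)
    then show ?thesis by (simp add: hnorm_minus_eq_zero)
  qed
  have Qadd: "Q (x \<oplus> y) = Q x \<oplus> Q y" if "x \<in> carrier H" "y \<in> carrier H" for x y
  proof (rule uniq)
    show "Q x \<oplus> Q y \<in> hclosure H V" using cl Q(1) that by (auto simp: subspace_of_def)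
    fix v assume v: "v \<in> hclosure H V"
    then show "hinner H (x \<oplus> y \<ominus> (Q x \<oplus> Q y)) v = 0"
      using Q(2)[of x v] Q(2)[of y v] that clC by (simp add: hinner_simps)
  qed (use that in auto)
  have Qsm: "Q (c \<odot> x) = c \<odot> Q x" if "x \<in> carrier H" for c x
  proof (rule uniq)
    show "c \<odot> Q x \<in> hclosure H V" using cl Q(1) that by (auto simp: subspace_of_def)
    fix v assume v: "v \<in> hclosure H V"
    then show "hinner H (c \<odot> x \<ominus> c \<odot> Q x) v = 0"
      using Q(2)[of x v] that clC by (simp add: hinner_simps)
  qed (use that in auto)
  have Qbd: "hnorm H (Q x) \<le> 1 * hnorm H x" if [simp]: "x \<in> carrier H" for x
  proof -
    have "hinner H (Q x) (Q x) = hinner H x (Q x)" using Q[OF that] Q(2)[OF that Q(1)[OF that]] by (simp add: hinner_minus_left)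
    then have "(hnorm H (Q x))\<^sup>2 = Re (hinner H x (Q x))" by (simp add: hnorm_sq)
    also have "\<dots> \<le> hnorm H x * hnorm H (Q x)"
      by (rule Re_hinner_le) auto
    finally have "hnorm H (Q x) * hnorm H (Q x) \<le> hnorm H x * hnorm H (Q x)"
      by (simp add: power2_eq_square)
    then show ?thesis using hnorm_nonneg[of "Q x"] hnorm_nonneg[of x]
      by (cases "hnorm H (Q x) = 0") (auto simp del: hnorm_nonneg)
  qed
  have bo: "bounded_operator H (\<pi> x)" if "x \<in> carrier B" for x
    using rep that by (simp add: representation_def)
  have \<pi>C: "\<pi> x y \<in> carrier H" if "x \<in> carrier B" "y \<in> carrier H" for x y
    using linear_mapD(1)[OF bounded_operatorD(1)[OF bo]] that by blast
  have inv': "\<pi> x y \<in> hclosure H V" if "x \<in> carrier B" "y \<in> hclosure H V" for x y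
  proof -
    obtain X where X: "\<And>n. X n \<in> V" "hconv H X y" "y \<in> carrier H"
      by (rule hclosureE[OF \<open>y \<in> hclosure H V\<close> VC]) (rule that)
    have "hconv H (\<lambda>n. \<pi> x (X n)) (\<pi> x y)"
      by (rule hconv_bounded[OF bo[OF that(1)] _ X(3,2)]) (use X(1) VC in blast)
    then have "\<pi> x y \<in> hclosure H (hclosure H V)"
      using inv[OF that(1) X(1)] clC \<pi>C[OF that(1) X(3)]
      by (intro hconv_hclosure[of "\<lambda>n. \<pi> x (X n)" "hclosure H V"]) auto
    then show ?thesis using hclosure_idem[OF VC] by blast
  qed
  have comm: "Q (\<pi> x y) = \<pi> x (Q y)" if [simp]: "x \<in> carrier B" "y \<in> carrier H" for x y
  proof (rule uniq)
    show "\<pi> x (Q y) \<in> hclosure H V" using inv' Q(1) that by blast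
    fix v assume v: "v \<in> hclosure H V"
    have [simp]: "v \<in> carrier H" using v clC by blast
    have "\<pi> x y \<ominus> \<pi> x (Q y) = \<pi> x (y \<ominus> Q y)"
      using linear_map_minus[OF hilbert_space_axioms bounded_operatorD(1)[OF bo], of x y "Q y"] by simp
    then have "hinner H (\<pi> x y \<ominus> \<pi> x (Q y)) v = hinner H (y \<ominus> Q y) (\<pi> (star B x) v)"
      using rep by (simp add: representation_def)
    also have "\<dots> = 0" by (rule Q(2)[OF that(2) inv'[OF star[OF that(1)] v]])
    finally show "hinner H (\<pi> x y \<ominus> \<pi> x (Q y)) v = 0" .
  qed (use \<pi>C in auto)
  have "Q \<in> commutant B H \<pi>"
  proof -
    have "linear_map H H Q" unfolding linear_map_def using Qadd Qsm QC by auto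
    then have "bounded_operator H Q" unfolding bounded_operator_def using Qbd by blast
    then show ?thesis unfolding commutant_def using comm by simp
  qed
  moreover have "Q x = x" if "x \<in> hclosure H V" for x
    by (rule uniq[OF clC[OF that] that]) (simp add: a_minus_def r_neg clC that)
  ultimately show ?thesis using that Q(1) by blast
qed

end


section \<open>Direct sum of two Hilbert spaces\<close>

definition direct_sum ::
  "('h, 'm) inner_module_scheme \<Rightarrow> ('k, 'n) inner_module_scheme \<Rightarrow> ('h \<times> 'k) inner_module" where
  "direct_sum H K =
     \<lparr>carrier = carrier H \<times> carrier K, mult = undefined, one = undefined,
      zero = (\<zero>\<^bsub>H\<^esub>, \<zero>\<^bsub>K\<^esub>), add = (\<lambda>(x, y) (x', y'). (x \<oplus>\<^bsub>H\<^esub> x', y \<oplus>\<^bsub>K\<^esub> y')),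
      smult = (\<lambda>c (x, y). (c \<odot>\<^bsub>H\<^esub> x, c \<odot>\<^bsub>K\<^esub> y)),
      hinner = (\<lambda>(x, y) (x', y'). hinner H x x' + hinner K y y')\<rparr>"

lemma direct_sum_simps [simp]:
  "carrier (direct_sum H K) = carrier H \<times> carrier K"
  "\<zero>\<^bsub>direct_sum H K\<^esub> = (\<zero>\<^bsub>H\<^esub>, \<zero>\<^bsub>K\<^esub>)"
  "(x, y) \<oplus>\<^bsub>direct_sum H K\<^esub> (x', y') = (x \<oplus>\<^bsub>H\<^esub> x', y \<oplus>\<^bsub>K\<^esub> y')"
  "c \<odot>\<^bsub>direct_sum H K\<^esub> (x, y) = (c \<odot>\<^bsub>H\<^esub> x, c \<odot>\<^bsub>K\<^esub> y)"
  "hinner (direct_sum H K) (x, y) (x', y') = hinner H x x' + hinner K y y'"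
  by (simp_all add: direct_sum_def)

lemma hilbert_space_direct_sum:
  assumes H: "hilbert_space H" and K: "hilbert_space K"
  shows "hilbert_space (direct_sum H K)"
proof -
  interpret H: hilbert_space H by fact
  interpret K: hilbert_space K by fact
  let ?S = "direct_sum H K"
  have ab: "abelian_group ?S"
  proof (rule abelian_groupI)
    fix x assume "x \<in> carrier ?S"
    then show "\<exists>y\<in>carrier ?S. y \<oplus>\<^bsub>?S\<^esub> x = \<zero>\<^bsub>?S\<^esub>"
      by (auto intro!: bexI[of _ "(\<ominus>\<^bsub>H\<^esub> fst x, \<ominus>\<^bsub>K\<^esub> snd x)"] simp: H.l_neg K.l_neg)
  qed (auto simp: H.a_ac K.a_ac)
  have mod: "Module.module complex_ring ?S"
    by (rule moduleI) (use ab cring_complex_ring H.smult_l_distr K.smult_l_distr H.smult_r_distr K.smult_r_distr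
        H.smult_assoc1 K.smult_assoc1 H.smult_one K.smult_one in auto)
  interpret S: Module.module complex_ring ?S by fact
  have minus: "(x, y) \<ominus>\<^bsub>?S\<^esub> (x', y') = (x \<ominus>\<^bsub>H\<^esub> x', y \<ominus>\<^bsub>K\<^esub> y')"
    if "x \<in> carrier H" "x' \<in> carrier H" "y \<in> carrier K" "y' \<in> carrier K" for x x' y y'
  proof -
    have "\<ominus>\<^bsub>?S\<^esub> (x', y') = (\<ominus>\<^bsub>H\<^esub> x', \<ominus>\<^bsub>K\<^esub> y')"
      by (rule S.minus_equality) (use that in \<open>auto simp: H.l_neg K.l_neg\<close>)
    then show ?thesis by (simp add: a_minus_def)
  qed
  have nrm: "hnorm ?S (x, y) = sqrt ((hnorm H x)\<^sup>2 + (hnorm K y)\<^sup>2)" if "x \<in> carrier H" "y \<in> carrier K" for x y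
    using that by (simp add: hnorm_def H.hinner_nonneg K.hinner_nonneg)
  show ?thesis
  proof
    fix x y z and c :: complex
    show "x \<in> carrier ?S \<Longrightarrow> y \<in> carrier ?S \<Longrightarrow> hinner ?S x y = cnj (hinner ?S y x)"
      using H.hinner_commute[of "fst x" "fst y"] K.hinner_commute[of "snd x" "snd y"] by auto
    show "x \<in> carrier ?S \<Longrightarrow> y \<in> carrier ?S \<Longrightarrow> z \<in> carrier ?S \<Longrightarrow>
        hinner ?S (x \<oplus>\<^bsub>?S\<^esub> y) z = hinner ?S x z + hinner ?S y z"
      by (auto simp: H.hinner_add_left K.hinner_add_left)
    show "x \<in> carrier ?S \<Longrightarrow> y \<in> carrier ?S \<Longrightarrow> hinner ?S (c \<odot>\<^bsub>?S\<^esub> x) y = c * hinner ?S x y"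
      by (auto simp: H.hinner_smult_left K.hinner_smult_left algebra_simps)
    show "x \<in> carrier ?S \<Longrightarrow> 0 \<le> Re (hinner ?S x x)"
      by (auto simp: H.hinner_nonneg K.hinner_nonneg)
    show "x = \<zero>\<^bsub>?S\<^esub>" if x: "x \<in> carrier ?S" and 0: "hinner ?S x x = 0"
    proof -
      obtain a b where ab: "x = (a, b)" "a \<in> carrier H" "b \<in> carrier K" using x by auto
      then have "complex_of_real ((hnorm H a)\<^sup>2 + (hnorm K b)\<^sup>2) = 0"
        using 0 by (simp add: H.hinner_self K.hinner_self)
      then have "(hnorm H a)\<^sup>2 + (hnorm K b)\<^sup>2 = 0" using of_real_eq_0_iff by blast
      then have "hnorm H a = 0 \<and> hnorm K b = 0" by (simp add: sum_power2_eq_zero_iff)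
      then show ?thesis using ab by (simp add: H.hnorm_eq_zero K.hnorm_eq_zero)
    qed
  next
    fix X :: "nat \<Rightarrow> _" assume XC: "\<And>n. X n \<in> carrier ?S"
      and cau: "\<And>e. e > 0 \<Longrightarrow> \<exists>N. \<forall>m\<ge>N. \<forall>n\<ge>N. hnorm ?S (X m \<ominus>\<^bsub>?S\<^esub> X n) < e"
    define A B where "A n = fst (X n)" and "B n = snd (X n)" for n
    have AC [simp]: "A n \<in> carrier H" and BC [simp]: "B n \<in> carrier K" and X: "X n = (A n, B n)" for n
      using XC[of n] by (auto simp: A_def B_def)
    have "hnorm H (A m \<ominus>\<^bsub>H\<^esub> A n) \<le> hnorm ?S (X m \<ominus>\<^bsub>?S\<^esub> X n)" "hnorm K (B m \<ominus>\<^bsub>K\<^esub> B n) \<le> hnorm ?S (X m \<ominus>\<^bsub>?S\<^esub> X n)" for m n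
      by (auto simp: X minus nrm intro!: real_le_rsqrt)
    then have "\<exists>N. \<forall>m\<ge>N. \<forall>n\<ge>N. hnorm H (A m \<ominus>\<^bsub>H\<^esub> A n) < e" "\<exists>N. \<forall>m\<ge>N. \<forall>n\<ge>N. hnorm K (B m \<ominus>\<^bsub>K\<^esub> B n) < e" if "e > 0" for e
      using cau[OF that] by (meson order_le_less_trans)+
    then obtain a b where ab: "a \<in> carrier H" "(\<lambda>n. hnorm H (A n \<ominus>\<^bsub>H\<^esub> a)) \<longlonglongrightarrow> (0::real)"
      "b \<in> carrier K" "(\<lambda>n. hnorm K (B n \<ominus>\<^bsub>K\<^esub> b)) \<longlonglongrightarrow> 0"
      using H.hcomplete[of A] K.hcomplete[of B] by auto
    have "(\<lambda>n. sqrt ((hnorm H (A n \<ominus>\<^bsub>H\<^esub> a))\<^sup>2 + (hnorm K (B n \<ominus>\<^bsub>K\<^esub> b))\<^sup>2)) \<longlonglongrightarrow> sqrt (0\<^sup>2 + 0\<^sup>2)"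
      by (intro tendsto_intros ab)
    then have "(\<lambda>n. hnorm ?S (X n \<ominus>\<^bsub>?S\<^esub> (a, b))) \<longlonglongrightarrow> 0"
      using ab by (simp add: X minus nrm)
    then show "\<exists>x\<in>carrier ?S. (\<lambda>n. hnorm ?S (X n \<ominus>\<^bsub>?S\<^esub> x)) \<longlonglongrightarrow> 0"
      using ab by (intro bexI[of _ "(a, b)"]) auto
  qed
qed

section \<open>Completions\<close>

text \<open>Shared by the two completions, of C_c(\<Gamma>, A) in the universal seminorm and of C(X)
  in the L^2 seminorm. The distance is a separate parameter, tied to q on V only, because
  \<open>universal_dist\<close> uses the subtraction of the ring record, which is identified with
  the ordinary one on the carrier.\<close>

locale seminorm_space =
  fixes V :: "'v::ab_group_add set" and q :: "'v \<Rightarrow> real" and d :: "'v \<Rightarrow> 'v \<Rightarrow> real"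
  assumes V_zero [simp]: "0 \<in> V"
    and V_add [simp]: "\<lbrakk>x \<in> V; y \<in> V\<rbrakk> \<Longrightarrow> x + y \<in> V"
    and V_uminus [simp]: "x \<in> V \<Longrightarrow> - x \<in> V"
    and q_zero [simp]: "q 0 = 0"
    and q_add: "\<lbrakk>x \<in> V; y \<in> V\<rbrakk> \<Longrightarrow> q (x + y) \<le> q x + q y"
    and q_uminus: "x \<in> V \<Longrightarrow> q (- x) = q x"
    and d_eq: "\<lbrakk>x \<in> V; y \<in> V\<rbrakk> \<Longrightarrow> d x y = q (x - y)"
begin

lemma V_minus [simp]: "\<lbrakk>x \<in> V; y \<in> V\<rbrakk> \<Longrightarrow> x - y \<in> V"
  using V_add[of x "- y"] by simp

lemma q_nonneg [simp]: "x \<in> V \<Longrightarrow> 0 \<le> q x"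
  using q_add[of x "- x"] q_uminus[of x] by simp

lemma q_minus_commute: "\<lbrakk>x \<in> V; y \<in> V\<rbrakk> \<Longrightarrow> q (x - y) = q (y - x)"
  using q_uminus[of "x - y"] by simp

lemma q_triangle: "\<lbrakk>x \<in> V; y \<in> V; z \<in> V\<rbrakk> \<Longrightarrow> q (x - z) \<le> q (x - y) + q (y - z)"
  using q_add[of "x - y" "y - z"] by simp

lemma q_diff_le: "\<lbrakk>x \<in> V; y \<in> V\<rbrakk> \<Longrightarrow> \<bar>q x - q y\<bar> \<le> q (x - y)"
  using q_triangle[of x y 0] q_triangle[of y x 0] q_minus_commute[of x y] by simp

abbreviation "CS \<equiv> cauchy_seqs V d"
abbreviation "cls X \<equiv> cauchy_rel V d `` {X}"

text \<open>Read as a limit along the product filter, the Cauchy property is inherited by comparison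
  with sums and multiples of null families, as in \<open>CS_I\<close>, instead of by epsilon
  arguments.\<close>

lemma CS_iff:
  "X \<in> CS \<longleftrightarrow> (\<forall>n. X n \<in> V) \<and> ((\<lambda>(m, n). q (X m - X n)) \<longlongrightarrow> 0) (sequentially \<times>\<^sub>F sequentially)"
proof -
  have swap: "(\<exists>N. \<forall>m\<ge>N. \<forall>n\<ge>N. R m n) \<longleftrightarrow> (\<exists>N. \<forall>m\<ge>N. \<forall>n\<ge>N. R n m)"
    for R :: "nat \<Rightarrow> nat \<Rightarrow> bool" by blast
  have "((\<lambda>(m, n). q (X m - X n)) \<longlongrightarrow> 0) (sequentially \<times>\<^sub>F sequentially) \<longleftrightarrow>
      (\<forall>e>0. \<exists>N. \<forall>m\<ge>N. \<forall>n\<ge>N. q (X m - X n) < e)" if "\<forall>n. X n \<in> V"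
    using that by (simp add: tendsto_iff eventually_prod_sequentially case_prod_unfold)
      (subst swap, rule refl)
  then show ?thesis
    by (auto simp: cauchy_seqs_def d_eq)
qed

lemma CS_V: "X \<in> CS \<Longrightarrow> X n \<in> V"
  by (simp add: CS_iff)

lemma CS_tendsto: "X \<in> CS \<Longrightarrow> ((\<lambda>p. q (X (fst p) - X (snd p))) \<longlongrightarrow> 0) (sequentially \<times>\<^sub>F sequentially)"
  by (simp add: CS_iff case_prod_unfold)

lemma CS_I:
  assumes "\<And>n. X n \<in> V" and "(f \<longlongrightarrow> 0) (sequentially \<times>\<^sub>F sequentially)"
    and "\<And>m n. q (X m - X n) \<le> f (m, n)"
  shows "X \<in> CS"
  unfolding CS_iff
proof (intro conjI allI)
  show "((\<lambda>(m, n). q (X m - X n)) \<longlongrightarrow> 0) (sequentially \<times>\<^sub>F sequentially)"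
    by (rule Lim_null_comparison[OF always_eventually assms(2)]) (use assms(1,3) in auto)
qed (rule assms(1))

lemma CS_D:
  assumes "X \<in> CS" "e > 0" shows "\<exists>N. \<forall>m\<ge>N. \<forall>n\<ge>N. q (X m - X n) < e"
  using assms CS_V[OF assms(1)] by (simp add: cauchy_seqs_def d_eq)

lemma CS_D2:
  assumes "X \<in> CS" "e > 0" shows "\<exists>N. \<forall>n\<ge>N. q (X n - X N) < e"
proof -
  obtain N where "\<forall>m\<ge>N. \<forall>n\<ge>N. q (X m - X n) < e" using CS_D[OF assms] ..
  then have "\<forall>n\<ge>N. q (X n - X N) < e" by simp
  then show ?thesis ..
qed

lemma rel_iff: "(X, Y) \<in> cauchy_rel V d \<longleftrightarrow> X \<in> CS \<and> Y \<in> CS \<and> (\<lambda>n. q (X n - Y n)) \<longlonglongrightarrow> 0"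
proof (cases "X \<in> CS \<and> Y \<in> CS")
  case True
  then have "d (X n) (Y n) = q (X n - Y n)" for n by (simp add: d_eq CS_V)
  then show ?thesis by (simp add: cauchy_rel_def)
qed (auto simp: cauchy_rel_def)

lemma q_null_trans:
  assumes "\<And>n. X n \<in> V" "\<And>n. Y n \<in> V" "\<And>n. Z n \<in> V"
    and "(\<lambda>n. q (X n - Y n)) \<longlonglongrightarrow> 0" "(\<lambda>n. q (Y n - Z n)) \<longlonglongrightarrow> 0"
  shows "(\<lambda>n. q (X n - Z n)) \<longlonglongrightarrow> 0"
  by (rule Lim_null_comparison[OF always_eventually tendsto_add_zero[OF assms(4,5)]])
    (use assms(1-3) q_triangle in auto)

lemma q_null_sym:
  assumes "\<And>n. X n \<in> V" "\<And>n. Y n \<in> V" "(\<lambda>n. q (X n - Y n)) \<longlonglongrightarrow> 0"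
  shows "(\<lambda>n. q (Y n - X n)) \<longlonglongrightarrow> 0"
  using assms by (simp add: q_minus_commute[of "Y _"])

lemma equiv_cauchy_rel: "equiv CS (cauchy_rel V d)"
proof (rule equivI)
  show "cauchy_rel V d \<subseteq> CS \<times> CS" by (auto simp: rel_iff)
  show "refl_on CS (cauchy_rel V d)" by (auto simp: refl_on_def rel_iff)
  show "sym (cauchy_rel V d)"
  proof (rule symI)
    fix X Y assume "(X, Y) \<in> cauchy_rel V d"
    then show "(Y, X) \<in> cauchy_rel V d"
      unfolding rel_iff using q_null_sym[of X Y] CS_V by simp
  qed
  show "trans (cauchy_rel V d)"
  proof (rule transI)
    fix X Y Z assume "(X, Y) \<in> cauchy_rel V d" "(Y, Z) \<in> cauchy_rel V d"
    then show "(X, Z) \<in> cauchy_rel V d"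
      unfolding rel_iff using q_null_trans[of X Y Z] CS_V by simp
  qed
qed

lemma cls_eq_iff: "\<lbrakk>X \<in> CS; Y \<in> CS\<rbrakk> \<Longrightarrow> cls X = cls Y \<longleftrightarrow> (\<lambda>n. q (X n - Y n)) \<longlonglongrightarrow> 0"
  using eq_equiv_class_iff[OF equiv_cauchy_rel, of X Y] by (simp add: rel_iff)

lemma cls_self: "X \<in> CS \<Longrightarrow> X \<in> cls X"
  by (simp add: rel_iff)

lemma completionI: "X \<in> CS \<Longrightarrow> cls X \<in> completion V d"
  by (simp add: completion_def quotientI)

lemma completionE:
  assumes "P \<in> completion V d" obtains X where "X \<in> CS" "P = cls X"
  using assms by (auto simp: completion_def elim: quotientE)

lemma completion_ex: "P \<in> completion V d \<Longrightarrow> \<exists>X. X \<in> CS \<and> P = cls X"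
  by (auto elim: completionE)

lemma const_CS [simp]: "v \<in> V \<Longrightarrow> (\<lambda>n. v) \<in> CS"
  by (rule CS_I[where f="\<lambda>_. 0"]) auto

lemma to_completion_eq: "to_completion V d v = cls (\<lambda>n. v)"
  by (simp add: to_completion_def)

text \<open>A Lipschitz map sends equivalent Cauchy sequences to equivalent ones, so the union over
  all representatives in \<open>completion_map1\<close> is a union of one and the same
  class.\<close>

lemma completion_map1_eq:
  assumes "\<And>x. x \<in> V \<Longrightarrow> f x \<in> V" and "\<And>x y. x \<in> V \<Longrightarrow> y \<in> V \<Longrightarrow> q (f x - f y) \<le> C * q (x - y)"
    and X: "X \<in> CS"
  shows "(\<lambda>n. f (X n)) \<in> CS" "completion_map1 V d f (cls X) = cls (\<lambda>n. f (X n))"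
proof -
  have cs: "(\<lambda>n. f (Y n)) \<in> CS" if "Y \<in> CS" for Y
    by (rule CS_I[where f="\<lambda>p. C * q (Y (fst p) - Y (snd p))"])
      (use assms(1,2) CS_V[OF that] tendsto_mult_right_zero[OF CS_tendsto[OF that]] in auto)
  show "(\<lambda>n. f (X n)) \<in> CS" by (rule cs[OF X])
  have "cls (\<lambda>n. f (Y n)) = cls (\<lambda>n. f (X n))" if "Y \<in> cls X" for Y
  proof -
    have r: "X \<in> CS" "Y \<in> CS" "(\<lambda>n. q (X n - Y n)) \<longlonglongrightarrow> 0" using that by (auto simp: rel_iff)
    have "(\<lambda>n. q (f (X n) - f (Y n))) \<longlonglongrightarrow> 0"
      by (rule Lim_null_comparison[OF always_eventually tendsto_mult_right_zero[OF r(3), of C]])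
        (use assms(1,2) CS_V r in auto)
    then have "cls (\<lambda>n. f (X n)) = cls (\<lambda>n. f (Y n))" using cls_eq_iff[OF cs cs] r by simp
    then show ?thesis ..
  qed
  moreover have "X \<in> cls X" using X by (rule cls_self)
  ultimately show "completion_map1 V d f (cls X) = cls (\<lambda>n. f (X n))"
    unfolding completion_map1_def by blast
qed

text \<open>Compatibility is assumed for Cauchy sequences rather than through a Lipschitz constant,
  because multiplication is Lipschitz only on bounded sets.\<close>

lemma completion_map2_eq:
  assumes cs: "\<And>X Y. X \<in> CS \<Longrightarrow> Y \<in> CS \<Longrightarrow> (\<lambda>n. f (X n) (Y n)) \<in> CS"
    and eq: "\<And>X X' Y Y'. X \<in> CS \<Longrightarrow> X' \<in> CS \<Longrightarrow> Y \<in> CS \<Longrightarrow> Y' \<in> CS \<Longrightarrow> (\<lambda>n. q (X n - X' n)) \<longlonglongrightarrow> 0 \<Longrightarrow>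
      (\<lambda>n. q (Y n - Y' n)) \<longlonglongrightarrow> 0 \<Longrightarrow> (\<lambda>n. q (f (X n) (Y n) - f (X' n) (Y' n))) \<longlonglongrightarrow> 0"
    and X: "X \<in> CS" and Y: "Y \<in> CS"
  shows "completion_map2 V d f (cls X) (cls Y) = cls (\<lambda>n. f (X n) (Y n))"
proof -
  have "cls (\<lambda>n. f (X' n) (Y' n)) = cls (\<lambda>n. f (X n) (Y n))" if "X' \<in> cls X" "Y' \<in> cls Y" for X' Y'
  proof -
    have r: "X' \<in> CS" "Y' \<in> CS" "(\<lambda>n. q (X n - X' n)) \<longlonglongrightarrow> 0" "(\<lambda>n. q (Y n - Y' n)) \<longlonglongrightarrow> 0"
      using that by (auto simp: rel_iff)
    show ?thesis
      using cls_eq_iff[OF cs[OF X Y] cs[OF r(1,2)]] eq[OF X r(1) Y r(2) r(3,4)] by simp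
  qed
  moreover have "X \<in> cls X" "Y \<in> cls Y" by (rule cls_self[OF X], rule cls_self[OF Y])
  ultimately show ?thesis
    unfolding completion_map2_def by blast
qed

lemma CS_add: "\<lbrakk>X \<in> CS; Y \<in> CS\<rbrakk> \<Longrightarrow> (\<lambda>n. X n + Y n) \<in> CS"
proof (rule CS_I)
  assume X: "X \<in> CS" and Y: "Y \<in> CS"
  show "((\<lambda>p. q (X (fst p) - X (snd p)) + q (Y (fst p) - Y (snd p))) \<longlongrightarrow> 0) (sequentially \<times>\<^sub>F sequentially)"
    by (rule tendsto_add_zero[OF CS_tendsto[OF X] CS_tendsto[OF Y]])
  fix m n
  show "X n + Y n \<in> V" using X Y CS_V by simp
  show "q (X m + Y m - (X n + Y n)) \<le> q (X (fst (m, n)) - X (snd (m, n))) + q (Y (fst (m, n)) - Y (snd (m, n)))"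
    using q_add[of "X m - X n" "Y m - Y n"] CS_V[OF X] CS_V[OF Y] by (simp add: algebra_simps)
qed

lemma completion_add_eq:
  assumes X: "X \<in> CS" and Y: "Y \<in> CS"
  shows "completion_map2 V d (+) (cls X) (cls Y) = cls (\<lambda>n. X n + Y n)"
proof (rule completion_map2_eq[OF CS_add _ X Y])
  fix X X' Y Y' assume CS: "X \<in> CS" "X' \<in> CS" "Y \<in> CS" "Y' \<in> CS"
    and lim: "(\<lambda>n. q (X n - X' n)) \<longlonglongrightarrow> 0" "(\<lambda>n. q (Y n - Y' n)) \<longlonglongrightarrow> 0"
  have "q (X n + Y n - (X' n + Y' n)) \<le> q (X n - X' n) + q (Y n - Y' n)" for n
    using q_add[of "X n - X' n" "Y n - Y' n"] CS CS_V by (simp add: algebra_simps)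
  then show "(\<lambda>n. q (X n + Y n - (X' n + Y' n))) \<longlonglongrightarrow> 0"
    by - (rule Lim_null_comparison[OF always_eventually tendsto_add_zero[OF lim]], use CS CS_V in auto)
qed

lemma CS_bounded:
  assumes "X \<in> CS" shows "\<exists>M>0. \<forall>n. q (X n) \<le> M"
proof -
  obtain N where N: "\<And>m n. m \<ge> N \<Longrightarrow> n \<ge> N \<Longrightarrow> q (X m - X n) < 1"
    using CS_D[OF assms, of 1] by auto
  \<comment> \<open>The sum bounds the head and the distance to the N-th term bounds the tail; the
    leading 1 also makes M positive, as later divisions by M require.\<close>
  define M where "M = 1 + q (X N) + (\<Sum>i<N. q (X i))"
  have V: "X n \<in> V" for n using assms by (rule CS_V)
  have s: "0 \<le> (\<Sum>i<N. q (X i))" using V by (intro sum_nonneg) auto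
  have "q (X n) \<le> M" for n
  proof (cases "n < N")
    case True
    then have "q (X n) \<le> (\<Sum>i<N. q (X i))" using V by (intro member_le_sum) auto
    then show ?thesis using V[of N] by (simp add: M_def add_increasing)
  next
    case False
    then have "q (X n - X N) < 1" using N by simp
    then show ?thesis using q_diff_le[OF V V, of n N] s by (simp add: M_def)
  qed
  moreover have "M > 0" using s V[of N] by (simp add: M_def add_pos_nonneg)
  ultimately show ?thesis by blast
qed

end

section \<open>Hilbert space completion of a semi-inner product\<close>

locale semi_inner_product =
  fixes sm :: "complex \<Rightarrow> 'v::ab_group_add \<Rightarrow> 'v" and s :: "'v \<Rightarrow> 'v \<Rightarrow> complex"
  assumes sm_add_right: "sm c (x + y) = sm c x + sm c y"
    and sm_add_left: "sm (c + c') x = sm c x + sm c' x"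
    and sm_assoc: "sm (c * c') x = sm c (sm c' x)"
    and sm_one: "sm 1 x = x"
    and s_commute: "s x y = cnj (s y x)"
    and s_add_left: "s (x + y) z = s x z + s y z"
    and s_sm_left: "s (sm c x) y = c * s x y"
    and s_nonneg: "0 \<le> Re (s x x)"
begin

definition "q x = sqrt (Re (s x x))"

lemma sm_uminus: "sm (-1) x = - x"
  using sm_add_left[of 1 "-1" x] sm_add_left[of 0 0 x] sm_one[of x]
  by (simp add: eq_neg_iff_add_eq_0 add.commute)

lemma s_add_right: "s z (x + y) = s z x + s z y"
  using s_commute[of z "x + y"] s_commute[of z x] s_commute[of z y] by (simp add: s_add_left)

lemma s_sm_right: "s x (sm c y) = cnj c * s x y"
  using s_commute[of x "sm c y"] s_commute[of x y] by (simp add: s_sm_left)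

lemma s_uminus_left: "s (- x) y = - s x y"
  using s_sm_left[of "-1" x y] by (simp add: sm_uminus)

lemma s_uminus_right: "s x (- y) = - s x y"
  using s_sm_right[of x "-1" y] by (simp add: sm_uminus)

lemma s_minus_left: "s (x - y) z = s x z - s y z"
  using s_add_left[of x "- y" z] by (simp add: s_uminus_left)

lemma s_minus_right: "s z (x - y) = s z x - s z y"
  using s_add_right[of z x "- y"] by (simp add: s_uminus_right)

lemma s_self: "s x x = of_real ((q x)\<^sup>2)"
proof -
  have "s x x = cnj (s x x)" by (rule s_commute)
  then have "Im (s x x) = 0" by (metis Reals_cnj_iff complex_is_Real_iff)
  then show ?thesis using s_nonneg[of x] by (simp add: complex_eq_iff q_def)
qed

lemma q_nonneg: "0 \<le> q x"
  by (simp add: q_def s_nonneg)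

text \<open>The form may be degenerate, so q y = 0 does not give y = 0 and that case needs its own
  argument. Testing positivity on x + t D y with D = s x y makes the cross term 2 t |D|^2 real,
  leaving a real quadratic inequality in t.\<close>

lemma s_cauchy_schwarz: "cmod (s x y) \<le> q x * q y"
proof -
  define D where "D = s x y"
  define a where "a = (q x)\<^sup>2"
  define b where "b = (q y)\<^sup>2"
  have yx: "s y x = cnj D" unfolding D_def by (rule s_commute)
  have ab: "a \<ge> 0" "b \<ge> 0" by (simp_all add: a_def b_def)
  have key: "0 \<le> a + 2 * t * (cmod D)\<^sup>2 + t\<^sup>2 * (cmod D)\<^sup>2 * b" for t :: real
  proof -
    let ?c = "of_real t * D"
    have "s (x + sm ?c y) (x + sm ?c y) = of_real a + 2 * of_real t * (D * cnj D) + (of_real t)\<^sup>2 * (D * cnj D) * of_real b"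
      using s_self[of x] s_self[of y]
      by (simp add: s_add_left s_add_right s_sm_left s_sm_right yx flip: a_def b_def D_def)
        (simp add: algebra_simps power2_eq_square)
    also have "\<dots> = of_real (a + 2 * t * (cmod D)\<^sup>2 + t\<^sup>2 * (cmod D)\<^sup>2 * b)"
      unfolding complex_norm_square[symmetric] by simp
    finally show ?thesis using s_nonneg[of "x + sm ?c y"] by simp
  qed
  have "(cmod D)\<^sup>2 \<le> a * b"
  proof (cases "b = 0")
    case True
    show ?thesis
    proof (rule ccontr)
      assume "\<not> ?thesis"
      then have pos: "(cmod D)\<^sup>2 > 0" using True by simp
      \<comment> \<open>For b = 0 the expression is affine in t; this t makes it equal to -a - 2,
        which is negative.\<close>
      have "0 \<le> a + 2 * (- (a + 1) / (cmod D)\<^sup>2) * (cmod D)\<^sup>2"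
        using key[of "- (a + 1) / (cmod D)\<^sup>2"] True by simp
      also have "\<dots> = - a - 2" using pos by simp
      finally show False using ab by simp
    qed
  next
    case False
    then have b: "b > 0" using ab by simp
    \<comment> \<open>The minimiser of the quadratic in t.\<close>
    have "0 \<le> a + 2 * (-1 / b) * (cmod D)\<^sup>2 + (-1 / b)\<^sup>2 * (cmod D)\<^sup>2 * b" by (rule key)
    also have "\<dots> = a - (cmod D)\<^sup>2 / b" using b by (simp add: field_simps power2_eq_square)
    finally show ?thesis using b by (simp add: field_simps)
  qed
  then have "(cmod D)\<^sup>2 \<le> (q x * q y)\<^sup>2" by (simp add: a_def b_def power_mult_distrib)
  then show ?thesis unfolding D_def by (rule power2_le_imp_le) (simp add: q_nonneg)
qed

lemma q_triangle_ineq: "q (x + y) \<le> q x + q y"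
proof (rule power2_le_imp_le)
  have "s y x = cnj (s x y)" by (rule s_commute)
  then have "Re (s y x) = Re (s x y)" by simp
  moreover have "(q z)\<^sup>2 = Re (s z z)" for z by (simp add: q_def s_nonneg)
  ultimately have "(q (x + y))\<^sup>2 = (q x)\<^sup>2 + (q y)\<^sup>2 + 2 * Re (s x y)"
    by (simp add: s_add_left s_add_right)
  also have "Re (s x y) \<le> q x * q y"
    by (rule order_trans[OF complex_Re_le_cmod s_cauchy_schwarz])
  finally show "(q (x + y))\<^sup>2 \<le> (q x + q y)\<^sup>2" by (simp add: power2_sum)
qed (simp add: q_nonneg)

lemma q_sm: "q (sm c x) = cmod c * q x"
proof -
  have "s (sm c x) (sm c x) = (c * cnj c) * s x x" by (simp add: s_sm_left s_sm_right)
  also have "\<dots> = of_real ((cmod c * q x)\<^sup>2)"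
    unfolding complex_norm_square[symmetric] s_self by (simp add: power_mult_distrib)
  finally show ?thesis by (simp add: q_def[of "sm c x"] real_sqrt_abs q_nonneg del: of_real_power)
qed

abbreviation "dst \<equiv> \<lambda>x y. sqrt (Re (s (x - y) (x - y)))"

sublocale seminorm_space UNIV q dst
proof
  show "q 0 = 0" using s_add_left[of 0 0 0] by (simp add: q_def)
  show "q (- x) = q x" for x by (simp add: q_def s_uminus_left s_uminus_right)
qed (simp_all add: q_def q_triangle_ineq[unfolded q_def])

text \<open>Spelled field by field like \<open>gns_space\<close>, and \<open>dst\<close> like
  \<open>gns_dist\<close>, so that for the form of a state the two spaces coincide by
  unfolding.\<close>

definition hilbert_completion :: "(nat \<Rightarrow> 'v) set inner_module" where
  "hilbert_completion =
     \<lparr>carrier = completion UNIV dst, mult = undefined, one = undefined,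
      zero = to_completion UNIV dst 0, add = completion_map2 UNIV dst (+),
      smult = (\<lambda>c. completion_map1 UNIV dst (sm c)),
      hinner = (\<lambda>P Q. THE l. \<forall>a\<in>P. \<forall>b\<in>Q. (\<lambda>n. s (a n) (b n)) \<longlonglongrightarrow> l)\<rparr>"

abbreviation "HC \<equiv> hilbert_completion"

lemma HC_carrier: "carrier HC = completion UNIV dst"
  by (simp add: hilbert_completion_def)

lemma HC_zero: "\<zero>\<^bsub>HC\<^esub> = cls (\<lambda>n. 0)"
  by (simp add: hilbert_completion_def to_completion_eq)

lemma HC_add: "\<lbrakk>X \<in> CS; Y \<in> CS\<rbrakk> \<Longrightarrow> cls X \<oplus>\<^bsub>HC\<^esub> cls Y = cls (\<lambda>n. X n + Y n)"
  by (simp add: hilbert_completion_def completion_add_eq)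

lemma sm_minus_right: "sm c (x - y) = sm c x - sm c y"
proof -
  have "sm c (- y) = - sm c y" using sm_assoc[of c "-1" y] sm_assoc[of "-1" c y] by (simp add: sm_uminus)
  then show ?thesis using sm_add_right[of c x "- y"] by simp
qed

lemma
  assumes "X \<in> CS"
  shows CS_sm: "(\<lambda>n. sm c (X n)) \<in> CS" and HC_smult: "c \<odot>\<^bsub>HC\<^esub> cls X = cls (\<lambda>n. sm c (X n))"
  using completion_map1_eq[of "sm c" "cmod c" X] assms
  by (simp_all add: q_sm hilbert_completion_def flip: sm_minus_right)

text \<open>Splitting the difference as s(X, Y - Y') + s(X - X', Y') pairs a bounded factor with a
  null one. The same splitting gives the Cauchy property in \<open>s_convergent\<close>.\<close>

lemma s_diff_tendsto_zero:
  assumes X: "X \<in> CS" and X': "X' \<in> CS" and Y: "Y \<in> CS" and Y': "Y' \<in> CS"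
    and lim: "(\<lambda>n. q (X n - X' n)) \<longlonglongrightarrow> 0" "(\<lambda>n. q (Y n - Y' n)) \<longlonglongrightarrow> 0"
  shows "(\<lambda>n. s (X n) (Y n) - s (X' n) (Y' n)) \<longlonglongrightarrow> 0"
proof -
  obtain M where M: "\<And>n. q (X n) \<le> M" using CS_bounded[OF X] by blast
  obtain M' where M': "\<And>n. q (Y' n) \<le> M'" using CS_bounded[OF Y'] by blast
  have "cmod (s (X n) (Y n) - s (X' n) (Y' n)) \<le> M * q (Y n - Y' n) + M' * q (X n - X' n)" for n
  proof -
    have "s (X n) (Y n) - s (X' n) (Y' n) = s (X n) (Y n - Y' n) + s (X n - X' n) (Y' n)"
      by (simp add: s_minus_left s_minus_right)
    then have "cmod (s (X n) (Y n) - s (X' n) (Y' n)) \<le> q (X n) * q (Y n - Y' n) + q (X n - X' n) * q (Y' n)"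
      using norm_triangle_le[OF add_mono[OF s_cauchy_schwarz s_cauchy_schwarz]] by metis
    also have "\<dots> \<le> M * q (Y n - Y' n) + q (X n - X' n) * M'"
      by (intro add_mono mult_right_mono mult_left_mono M M' q_nonneg UNIV_I)
    finally show ?thesis by (simp add: mult.commute)
  qed
  moreover have "(\<lambda>n. M * q (Y n - Y' n) + M' * q (X n - X' n)) \<longlonglongrightarrow> 0"
    by (intro tendsto_add_zero tendsto_mult_right_zero lim)
  ultimately show ?thesis
    by - (rule Lim_null_comparison[OF always_eventually], auto)
qed

lemma s_convergent:
  assumes X: "X \<in> CS" and Y: "Y \<in> CS"
  shows "convergent (\<lambda>n. s (X n) (Y n))"
proof -
  obtain M where M: "M > 0" "\<And>n. q (X n) \<le> M" using CS_bounded[OF X] by blast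
  obtain M' where M': "M' > 0" "\<And>n. q (Y n) \<le> M'" using CS_bounded[OF Y] by blast
  have "Cauchy (\<lambda>n. s (X n) (Y n))"
  proof (rule CauchyI)
    fix e :: real assume e: "e > 0"
    obtain N1 where N1: "\<forall>m\<ge>N1. \<forall>n\<ge>N1. q (X m - X n) < e / (2 * M')" using CS_D[OF X, of "e / (2*M')"] e M' by auto
    obtain N2 where N2: "\<forall>m\<ge>N2. \<forall>n\<ge>N2. q (Y m - Y n) < e / (2 * M)" using CS_D[OF Y, of "e / (2*M)"] e M by auto
    have "cmod (s (X m) (Y m) - s (X n) (Y n)) < e" if "m \<ge> max N1 N2" "n \<ge> max N1 N2" for m n
    proof -
      have "s (X m) (Y m) - s (X n) (Y n) = s (X m) (Y m - Y n) + s (X m - X n) (Y n)"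
        by (simp add: s_minus_left s_minus_right)
      then have "cmod (s (X m) (Y m) - s (X n) (Y n)) \<le> q (X m) * q (Y m - Y n) + q (X m - X n) * q (Y n)"
        using norm_triangle_le[OF add_mono[OF s_cauchy_schwarz s_cauchy_schwarz]] by metis
      also have "\<dots> \<le> M * q (Y m - Y n) + q (X m - X n) * M'"
        by (intro add_mono mult_right_mono mult_left_mono M M' q_nonneg UNIV_I)
      also have "\<dots> < M * (e / (2 * M)) + e / (2 * M') * M'"
        using N1 N2 that M M' by (intro add_strict_mono mult_strict_left_mono mult_strict_right_mono) auto
      also have "\<dots> = e" using M M' by simp
      finally show ?thesis .
    qed
    then show "\<exists>N. \<forall>m\<ge>N. \<forall>n\<ge>N. cmod (s (X m) (Y m) - s (X n) (Y n)) < e" by blast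
  qed
  then show ?thesis by (rule Cauchy_convergent)
qed

text \<open>Makes the definite description in \<open>hinner\<close> meaningful: all representatives
  of two classes give the same limit.\<close>

lemma HC_hinner_lim:
  assumes X: "X \<in> CS" and Y: "Y \<in> CS"
  shows "(\<lambda>n. s (X n) (Y n)) \<longlonglongrightarrow> hinner HC (cls X) (cls Y)"
proof -
  obtain l where l: "(\<lambda>n. s (X n) (Y n)) \<longlonglongrightarrow> l" using s_convergent[OF X Y] by (auto simp: convergent_def)
  have all: "\<forall>a\<in>cls X. \<forall>b\<in>cls Y. (\<lambda>n. s (a n) (b n)) \<longlonglongrightarrow> l"
  proof (intro ballI)
    fix a b assume "a \<in> cls X" "b \<in> cls Y"
    then have r: "a \<in> CS" "b \<in> CS" "(\<lambda>n. q (X n - a n)) \<longlonglongrightarrow> 0" "(\<lambda>n. q (Y n - b n)) \<longlonglongrightarrow> 0"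
      by (auto simp: rel_iff)
    have "(\<lambda>n. s (X n) (Y n) - (s (X n) (Y n) - s (a n) (b n))) \<longlonglongrightarrow> l - 0"
      by (intro tendsto_diff l s_diff_tendsto_zero X Y r)
    then show "(\<lambda>n. s (a n) (b n)) \<longlonglongrightarrow> l" by simp
  qed
  have "hinner HC (cls X) (cls Y) = (THE l. \<forall>a\<in>cls X. \<forall>b\<in>cls Y. (\<lambda>n. s (a n) (b n)) \<longlonglongrightarrow> l)"
    by (simp add: hilbert_completion_def)
  also have "\<dots> = l"
  proof (rule the_equality)
    show "\<forall>a\<in>cls X. \<forall>b\<in>cls Y. (\<lambda>n. s (a n) (b n)) \<longlonglongrightarrow> l" by (rule all)
    fix l' assume "\<forall>a\<in>cls X. \<forall>b\<in>cls Y. (\<lambda>n. s (a n) (b n)) \<longlonglongrightarrow> l'"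
    then have "(\<lambda>n. s (X n) (Y n)) \<longlonglongrightarrow> l'" using cls_self[OF X] cls_self[OF Y] by blast
    then show "l' = l" using l LIMSEQ_unique by blast
  qed
  finally show ?thesis using l by simp
qed

lemma HC_hinner_eqI: "\<lbrakk>X \<in> CS; Y \<in> CS; (\<lambda>n. s (X n) (Y n)) \<longlonglongrightarrow> l\<rbrakk> \<Longrightarrow> hinner HC (cls X) (cls Y) = l"
  using HC_hinner_lim LIMSEQ_unique by blast

lemma HC_hnorm_lim:
  assumes "X \<in> CS" shows "(\<lambda>n. q (X n)) \<longlonglongrightarrow> hnorm HC (cls X)"
  unfolding hnorm_def q_def by (intro tendsto_intros HC_hinner_lim assms)

lemma HC_module: "Module.module complex_ring HC"
proof (rule moduleI)
  show "abelian_group HC"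
  proof (rule abelian_groupI)
    fix x y z assume "x \<in> carrier HC" "y \<in> carrier HC" "z \<in> carrier HC"
    then have "\<exists>X. X \<in> CS \<and> x = cls X" "\<exists>X. X \<in> CS \<and> y = cls X" "\<exists>X. X \<in> CS \<and> z = cls X"
      unfolding HC_carrier by (simp_all only: completion_ex)
    then obtain X Y Z where "X \<in> CS" "x = cls X" "Y \<in> CS" "y = cls Y" "Z \<in> CS" "z = cls Z"
      by blast
    then show "x \<oplus>\<^bsub>HC\<^esub> y \<in> carrier HC" "x \<oplus>\<^bsub>HC\<^esub> y \<oplus>\<^bsub>HC\<^esub> z = x \<oplus>\<^bsub>HC\<^esub> (y \<oplus>\<^bsub>HC\<^esub> z)" "x \<oplus>\<^bsub>HC\<^esub> y = y \<oplus>\<^bsub>HC\<^esub> x"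
      by (simp_all add: HC_add CS_add HC_carrier completionI ac_simps)
  next
    fix x assume "x \<in> carrier HC"
    then obtain X where X: "X \<in> CS" "x = cls X" unfolding HC_carrier by (blast dest: completion_ex)
    then show "\<zero>\<^bsub>HC\<^esub> \<oplus>\<^bsub>HC\<^esub> x = x" by (simp add: HC_zero HC_add)
    have "cls (\<lambda>n. sm (-1) (X n)) \<in> carrier HC" "cls (\<lambda>n. sm (-1) (X n)) \<oplus>\<^bsub>HC\<^esub> x = \<zero>\<^bsub>HC\<^esub>"
      using X CS_sm[OF X(1), of "-1"] by (simp_all add: HC_carrier completionI HC_add HC_zero sm_uminus)
    then show "\<exists>y\<in>carrier HC. y \<oplus>\<^bsub>HC\<^esub> x = \<zero>\<^bsub>HC\<^esub>" by blast
  qed (simp add: HC_zero HC_carrier completionI)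
  fix a b :: complex and x y assume "x \<in> carrier HC"
  then obtain X where X: "X \<in> CS" "x = cls X" unfolding HC_carrier by (blast dest: completion_ex)
  show "a \<odot>\<^bsub>HC\<^esub> x \<in> carrier HC" using X by (simp add: HC_smult HC_carrier completionI CS_sm)
  show "(a \<oplus>\<^bsub>complex_ring\<^esub> b) \<odot>\<^bsub>HC\<^esub> x = a \<odot>\<^bsub>HC\<^esub> x \<oplus>\<^bsub>HC\<^esub> b \<odot>\<^bsub>HC\<^esub> x"
    using X by (simp add: HC_smult HC_add CS_sm sm_add_left)
  show "(a \<otimes>\<^bsub>complex_ring\<^esub> b) \<odot>\<^bsub>HC\<^esub> x = a \<odot>\<^bsub>HC\<^esub> (b \<odot>\<^bsub>HC\<^esub> x)"
    using X by (simp add: HC_smult CS_sm sm_assoc)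
  show "\<one>\<^bsub>complex_ring\<^esub> \<odot>\<^bsub>HC\<^esub> x = x" using X by (simp add: HC_smult sm_one)
  assume "y \<in> carrier HC"
  then obtain Y where Y: "Y \<in> CS" "y = cls Y" unfolding HC_carrier by (blast dest: completion_ex)
  show "a \<odot>\<^bsub>HC\<^esub> (x \<oplus>\<^bsub>HC\<^esub> y) = a \<odot>\<^bsub>HC\<^esub> x \<oplus>\<^bsub>HC\<^esub> a \<odot>\<^bsub>HC\<^esub> y"
    using X Y by (simp add: HC_smult HC_add CS_sm CS_add sm_add_right)
qed (rule cring_complex_ring)

lemma HC_minus: "\<lbrakk>X \<in> CS; Y \<in> CS\<rbrakk> \<Longrightarrow> cls X \<ominus>\<^bsub>HC\<^esub> cls Y = cls (\<lambda>n. X n - Y n)"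
  and CS_minus: "\<lbrakk>X \<in> CS; Y \<in> CS\<rbrakk> \<Longrightarrow> (\<lambda>n. X n - Y n) \<in> CS"
proof -
  interpret M: Module.module complex_ring HC by (rule HC_module)
  assume X: "X \<in> CS" and Y: "Y \<in> CS"
  have nY: "(\<lambda>n. - Y n) \<in> CS" using CS_sm[OF Y, of "-1"] by (simp add: sm_uminus)
  show "(\<lambda>n. X n - Y n) \<in> CS" using CS_add[OF X nY] by simp
  have "\<ominus>\<^bsub>HC\<^esub> cls Y = cls (\<lambda>n. - Y n)"
    by (rule M.minus_equality) (use Y nY in \<open>simp_all add: HC_add HC_zero HC_carrier completionI\<close>)
  then show "cls X \<ominus>\<^bsub>HC\<^esub> cls Y = cls (\<lambda>n. X n - Y n)"
    using HC_add[OF X nY] by (simp add: a_minus_def)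
qed

lemma HC_dist_const:
  assumes X: "X \<in> CS" and e: "\<And>n. n \<ge> N \<Longrightarrow> q (X n - v) \<le> e"
  shows "hnorm HC (cls X \<ominus>\<^bsub>HC\<^esub> cls (\<lambda>n. v)) \<le> e"
proof -
  have "(\<lambda>n. q (X n - v)) \<longlonglongrightarrow> hnorm HC (cls X \<ominus>\<^bsub>HC\<^esub> cls (\<lambda>n. v))"
    using HC_hnorm_lim[OF CS_minus[OF X const_CS]] X by (simp add: HC_minus)
  then show ?thesis by (rule LIMSEQ_le_const2) (use e in blast)
qed

text \<open>The algebraic laws pass to the limit from s. Completeness is a diagonal argument: each
  class in the given Cauchy sequence is approximated by a single vector, and these vectors form a
  representative of the limit class.\<close>

sublocale HC: hilbert_space HC
proof -
  interpret M: Module.module complex_ring HC by (rule HC_module)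
  show "hilbert_space HC"
  proof
    fix x y z and c :: complex assume "x \<in> carrier HC" "y \<in> carrier HC"
    then have "\<exists>X. X \<in> CS \<and> x = cls X" "\<exists>X. X \<in> CS \<and> y = cls X"
      unfolding HC_carrier by (simp_all only: completion_ex)
    then obtain X Y where X: "X \<in> CS" "x = cls X" and Y: "Y \<in> CS" "y = cls Y"
      by blast
    note lim = HC_hinner_lim[OF X(1) Y(1)]
    show "hinner HC x y = cnj (hinner HC y x)"
      unfolding X Y by (rule HC_hinner_eqI[OF X(1) Y(1)])
        (use tendsto_cnj[OF HC_hinner_lim[OF Y(1) X(1)]] in \<open>simp flip: s_commute\<close>)
    show "hinner HC (c \<odot>\<^bsub>HC\<^esub> x) y = c * hinner HC x y"
      unfolding X Y HC_smult[OF X(1)] by (rule HC_hinner_eqI[OF CS_sm[OF X(1)] Y(1)])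
        (use tendsto_mult_left[OF lim, of c] in \<open>simp add: s_sm_left\<close>)
    assume "z \<in> carrier HC"
    then obtain Z where Z: "Z \<in> CS" "z = cls Z" unfolding HC_carrier by (blast dest: completion_ex)
    show "hinner HC (x \<oplus>\<^bsub>HC\<^esub> y) z = hinner HC x z + hinner HC y z"
      unfolding X Y Z HC_add[OF X(1) Y(1)]
      by (rule HC_hinner_eqI[OF CS_add[OF X(1) Y(1)] Z(1)])
        (use tendsto_add[OF HC_hinner_lim[OF X(1) Z(1)] HC_hinner_lim[OF Y(1) Z(1)]] in \<open>simp add: s_add_left\<close>)
  next
    fix x assume "x \<in> carrier HC"
    then obtain X where X: "X \<in> CS" "x = cls X" unfolding HC_carrier by (blast dest: completion_ex)
    note lim = HC_hinner_lim[OF X(1) X(1)]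
    show "0 \<le> Re (hinner HC x x)"
      unfolding X by (rule LIMSEQ_le_const[OF tendsto_Re[OF lim]]) (simp add: s_nonneg)
    assume 0: "hinner HC x x = 0"
    then have "hnorm HC (cls X) = 0" by (simp add: hnorm_def X)
    then have "(\<lambda>n. q (X n)) \<longlonglongrightarrow> 0" using HC_hnorm_lim[OF X(1)] by simp
    then show "x = \<zero>\<^bsub>HC\<^esub>" unfolding X HC_zero using cls_eq_iff[OF X(1), of "\<lambda>n. 0"] by simp
  next
    fix P :: "nat \<Rightarrow> _" assume PC: "\<And>k. P k \<in> carrier HC"
      and cau: "\<And>e. e > 0 \<Longrightarrow> \<exists>N. \<forall>m\<ge>N. \<forall>n\<ge>N. hnorm HC (P m \<ominus>\<^bsub>HC\<^esub> P n) < e"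
    have "\<forall>k. \<exists>Y. Y \<in> CS \<and> P k = cls Y" 
    proof
      fix k show "\<exists>Y. Y \<in> CS \<and> P k = cls Y"
        using PC[of k] unfolding HC_carrier by (rule completionE) blast
    qed
    from choice[OF this] obtain Y where Y': "\<forall>k. Y k \<in> CS \<and> P k = cls (Y k)" ..
    then have Y: "Y k \<in> CS" "P k = cls (Y k)" for k by simp_all
    have "\<forall>k. \<exists>N. \<forall>n\<ge>N. q (Y k n - Y k N) < inverse (real (Suc k))"
      by (intro allI CS_D2[OF Y(1)]) simp
    from choice[OF this] obtain N
      where N': "\<forall>k. \<forall>n\<ge>N k. q (Y k n - Y k (N k)) < inverse (real (Suc k))" ..
    then have N: "n \<ge> N k \<Longrightarrow> q (Y k n - Y k (N k)) < inverse (real (Suc k))" for k n by simp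
    \<comment> \<open>From index \<open>N k\<close> on, the representative \<open>Y k\<close> stays
      within 1/(k+1) of this term, so the constant class of \<open>v k\<close> is that close to
      \<open>P k\<close>.\<close>
    define v where "v k = Y k (N k)" for k
    define \<epsilon> where "\<epsilon> k = inverse (real (Suc k))" for k
    have \<epsilon>0: "\<epsilon> \<longlonglongrightarrow> 0" unfolding \<epsilon>_def by (rule LIMSEQ_inverse_real_of_nat)
    have Pv: "hnorm HC (P k \<ominus>\<^bsub>HC\<^esub> cls (\<lambda>n. v k)) \<le> \<epsilon> k" for k
      unfolding Y(2) by (rule HC_dist_const[OF Y(1), of "N k"]) (use N[of k] in \<open>auto simp: v_def \<epsilon>_def less_imp_le\<close>)
    \<comment> \<open>\<open>v k\<close> and \<open>v l\<close> are compared through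
      \<open>Y k n\<close> and \<open>Y l n\<close> at a late index n; as n grows, the middle
      distance tends to the distance of the two classes.\<close>
    have dist: "q (v k - v l) \<le> \<epsilon> k + hnorm HC (P k \<ominus>\<^bsub>HC\<^esub> P l) + \<epsilon> l" for k l
    proof -
      have le: "q (v k - v l) \<le> q (Y k n - v k) + q (Y k n - Y l n) + q (Y l n - v l)" for n
        using q_triangle[of "v k" "Y k n" "v l"] q_triangle[of "Y k n" "Y l n" "v l"] q_minus_commute[of "v k" "Y k n"] by simp
      have "(\<lambda>n. q (Y k n - Y l n)) \<longlonglongrightarrow> hnorm HC (P k \<ominus>\<^bsub>HC\<^esub> P l)"
        using HC_hnorm_lim[OF CS_minus[OF Y(1)[of k] Y(1)[of l]]] by (simp add: Y HC_minus)
      then have lim: "(\<lambda>n. \<epsilon> k + q (Y k n - Y l n) + \<epsilon> l) \<longlonglongrightarrow> \<epsilon> k + hnorm HC (P k \<ominus>\<^bsub>HC\<^esub> P l) + \<epsilon> l"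
        by (intro tendsto_intros)
      show ?thesis
      proof (rule LIMSEQ_le_const[OF lim], intro exI allI impI)
        fix n assume n: "max (N k) (N l) \<le> n"
        have "q (Y k n - v k) < \<epsilon> k" "q (Y l n - v l) < \<epsilon> l" using N n by (auto simp: v_def \<epsilon>_def)
        then show "q (v k - v l) \<le> \<epsilon> k + q (Y k n - Y l n) + \<epsilon> l" using le[of n] by linarith
      qed
    qed
    have vCS: "v \<in> CS"
    proof -
      have "\<exists>M. \<forall>k\<ge>M. \<forall>l\<ge>M. q (v k - v l) < e" if "e > 0" for e
      proof -
        obtain M1 where M1: "\<forall>m\<ge>M1. \<forall>n\<ge>M1. hnorm HC (P m \<ominus>\<^bsub>HC\<^esub> P n) < e / 2" using cau[OF half_gt_zero[OF \<open>e > 0\<close>]] by blast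
        obtain M2 where M2: "\<And>k. k \<ge> M2 \<Longrightarrow> \<epsilon> k < e / 4" using order_tendstoD(2)[OF \<epsilon>0, of "e/4"] \<open>e > 0\<close>
          by (auto simp: eventually_sequentially)
        have "q (v k - v l) < e" if "k \<ge> max M1 M2" "l \<ge> max M1 M2" for k l
        proof -
          have "hnorm HC (P k \<ominus>\<^bsub>HC\<^esub> P l) < e / 2" "\<epsilon> k < e / 4" "\<epsilon> l < e / 4" using M1 M2 that by auto
          then show ?thesis using dist[of k l] by simp
        qed
        then show ?thesis by blast
      qed
      then show ?thesis by (simp add: cauchy_seqs_def d_eq)
    qed
    have "(\<lambda>k. hnorm HC (P k \<ominus>\<^bsub>HC\<^esub> cls v)) \<longlonglongrightarrow> 0"
    proof (rule LIMSEQ_I)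
      fix e :: real assume e: "e > 0"
      obtain M1 where M1: "\<forall>m\<ge>M1. \<forall>n\<ge>M1. q (v m - v n) < e / 2" using CS_D[OF vCS, of "e/2"] e by auto
      obtain M2 where M2: "\<And>k. k \<ge> M2 \<Longrightarrow> \<epsilon> k < e / 4" using order_tendstoD(2)[OF \<epsilon>0, of "e/4"] e
        by (auto simp: eventually_sequentially)
      have "norm (hnorm HC (P k \<ominus>\<^bsub>HC\<^esub> cls v) - 0) < e" if k: "k \<ge> max M1 M2" for k
      proof -
        let ?a = "\<lambda>n. \<epsilon> k + q (Y k n - Y k (N k)) + q (v k - v n)"
        have lim: "(\<lambda>n. q (Y k n - v n)) \<longlonglongrightarrow> hnorm HC (P k \<ominus>\<^bsub>HC\<^esub> cls v)"
          using HC_hnorm_lim[OF CS_minus[OF Y(1)[of k] vCS]] vCS by (simp add: Y HC_minus)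
        have "hnorm HC (P k \<ominus>\<^bsub>HC\<^esub> cls v) \<le> e / 4 + e / 2"
        proof (rule LIMSEQ_le_const2[OF lim], intro exI allI impI)
          fix n assume n: "max (N k) M1 \<le> n"
          have "q (Y k n - v k) < \<epsilon> k" using N[of k n] n by (simp add: v_def \<epsilon>_def)
          moreover have "q (v k - v n) < e / 2" using M1 n k by simp
          moreover have "\<epsilon> k < e / 4" using M2 k by simp
          ultimately show "q (Y k n - v n) \<le> e / 4 + e / 2" using q_triangle[of "Y k n" "v k" "v n"] by simp
        qed
        moreover have "0 \<le> hnorm HC (P k \<ominus>\<^bsub>HC\<^esub> cls v)"
          by (rule LIMSEQ_le_const[OF lim]) (simp add: q_nonneg)
        ultimately show ?thesis using e by simp
      qed
      then show "\<exists>no. \<forall>n\<ge>no. norm (hnorm HC (P n \<ominus>\<^bsub>HC\<^esub> cls v) - 0) < e" by blast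
    qed
    then show "\<exists>x\<in>carrier HC. (\<lambda>k. hnorm HC (P k \<ominus>\<^bsub>HC\<^esub> x)) \<longlonglongrightarrow> 0"
      unfolding HC_carrier by (rule bexI[OF _ completionI[OF vCS]])
  qed
qed

end

section \<open>Representations of a C*-completion\<close>

text \<open>The supremum runs over the unit ball and not the sphere, so that the index set contains
  the zero vector and is nonempty even when H = 0.\<close>

definition hopnorm :: "('h, 'm) inner_module_scheme \<Rightarrow> ('h \<Rightarrow> 'h) \<Rightarrow> real" where
  "hopnorm H T = (SUP x\<in>{x \<in> carrier H. hnorm H x \<le> 1}. hnorm H (T x))"

context hilbert_space
begin

lemma hopnorm_bdd:
  assumes "bounded_operator H T"
  shows "bdd_above ((\<lambda>x. hnorm H (T x)) ` {x \<in> carrier H. hnorm H x \<le> 1})"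
proof -
  obtain K where K: "K \<ge> 0" "\<forall>x\<in>carrier H. hnorm H (T x) \<le> K * hnorm H x"
    using bounded_operatorD(2)[OF assms] by blast
  have "hnorm H (T x) \<le> K" if "x \<in> carrier H" "hnorm H x \<le> 1" for x
    using K(2) that mult_left_mono[OF that(2) K(1)] by fastforce
  then show ?thesis by (auto intro!: bdd_aboveI2)
qed

lemma hopnorm_bound:
  assumes T: "bounded_operator H T" and x: "x \<in> carrier H"
  shows "hnorm H (T x) \<le> hopnorm H T * hnorm H x"
proof (cases "hnorm H x = 0")
  case True
  then show ?thesis using bounded_operatorD(2)[OF T] x by fastforce
next
  case False
  then have pos: "hnorm H x > 0" using hnorm_nonneg[OF x] by linarith
  let ?y = "of_real (1 / hnorm H x) \<odot> x"
  have y: "?y \<in> carrier H" "hnorm H ?y \<le> 1" using x pos by (simp_all add: norm_divide)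
  have "hnorm H (T ?y) \<le> hopnorm H T"
    unfolding hopnorm_def by (rule cSUP_upper[OF _ hopnorm_bdd[OF T]]) (use y in simp)
  moreover have "T ?y = of_real (1 / hnorm H x) \<odot> T x"
    by (rule linear_mapD(3)[OF bounded_operatorD(1)[OF T] x])
  moreover have "T x \<in> carrier H" by (rule linear_mapD(1)[OF bounded_operatorD(1)[OF T] x])
  ultimately have "hnorm H (T x) / hnorm H x \<le> hopnorm H T" using pos by (simp add: norm_divide)
  then show ?thesis using pos by (simp add: field_simps)
qed

lemma hopnorm_le:
  assumes "\<And>x. x \<in> carrier H \<Longrightarrow> hnorm H (T x) \<le> K * hnorm H x" "K \<ge> 0"
  shows "hopnorm H T \<le> K"
  unfolding hopnorm_def
proof (rule cSUP_least)
  show "{x \<in> carrier H. hnorm H x \<le> 1} \<noteq> {}" by (auto intro!: exI[of _ \<zero>])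
  fix x assume "x \<in> {x \<in> carrier H. hnorm H x \<le> 1}"
  then have x: "x \<in> carrier H" "hnorm H x \<le> 1" by simp_all
  show "hnorm H (T x) \<le> K" using assms(1)[OF x(1)] mult_left_mono[OF x(2) assms(2)] by simp
qed

lemma hopnorm_nonneg:
  assumes T: "bounded_operator H T" shows "0 \<le> hopnorm H T"
proof -
  have "T \<zero> \<in> carrier H" by (rule linear_mapD(1)[OF bounded_operatorD(1)[OF T]]) simp
  then have "0 \<le> hnorm H (T \<zero>)" by simp
  also have "\<dots> \<le> hopnorm H T"
    unfolding hopnorm_def by (rule cSUP_upper[OF _ hopnorm_bdd[OF T]]) simp
  finally show ?thesis .
qed

end

lemma representationD:
  assumes "representation B H \<pi>" "x \<in> carrier B"
  shows "bounded_operator H (\<pi> x)"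
    and "\<lbrakk>y \<in> carrier B; \<xi> \<in> carrier H\<rbrakk> \<Longrightarrow> \<pi> (x \<oplus>\<^bsub>B\<^esub> y) \<xi> = \<pi> x \<xi> \<oplus>\<^bsub>H\<^esub> \<pi> y \<xi>"
    and "\<xi> \<in> carrier H \<Longrightarrow> \<pi> (c \<odot>\<^bsub>B\<^esub> x) \<xi> = c \<odot>\<^bsub>H\<^esub> \<pi> x \<xi>"
    and "\<lbrakk>y \<in> carrier B; \<xi> \<in> carrier H\<rbrakk> \<Longrightarrow> \<pi> (x \<otimes>\<^bsub>B\<^esub> y) \<xi> = \<pi> x (\<pi> y \<xi>)"
    and "\<lbrakk>\<xi> \<in> carrier H; \<eta> \<in> carrier H\<rbrakk> \<Longrightarrow> hinner H (\<pi> x \<xi>) \<eta> = hinner H \<xi> (\<pi> (star B x) \<eta>)"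
    and "\<xi> \<in> carrier H \<Longrightarrow> \<pi> x \<xi> \<in> carrier H"
  using assms by (auto simp: representation_def bounded_operator_def linear_map_def)

lemma (in hilbert_space) hopnorm_star:
  assumes rep: "representation B H \<pi>" and x: "x \<in> carrier B" and sx: "star B x \<in> carrier B"
  shows "hopnorm H (\<pi> (star B x)) \<le> hopnorm H (\<pi> x)"
proof (rule hopnorm_le)
  note D = representationD[OF rep]
  show "0 \<le> hopnorm H (\<pi> x)" by (rule hopnorm_nonneg[OF D(1)[OF x]])
  fix \<eta> assume \<eta>: "\<eta> \<in> carrier H"
  let ?y = "\<pi> (star B x) \<eta>"
  have y: "?y \<in> carrier H" by (rule D(6)[OF sx \<eta>])
  have "(hnorm H ?y)\<^sup>2 = Re (hinner H (\<pi> x ?y) \<eta>)"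
    unfolding D(5)[OF x y \<eta>] by (rule hnorm_sq[OF y])
  also have "\<dots> \<le> hnorm H (\<pi> x ?y) * hnorm H \<eta>" by (rule Re_hinner_le[OF D(6)[OF x y] \<eta>])
  also have "\<dots> \<le> hopnorm H (\<pi> x) * hnorm H ?y * hnorm H \<eta>"
    by (intro mult_right_mono hopnorm_bound[OF D(1)[OF x] y] hnorm_nonneg[OF \<eta>])
  finally have "hnorm H ?y * hnorm H ?y \<le> hnorm H ?y * (hopnorm H (\<pi> x) * hnorm H \<eta>)"
    by (simp add: power2_eq_square mult_ac)
  moreover have "0 \<le> hopnorm H (\<pi> x) * hnorm H \<eta>"
    by (intro mult_nonneg_nonneg hopnorm_nonneg[OF D(1)[OF x]] hnorm_nonneg[OF \<eta>])
  ultimately show "hnorm H ?y \<le> hopnorm H (\<pi> x) * hnorm H \<eta>"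
    using hnorm_nonneg[OF y] by (cases "hnorm H ?y = 0") (simp_all add: mult_le_cancel_left)
qed

text \<open>Addition and zero are those of the type, which makes type-class arithmetic available on
  the carrier. \<open>seminorms_bounded\<close> is the analytic assumption: it turns the real
  supremum in \<open>universal_seminorm\<close> into a true least upper bound.\<close>

locale pre_cstar =
  fixes B :: "('v::ab_group_add) star_algebra"
  assumes add_B: "x \<oplus>\<^bsub>B\<^esub> y = x + y"
    and zero_B: "\<zero>\<^bsub>B\<^esub> = 0"
    and C_zero [simp]: "0 \<in> carrier B"
    and C_add [simp]: "\<lbrakk>x \<in> carrier B; y \<in> carrier B\<rbrakk> \<Longrightarrow> x + y \<in> carrier B"
    and C_uminus [simp]: "x \<in> carrier B \<Longrightarrow> - x \<in> carrier B"
    and C_smult [simp]: "x \<in> carrier B \<Longrightarrow> c \<odot>\<^bsub>B\<^esub> x \<in> carrier B"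
    and C_mult [simp]: "\<lbrakk>x \<in> carrier B; y \<in> carrier B\<rbrakk> \<Longrightarrow> x \<otimes>\<^bsub>B\<^esub> y \<in> carrier B"
    and C_star [simp]: "x \<in> carrier B \<Longrightarrow> star B x \<in> carrier B"
    and C_one [simp]: "\<one>\<^bsub>B\<^esub> \<in> carrier B"
    and smult_add_right: "\<lbrakk>x \<in> carrier B; y \<in> carrier B\<rbrakk> \<Longrightarrow> c \<odot>\<^bsub>B\<^esub> (x + y) = c \<odot>\<^bsub>B\<^esub> x + c \<odot>\<^bsub>B\<^esub> y"
    and smult_add_left: "x \<in> carrier B \<Longrightarrow> (c + c') \<odot>\<^bsub>B\<^esub> x = c \<odot>\<^bsub>B\<^esub> x + c' \<odot>\<^bsub>B\<^esub> x"
    and smult_one: "x \<in> carrier B \<Longrightarrow> 1 \<odot>\<^bsub>B\<^esub> x = x"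
    and mult_add_left: "\<lbrakk>x \<in> carrier B; y \<in> carrier B; z \<in> carrier B\<rbrakk> \<Longrightarrow> (x + y) \<otimes>\<^bsub>B\<^esub> z = x \<otimes>\<^bsub>B\<^esub> z + y \<otimes>\<^bsub>B\<^esub> z"
    and mult_add_right: "\<lbrakk>x \<in> carrier B; y \<in> carrier B; z \<in> carrier B\<rbrakk> \<Longrightarrow> z \<otimes>\<^bsub>B\<^esub> (x + y) = z \<otimes>\<^bsub>B\<^esub> x + z \<otimes>\<^bsub>B\<^esub> y"
    and mult_one_right: "x \<in> carrier B \<Longrightarrow> x \<otimes>\<^bsub>B\<^esub> \<one>\<^bsub>B\<^esub> = x"
    and star_add: "\<lbrakk>x \<in> carrier B; y \<in> carrier B\<rbrakk> \<Longrightarrow> star B (x + y) = star B x + star B y"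
    and star_star: "x \<in> carrier B \<Longrightarrow> star B (star B x) = x"
    and star_one: "star B \<one>\<^bsub>B\<^esub> = \<one>\<^bsub>B\<^esub>"
    and seminorms_bounded: "x \<in> carrier B \<Longrightarrow> \<exists>K. \<forall>p. cstar_seminorm B p \<longrightarrow> p x \<le> K"
begin

section \<open>The universal seminorm and the operations of the completion\<close>

lemma smult_zero: "x \<in> carrier B \<Longrightarrow> 0 \<odot>\<^bsub>B\<^esub> x = 0"
  using smult_add_left[of x 0 0] by simp

lemma smult_uminus: "x \<in> carrier B \<Longrightarrow> (-1) \<odot>\<^bsub>B\<^esub> x = - x"
  using smult_add_left[of x 1 "-1"] smult_one[of x] smult_zero[of x]
  by (simp add: eq_neg_iff_add_eq_0 add.commute)

lemma B_minus: "\<lbrakk>x \<in> carrier B; y \<in> carrier B\<rbrakk> \<Longrightarrow> x \<ominus>\<^bsub>B\<^esub> y = x - y"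
proof -
  assume y: "y \<in> carrier B"
  have "\<ominus>\<^bsub>B\<^esub> y = - y"
    unfolding a_inv_def m_inv_def
  proof (rule the_equality)
    fix z assume "z \<in> carrier (add_monoid B) \<and> y \<otimes>\<^bsub>add_monoid B\<^esub> z = \<one>\<^bsub>add_monoid B\<^esub> \<and> z \<otimes>\<^bsub>add_monoid B\<^esub> y = \<one>\<^bsub>add_monoid B\<^esub>"
    then have "z + y = 0" by (simp add: add_B zero_B)
    then show "z = - y" by (simp add: eq_neg_iff_add_eq_0)
  qed (use y in \<open>simp add: add_B zero_B\<close>)
  then show ?thesis by (simp add: a_minus_def add_B)
qed

abbreviation "u \<equiv> universal_seminorm B"

lemma
  assumes "cstar_seminorm B p" "x \<in> carrier B"
  shows css_nonneg: "0 \<le> p x" and css_add: "y \<in> carrier B \<Longrightarrow> p (x + y) \<le> p x + p y"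
    and css_smult: "p (c \<odot>\<^bsub>B\<^esub> x) = cmod c * p x"
    and css_mult: "y \<in> carrier B \<Longrightarrow> p (x \<otimes>\<^bsub>B\<^esub> y) \<le> p x * p y"
    and css_star_mult: "p (star B x \<otimes>\<^bsub>B\<^esub> x) = (p x)\<^sup>2"
  using assms by (auto simp: cstar_seminorm_def add_B)

lemma css_star:
  assumes p: "cstar_seminorm B p" and x: "x \<in> carrier B"
  shows "p (star B x) = p x"
proof -
  have le: "p y \<le> p (star B y)" if y: "y \<in> carrier B" for y
  proof -
    have "p y * p y \<le> p (star B y) * p y"
      using css_star_mult[OF p y] css_mult[OF p _ y, of "star B y"] y by (simp add: power2_eq_square)
    moreover have "0 \<le> p y" "0 \<le> p (star B y)" using css_nonneg[OF p] y by simp_all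
    ultimately show ?thesis by (cases "p y = 0") (simp_all add: mult_le_cancel_right)
  qed
  show ?thesis using le[OF x] le[of "star B x"] x by (simp add: star_star)
qed

text \<open>Makes the family of C*-seminorms nonempty, without which the real supremum would be
  meaningless.\<close>

lemma css_zero: "cstar_seminorm B (\<lambda>_. 0)"
  by (simp add: cstar_seminorm_def)

lemma css_le_u: "\<lbrakk>cstar_seminorm B p; x \<in> carrier B\<rbrakk> \<Longrightarrow> p x \<le> u x"
proof -
  assume p: "cstar_seminorm B p" and x: "x \<in> carrier B"
  obtain K where "\<forall>p. cstar_seminorm B p \<longrightarrow> p x \<le> K" using seminorms_bounded[OF x] ..
  then have "bdd_above ((\<lambda>p. p x) ` {p. cstar_seminorm B p})" by (auto intro!: bdd_aboveI2)
  then show ?thesis unfolding universal_seminorm_def by (rule cSUP_upper[rotated]) (use p in simp)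
qed

lemma u_least: "(\<And>p. cstar_seminorm B p \<Longrightarrow> p x \<le> K) \<Longrightarrow> u x \<le> K"
  unfolding universal_seminorm_def by (rule cSUP_least) (use css_zero in auto)

lemma u_nonneg: "x \<in> carrier B \<Longrightarrow> 0 \<le> u x"
  using css_le_u[OF css_zero] .

lemma u_add: "\<lbrakk>x \<in> carrier B; y \<in> carrier B\<rbrakk> \<Longrightarrow> u (x + y) \<le> u x + u y"
  by (rule u_least) (meson css_add css_le_u add_mono order_trans)

lemma u_smult_le: "x \<in> carrier B \<Longrightarrow> u (c \<odot>\<^bsub>B\<^esub> x) \<le> cmod c * u x"
  by (rule u_least) (simp add: css_smult css_le_u mult_left_mono)

lemma u_mult: "\<lbrakk>x \<in> carrier B; y \<in> carrier B\<rbrakk> \<Longrightarrow> u (x \<otimes>\<^bsub>B\<^esub> y) \<le> u x * u y"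
  by (rule u_least)
    (rule order_trans[OF css_mult], auto intro!: mult_mono css_le_u css_nonneg u_nonneg)

lemma u_star_le: "x \<in> carrier B \<Longrightarrow> u (star B x) \<le> u x"
  by (rule u_least) (simp add: css_star css_le_u)

sublocale seminorm_space "carrier B" u "universal_dist B"
proof
  have "u 0 \<le> 0" using u_smult_le[of 0 0] by (simp add: smult_zero)
  then show "u 0 = 0" using u_nonneg[of 0] by simp
  show "u (- x) = u x" if "x \<in> carrier B" for x
    using that u_smult_le[of x "-1"] u_smult_le[of "- x" "-1"] by (simp add: smult_uminus)
qed (simp_all add: u_add universal_dist_def B_minus)

abbreviation "CC \<equiv> cstar_completion B"

lemma smult_minus: "\<lbrakk>x \<in> carrier B; y \<in> carrier B\<rbrakk> \<Longrightarrow> c \<odot>\<^bsub>B\<^esub> (x - y) = c \<odot>\<^bsub>B\<^esub> x - c \<odot>\<^bsub>B\<^esub> y"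
  using smult_add_right[of "x - y" y c] by simp

lemma star_minus: "\<lbrakk>x \<in> carrier B; y \<in> carrier B\<rbrakk> \<Longrightarrow> star B (x - y) = star B x - star B y"
  using star_add[of "x - y" y] by simp

lemma mult_minus_left:
  "\<lbrakk>x \<in> carrier B; y \<in> carrier B; z \<in> carrier B\<rbrakk> \<Longrightarrow> (x - y) \<otimes>\<^bsub>B\<^esub> z = x \<otimes>\<^bsub>B\<^esub> z - y \<otimes>\<^bsub>B\<^esub> z"
  using mult_add_left[of "x - y" y z] by simp

lemma mult_minus_right:
  "\<lbrakk>x \<in> carrier B; y \<in> carrier B; z \<in> carrier B\<rbrakk> \<Longrightarrow> z \<otimes>\<^bsub>B\<^esub> (x - y) = z \<otimes>\<^bsub>B\<^esub> x - z \<otimes>\<^bsub>B\<^esub> y"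
  using mult_add_right[of "x - y" y z] by simp

lemma u_mult_diff:
  assumes "x \<in> carrier B" "y \<in> carrier B" "x' \<in> carrier B" "y' \<in> carrier B"
    and "u x \<le> M" "u y' \<le> M'"
  shows "u (x \<otimes>\<^bsub>B\<^esub> y - x' \<otimes>\<^bsub>B\<^esub> y') \<le> M * u (y - y') + M' * u (x - x')"
proof -
  have "x \<otimes>\<^bsub>B\<^esub> y - x' \<otimes>\<^bsub>B\<^esub> y' = x \<otimes>\<^bsub>B\<^esub> (y - y') + (x - x') \<otimes>\<^bsub>B\<^esub> y'"
    using assms by (simp add: mult_minus_left mult_minus_right)
  then have "u (x \<otimes>\<^bsub>B\<^esub> y - x' \<otimes>\<^bsub>B\<^esub> y') \<le> u (x \<otimes>\<^bsub>B\<^esub> (y - y')) + u ((x - x') \<otimes>\<^bsub>B\<^esub> y')"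
    using u_add[of "x \<otimes>\<^bsub>B\<^esub> (y - y')" "(x - x') \<otimes>\<^bsub>B\<^esub> y'"] assms by simp
  also have "\<dots> \<le> u x * u (y - y') + u (x - x') * u y'"
    by (intro add_mono u_mult) (use assms in auto)
  also have "\<dots> \<le> M * u (y - y') + u (x - x') * M'"
    by (intro add_mono mult_right_mono mult_left_mono u_nonneg) (use assms in auto)
  finally show ?thesis by (simp add: mult.commute)
qed

lemma CS_mult: "\<lbrakk>X \<in> CS; Y \<in> CS\<rbrakk> \<Longrightarrow> (\<lambda>n. X n \<otimes>\<^bsub>B\<^esub> Y n) \<in> CS"
proof -
  assume X: "X \<in> CS" and Y: "Y \<in> CS"
  obtain M where M: "\<And>n. u (X n) \<le> M" using CS_bounded[OF X] by blast
  obtain M' where M': "\<And>n. u (Y n) \<le> M'" using CS_bounded[OF Y] by blast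
  have "((\<lambda>p. M * u (Y (fst p) - Y (snd p)) + M' * u (X (fst p) - X (snd p))) \<longlongrightarrow> 0) (sequentially \<times>\<^sub>F sequentially)"
    by (intro tendsto_add_zero tendsto_mult_right_zero CS_tendsto X Y)
  then show ?thesis
    by (rule CS_I[rotated]) (simp_all add: CS_V[OF X] CS_V[OF Y] u_mult_diff M M')
qed

lemma CC_carrier: "carrier CC = completion (carrier B) (universal_dist B)"
  by (simp add: cstar_completion_def)

lemma CC_cls: "X \<in> CS \<Longrightarrow> cls X \<in> carrier CC"
  by (simp add: CC_carrier completionI)

lemma CC_ex: "P \<in> carrier CC \<Longrightarrow> \<exists>X. X \<in> CS \<and> P = cls X"
  by (simp add: CC_carrier completion_ex)

lemma embed_eq: "cstar_embed B x = cls (\<lambda>n. x)"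
  by (simp add: cstar_embed_def to_completion_eq)

lemma embed_carrier: "x \<in> carrier B \<Longrightarrow> cstar_embed B x \<in> carrier CC"
  by (simp add: embed_eq CC_cls)

lemma CC_one: "\<one>\<^bsub>CC\<^esub> = cls (\<lambda>n. \<one>\<^bsub>B\<^esub>)"
  by (simp add: cstar_completion_def embed_eq)

lemma add_B_fun: "(\<oplus>\<^bsub>B\<^esub>) = (+)"
  by (intro ext add_B)

lemma CC_add: "\<lbrakk>X \<in> CS; Y \<in> CS\<rbrakk> \<Longrightarrow> cls X \<oplus>\<^bsub>CC\<^esub> cls Y = cls (\<lambda>n. X n + Y n)"
  by (simp add: cstar_completion_def add_B_fun completion_add_eq)

lemma CC_mult:
  assumes "X \<in> CS" "Y \<in> CS" shows "cls X \<otimes>\<^bsub>CC\<^esub> cls Y = cls (\<lambda>n. X n \<otimes>\<^bsub>B\<^esub> Y n)"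
proof -
  have "completion_map2 (carrier B) (universal_dist B) (\<otimes>\<^bsub>B\<^esub>) (cls X) (cls Y) = cls (\<lambda>n. X n \<otimes>\<^bsub>B\<^esub> Y n)"
  proof (rule completion_map2_eq[OF CS_mult _ assms])
    fix X X' Y Y' assume CS: "X \<in> CS" "X' \<in> CS" "Y \<in> CS" "Y' \<in> CS"
      and lim: "(\<lambda>n. u (X n - X' n)) \<longlonglongrightarrow> 0" "(\<lambda>n. u (Y n - Y' n)) \<longlonglongrightarrow> 0"
    obtain M where M: "\<And>n. u (X n) \<le> M" using CS_bounded[OF CS(1)] by blast
    obtain M' where M': "\<And>n. u (Y' n) \<le> M'" using CS_bounded[OF CS(4)] by blast
    have "(\<lambda>n. M * u (Y n - Y' n) + M' * u (X n - X' n)) \<longlonglongrightarrow> 0"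
      by (intro tendsto_add_zero tendsto_mult_right_zero lim)
    then show "(\<lambda>n. u (X n \<otimes>\<^bsub>B\<^esub> Y n - X' n \<otimes>\<^bsub>B\<^esub> Y' n)) \<longlonglongrightarrow> 0"
      by (rule Lim_null_comparison[OF always_eventually, rotated])
        (simp add: CS_V[OF CS(1)] CS_V[OF CS(2)] CS_V[OF CS(3)] CS_V[OF CS(4)] u_mult_diff M M')
  qed
  then show ?thesis by (simp add: cstar_completion_def)
qed

lemma
  assumes "X \<in> CS"
  shows CS_smult: "(\<lambda>n. c \<odot>\<^bsub>B\<^esub> X n) \<in> CS" and CC_smult: "c \<odot>\<^bsub>CC\<^esub> cls X = cls (\<lambda>n. c \<odot>\<^bsub>B\<^esub> X n)"
  using completion_map1_eq[of "(\<odot>\<^bsub>B\<^esub>) c" "cmod c" X] assms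
  by (simp_all add: cstar_completion_def u_smult_le flip: smult_minus)

lemma
  assumes "X \<in> CS"
  shows CS_star: "(\<lambda>n. star B (X n)) \<in> CS" and CC_star: "star CC (cls X) = cls (\<lambda>n. star B (X n))"
  using completion_map1_eq[of "star B" 1 X] assms
  by (simp_all add: cstar_completion_def u_star_le flip: star_minus)

lemma CC_star_closed: "P \<in> carrier CC \<Longrightarrow> star CC P \<in> carrier CC"
  by (drule CC_ex) (auto simp: CC_star CC_cls CS_star)

lemma CC_mult_closed: "\<lbrakk>P \<in> carrier CC; Q \<in> carrier CC\<rbrakk> \<Longrightarrow> P \<otimes>\<^bsub>CC\<^esub> Q \<in> carrier CC"
  by (drule CC_ex, drule CC_ex) (auto simp: CC_mult CC_cls CS_mult)

lemma representation_embed: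
  assumes "representation CC H \<pi>"
  shows "representation B H (\<lambda>x. \<pi> (cstar_embed B x))"
proof -
  note D = representationD[OF assms CC_cls]
  show ?thesis
    unfolding representation_def embed_eq
  proof (intro conjI ballI allI)
    fix x y c \<xi> \<eta> assume x: "x \<in> carrier B" and \<xi>: "\<xi> \<in> carrier H"
    note cx = const_CS[OF x]
    show "\<pi> (cls (\<lambda>n. c \<odot>\<^bsub>B\<^esub> x)) \<xi> = c \<odot>\<^bsub>H\<^esub> \<pi> (cls (\<lambda>n. x)) \<xi>"
      using D(3)[OF cx \<xi>, of c] by (simp add: CC_smult[OF cx])
    assume \<eta>: "\<eta> \<in> carrier H"
    show "hinner H (\<pi> (cls (\<lambda>n. x)) \<xi>) \<eta> = hinner H \<xi> (\<pi> (cls (\<lambda>n. star B x)) \<eta>)"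
      using D(5)[OF cx \<xi> \<eta>] by (simp add: CC_star[OF cx])
  next
    fix x y \<xi> assume x: "x \<in> carrier B" and y: "y \<in> carrier B" and \<xi>: "\<xi> \<in> carrier H"
    note cx = const_CS[OF x] and cy = const_CS[OF y]
    show "\<pi> (cls (\<lambda>n. x \<oplus>\<^bsub>B\<^esub> y)) \<xi> = \<pi> (cls (\<lambda>n. x)) \<xi> \<oplus>\<^bsub>H\<^esub> \<pi> (cls (\<lambda>n. y)) \<xi>"
      using D(2)[OF cx CC_cls[OF cy] \<xi>] by (simp add: CC_add[OF cx cy] add_B)
    show "\<pi> (cls (\<lambda>n. x \<otimes>\<^bsub>B\<^esub> y)) \<xi> = \<pi> (cls (\<lambda>n. x)) (\<pi> (cls (\<lambda>n. y)) \<xi>)"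
      using D(4)[OF cx CC_cls[OF cy] \<xi>] by (simp add: CC_mult[OF cx cy])
  qed (use D(1) in simp)
qed

text \<open>Puts the operator norm of a representation among the seminorms whose supremum is
  u.\<close>

lemma hopnorm_cstar_seminorm:
  assumes H: "hilbert_space H" and rep: "representation B H \<rho>"
  shows "cstar_seminorm B (\<lambda>x. hopnorm H (\<rho> x))"
proof -
  interpret H: hilbert_space H by (rule H)
  note D = representationD[OF rep]
  have nn: "0 \<le> hopnorm H (\<rho> x)" if "x \<in> carrier B" for x by (rule H.hopnorm_nonneg[OF D(1)[OF that]])
  have mult: "hopnorm H (\<rho> (x \<otimes>\<^bsub>B\<^esub> y)) \<le> hopnorm H (\<rho> x) * hopnorm H (\<rho> y)" if x: "x \<in> carrier B" and y: "y \<in> carrier B" for x y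
  proof (rule H.hopnorm_le)
    fix \<xi> assume \<xi>: "\<xi> \<in> carrier H"
    have "hnorm H (\<rho> (x \<otimes>\<^bsub>B\<^esub> y) \<xi>) \<le> hopnorm H (\<rho> x) * hnorm H (\<rho> y \<xi>)"
      unfolding D(4)[OF x y \<xi>] by (rule H.hopnorm_bound[OF D(1)[OF x] D(6)[OF y \<xi>]])
    also have "\<dots> \<le> hopnorm H (\<rho> x) * (hopnorm H (\<rho> y) * hnorm H \<xi>)"
      by (intro mult_left_mono H.hopnorm_bound[OF D(1)[OF y] \<xi>] nn x)
    finally show "hnorm H (\<rho> (x \<otimes>\<^bsub>B\<^esub> y) \<xi>) \<le> hopnorm H (\<rho> x) * hopnorm H (\<rho> y) * hnorm H \<xi>" by simp
  qed (use nn x y in simp)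
  have smle: "hopnorm H (\<rho> (c \<odot>\<^bsub>B\<^esub> x)) \<le> cmod c * hopnorm H (\<rho> x)" if x: "x \<in> carrier B" for c x
  proof (rule H.hopnorm_le)
    fix \<xi> assume \<xi>: "\<xi> \<in> carrier H"
    have "hnorm H (\<rho> (c \<odot>\<^bsub>B\<^esub> x) \<xi>) = cmod c * hnorm H (\<rho> x \<xi>)"
      unfolding D(3)[OF x \<xi>] by (rule H.hnorm_smult[OF D(6)[OF x \<xi>]])
    also have "\<dots> \<le> cmod c * (hopnorm H (\<rho> x) * hnorm H \<xi>)"
      by (intro mult_left_mono H.hopnorm_bound[OF D(1)[OF x] \<xi>]) auto
    finally show "hnorm H (\<rho> (c \<odot>\<^bsub>B\<^esub> x) \<xi>) \<le> cmod c * hopnorm H (\<rho> x) * hnorm H \<xi>" by simp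
  qed (use nn x in simp)
  show ?thesis
    unfolding cstar_seminorm_def add_B
  proof (intro conjI ballI allI)
    fix x y c assume x: "x \<in> carrier B"
    show "0 \<le> hopnorm H (\<rho> x)" by (rule nn[OF x])
    show "hopnorm H (\<rho> (c \<odot>\<^bsub>B\<^esub> x)) = cmod c * hopnorm H (\<rho> x)"
    proof (rule antisym[OF smle[OF x]])
      show "cmod c * hopnorm H (\<rho> x) \<le> hopnorm H (\<rho> (c \<odot>\<^bsub>B\<^esub> x))"
      proof (cases "c = 0")
        case False
        have "hopnorm H (\<rho> x) \<le> hopnorm H (\<rho> (c \<odot>\<^bsub>B\<^esub> x)) / cmod c"
        proof (rule H.hopnorm_le)
          fix \<xi> assume \<xi>: "\<xi> \<in> carrier H"
          have "cmod c * hnorm H (\<rho> x \<xi>) = hnorm H (\<rho> (c \<odot>\<^bsub>B\<^esub> x) \<xi>)"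
            unfolding D(3)[OF x \<xi>] by (rule H.hnorm_smult[OF D(6)[OF x \<xi>], symmetric])
          also have "\<dots> \<le> hopnorm H (\<rho> (c \<odot>\<^bsub>B\<^esub> x)) * hnorm H \<xi>"
            by (rule H.hopnorm_bound[OF D(1) \<xi>]) (use x in simp)
          finally show "hnorm H (\<rho> x \<xi>) \<le> hopnorm H (\<rho> (c \<odot>\<^bsub>B\<^esub> x)) / cmod c * hnorm H \<xi>"
            using False by (simp add: field_simps)
        qed (use nn x in simp)
        then show ?thesis using False by (simp add: field_simps)
      qed (use nn x in simp)
    qed
    show "hopnorm H (\<rho> (star B x \<otimes>\<^bsub>B\<^esub> x)) = (hopnorm H (\<rho> x))\<^sup>2"
    proof (rule antisym)
      have sx: "star B x \<in> carrier B" using x by simp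
      have "hopnorm H (\<rho> (star B x \<otimes>\<^bsub>B\<^esub> x)) \<le> hopnorm H (\<rho> (star B x)) * hopnorm H (\<rho> x)"
        by (rule mult[OF sx x])
      also have "\<dots> \<le> hopnorm H (\<rho> x) * hopnorm H (\<rho> x)"
        by (intro mult_right_mono nn x H.hopnorm_star[OF rep x sx])
      finally show "hopnorm H (\<rho> (star B x \<otimes>\<^bsub>B\<^esub> x)) \<le> (hopnorm H (\<rho> x))\<^sup>2" by (simp add: power2_eq_square)
      have sxx: "star B x \<otimes>\<^bsub>B\<^esub> x \<in> carrier B" using x by simp
      let ?K = "hopnorm H (\<rho> (star B x \<otimes>\<^bsub>B\<^esub> x))"
      \<comment> \<open>The lower half of the C*-identity, from ||\<rho>(x) \<xi>||^2 = <\<xi>,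
        \<rho>(x^* x) \<xi>>.\<close>
      have "hopnorm H (\<rho> x) \<le> sqrt ?K"
      proof (rule H.hopnorm_le)
        fix \<xi> assume \<xi>: "\<xi> \<in> carrier H"
        have r: "\<rho> x \<xi> \<in> carrier H" by (rule D(6)[OF x \<xi>])
        have "(hnorm H (\<rho> x \<xi>))\<^sup>2 = Re (hinner H \<xi> (\<rho> (star B x \<otimes>\<^bsub>B\<^esub> x) \<xi>))"
          unfolding H.hnorm_sq[OF r] D(5)[OF x \<xi> r] D(4)[OF sx x \<xi>] ..
        also have "\<dots> \<le> hnorm H \<xi> * hnorm H (\<rho> (star B x \<otimes>\<^bsub>B\<^esub> x) \<xi>)"
          by (rule H.Re_hinner_le[OF \<xi> D(6)[OF sxx \<xi>]])
        also have "\<dots> \<le> hnorm H \<xi> * (?K * hnorm H \<xi>)"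
          by (intro mult_left_mono H.hopnorm_bound[OF D(1)[OF sxx] \<xi>] H.hnorm_nonneg \<xi>)
        also have "\<dots> = (sqrt ?K * hnorm H \<xi>)\<^sup>2"
          using nn[OF sxx] by (simp add: power_mult_distrib) (simp add: power2_eq_square)
        finally show "hnorm H (\<rho> x \<xi>) \<le> sqrt ?K * hnorm H \<xi>"
          by (rule power2_le_imp_le) (use nn[OF sxx] H.hnorm_nonneg[OF \<xi>] in simp)
      qed (use nn[OF sxx] in simp)
      then show "(hopnorm H (\<rho> x))\<^sup>2 \<le> ?K" using nn[OF sxx] nn[OF x]
        by (metis real_sqrt_le_iff real_sqrt_pow2_iff real_sqrt_unique sqrt_le_D)
    qed
  next
    fix x y assume x: "x \<in> carrier B" and y: "y \<in> carrier B"
    show "hopnorm H (\<rho> (x \<otimes>\<^bsub>B\<^esub> y)) \<le> hopnorm H (\<rho> x) * hopnorm H (\<rho> y)" by (rule mult[OF x y])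
    show "hopnorm H (\<rho> (x + y)) \<le> hopnorm H (\<rho> x) + hopnorm H (\<rho> y)"
    proof (rule H.hopnorm_le)
      fix \<xi> assume \<xi>: "\<xi> \<in> carrier H"
      have "hnorm H (\<rho> (x + y) \<xi>) \<le> hnorm H (\<rho> x \<xi>) + hnorm H (\<rho> y \<xi>)"
        unfolding D(2)[OF x y \<xi>, unfolded add_B] by (rule H.hnorm_triangle[OF D(6)[OF x \<xi>] D(6)[OF y \<xi>]])
      also have "\<dots> \<le> hopnorm H (\<rho> x) * hnorm H \<xi> + hopnorm H (\<rho> y) * hnorm H \<xi>"
        by (intro add_mono H.hopnorm_bound[OF D(1)[OF x] \<xi>] H.hopnorm_bound[OF D(1)[OF y] \<xi>])
      finally show "hnorm H (\<rho> (x + y) \<xi>) \<le> (hopnorm H (\<rho> x) + hopnorm H (\<rho> y)) * hnorm H \<xi>"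
        by (simp add: algebra_simps)
    qed (use nn x y in simp)
  qed
qed

text \<open>On B contractivity is built into u. For a representation of the completion this controls
  only the embedded copy of B; a bound on limits has to come from the algebra of the completion
  itself.\<close>

lemma representation_le_u:
  assumes H: "hilbert_space H" and rep: "representation B H \<rho>" and x: "x \<in> carrier B" and \<xi>: "\<xi> \<in> carrier H"
  shows "hnorm H (\<rho> x \<xi>) \<le> u x * hnorm H \<xi>"
proof -
  interpret H: hilbert_space H by (rule H)
  have "hnorm H (\<rho> x \<xi>) \<le> hopnorm H (\<rho> x) * hnorm H \<xi>"
    by (rule H.hopnorm_bound[OF representationD(1)[OF rep x] \<xi>])
  also have "\<dots> \<le> u x * hnorm H \<xi>"
    by (intro mult_right_mono css_le_u[OF hopnorm_cstar_seminorm[OF H rep] x] H.hnorm_nonneg[OF \<xi>])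
  finally show ?thesis .
qed


text \<open>Partial sums of the Neumann series of \<open>(1 - a)\<^sup>-\<^sup>1\<close>, arranged so that associativity of the product is
  never needed.\<close>

primrec neumann :: "nat \<Rightarrow> 'v \<Rightarrow> 'v" where
  "neumann 0 a = \<one>\<^bsub>B\<^esub>"
| "neumann (Suc k) a = neumann k a \<otimes>\<^bsub>B\<^esub> a + \<one>\<^bsub>B\<^esub>"

lemma neumann_carrier [simp]: "a \<in> carrier B \<Longrightarrow> neumann k a \<in> carrier B"
  by (induction k) auto

context
  fixes r :: real assumes r: "0 \<le> r" "r < 1"
begin

text \<open>The bound is the fixed point of K \<mapsto> K r + u(1), the recursion that the partial
  sums satisfy. The value u(1) is kept as a constant instead of being normalised.\<close>

lemma u_neumann:
  assumes "a \<in> carrier B" "u a \<le> r" shows "u (neumann k a) \<le> u \<one>\<^bsub>B\<^esub> / (1 - r)"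
proof (induction k)
  case 0
  have "u \<one>\<^bsub>B\<^esub> * (1 - r) \<le> u \<one>\<^bsub>B\<^esub> * 1" by (intro mult_left_mono u_nonneg) (use r in auto)
  then show ?case using r by (simp add: pos_le_divide_eq)
next
  case (Suc k)
  have "u (neumann (Suc k) a) \<le> u (neumann k a \<otimes>\<^bsub>B\<^esub> a) + u \<one>\<^bsub>B\<^esub>"
    using u_add[of "neumann k a \<otimes>\<^bsub>B\<^esub> a" "\<one>\<^bsub>B\<^esub>"] assms by simp
  also have "u (neumann k a \<otimes>\<^bsub>B\<^esub> a) \<le> u (neumann k a) * u a" by (rule u_mult) (use assms in auto)
  also have "\<dots> \<le> u \<one>\<^bsub>B\<^esub> / (1 - r) * r"
    by (intro mult_mono Suc assms u_nonneg) (use assms r u_nonneg[of "\<one>\<^bsub>B\<^esub>"] in auto)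
  also have "u \<one>\<^bsub>B\<^esub> / (1 - r) * r + u \<one>\<^bsub>B\<^esub> = u \<one>\<^bsub>B\<^esub> / (1 - r)" using r by (simp add: field_simps)
  finally show ?case by simp
qed

text \<open>Raising both indices by one multiplies the difference of partial sums by a on the right,
  whence the power of r. The factor 2 is the triangle inequality at n = 0.\<close>

lemma u_neumann_step:
  assumes a: "a \<in> carrier B" "u a \<le> r"
  shows "u (neumann (n + j) a - neumann n a) \<le> r ^ n * (2 * (u \<one>\<^bsub>B\<^esub> / (1 - r)))"
proof (induction n)
  case 0
  have "u (neumann j a - neumann 0 a) \<le> u (neumann j a) + u (neumann 0 a)"
    using u_add[of "neumann j a" "- neumann 0 a"] a q_uminus[of "neumann 0 a"] by simp
  also have "\<dots> \<le> u \<one>\<^bsub>B\<^esub> / (1 - r) + u \<one>\<^bsub>B\<^esub> / (1 - r)"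
    by (intro add_mono u_neumann a)
  finally show ?case by simp
next
  case (Suc n)
  have "neumann (Suc n + j) a - neumann (Suc n) a = (neumann (n + j) a - neumann n a) \<otimes>\<^bsub>B\<^esub> a"
    using a by (simp add: mult_minus_left)
  then have "u (neumann (Suc n + j) a - neumann (Suc n) a) \<le> u (neumann (n + j) a - neumann n a) * u a"
    using u_mult[of "neumann (n + j) a - neumann n a" a] a by simp
  also have "\<dots> \<le> (r ^ n * (2 * (u \<one>\<^bsub>B\<^esub> / (1 - r)))) * r"
    by (intro mult_mono Suc a u_nonneg) (use a r u_nonneg[of "\<one>\<^bsub>B\<^esub>"] in auto)
  finally show ?case by (simp add: mult_ac)
qed

text \<open>The constant L = u(1) / (1 - r)^2 solves L = u(1) / (1 - r) + r L. Its independence of k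
  is what allows the number of terms and the argument to vary together in
  \<open>neumann_CS\<close>.\<close>

lemma u_neumann_lipschitz:
  assumes a: "a \<in> carrier B" "u a \<le> r" and b: "b \<in> carrier B" "u b \<le> r"
  shows "u (neumann k a - neumann k b) \<le> u \<one>\<^bsub>B\<^esub> / (1 - r)\<^sup>2 * u (a - b)"
proof (induction k)
  case 0
  then show ?case using u_nonneg[of "\<one>\<^bsub>B\<^esub>"] u_nonneg[of "a - b"] a b by simp
next
  case (Suc k)
  let ?L = "u \<one>\<^bsub>B\<^esub> / (1 - r)\<^sup>2 * u (a - b)"
  have "neumann (Suc k) a - neumann (Suc k) b = neumann k a \<otimes>\<^bsub>B\<^esub> a - neumann k b \<otimes>\<^bsub>B\<^esub> b"
    by simp
  moreover have "u (neumann k a \<otimes>\<^bsub>B\<^esub> a - neumann k b \<otimes>\<^bsub>B\<^esub> b) \<le> u \<one>\<^bsub>B\<^esub> / (1 - r) * u (a - b) + r * u (neumann k a - neumann k b)"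
    by (intro u_mult_diff neumann_carrier a b u_neumann)
  ultimately have "u (neumann (Suc k) a - neumann (Suc k) b) \<le> u \<one>\<^bsub>B\<^esub> / (1 - r) * u (a - b) + r * ?L"
    using mult_left_mono[OF Suc r(1)] by simp
  also have "u \<one>\<^bsub>B\<^esub> / (1 - r) = u \<one>\<^bsub>B\<^esub> / (1 - r)\<^sup>2 * (1 - r)"
    using r by (simp add: power2_eq_square)
  also have "u \<one>\<^bsub>B\<^esub> / (1 - r)\<^sup>2 * (1 - r) * u (a - b) + r * ?L = ?L"
    by (simp only: right_diff_distrib left_diff_distrib mult_1_right mult.assoc mult.commute[of r] mult.left_commute[of _ r])
  finally show ?case .
qed

text \<open>A diagonal sequence, as a class is only known through its approximants: the n-th term is
  the n-th partial sum at \<open>A n\<close>. The argument is changed at fixed length by the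
  Lipschitz bound, then the length at fixed argument by geometric decay.\<close>

lemma neumann_CS:
  assumes A: "A \<in> CS" and le: "\<And>n. u (A n) \<le> r"
  shows "(\<lambda>n. neumann n (A n)) \<in> CS"
proof -
  define K where "K = 2 * (u \<one>\<^bsub>B\<^esub> / (1 - r))"
  define L where "L = u \<one>\<^bsub>B\<^esub> / (1 - r)\<^sup>2"
  have K0: "K \<ge> 0" using r u_nonneg[of "\<one>\<^bsub>B\<^esub>"] by (simp add: K_def)
  have AV [simp]: "A n \<in> carrier B" for n by (rule CS_V[OF A])
  have step: "u (neumann m a - neumann n a) \<le> (r ^ m + r ^ n) * K" if a: "a \<in> carrier B" "u a \<le> r" for a m n
  proof (cases "n \<le> m")
    case True
    then have "u (neumann m a - neumann n a) \<le> r ^ n * K"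
      using u_neumann_step[OF a, of n "m - n"] by (simp add: K_def)
    also have "\<dots> \<le> (r ^ m + r ^ n) * K" using r K0 by (intro mult_right_mono) auto
    finally show ?thesis .
  next
    case False
    then have "u (neumann m a - neumann n a) \<le> r ^ m * K"
      using u_neumann_step[OF a, of m "n - m"] a by (simp add: K_def q_minus_commute[of "neumann m a"])
    also have "\<dots> \<le> (r ^ m + r ^ n) * K" using r K0 by (intro mult_right_mono) auto
    finally show ?thesis .
  qed
  let ?f = "\<lambda>p. L * u (A (fst p) - A (snd p)) + (r ^ fst p + r ^ snd p) * K"
  have pw: "((^) r \<longlongrightarrow> 0) sequentially" using r by (intro LIMSEQ_power_zero) auto
  have "(?f \<longlongrightarrow> 0) (sequentially \<times>\<^sub>F sequentially)"
    by (intro tendsto_add_zero tendsto_mult_right_zero tendsto_mult_left_zero CS_tendsto A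
        filterlim_compose[OF pw filterlim_fst] filterlim_compose[OF pw filterlim_snd])
  moreover have "u (neumann m (A m) - neumann n (A n)) \<le> ?f (m, n)" for m n
  proof -
    have "u (neumann m (A m) - neumann n (A n)) \<le>
        u (neumann m (A m) - neumann m (A n)) + u (neumann m (A n) - neumann n (A n))"
      by (rule q_triangle) auto
    also have "\<dots> \<le> L * u (A m - A n) + (r ^ m + r ^ n) * K"
      unfolding L_def by (intro add_mono u_neumann_lipschitz step le AV)
    finally show ?thesis by simp
  qed
  ultimately show ?thesis by (rule CS_I[rotated]) simp
qed

text \<open>A left inverse is enough: applied through \<pi> it recovers a vector from its image
  under \<pi>(1 - a), which bounds that operator from below.\<close>

lemma neumann_inverse:
  assumes A: "A \<in> CS" and le: "\<And>n. u (A n) \<le> r"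
  shows "\<exists>b\<in>carrier CC. b \<otimes>\<^bsub>CC\<^esub> (\<one>\<^bsub>CC\<^esub> \<oplus>\<^bsub>CC\<^esub> (-1) \<odot>\<^bsub>CC\<^esub> cls A) = \<one>\<^bsub>CC\<^esub>"
proof
  let ?N = "\<lambda>n. neumann n (A n)"
  have AV [simp]: "A n \<in> carrier B" for n by (rule CS_V[OF A])
  have N: "?N \<in> CS" by (rule neumann_CS[OF A le])
  show "cls ?N \<in> carrier CC" by (rule CC_cls[OF N])
  have mA: "(\<lambda>n. (-1) \<odot>\<^bsub>B\<^esub> A n) \<in> CS" by (rule CS_smult[OF A])
  have one: "(\<lambda>n. \<one>\<^bsub>B\<^esub>) \<in> CS" by simp
  have s: "(\<lambda>n. \<one>\<^bsub>B\<^esub> + (-1) \<odot>\<^bsub>B\<^esub> A n) \<in> CS" by (rule CS_add[OF one mA])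
  have p: "(\<lambda>n. ?N n \<otimes>\<^bsub>B\<^esub> (\<one>\<^bsub>B\<^esub> + (-1) \<odot>\<^bsub>B\<^esub> A n)) \<in> CS" by (rule CS_mult[OF N s])
  \<comment> \<open>The recursion gives N_n a = N_{n+1} - 1 for the partial sums N_n at a =
    \<open>A n\<close>, so the product differs from 1 by one step of the series.\<close>
  have *: "?N n \<otimes>\<^bsub>B\<^esub> (\<one>\<^bsub>B\<^esub> + (-1) \<odot>\<^bsub>B\<^esub> A n) - \<one>\<^bsub>B\<^esub> = ?N n - neumann (n + 1) (A n)" for n
    by (simp add: mult_minus_right smult_uminus mult_one_right)
  have **: "u (?N n - neumann (n + 1) (A n)) \<le> r ^ n * (2 * (u \<one>\<^bsub>B\<^esub> / (1 - r)))" for n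
    unfolding q_minus_commute[OF neumann_carrier[OF AV] neumann_carrier[OF AV], of n n "n + 1" n]
    by (rule u_neumann_step[OF AV le])
  have "(\<lambda>n. r ^ n * (2 * (u \<one>\<^bsub>B\<^esub> / (1 - r)))) \<longlonglongrightarrow> 0"
    by (intro tendsto_mult_left_zero LIMSEQ_power_zero) (use r in auto)
  then have "(\<lambda>n. u (?N n \<otimes>\<^bsub>B\<^esub> (\<one>\<^bsub>B\<^esub> + (-1) \<odot>\<^bsub>B\<^esub> A n) - \<one>\<^bsub>B\<^esub>)) \<longlonglongrightarrow> 0"
    by (rule Lim_null_comparison[OF always_eventually[OF allI], rotated])
      (simp only: * real_norm_def abs_of_nonneg u_nonneg V_minus neumann_carrier AV **)
  then have "cls (\<lambda>n. ?N n \<otimes>\<^bsub>B\<^esub> (\<one>\<^bsub>B\<^esub> + (-1) \<odot>\<^bsub>B\<^esub> A n)) = cls (\<lambda>n. \<one>\<^bsub>B\<^esub>)"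
    unfolding cls_eq_iff[OF p one] .
  then show "cls ?N \<otimes>\<^bsub>CC\<^esub> (\<one>\<^bsub>CC\<^esub> \<oplus>\<^bsub>CC\<^esub> (-1) \<odot>\<^bsub>CC\<^esub> cls A) = \<one>\<^bsub>CC\<^esub>"
    unfolding CC_one CC_smult[OF A] CC_add[OF one mA] CC_mult[OF N s] .
qed

end

text \<open>If the norm of \<open>\<pi>(x)\<close> were 1, then \<open>\<pi>(1 - x\<^sup>*x)\<close> would not be bounded below, contradicting the
  invertibility of \<open>1 - x\<^sup>*x\<close>.\<close>

lemma representation_norm_neq_1:
  assumes H: "hilbert_space H" and rep: "representation CC H \<pi>"
    and X: "X \<in> CS" and r: "r < 1" and le: "\<And>n. u (X n) \<le> r"
  shows "hopnorm H (\<pi> (cls X)) \<noteq> 1"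
proof
  interpret H: hilbert_space H by (rule H)
  note D = representationD[OF rep]
  assume norm1: "hopnorm H (\<pi> (cls X)) = 1"
  have r0: "0 \<le> r" using le[of 0] u_nonneg[OF CS_V[OF X, of 0]] by simp
  define A where "A n = star B (X n) \<otimes>\<^bsub>B\<^esub> X n" for n
  have A: "A \<in> CS" unfolding A_def by (rule CS_mult[OF CS_star[OF X] X])
  have uA: "u (A n) \<le> r\<^sup>2" for n
  proof -
    have "u (A n) \<le> u (star B (X n)) * u (X n)" unfolding A_def by (rule u_mult) (simp_all add: CS_V[OF X])
    also have "\<dots> \<le> r * r"
      by (intro mult_mono order_trans[OF u_star_le le] le u_nonneg r0) (simp_all add: CS_V[OF X])
    finally show ?thesis by (simp add: power2_eq_square)
  qed
  have r2: "0 \<le> r\<^sup>2" "r\<^sup>2 < 1" using r r0 by (simp_all add: power_less_one_iff)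
  let ?x = "cls X" and ?a = "cls A" and ?e = "\<one>\<^bsub>CC\<^esub>"
  let ?s = "star CC ?x" and ?c = "\<one>\<^bsub>CC\<^esub> \<oplus>\<^bsub>CC\<^esub> (-1) \<odot>\<^bsub>CC\<^esub> cls A"
  obtain b where b: "b \<in> carrier CC" "b \<otimes>\<^bsub>CC\<^esub> ?c = ?e"
    using neumann_inverse[OF r2 A uA] by blast
  have one: "(\<lambda>n. \<one>\<^bsub>B\<^esub>) \<in> CS" by simp
  have xC: "?x \<in> carrier CC" by (rule CC_cls[OF X])
  have aC: "?a \<in> carrier CC" by (rule CC_cls[OF A])
  have eC: "?e \<in> carrier CC" unfolding CC_one by (rule CC_cls[OF one])
  have sC: "?s \<in> carrier CC" by (rule CC_star_closed[OF xC])
  have mC: "(-1) \<odot>\<^bsub>CC\<^esub> ?a \<in> carrier CC" unfolding CC_smult[OF A] by (rule CC_cls[OF CS_smult[OF A]])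
  have cC: "?c \<in> carrier CC"
    unfolding CC_one CC_smult[OF A] CC_add[OF one CS_smult[OF A]]
    by (rule CC_cls[OF CS_add[OF one CS_smult[OF A]]])
  have a_eq: "?s \<otimes>\<^bsub>CC\<^esub> ?x = ?a" unfolding CC_star[OF X] CC_mult[OF CS_star[OF X] X] A_def ..
  have xe: "?x \<otimes>\<^bsub>CC\<^esub> ?e = ?x"
    unfolding CC_one CC_mult[OF X one] by (simp add: mult_one_right CS_V[OF X])
  have ee: "?e \<otimes>\<^bsub>CC\<^esub> ?e = ?e" unfolding CC_one CC_mult[OF one one] by (simp add: mult_one_right)
  have se: "star CC ?e = ?e" unfolding CC_one CC_star[OF one] by (simp add: star_one)
  obtain K where K: "K \<ge> 0" "\<forall>\<xi>\<in>carrier H. hnorm H (\<pi> b \<xi>) \<le> K * hnorm H \<xi>"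
    using H.bounded_operatorD(2)[OF D(1)[OF b(1)]] by blast
  \<comment> \<open>Solves the two estimates ||\<eta>|| \<le> (1 + K) ||\<zeta>|| and ||\<zeta>||^2
    \<le> ||\<eta>||^2 - ||\<pi>(x) \<eta>||^2 below for ||\<pi>(x) \<eta>||^2. Using 1 + K in place
    of K avoids a division by zero.\<close>
  define k where "k = 1 - 1 / (1 + K)\<^sup>2"
  have k: "0 \<le> k" "k < 1" using K by (simp_all add: k_def)
  \<comment> \<open>The unit acts as a self-adjoint idempotent, hence contractively, though perhaps
    not as the identity.\<close>
  have e_le: "hnorm H (\<pi> ?e \<xi>) \<le> hnorm H \<xi>" if \<xi>: "\<xi> \<in> carrier H" for \<xi>
  proof -
    note e\<xi> = D(6)[OF eC \<xi>]
    have "(hnorm H (\<pi> ?e \<xi>))\<^sup>2 = Re (hinner H \<xi> (\<pi> ?e \<xi>))"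
      unfolding H.hnorm_sq[OF e\<xi>] D(5)[OF eC \<xi> e\<xi>] se D(4)[OF eC eC \<xi>, symmetric] ee ..
    also have "\<dots> \<le> hnorm H \<xi> * hnorm H (\<pi> ?e \<xi>)" by (rule H.Re_hinner_le[OF \<xi> e\<xi>])
    finally have "hnorm H (\<pi> ?e \<xi>) * hnorm H (\<pi> ?e \<xi>) \<le> hnorm H \<xi> * hnorm H (\<pi> ?e \<xi>)"
      by (simp add: power2_eq_square)
    then show ?thesis using H.hnorm_nonneg[OF e\<xi>] H.hnorm_nonneg[OF \<xi>]
      by (cases "hnorm H (\<pi> ?e \<xi>) = 0") (simp_all add: mult_le_cancel_right)
  qed
  have main: "(hnorm H (\<pi> ?x \<xi>))\<^sup>2 \<le> k * (hnorm H \<xi>)\<^sup>2" if \<xi>: "\<xi> \<in> carrier H" for \<xi>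
  proof -
    \<comment> \<open>Replaces \<xi> by its component in the range of \<pi>(1), where the unit does
      act as the identity; \<pi>(x) does not see the difference because x 1 = x.\<close>
    define \<eta> where "\<eta> = \<pi> ?e \<xi>"
    have \<eta>: "\<eta> \<in> carrier H" unfolding \<eta>_def by (rule D(6)[OF eC \<xi>])
    have e\<eta>: "\<pi> ?e \<eta> = \<eta>" unfolding \<eta>_def D(4)[OF eC eC \<xi>, symmetric] ee ..
    have x\<eta>: "\<pi> ?x \<eta> = \<pi> ?x \<xi>" unfolding \<eta>_def D(4)[OF xC eC \<xi>, symmetric] xe ..
    note [simp] = \<eta> D(6)[OF xC \<eta>] D(6)[OF aC \<eta>]
    define \<zeta> where "\<zeta> = \<eta> \<ominus>\<^bsub>H\<^esub> \<pi> ?a \<eta>"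
    have \<zeta>: "\<zeta> \<in> carrier H" by (simp add: \<zeta>_def)
    have "\<pi> ?c \<eta> = \<zeta>"
      unfolding D(2)[OF eC mC \<eta>] D(3)[OF aC \<eta>] e\<eta> \<zeta>_def by (simp add: H.hminus_eq)
    then have b\<zeta>: "\<pi> b \<zeta> = \<eta>" using D(4)[OF b(1) cC \<eta>] b(2) e\<eta> by simp
    have a\<eta>: "\<pi> ?a \<eta> = \<pi> ?s (\<pi> ?x \<eta>)" unfolding a_eq[symmetric] D(4)[OF sC xC \<eta>] ..
    have norm_a: "hnorm H (\<pi> ?a \<eta>) \<le> hnorm H (\<pi> ?x \<eta>)"
    proof -
      have "hnorm H (\<pi> ?a \<eta>) \<le> hopnorm H (\<pi> ?s) * hnorm H (\<pi> ?x \<eta>)"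
        unfolding a\<eta> by (rule H.hopnorm_bound[OF D(1)[OF sC] D(6)[OF xC \<eta>]])
      also have "\<dots> \<le> 1 * hnorm H (\<pi> ?x \<eta>)"
        by (intro mult_right_mono H.hnorm_nonneg D(6)[OF xC \<eta>])
          (use H.hopnorm_star[OF rep xC sC] norm1 in simp)
      finally show ?thesis by simp
    qed
    have ip: "hinner H \<eta> (\<pi> ?a \<eta>) = of_real ((hnorm H (\<pi> ?x \<eta>))\<^sup>2)"
      unfolding a\<eta> D(5)[OF xC \<eta> D(6)[OF xC \<eta>], symmetric] by (rule H.hinner_self[OF D(6)[OF xC \<eta>]])
    have ip': "hinner H (\<pi> ?a \<eta>) \<eta> = of_real ((hnorm H (\<pi> ?x \<eta>))\<^sup>2)"
      using H.hinner_commute[of "\<pi> ?a \<eta>" \<eta>] by (simp add: ip)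
    \<comment> \<open>The square of \<eta> - \<pi>(a) \<eta> with a = x^* x. The cross terms equal
      ||\<pi>(x) \<eta>||^2, and the last term is at most this by the assumption that \<pi>(x) has
      norm 1.\<close>
    have "(hnorm H \<zeta>)\<^sup>2 = (hnorm H \<eta>)\<^sup>2 - 2 * (hnorm H (\<pi> ?x \<eta>))\<^sup>2 + (hnorm H (\<pi> ?a \<eta>))\<^sup>2"
      unfolding H.hnorm_sq[OF \<zeta>] unfolding \<zeta>_def
      by (simp add: H.hinner_simps ip ip' H.hinner_self[of \<eta>] H.hinner_self[of "\<pi> ?a \<eta>"] del: of_real_power)
    also have "\<dots> \<le> (hnorm H \<eta>)\<^sup>2 - (hnorm H (\<pi> ?x \<eta>))\<^sup>2"
      using power_mono[OF norm_a, of 2] by simp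
    finally have z: "(hnorm H \<zeta>)\<^sup>2 \<le> (hnorm H \<eta>)\<^sup>2 - (hnorm H (\<pi> ?x \<eta>))\<^sup>2" .
    have "hnorm H \<eta> \<le> (1 + K) * hnorm H \<zeta>"
      using K(2)[rule_format, OF \<zeta>] b\<zeta> H.hnorm_nonneg[OF \<zeta>] by (simp add: algebra_simps)
    then have "(hnorm H \<eta>)\<^sup>2 \<le> (1 + K)\<^sup>2 * (hnorm H \<zeta>)\<^sup>2"
      using power_mono[OF _ H.hnorm_nonneg[OF \<eta>], of _ 2] by (fastforce simp: power_mult_distrib)
    also have "\<dots> \<le> (1 + K)\<^sup>2 * ((hnorm H \<eta>)\<^sup>2 - (hnorm H (\<pi> ?x \<eta>))\<^sup>2)"
      by (intro mult_left_mono z) simp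
    finally have "(hnorm H \<eta>)\<^sup>2 / (1 + K)\<^sup>2 \<le> (hnorm H \<eta>)\<^sup>2 - (hnorm H (\<pi> ?x \<eta>))\<^sup>2"
      using K by (simp add: divide_le_eq mult.commute)
    then have "(hnorm H (\<pi> ?x \<eta>))\<^sup>2 \<le> k * (hnorm H \<eta>)\<^sup>2" by (simp add: k_def algebra_simps)
    also have "\<dots> \<le> k * (hnorm H \<xi>)\<^sup>2"
      by (intro mult_left_mono power_mono k H.hnorm_nonneg \<eta>) (unfold \<eta>_def, rule e_le[OF \<xi>])
    finally show ?thesis unfolding x\<eta> .
  qed
  have "hopnorm H (\<pi> ?x) \<le> sqrt k"
  proof (rule H.hopnorm_le)
    fix \<xi> assume \<xi>: "\<xi> \<in> carrier H"
    have "(hnorm H (\<pi> ?x \<xi>))\<^sup>2 \<le> (sqrt k * hnorm H \<xi>)\<^sup>2" using main[OF \<xi>] k by (simp add: power_mult_distrib)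
    then show "hnorm H (\<pi> ?x \<xi>) \<le> sqrt k * hnorm H \<xi>"
      by (rule power2_le_imp_le) (use k H.hnorm_nonneg[OF \<xi>] in simp)
  qed (use k in simp)
  also have "sqrt k < 1" using k by simp
  finally show False using norm1 by simp
qed

text \<open>If the norm L exceeded 1, then x / L would have norm exactly 1, while its approximants
  still have seminorm at most r < 1; that value is excluded by
  \<open>representation_norm_neq_1\<close>.\<close>

lemma representation_norm_le_1:
  assumes H: "hilbert_space H" and rep: "representation CC H \<pi>"
    and X: "X \<in> CS" and r: "r < 1" and le: "\<And>n. u (X n) \<le> r"
  shows "hopnorm H (\<pi> (cls X)) \<le> 1"
proof (rule ccontr)
  interpret H: hilbert_space H by (rule H)
  note D = representationD[OF rep CC_cls[OF X]]
  define L where "L = hopnorm H (\<pi> (cls X))"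
  assume "\<not> ?thesis"
  then have L: "L > 1" by (simp add: L_def)
  let ?c = "of_real (1 / L) :: complex"
  let ?Y = "\<lambda>n. ?c \<odot>\<^bsub>B\<^esub> X n"
  have Y: "?Y \<in> CS" by (rule CS_smult[OF X])
  have r0: "0 \<le> r" using le[of 0] u_nonneg[OF CS_V[OF X, of 0]] by simp
  have "u (?Y n) \<le> r" for n
  proof -
    have "u (?Y n) \<le> (1 / L) * u (X n)" using u_smult_le[OF CS_V[OF X], of ?c n] L by (simp add: norm_divide)
    also have "\<dots> \<le> 1 * r" by (intro mult_mono le u_nonneg) (use L CS_V[OF X] in auto)
    finally show ?thesis by simp
  qed
  then have "hopnorm H (\<pi> (cls ?Y)) \<noteq> 1" by (rule representation_norm_neq_1[OF H rep Y r])
  moreover have "hopnorm H (\<pi> (cls ?Y)) = 1"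
  proof -
    have eq: "hnorm H (\<pi> (cls ?Y) \<xi>) = hnorm H (\<pi> (cls X) \<xi>) / L" if \<xi>: "\<xi> \<in> carrier H" for \<xi>
      using D(3)[OF \<xi>, of ?c] H.hnorm_smult[OF D(6)[OF \<xi>], of ?c] L by (simp add: CC_smult[OF X] norm_divide)
    have Yb: "bounded_operator H (\<pi> (cls ?Y))" by (rule representationD(1)[OF rep CC_cls[OF Y]])
    have "hopnorm H (\<pi> (cls ?Y)) \<le> 1"
    proof (rule H.hopnorm_le)
      fix \<xi> assume \<xi>: "\<xi> \<in> carrier H"
      show "hnorm H (\<pi> (cls ?Y) \<xi>) \<le> 1 * hnorm H \<xi>"
        unfolding eq[OF \<xi>] using H.hopnorm_bound[OF D(1) \<xi>] L by (simp add: L_def field_simps)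
    qed simp
    moreover have "hopnorm H (\<pi> (cls X)) \<le> L * hopnorm H (\<pi> (cls ?Y))"
    proof (rule H.hopnorm_le)
      fix \<xi> assume \<xi>: "\<xi> \<in> carrier H"
      show "hnorm H (\<pi> (cls X) \<xi>) \<le> L * hopnorm H (\<pi> (cls ?Y)) * hnorm H \<xi>"
        using H.hopnorm_bound[OF Yb \<xi>] L unfolding eq[OF \<xi>] by (simp add: field_simps)
    qed (use L H.hopnorm_nonneg[OF Yb] in simp)
    ultimately show ?thesis using L by (simp flip: L_def)
  qed
  ultimately show False by simp
qed

text \<open>Lets a bound that holds from some index on be treated as holding for all
  indices.\<close>

lemma cls_shift:
  assumes X: "X \<in> CS" shows "(\<lambda>n. X (n + N)) \<in> CS" "cls (\<lambda>n. X (n + N)) = cls X"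
proof -
  have V: "X n \<in> carrier B" for n by (rule CS_V[OF X])
  have *: "\<exists>M. \<forall>m\<ge>M. \<forall>n\<ge>M. u (X (m + N) - X (n + N)) < e" if "e > 0" for e
  proof -
    obtain M where M: "\<forall>m\<ge>M. \<forall>n\<ge>M. u (X m - X n) < e" using CS_D[OF X \<open>e > 0\<close>] ..
    then have "\<forall>m\<ge>M. \<forall>n\<ge>M. u (X (m + N) - X (n + N)) < e" by simp
    then show ?thesis ..
  qed
  then show cs: "(\<lambda>n. X (n + N)) \<in> CS" by (simp add: cauchy_seqs_def d_eq V)
  have "(\<lambda>n. u (X (n + N) - X n)) \<longlonglongrightarrow> 0"
  proof (rule LIMSEQ_I)
    fix e :: real assume "e > 0"
    from CS_D[OF X this] obtain M where M: "\<forall>m\<ge>M. \<forall>n\<ge>M. u (X m - X n) < e" ..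
    have "\<forall>n\<ge>M. norm (u (X (n + N) - X n) - 0) < e" using M by (simp add: V)
    then show "\<exists>no. \<forall>n\<ge>no. norm (u (X (n + N) - X n) - 0) < e" ..
  qed
  then show "cls (\<lambda>n. X (n + N)) = cls X" by (simp add: cls_eq_iff[OF cs X])
qed

text \<open>Dividing by 2 r makes the approximants at most 1/2, strictly below 1 as
  \<open>representation_norm_le_1\<close> asks. The resulting factor 2 is harmless, since continuity
  only requires some constant.\<close>

lemma representation_bound:
  assumes H: "hilbert_space H" and rep: "representation CC H \<pi>"
    and X: "X \<in> CS" and r: "r > 0" and le: "\<And>n. n \<ge> N \<Longrightarrow> u (X n) \<le> r" and \<xi>: "\<xi> \<in> carrier H"
  shows "hnorm H (\<pi> (cls X) \<xi>) \<le> 2 * r * hnorm H \<xi>"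
proof -
  interpret H: hilbert_space H by (rule H)
  define X' where "X' n = X (n + N)" for n
  have X': "X' \<in> CS" "cls X' = cls X" using cls_shift[OF X, of N] by (simp_all add: X'_def[abs_def])
  note D = representationD[OF rep CC_cls[OF X'(1)]]
  let ?c = "of_real (1 / (2 * r)) :: complex"
  let ?Y = "\<lambda>n. ?c \<odot>\<^bsub>B\<^esub> X' n"
  have Y: "?Y \<in> CS" by (rule CS_smult[OF X'(1)])
  have uY: "u (?Y n) \<le> 1/2" for n
  proof -
    have "u (?Y n) \<le> (1 / (2 * r)) * u (X' n)"
      using u_smult_le[OF CS_V[OF X'(1)], of ?c n] r by (simp add: norm_divide norm_mult)
    also have "\<dots> \<le> 1 / (2 * r) * r" using le[of "n + N"] r by (intro mult_left_mono) (simp_all add: X'_def)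
    finally show ?thesis using r by simp
  qed
  have Yb: "bounded_operator H (\<pi> (cls ?Y))" by (rule representationD(1)[OF rep CC_cls[OF Y]])
  have "hnorm H (\<pi> (cls ?Y) \<xi>) \<le> hopnorm H (\<pi> (cls ?Y)) * hnorm H \<xi>" by (rule H.hopnorm_bound[OF Yb \<xi>])
  also have "\<dots> \<le> 1 * hnorm H \<xi>"
    by (intro mult_right_mono H.hnorm_nonneg[OF \<xi>] representation_norm_le_1[OF H rep Y _ uY]) simp
  finally have "hnorm H (\<pi> (cls ?Y) \<xi>) \<le> hnorm H \<xi>" by simp
  moreover have "hnorm H (\<pi> (cls ?Y) \<xi>) = hnorm H (\<pi> (cls X') \<xi>) / (2 * r)"
    using D(3)[OF \<xi>, of ?c] H.hnorm_smult[OF D(6)[OF \<xi>], of ?c] r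
    by (simp add: CC_smult[OF X'(1)] norm_divide norm_mult)
  ultimately have "hnorm H (\<pi> (cls X') \<xi>) / (2 * r) \<le> hnorm H \<xi>" by simp
  then show ?thesis using r unfolding X'(2) by (simp add: divide_le_eq mult_ac)
qed

text \<open>Automatic continuity in the form used later: cls X is the embedded \<open>X m\<close>
  plus the class of \<open>X n - X m\<close>, which is eventually small.\<close>

lemma representation_continuous:
  assumes H: "hilbert_space H" and rep: "representation CC H \<pi>"
    and X: "X \<in> CS" and \<xi>: "\<xi> \<in> carrier H"
  shows "hconv H (\<lambda>m. \<pi> (cstar_embed B (X m)) \<xi>) (\<pi> (cls X) \<xi>)"
  unfolding hconv_def
proof (rule LIMSEQ_I)
  interpret H: hilbert_space H by (rule H)
  note D = representationD[OF rep]
  have V [simp]: "X n \<in> carrier B" for n by (rule CS_V[OF X])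
  fix e :: real assume e: "e > 0"
  \<comment> \<open>Chosen so that the bound 2 r ||\<xi>|| stays below e; the added 1 covers \<xi> =
    0.\<close>
  define r where "r = e / (2 * (hnorm H \<xi> + 1))"
  have h0: "0 \<le> hnorm H \<xi>" by (rule H.hnorm_nonneg[OF \<xi>])
  have r: "r > 0" unfolding r_def using e h0 by (intro divide_pos_pos) auto
  have re: "2 * r * hnorm H \<xi> < e"
  proof -
    have "2 * r * hnorm H \<xi> = e * (hnorm H \<xi> / (hnorm H \<xi> + 1))" using h0 by (simp add: r_def field_simps)
    also have "\<dots> < e * 1" using e h0 by (intro mult_strict_left_mono) auto
    finally show ?thesis by simp
  qed
  obtain N where N: "\<forall>m\<ge>N. \<forall>n\<ge>N. u (X m - X n) < r" using CS_D[OF X r] ..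
  have "norm (hnorm H (\<pi> (cstar_embed B (X m)) \<xi> \<ominus>\<^bsub>H\<^esub> \<pi> (cls X) \<xi>) - 0) < e" if m: "m \<ge> N" for m
  proof -
    let ?c = "\<lambda>n. X m" and ?Y = "\<lambda>n. X n - X m"
    have c: "?c \<in> CS" by simp
    have Y: "?Y \<in> CS" using CS_add[OF X, of "\<lambda>n. - X m"] by simp
    have XY: "cls X = cls ?c \<oplus>\<^bsub>CC\<^esub> cls ?Y" by (simp add: CC_add[OF c Y])
    note mem [simp] = D(6)[OF CC_cls[OF c] \<xi>] D(6)[OF CC_cls[OF Y] \<xi>]
    have "\<pi> (cls X) \<xi> = \<pi> (cls ?c) \<xi> \<oplus>\<^bsub>H\<^esub> \<pi> (cls ?Y) \<xi>"
      unfolding XY by (rule D(2)[OF CC_cls[OF c] CC_cls[OF Y] \<xi>])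
    then have "\<pi> (cls X) \<xi> \<ominus>\<^bsub>H\<^esub> \<pi> (cls ?c) \<xi> = \<pi> (cls ?Y) \<xi>"
      by (intro H.hinner_ext) (auto simp: H.hinner_simps)
    moreover have "hnorm H (\<pi> (cls ?Y) \<xi>) \<le> 2 * r * hnorm H \<xi>"
      by (rule representation_bound[OF H rep Y r _ \<xi>, of N]) (use N m in \<open>simp add: less_imp_le\<close>)
    ultimately show ?thesis
      using H.hnorm_minus_commute[OF D(6)[OF CC_cls[OF X] \<xi>] mem(1)] re D(6)[OF CC_cls[OF X] \<xi>]
      by (simp add: embed_eq)
  qed
  then show "\<exists>no. \<forall>n\<ge>no. norm (hnorm H (\<pi> (cstar_embed B (X n)) \<xi> \<ominus>\<^bsub>H\<^esub> \<pi> (cls X) \<xi>) - 0) < e" by blast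
qed

text \<open>The uniqueness half of the definite description in \<open>koopman_rep\<close>.\<close>

lemma representation_unique:
  assumes H: "hilbert_space H" and rep: "representation CC H \<pi>" "representation CC H \<rho>"
    and eq: "\<And>x \<xi>. x \<in> carrier B \<Longrightarrow> \<xi> \<in> carrier H \<Longrightarrow> \<pi> (cstar_embed B x) \<xi> = \<rho> (cstar_embed B x) \<xi>"
    and P: "P \<in> carrier CC" and \<xi>: "\<xi> \<in> carrier H"
  shows "\<pi> P \<xi> = \<rho> P \<xi>"
proof -
  interpret H: hilbert_space H by (rule H)
  obtain X where X: "X \<in> CS" "P = cls X" using CC_ex[OF P] by blast
  have V: "X n \<in> carrier B" for n by (rule CS_V[OF X(1)])
  have e: "\<pi> (cstar_embed B (X n)) \<xi> = \<rho> (cstar_embed B (X n)) \<xi>" for n by (rule eq[OF V \<xi>])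
  have 1: "hconv H (\<lambda>m. \<rho> (cstar_embed B (X m)) \<xi>) (\<pi> (cls X) \<xi>)"
    using representation_continuous[OF H rep(1) X(1) \<xi>] by (simp add: e)
  have 2: "hconv H (\<lambda>m. \<rho> (cstar_embed B (X m)) \<xi>) (\<rho> (cls X) \<xi>)"
    by (rule representation_continuous[OF H rep(2) X(1) \<xi>])
  show ?thesis
    unfolding X(2)
    by (rule H.hconv_unique[OF _ _ _ 1 2])
      (intro representationD(6)[OF rep(1)] representationD(6)[OF rep(2)] embed_carrier V CC_cls X \<xi>)+
qed

text \<open>The existence half for \<open>koopman_rep\<close>. Boundedness by u makes
  \<open>\<rho> (X n) \<xi>\<close> Cauchy in the complete space H, and each relation of a
  representation survives the limit.\<close>

lemma representation_extend:
  assumes H: "hilbert_space H" and rep: "representation B H \<rho>"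
  shows "\<exists>\<pi>. representation CC H \<pi> \<and>
    (\<forall>x\<in>carrier B. \<forall>\<xi>\<in>carrier H. \<pi> (cstar_embed B x) \<xi> = \<rho> x \<xi>)"
proof -
  interpret H: hilbert_space H by (rule H)
  note D = representationD[OF rep]
  have diff: "\<rho> (x - y) \<xi> = \<rho> x \<xi> \<ominus>\<^bsub>H\<^esub> \<rho> y \<xi>" if x: "x \<in> carrier B" and y: "y \<in> carrier B" and \<xi>: "\<xi> \<in> carrier H" for x y \<xi>
  proof -
    have xy: "x - y \<in> carrier B" using x y by simp
    have "\<rho> x \<xi> = \<rho> (x - y) \<xi> \<oplus>\<^bsub>H\<^esub> \<rho> y \<xi>" using D(2)[OF xy y \<xi>] by (simp add: add_B)
    then show ?thesis using D(6)[OF xy \<xi>] D(6)[OF y \<xi>]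
      by (intro H.hinner_ext) (auto simp: H.hinner_simps)
  qed
  have lim_ex: "\<exists>y\<in>carrier H. hconv H (\<lambda>n. \<rho> (X n) \<xi>) y" if X: "X \<in> CS" and \<xi>: "\<xi> \<in> carrier H" for X \<xi>
    unfolding hconv_def
  proof (rule H.hcomplete)
    have V: "X n \<in> carrier B" for n by (rule CS_V[OF X])
    show "\<rho> (X n) \<xi> \<in> carrier H" for n by (rule D(6)[OF V \<xi>])
    fix e :: real assume e: "e > 0"
    have h0: "0 \<le> hnorm H \<xi>" by (rule H.hnorm_nonneg[OF \<xi>])
    have "e / (hnorm H \<xi> + 1) > 0" using e h0 by (intro divide_pos_pos) auto
    then obtain N where N: "\<forall>m\<ge>N. \<forall>n\<ge>N. u (X m - X n) < e / (hnorm H \<xi> + 1)" using CS_D[OF X] by blast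
    have "hnorm H (\<rho> (X m) \<xi> \<ominus>\<^bsub>H\<^esub> \<rho> (X n) \<xi>) < e" if "m \<ge> N" "n \<ge> N" for m n
    proof -
      have "hnorm H (\<rho> (X m) \<xi> \<ominus>\<^bsub>H\<^esub> \<rho> (X n) \<xi>) \<le> u (X m - X n) * hnorm H \<xi>"
        unfolding diff[OF V V \<xi>, symmetric] by (rule representation_le_u[OF H rep _ \<xi>]) (simp add: V)
      also have "\<dots> \<le> e / (hnorm H \<xi> + 1) * hnorm H \<xi>"
        by (intro mult_right_mono h0) (use N that in \<open>simp add: less_imp_le\<close>)
      also have "\<dots> = e * (hnorm H \<xi> / (hnorm H \<xi> + 1))" by simp
      also have "\<dots> < e * 1" using e h0 by (intro mult_strict_left_mono) auto
      finally show ?thesis by simp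
    qed
    then show "\<exists>N. \<forall>m\<ge>N. \<forall>n\<ge>N. hnorm H (\<rho> (X m) \<xi> \<ominus>\<^bsub>H\<^esub> \<rho> (X n) \<xi>) < e" by blast
  qed
  have same: "hconv H (\<lambda>n. \<rho> (Y n) \<xi>) y" if X: "X \<in> CS" and Y: "Y \<in> CS" and null: "(\<lambda>n. u (X n - Y n)) \<longlonglongrightarrow> 0"
    and \<xi>: "\<xi> \<in> carrier H" and y: "y \<in> carrier H" "hconv H (\<lambda>n. \<rho> (X n) \<xi>) y" for X Y \<xi> y
    unfolding hconv_def
  proof (rule Lim_null_comparison[OF always_eventually[OF allI]])
    have V: "X n \<in> carrier B" "Y n \<in> carrier B" for n by (rule CS_V[OF X], rule CS_V[OF Y])
    show "(\<lambda>n. u (X n - Y n) * hnorm H \<xi> + hnorm H (\<rho> (X n) \<xi> \<ominus>\<^bsub>H\<^esub> y)) \<longlonglongrightarrow> 0"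
      using y(2) unfolding hconv_def by (intro tendsto_add_zero tendsto_mult_left_zero null)
    fix n
    note mem = D(6)[OF V(1)[of n] \<xi>] D(6)[OF V(2)[of n] \<xi>]
    have "hnorm H (\<rho> (Y n) \<xi> \<ominus>\<^bsub>H\<^esub> y) \<le> hnorm H (\<rho> (Y n) \<xi> \<ominus>\<^bsub>H\<^esub> \<rho> (X n) \<xi>) + hnorm H (\<rho> (X n) \<xi> \<ominus>\<^bsub>H\<^esub> y)"
      by (rule H.hnorm_triangle_minus[OF mem(2) mem(1) y(1)])
    also have "hnorm H (\<rho> (Y n) \<xi> \<ominus>\<^bsub>H\<^esub> \<rho> (X n) \<xi>) = hnorm H (\<rho> (X n - Y n) \<xi>)"
      unfolding diff[OF V \<xi>] by (rule H.hnorm_minus_commute[OF mem(2,1)])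
    also have "\<dots> \<le> u (X n - Y n) * hnorm H \<xi>" by (rule representation_le_u[OF H rep _ \<xi>]) (simp add: V)
    finally show "norm (hnorm H (\<rho> (Y n) \<xi> \<ominus>\<^bsub>H\<^esub> y)) \<le> u (X n - Y n) * hnorm H \<xi> + hnorm H (\<rho> (X n) \<xi> \<ominus>\<^bsub>H\<^esub> y)"
      using mem y(1) by simp
  qed
  \<comment> \<open>A limit along some representative of P; \<open>same\<close> and
    \<open>uniq\<close> show that every representative yields the same vector.\<close>
  define \<pi> where "\<pi> P \<xi> = (SOME y. y \<in> carrier H \<and> (\<exists>X\<in>P. hconv H (\<lambda>n. \<rho> (X n) \<xi>) y))" for P \<xi>
  have \<pi>: "\<pi> (cls X) \<xi> \<in> carrier H" "hconv H (\<lambda>n. \<rho> (X n) \<xi>) (\<pi> (cls X) \<xi>)"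
    if X: "X \<in> CS" and \<xi>: "\<xi> \<in> carrier H" for X \<xi>
  proof -
    obtain y where "y \<in> carrier H" "hconv H (\<lambda>n. \<rho> (X n) \<xi>) y" using lim_ex[OF X \<xi>] by blast
    then have "\<exists>y. y \<in> carrier H \<and> (\<exists>X\<in>cls X. hconv H (\<lambda>n. \<rho> (X n) \<xi>) y)" using cls_self[OF X] by blast
    then have s: "\<pi> (cls X) \<xi> \<in> carrier H \<and> (\<exists>Y\<in>cls X. hconv H (\<lambda>n. \<rho> (Y n) \<xi>) (\<pi> (cls X) \<xi>))"
      unfolding \<pi>_def by (rule someI_ex)
    then obtain Y where Y: "Y \<in> cls X" "hconv H (\<lambda>n. \<rho> (Y n) \<xi>) (\<pi> (cls X) \<xi>)" by blast
    have r: "Y \<in> CS" "(\<lambda>n. u (Y n - X n)) \<longlonglongrightarrow> 0"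
      using Y(1) q_null_sym[of X Y] CS_V[of X] CS_V[of Y] by (auto simp: rel_iff)
    show "\<pi> (cls X) \<xi> \<in> carrier H" using s by blast
    then show "hconv H (\<lambda>n. \<rho> (X n) \<xi>) (\<pi> (cls X) \<xi>)" by (rule same[OF r(1) X r(2) \<xi> _ Y(2)])
  qed
  have uniq: "\<pi> (cls X) \<xi> = y" if "X \<in> CS" "\<xi> \<in> carrier H" "y \<in> carrier H" "hconv H (\<lambda>n. \<rho> (X n) \<xi>) y" for X \<xi> y
    by (rule H.hconv_unique[OF D(6)[OF CS_V[OF that(1)] that(2)] \<pi>(1)[OF that(1,2)] that(3) \<pi>(2)[OF that(1,2)] that(4)])
  have bdd: "\<exists>M. \<forall>\<xi>\<in>carrier H. hnorm H (\<pi> (cls X) \<xi>) \<le> M * hnorm H \<xi>" if X: "X \<in> CS" for X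
  proof -
    obtain M where M: "\<And>n. u (X n) \<le> M" using CS_bounded[OF X] by blast
    have V: "X n \<in> carrier B" for n by (rule CS_V[OF X])
    have "hnorm H (\<pi> (cls X) \<xi>) \<le> M * hnorm H \<xi>" if \<xi>: "\<xi> \<in> carrier H" for \<xi>
    proof (rule LIMSEQ_le_const2[OF H.hconv_hnorm[OF D(6)[OF V \<xi>] \<pi>[OF X \<xi>]]], intro exI allI impI)
      fix n
      have "hnorm H (\<rho> (X n) \<xi>) \<le> u (X n) * hnorm H \<xi>" by (rule representation_le_u[OF H rep V \<xi>])
      also have "\<dots> \<le> M * hnorm H \<xi>" by (intro mult_right_mono M H.hnorm_nonneg \<xi>)
      finally show "hnorm H (\<rho> (X n) \<xi>) \<le> M * hnorm H \<xi>" .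
    qed
    then show ?thesis by blast
  qed
  have lin: "linear_map H H (\<pi> (cls X))" if X: "X \<in> CS" for X
    unfolding linear_map_def
  proof (intro conjI ballI allI)
    have V: "X n \<in> carrier B" for n by (rule CS_V[OF X])
    note L = H.linear_mapD[OF H.bounded_operatorD(1)[OF D(1)[OF V]]]
    show "\<pi> (cls X) \<in> carrier H \<rightarrow> carrier H" using \<pi>(1)[OF X] by blast
    fix x c assume x: "x \<in> carrier H"
    have "hconv H (\<lambda>n. c \<odot>\<^bsub>H\<^esub> \<rho> (X n) x) (c \<odot>\<^bsub>H\<^esub> \<pi> (cls X) x)"
      by (rule H.hconv_smult[OF D(6)[OF V x] \<pi>[OF X x]])
    then show "\<pi> (cls X) (c \<odot>\<^bsub>H\<^esub> x) = c \<odot>\<^bsub>H\<^esub> \<pi> (cls X) x"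
      by (intro uniq[OF X]) (simp_all add: L(3)[OF x] x \<pi>(1)[OF X x])
    fix y assume y: "y \<in> carrier H"
    have "hconv H (\<lambda>n. \<rho> (X n) x \<oplus>\<^bsub>H\<^esub> \<rho> (X n) y) (\<pi> (cls X) x \<oplus>\<^bsub>H\<^esub> \<pi> (cls X) y)"
      by (rule H.hconv_add[OF D(6)[OF V x] \<pi>(1)[OF X x] D(6)[OF V y] \<pi>(1)[OF X y] \<pi>(2)[OF X x] \<pi>(2)[OF X y]])
    then show "\<pi> (cls X) (x \<oplus>\<^bsub>H\<^esub> y) = \<pi> (cls X) x \<oplus>\<^bsub>H\<^esub> \<pi> (cls X) y"
      by (intro uniq[OF X]) (simp_all add: L(2)[OF x y] x y \<pi>(1)[OF X x] \<pi>(1)[OF X y])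
  qed
  have "representation CC H \<pi>"
    unfolding representation_def
  proof (intro conjI ballI allI)
    fix P assume "P \<in> carrier CC"
    then obtain X where X: "X \<in> CS" "P = cls X" using CC_ex by blast
    have V: "X n \<in> carrier B" for n by (rule CS_V[OF X(1)])
    show "bounded_operator H (\<pi> P)" unfolding X(2) bounded_operator_def using lin[OF X(1)] bdd[OF X(1)] by blast
    fix \<xi> c assume \<xi>: "\<xi> \<in> carrier H"
    note \<pi>X = \<pi>[OF X(1) \<xi>]
    have "hconv H (\<lambda>n. c \<odot>\<^bsub>H\<^esub> \<rho> (X n) \<xi>) (c \<odot>\<^bsub>H\<^esub> \<pi> (cls X) \<xi>)"
      by (rule H.hconv_smult[OF D(6)[OF V \<xi>] \<pi>X])
    then show "\<pi> (c \<odot>\<^bsub>CC\<^esub> P) \<xi> = c \<odot>\<^bsub>H\<^esub> \<pi> P \<xi>"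
      unfolding X(2) CC_smult[OF X(1)]
      by (intro uniq[OF CS_smult[OF X(1)] \<xi>]) (simp_all add: D(3)[OF V \<xi>] \<pi>X(1))
    fix \<eta> assume \<eta>: "\<eta> \<in> carrier H"
    have V': "star B (X n) \<in> carrier B" for n using V by simp
    have "(\<lambda>n. hinner H (\<rho> (X n) \<xi>) \<eta>) \<longlonglongrightarrow> hinner H (\<pi> (cls X) \<xi>) \<eta>"
      by (rule H.hconv_hinner[OF D(6)[OF V \<xi>] \<pi>X(1) \<eta> \<pi>X(2)])
    moreover have "(\<lambda>n. hinner H \<xi> (\<rho> (star B (X n)) \<eta>)) \<longlonglongrightarrow> hinner H \<xi> (\<pi> (star CC (cls X)) \<eta>)"
      unfolding CC_star[OF X(1)]
      by (rule H.hconv_hinner2[OF \<xi> \<xi> H.hconv_const[OF \<xi>] D(6)[OF V' \<eta>] \<pi>[OF CS_star[OF X(1)] \<eta>]])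
    ultimately show "hinner H (\<pi> P \<xi>) \<eta> = hinner H \<xi> (\<pi> (star CC P) \<eta>)"
      unfolding X(2) D(5)[OF V \<xi> \<eta>] by (rule LIMSEQ_unique)
  next
    fix P Q \<xi> assume "P \<in> carrier CC" "Q \<in> carrier CC" and \<xi>: "\<xi> \<in> carrier H"
    then obtain X Y where X: "X \<in> CS" "P = cls X" and Y: "Y \<in> CS" "Q = cls Y" using CC_ex by blast
    have V: "X n \<in> carrier B" "Y n \<in> carrier B" for n by (rule CS_V[OF X(1)], rule CS_V[OF Y(1)])
    note \<pi>X = \<pi>[OF X(1) \<xi>] and \<pi>Y = \<pi>[OF Y(1) \<xi>]
    note \<pi>XY = \<pi>[OF X(1) \<pi>Y(1)]
    have "hconv H (\<lambda>n. \<rho> (X n) \<xi> \<oplus>\<^bsub>H\<^esub> \<rho> (Y n) \<xi>) (\<pi> (cls X) \<xi> \<oplus>\<^bsub>H\<^esub> \<pi> (cls Y) \<xi>)"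
      by (rule H.hconv_add[OF D(6)[OF V(1) \<xi>] \<pi>X(1) D(6)[OF V(2) \<xi>] \<pi>Y(1) \<pi>X(2) \<pi>Y(2)])
    then show "\<pi> (P \<oplus>\<^bsub>CC\<^esub> Q) \<xi> = \<pi> P \<xi> \<oplus>\<^bsub>H\<^esub> \<pi> Q \<xi>"
      unfolding X(2) Y(2) CC_add[OF X(1) Y(1)]
      by (intro uniq[OF CS_add[OF X(1) Y(1)] \<xi>]) (simp_all add: D(2)[OF V \<xi>, unfolded add_B] \<pi>X(1) \<pi>Y(1))
    obtain M where M: "\<And>n. u (X n) \<le> M" using CS_bounded[OF X(1)] by blast
    \<comment> \<open>Operators and vectors converge at the same time, which is controlled by the
      common bound M of the operators \<open>\<rho> (X n)\<close>.\<close>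
    have "hconv H (\<lambda>n. \<rho> (X n) (\<rho> (Y n) \<xi>)) (\<pi> (cls X) (\<pi> (cls Y) \<xi>))"
      unfolding hconv_def
    proof (rule Lim_null_comparison[OF always_eventually[OF allI]])
      let ?y = "\<pi> (cls Y) \<xi>" and ?z = "\<pi> (cls X) (\<pi> (cls Y) \<xi>)"
      show "(\<lambda>n. M * hnorm H (\<rho> (Y n) \<xi> \<ominus>\<^bsub>H\<^esub> ?y) + hnorm H (\<rho> (X n) ?y \<ominus>\<^bsub>H\<^esub> ?z)) \<longlonglongrightarrow> 0"
        using \<pi>Y(2) \<pi>XY(2) unfolding hconv_def by (intro tendsto_add_zero tendsto_mult_right_zero)
      fix n
      note m1 = D(6)[OF V(2)[of n] \<xi>] and m2 = \<pi>Y(1) and m3 = \<pi>XY(1)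
      note m4 = D(6)[OF V(1)[of n] m1] and m5 = D(6)[OF V(1)[of n] m2]
      have "hnorm H (\<rho> (X n) (\<rho> (Y n) \<xi>) \<ominus>\<^bsub>H\<^esub> ?z) \<le>
          hnorm H (\<rho> (X n) (\<rho> (Y n) \<xi>) \<ominus>\<^bsub>H\<^esub> \<rho> (X n) ?y) + hnorm H (\<rho> (X n) ?y \<ominus>\<^bsub>H\<^esub> ?z)"
        by (rule H.hnorm_triangle_minus[OF m4 m5 m3])
      also have "\<rho> (X n) (\<rho> (Y n) \<xi>) \<ominus>\<^bsub>H\<^esub> \<rho> (X n) ?y = \<rho> (X n) (\<rho> (Y n) \<xi> \<ominus>\<^bsub>H\<^esub> ?y)"
        by (rule H.linear_map_minus[OF H H.bounded_operatorD(1)[OF D(1)[OF V(1)]] m1 m2, symmetric])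
      also have "hnorm H (\<rho> (X n) (\<rho> (Y n) \<xi> \<ominus>\<^bsub>H\<^esub> ?y)) \<le> u (X n) * hnorm H (\<rho> (Y n) \<xi> \<ominus>\<^bsub>H\<^esub> ?y)"
        by (rule representation_le_u[OF H rep V(1) H.minus_closed[OF m1 m2]])
      also have "\<dots> \<le> M * hnorm H (\<rho> (Y n) \<xi> \<ominus>\<^bsub>H\<^esub> ?y)"
        by (intro mult_right_mono M H.hnorm_nonneg H.minus_closed m1 m2)
      finally show "norm (hnorm H (\<rho> (X n) (\<rho> (Y n) \<xi>) \<ominus>\<^bsub>H\<^esub> ?z)) \<le> M * hnorm H (\<rho> (Y n) \<xi> \<ominus>\<^bsub>H\<^esub> ?y) + hnorm H (\<rho> (X n) ?y \<ominus>\<^bsub>H\<^esub> ?z)"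
        using m4 m3 by simp
    qed
    then show "\<pi> (P \<otimes>\<^bsub>CC\<^esub> Q) \<xi> = \<pi> P (\<pi> Q \<xi>)"
      unfolding X(2) Y(2) CC_mult[OF X(1) Y(1)]
      by (intro uniq[OF CS_mult[OF X(1) Y(1)] \<xi>]) (simp_all add: D(4)[OF V \<xi>] \<pi>XY(1))
  qed
  moreover have "\<pi> (cstar_embed B x) \<xi> = \<rho> x \<xi>" if x: "x \<in> carrier B" and \<xi>: "\<xi> \<in> carrier H" for x \<xi>
    unfolding embed_eq by (rule uniq[OF const_CS[OF x] \<xi> D(6)[OF x \<xi>] H.hconv_const[OF D(6)[OF x \<xi>]]])
  ultimately show ?thesis by blast
qed

end

section \<open>The algebra C(X)\<close>

lemma apply_cfun_scale [simp]: "apply_bcontfun (cfun_scale c f) x = c * apply_bcontfun f x"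
  by (simp add: cfun_scale_def)

lemma apply_Bcontfun:
  fixes f :: "'x::topological_space \<Rightarrow> 'b::real_normed_vector"
  assumes "continuous_on UNIV f" "\<And>x. norm (f x) \<le> b"
  shows "apply_bcontfun (Bcontfun f) x = f x"
  using bcontfun_normI[OF assms] by (simp add: Bcontfun_inverse)

lemma cfun_mult_commute: "cfun_mult f g = cfun_mult g f"
  by (rule bcontfun_eqI) simp

lemma cfun_mult_assoc: "cfun_mult (cfun_mult f g) h = cfun_mult f (cfun_mult g h)"
  by (rule bcontfun_eqI) simp

lemma cfun_mult_add_left: "cfun_mult (f + g) h = cfun_mult f h + cfun_mult g h"
  by (rule bcontfun_eqI) (simp add: algebra_simps)

lemma cfun_mult_add_right: "cfun_mult h (f + g) = cfun_mult h f + cfun_mult h g"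
  by (rule bcontfun_eqI) (simp add: algebra_simps)

lemma cfun_mult_minus_right: "cfun_mult h (f - g) = cfun_mult h f - cfun_mult h g"
  by (rule bcontfun_eqI) (simp add: algebra_simps)

lemma cfun_mult_zero [simp]: "cfun_mult 0 f = 0" "cfun_mult f 0 = 0"
  by (rule bcontfun_eqI, simp)+

lemma cfun_mult_one [simp]: "cfun_mult (const_bcontfun 1) f = f" "cfun_mult f (const_bcontfun 1) = f"
  by (rule bcontfun_eqI, simp)+

lemma cfun_mult_scale_left: "cfun_mult (cfun_scale c f) g = cfun_scale c (cfun_mult f g)"
  by (rule bcontfun_eqI) simp

lemma cfun_mult_scale_right: "cfun_mult f (cfun_scale c g) = cfun_scale c (cfun_mult f g)"
  by (rule bcontfun_eqI) simp

lemma cfun_scale_add: "cfun_scale c (f + g) = cfun_scale c f + cfun_scale c g"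
  by (rule bcontfun_eqI) (simp add: algebra_simps)

lemma cfun_scale_add_left: "cfun_scale (c + c') f = cfun_scale c f + cfun_scale c' f"
  by (rule bcontfun_eqI) (simp add: algebra_simps)

lemma cfun_scale_zero [simp]: "cfun_scale c 0 = 0" "cfun_scale 0 f = 0"
  by (rule bcontfun_eqI, simp)+

lemma cfun_scale_one [simp]: "cfun_scale 1 f = f"
  by (rule bcontfun_eqI) simp

lemma cfun_scale_scale: "cfun_scale c (cfun_scale c' f) = cfun_scale (c * c') f"
  by (rule bcontfun_eqI) simp

lemma cfun_cnj_zero [simp]: "cfun_cnj 0 = 0"
  by (rule bcontfun_eqI) simp

lemma cfun_cnj_cnj [simp]: "cfun_cnj (cfun_cnj f) = f"
  by (rule bcontfun_eqI) simp

lemma cfun_cnj_one [simp]: "cfun_cnj (const_bcontfun 1) = const_bcontfun 1"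
  by (rule bcontfun_eqI) simp

lemma cfun_cnj_mult: "cfun_cnj (cfun_mult f g) = cfun_mult (cfun_cnj f) (cfun_cnj g)"
  by (rule bcontfun_eqI) simp

lemma cfun_cnj_add: "cfun_cnj (f + g) = cfun_cnj f + cfun_cnj g"
  by (rule bcontfun_eqI) simp

text \<open>Applied to eta-expanded sums, these rules would unfold the addition of functions itself.\<close>

declare plus_fun_apply [simp del] zero_fun_apply [simp del]

abbreviation "cfun_abs_sq f \<equiv> cfun_mult (cfun_cnj f) f"

text \<open>Polarisation against the unit: the sum over k of i^k |f + i^k|^2 / 4. Thus absolute
  squares span C(X), and a linear functional is determined by its values on them.\<close>

lemma cfun_polarization:
  "f = cfun_scale (1/4) (cfun_abs_sq (f + const_bcontfun 1)) + cfun_scale (\<i>/4) (cfun_abs_sq (f + const_bcontfun \<i>))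
     + cfun_scale (-1/4) (cfun_abs_sq (f + const_bcontfun (-1))) + cfun_scale (-\<i>/4) (cfun_abs_sq (f + const_bcontfun (-\<i>)))"
  by (rule bcontfun_eqI) (simp add: complex_eq_iff field_simps)

text \<open>Links positivity of a state, which is stated for absolute squares, to pointwise
  nonnegativity.\<close>

lemma cfun_sqrt_ex:
  fixes f :: "'x::topological_space \<Rightarrow>\<^sub>C complex"
  assumes "\<And>x. Im (apply_bcontfun f x) = 0" "\<And>x. 0 \<le> Re (apply_bcontfun f x)"
  shows "\<exists>h. f = cfun_abs_sq h"
proof -
  let ?h = "\<lambda>x. complex_of_real (sqrt (Re (apply_bcontfun f x)))"
  have "norm (?h x) \<le> sqrt (norm f)" for x
    using complex_Re_le_cmod[of "apply_bcontfun f x"] norm_bounded[of f x] assms(2)[of x] by simp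
  moreover have "continuous_on UNIV ?h" by (intro continuous_intros) auto
  ultimately have h: "apply_bcontfun (Bcontfun ?h) x = ?h x" for x by (intro apply_Bcontfun) auto
  have "f = cfun_abs_sq (Bcontfun ?h)"
    by (rule bcontfun_eqI) (use assms in \<open>simp add: h complex_eq_iff\<close>)
  then show ?thesis ..
qed

section \<open>States\<close>

lemma
  assumes "state \<phi>"
  shows state_add: "\<phi> (f + g) = \<phi> f + \<phi> g" and state_scale: "\<phi> (cfun_scale c f) = c * \<phi> f"
    and state_abs_sq: "Im (\<phi> (cfun_abs_sq f)) = 0" "0 \<le> Re (\<phi> (cfun_abs_sq f))"
    and state_one: "\<phi> (const_bcontfun 1) = 1"
  using assms by (auto simp: state_def complex_is_Real_iff)

text \<open>Conjugation only swaps the coefficients i/4 and -i/4 in the polarisation formula, and a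
  state is real on absolute squares.\<close>

lemma state_cnj:
  assumes "state \<phi>" shows "\<phi> (cfun_cnj f) = cnj (\<phi> f)"
proof -
  let ?P = "\<lambda>c. cfun_abs_sq (f + const_bcontfun c)"
  have P: "cnj (\<phi> (?P c)) = \<phi> (?P c)" for c
    using state_abs_sq(1)[OF assms] by (simp add: complex_eq_iff)
  have "\<phi> f = 1/4 * \<phi> (?P 1) + \<i>/4 * \<phi> (?P \<i>) + -1/4 * \<phi> (?P (-1)) + -\<i>/4 * \<phi> (?P (-\<i>))"
    by (subst cfun_polarization) (simp only: state_add[OF assms] state_scale[OF assms])
  moreover have "cfun_cnj f = cfun_scale (1/4) (?P 1) + cfun_scale (-\<i>/4) (?P \<i>)
      + cfun_scale (-1/4) (?P (-1)) + cfun_scale (\<i>/4) (?P (-\<i>))"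
    by (rule bcontfun_eqI) (simp add: complex_eq_iff field_simps)
  then have "\<phi> (cfun_cnj f) = 1/4 * \<phi> (?P 1) + -\<i>/4 * \<phi> (?P \<i>) + -1/4 * \<phi> (?P (-1)) + \<i>/4 * \<phi> (?P (-\<i>))"
    by (simp only: state_add[OF assms] state_scale[OF assms])
  ultimately show ?thesis by (simp add: P)
qed

lemma state_eqI:
  assumes "state \<phi>" "state \<psi>" "\<And>f. \<phi> (cfun_abs_sq f) = \<psi> (cfun_abs_sq f)"
  shows "\<phi> = \<psi>"
proof
  fix f
  have "\<phi> f = \<psi> f"
    by (subst (1 2) cfun_polarization)
      (simp only: state_add[OF assms(1)] state_scale[OF assms(1)] state_add[OF assms(2)] state_scale[OF assms(2)] assms(3))
  then show "\<phi> f = \<psi> f" .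
qed

lemma state_pos:
  assumes "state \<phi>" "\<And>x. Im (apply_bcontfun f x) = 0" "\<And>x. 0 \<le> Re (apply_bcontfun f x)"
  shows "0 \<le> Re (\<phi> f)"
  using cfun_sqrt_ex[of f] assms(2,3) state_abs_sq[OF assms(1)] by auto

lemma state_minus: "state \<phi> \<Longrightarrow> \<phi> (f - g) = \<phi> f - \<phi> g"
  using state_add[of \<phi> "f - g" g] by simp

locale state_space =
  fixes \<phi> :: "('x::topological_space \<Rightarrow>\<^sub>C complex) \<Rightarrow> complex"
  assumes state: "state \<phi>"
begin

sublocale G: semi_inner_product cfun_scale "\<lambda>a b. \<phi> (cfun_mult (cfun_cnj b) a)"
proof
  fix x y z :: "'x \<Rightarrow>\<^sub>C complex" and c c' :: complex
  show "\<phi> (cfun_mult (cfun_cnj y) x) = cnj (\<phi> (cfun_mult (cfun_cnj x) y))"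
    using state_cnj[OF state, of "cfun_mult (cfun_cnj x) y"]
    by (simp add: cfun_cnj_mult cfun_mult_commute)
qed (simp_all add: cfun_scale_add cfun_scale_add_left cfun_scale_scale cfun_mult_add_right
    state_add[OF state] cfun_mult_scale_right state_scale[OF state] state_abs_sq[OF state])

lemma gns_dist_eq: "gns_dist \<phi> = G.dst"
  by (intro ext) (simp add: gns_dist_def)

lemma gns_space_eq: "gns_space \<phi> = G.HC"
  unfolding gns_space_def G.hilbert_completion_def gns_dist_eq ..

text \<open>The function ||a||^2 |b|^2 - |a b|^2 is nonnegative pointwise, so the state is
  nonnegative on it.\<close>

lemma q_mult_le: "G.q (cfun_mult a b) \<le> norm a * G.q b"
proof -
  let ?d = "cfun_scale (of_real ((norm a)\<^sup>2)) (cfun_abs_sq b) - cfun_abs_sq (cfun_mult a b)"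
  have "0 \<le> Re (\<phi> ?d)"
  proof (rule state_pos[OF state])
    fix x
    have *: "apply_bcontfun ?d x = of_real ((norm a)\<^sup>2 * (cmod (apply_bcontfun b x))\<^sup>2 -
        (cmod (apply_bcontfun a x))\<^sup>2 * (cmod (apply_bcontfun b x))\<^sup>2)"
      unfolding of_real_diff of_real_mult complex_norm_square by (simp add: mult_ac)
    have "(cmod (apply_bcontfun a x))\<^sup>2 * (cmod (apply_bcontfun b x))\<^sup>2 \<le> (norm a)\<^sup>2 * (cmod (apply_bcontfun b x))\<^sup>2"
      by (intro mult_right_mono power_mono norm_bounded) auto
    then show "0 \<le> Re (apply_bcontfun ?d x)" "Im (apply_bcontfun ?d x) = 0"
      unfolding * by (simp_all del: of_real_diff of_real_mult of_real_power)
  qed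
  then have "(G.q (cfun_mult a b))\<^sup>2 \<le> (norm a * G.q b)\<^sup>2"
    using state_abs_sq[OF state]
    by (simp add: G.q_def state_minus[OF state] state_scale[OF state] power_mult_distrib)
  then show ?thesis by (rule power2_le_imp_le) (simp add: G.q_nonneg)
qed

end

section \<open>The crossed product\<close>

text \<open>The coefficient function of the monomial \<open>a u\<^sub>s\<close>.\<close>

definition delta :: "'g \<Rightarrow> 'b::zero \<Rightarrow> 'g \<Rightarrow> 'b" where
  "delta s a = (\<lambda>r. if r = s then a else 0)"

lemma delta_simps [simp]: "delta s a s = a" "r \<noteq> s \<Longrightarrow> delta s a r = 0" "delta s 0 = 0"
  by (auto simp: delta_def zero_fun_def)

lemma delta_add: "delta s (a + b) = delta s a + delta s (b::'b::ab_group_add)"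
  by (auto simp: delta_def fun_eq_iff plus_fun_apply)

locale crossed_system =
  fixes \<Gamma> :: "('g, 'm) monoid_scheme" and act :: "'g \<Rightarrow> 'x::topological_space \<Rightarrow> 'x"
  assumes group: "Group.group \<Gamma>" and acts: "acts_by_homeomorphisms \<Gamma> act"
begin

sublocale Group.group \<Gamma> by (rule group)

abbreviation "\<alpha> \<equiv> translate \<Gamma> act"
abbreviation "A \<equiv> crossed_alg \<Gamma> act"
abbreviation "supp f \<equiv> {s. f s \<noteq> (0::'x \<Rightarrow>\<^sub>C complex)}"

lemma ga: "group_action \<Gamma> UNIV act"
  using acts by (simp add: acts_by_homeomorphisms_def)

lemma act_mult: "\<lbrakk>s \<in> carrier \<Gamma>; t \<in> carrier \<Gamma>\<rbrakk> \<Longrightarrow> act (s \<otimes>\<^bsub>\<Gamma>\<^esub> t) x = act s (act t x)"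
  by (rule group_action.composition_rule[OF ga]) auto

lemma act_one: "act \<one>\<^bsub>\<Gamma>\<^esub> x = x"
  using group_action.id_eq_one[OF ga] by (metis UNIV_I restrict_apply)

lemma act_cont: "s \<in> carrier \<Gamma> \<Longrightarrow> continuous_on UNIV (act s)"
  using acts by (auto simp: acts_by_homeomorphisms_def homeomorphism_def)

lemma apply_translate [simp]:
  "s \<in> carrier \<Gamma> \<Longrightarrow> apply_bcontfun (\<alpha> s f) x = apply_bcontfun f (act (inv\<^bsub>\<Gamma>\<^esub> s) x)"
  unfolding translate_def
  by (rule apply_Bcontfun[where b="norm f"])
    (auto intro!: continuous_on_compose2[OF continuous_on_apply_bcontfun act_cont] norm_bounded)

context
  fixes s assumes s [simp]: "s \<in> carrier \<Gamma>"
begin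

lemma translate_add: "\<alpha> s (f + g) = \<alpha> s f + \<alpha> s g"
  and translate_minus: "\<alpha> s (f - g) = \<alpha> s f - \<alpha> s g"
  and translate_mult: "\<alpha> s (cfun_mult f g) = cfun_mult (\<alpha> s f) (\<alpha> s g)"
  and translate_cnj: "\<alpha> s (cfun_cnj f) = cfun_cnj (\<alpha> s f)"
  and translate_scale: "\<alpha> s (cfun_scale c f) = cfun_scale c (\<alpha> s f)"
  and translate_const [simp]: "\<alpha> s (const_bcontfun c) = const_bcontfun c"
  and translate_zero [simp]: "\<alpha> s 0 = 0"
  by (rule bcontfun_eqI, simp)+

lemma translate_translate: "t \<in> carrier \<Gamma> \<Longrightarrow> \<alpha> s (\<alpha> t f) = \<alpha> (s \<otimes>\<^bsub>\<Gamma>\<^esub> t) f"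
  by (rule bcontfun_eqI) (simp add: inv_mult_group act_mult)

end

lemma translate_one [simp]: "\<alpha> \<one>\<^bsub>\<Gamma>\<^esub> f = f"
  by (rule bcontfun_eqI) (simp add: act_one)

lemma A_carrier: "carrier A = {f. finite (supp f) \<and> supp f \<subseteq> carrier \<Gamma>}"
  by (simp add: crossed_alg_def)

lemma A_add: "f \<oplus>\<^bsub>A\<^esub> g = f + g"
  by (simp add: crossed_alg_def plus_fun_def)

lemma A_zero: "\<zero>\<^bsub>A\<^esub> = 0"
  by (simp add: crossed_alg_def zero_fun_def)

lemma A_one: "\<one>\<^bsub>A\<^esub> = delta \<one>\<^bsub>\<Gamma>\<^esub> (const_bcontfun 1)"
  by (simp add: crossed_alg_def delta_def)

lemma A_smult: "(c \<odot>\<^bsub>A\<^esub> f) r = cfun_scale c (f r)"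
  by (simp add: crossed_alg_def)

lemma A_star: "star A f r = (if r \<in> carrier \<Gamma> then \<alpha> r (cfun_cnj (f (inv\<^bsub>\<Gamma>\<^esub> r))) else 0)"
  by (simp add: crossed_alg_def)

text \<open>Allows the convolution to be summed over any finite set containing the support, so that
  two factors can share one index set.\<close>

lemma A_mult:
  assumes "finite S" "supp f \<subseteq> S"
  shows "(f \<otimes>\<^bsub>A\<^esub> g) r = (if r \<in> carrier \<Gamma> then \<Sum>s\<in>S. cfun_mult (f s) (\<alpha> s (g (inv\<^bsub>\<Gamma>\<^esub> s \<otimes>\<^bsub>\<Gamma>\<^esub> r))) else 0)"
proof -
  have "(\<Sum>s\<in>supp f. cfun_mult (f s) (\<alpha> s (g (inv\<^bsub>\<Gamma>\<^esub> s \<otimes>\<^bsub>\<Gamma>\<^esub> r)))) =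
      (\<Sum>s\<in>S. cfun_mult (f s) (\<alpha> s (g (inv\<^bsub>\<Gamma>\<^esub> s \<otimes>\<^bsub>\<Gamma>\<^esub> r))))"
    by (rule sum.mono_neutral_left[OF assms]) auto
  then show ?thesis by (simp add: crossed_alg_def)
qed

lemma A_outside: "f \<in> carrier A \<Longrightarrow> r \<notin> carrier \<Gamma> \<Longrightarrow> f r = 0"
  by (auto simp: A_carrier)

lemma A_carrierI: "finite S \<Longrightarrow> S \<subseteq> carrier \<Gamma> \<Longrightarrow> (\<And>r. r \<notin> S \<Longrightarrow> f r = 0) \<Longrightarrow> f \<in> carrier A"
  unfolding A_carrier by (auto intro: finite_subset)

lemma A_carrierD: "f \<in> carrier A \<Longrightarrow> finite (supp f)" "f \<in> carrier A \<Longrightarrow> supp f \<subseteq> carrier \<Gamma>"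
  by (auto simp: A_carrier)

lemma delta_carrier [simp]: "s \<in> carrier \<Gamma> \<Longrightarrow> delta s a \<in> carrier A"
  by (rule A_carrierI[of "{s}"]) auto

lemma zero_carrier: "0 \<in> carrier A"
  by (rule A_carrierI[of "{}"]) (auto simp: zero_fun_apply)

lemma add_carrier: "f \<in> carrier A \<Longrightarrow> g \<in> carrier A \<Longrightarrow> f + g \<in> carrier A"
  by (rule A_carrierI[of "supp f \<union> supp g"]) (auto dest: A_carrierD simp: plus_fun_apply)

lemma smult_carrier: "f \<in> carrier A \<Longrightarrow> c \<odot>\<^bsub>A\<^esub> f \<in> carrier A"
  by (rule A_carrierI[of "supp f"]) (auto dest: A_carrierD simp: A_smult)

lemma A_mult_delta:
  assumes s: "s \<in> carrier \<Gamma>"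
  shows "(delta s a \<otimes>\<^bsub>A\<^esub> g) r = (if r \<in> carrier \<Gamma> then cfun_mult a (\<alpha> s (g (inv\<^bsub>\<Gamma>\<^esub> s \<otimes>\<^bsub>\<Gamma>\<^esub> r))) else 0)"
  by (subst A_mult[of "{s}"]) (auto simp: delta_def)

lemma delta_mult_delta:
  assumes s: "s \<in> carrier \<Gamma>" and t: "t \<in> carrier \<Gamma>"
  shows "delta s a \<otimes>\<^bsub>A\<^esub> delta t b = delta (s \<otimes>\<^bsub>\<Gamma>\<^esub> t) (cfun_mult a (\<alpha> s b))"
proof
  fix r
  have "inv\<^bsub>\<Gamma>\<^esub> s \<otimes>\<^bsub>\<Gamma>\<^esub> r = t \<longleftrightarrow> r = s \<otimes>\<^bsub>\<Gamma>\<^esub> t" if "r \<in> carrier \<Gamma>"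
    using s t that by (metis inv_solve_left)
  then show "(delta s a \<otimes>\<^bsub>A\<^esub> delta t b) r = delta (s \<otimes>\<^bsub>\<Gamma>\<^esub> t) (cfun_mult a (\<alpha> s b)) r"
    using s t unfolding A_mult_delta[OF s] by (auto simp: delta_def)
qed

lemma star_delta:
  assumes s: "s \<in> carrier \<Gamma>"
  shows "star A (delta s a) = delta (inv\<^bsub>\<Gamma>\<^esub> s) (\<alpha> (inv\<^bsub>\<Gamma>\<^esub> s) (cfun_cnj a))"
proof
  fix r
  have "inv\<^bsub>\<Gamma>\<^esub> r = s \<longleftrightarrow> r = inv\<^bsub>\<Gamma>\<^esub> s" if "r \<in> carrier \<Gamma>" using s that by auto
  then show "star A (delta s a) r = delta (inv\<^bsub>\<Gamma>\<^esub> s) (\<alpha> (inv\<^bsub>\<Gamma>\<^esub> s) (cfun_cnj a)) r"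
    using s by (auto simp: A_star delta_def)
qed

lemma smult_delta: "c \<odot>\<^bsub>A\<^esub> delta s a = delta s (cfun_scale c a)"
  by (rule ext) (auto simp: A_smult delta_def)

lemma A_smult_zero [simp]: "c \<odot>\<^bsub>A\<^esub> 0 = 0"
  by (rule ext) (simp add: A_smult zero_fun_apply)

text \<open>Removing one coefficient at a time writes each element as a finite sum of monomials;
  additive identities then only need checking on a single \<open>delta s a\<close>.\<close>

lemma A_induct [consumes 1, case_names zero add]:
  assumes f: "f \<in> carrier A" and 0: "P 0"
    and step: "\<And>s a f. s \<in> carrier \<Gamma> \<Longrightarrow> f \<in> carrier A \<Longrightarrow> P f \<Longrightarrow> P (delta s a + f)"
  shows "P f"
proof -
  have "P f" if "finite S" "S \<subseteq> carrier \<Gamma>" "\<And>r. r \<notin> S \<Longrightarrow> f r = 0" for S f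
    using that
  proof (induction S arbitrary: f rule: finite_induct)
    case empty
    then have "f = 0" by (simp add: fun_eq_iff zero_fun_apply)
    then show ?case using 0 by simp
  next
    case (insert s S)
    let ?g = "f(s := 0)"
    have "?g \<in> carrier A" by (rule A_carrierI[of S]) (use insert in auto)
    moreover have "P ?g" by (rule insert.IH) (use insert.prems in auto)
    ultimately have "P (delta s (f s) + ?g)" using insert.prems by (intro step) auto
    moreover have "delta s (f s) + ?g = f" by (auto simp: delta_def fun_eq_iff plus_fun_apply)
    ultimately show ?case by simp
  qed
  from this[OF A_carrierD[OF f]] show ?thesis by blast
qed

lemma mult_carrier:
  assumes f: "f \<in> carrier A" and g: "g \<in> carrier A" shows "f \<otimes>\<^bsub>A\<^esub> g \<in> carrier A"
proof (rule A_carrierI)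
  let ?S = "(\<lambda>(s, t). s \<otimes>\<^bsub>\<Gamma>\<^esub> t) ` (supp f \<times> supp g)"
  show "finite ?S" using A_carrierD[OF f] A_carrierD[OF g] by simp
  show "?S \<subseteq> carrier \<Gamma>" using A_carrierD[OF f] A_carrierD[OF g] by auto
  fix r assume r: "r \<notin> ?S"
  have "cfun_mult (f s) (\<alpha> s (g (inv\<^bsub>\<Gamma>\<^esub> s \<otimes>\<^bsub>\<Gamma>\<^esub> r))) = 0" if s: "s \<in> supp f" and rc: "r \<in> carrier \<Gamma>" for s
  proof -
    have sc: "s \<in> carrier \<Gamma>" using s A_carrierD[OF f] by auto
    have "s \<otimes>\<^bsub>\<Gamma>\<^esub> (inv\<^bsub>\<Gamma>\<^esub> s \<otimes>\<^bsub>\<Gamma>\<^esub> r) = r" using sc rc by (simp add: m_assoc[symmetric])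
    then have "g (inv\<^bsub>\<Gamma>\<^esub> s \<otimes>\<^bsub>\<Gamma>\<^esub> r) = 0"
      using r s imageI[of "(s, inv\<^bsub>\<Gamma>\<^esub> s \<otimes>\<^bsub>\<Gamma>\<^esub> r)" "supp f \<times> supp g" "\<lambda>(s, t). s \<otimes>\<^bsub>\<Gamma>\<^esub> t"] by auto
    then show ?thesis using sc by simp
  qed
  then show "(f \<otimes>\<^bsub>A\<^esub> g) r = 0" by (simp add: A_mult[OF A_carrierD(1)[OF f] order_refl])
qed

lemma star_carrier:
  assumes f: "f \<in> carrier A" shows "star A f \<in> carrier A"
proof (rule A_carrierI)
  show "finite ((\<lambda>s. inv\<^bsub>\<Gamma>\<^esub> s) ` supp f)" "(\<lambda>s. inv\<^bsub>\<Gamma>\<^esub> s) ` supp f \<subseteq> carrier \<Gamma>" using A_carrierD[OF f] by auto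
  fix r assume r: "r \<notin> (\<lambda>s. inv\<^bsub>\<Gamma>\<^esub> s) ` supp f"
  show "star A f r = 0"
  proof (cases "r \<in> carrier \<Gamma>")
    case True
    then have "inv\<^bsub>\<Gamma>\<^esub> (inv\<^bsub>\<Gamma>\<^esub> r) = r" by simp
    then have "f (inv\<^bsub>\<Gamma>\<^esub> r) = 0" using r by (metis (mono_tags, lifting) imageI mem_Collect_eq)
    then show ?thesis using True by (simp add: A_star)
  qed (simp add: A_star)
qed

lemma A_mult_add_left:
  assumes f: "f \<in> carrier A" and f': "f' \<in> carrier A"
  shows "(f + f') \<otimes>\<^bsub>A\<^esub> g = f \<otimes>\<^bsub>A\<^esub> g + f' \<otimes>\<^bsub>A\<^esub> g"
proof
  fix r
  let ?S = "supp f \<union> supp f'"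
  have fin: "finite ?S" using A_carrierD[OF f] A_carrierD[OF f'] by simp
  have sub: "supp (f + f') \<subseteq> ?S" by (auto simp: plus_fun_apply)
  show "((f + f') \<otimes>\<^bsub>A\<^esub> g) r = (f \<otimes>\<^bsub>A\<^esub> g + f' \<otimes>\<^bsub>A\<^esub> g) r"
    unfolding plus_fun_apply[of "f \<otimes>\<^bsub>A\<^esub> g"] A_mult[where f=f, OF fin Un_upper1] A_mult[where f=f', OF fin Un_upper2]
      A_mult[where f="f + f'", OF fin sub]
    by (simp add: cfun_mult_add_left sum.distrib plus_fun_apply)
qed

lemma A_mult_add_right:
  assumes h: "h \<in> carrier A"
  shows "h \<otimes>\<^bsub>A\<^esub> (f + g) = h \<otimes>\<^bsub>A\<^esub> f + h \<otimes>\<^bsub>A\<^esub> g"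
proof
  fix r
  note S = A_carrierD(1)[OF h]
  have "cfun_mult (h s) (\<alpha> s ((f + g) t)) = cfun_mult (h s) (\<alpha> s (f t)) + cfun_mult (h s) (\<alpha> s (g t))"
    if "s \<in> supp h" for s t
    using that A_carrierD(2)[OF h] by (auto simp: translate_add cfun_mult_add_right plus_fun_apply)
  then show "(h \<otimes>\<^bsub>A\<^esub> (f + g)) r = (h \<otimes>\<^bsub>A\<^esub> f + h \<otimes>\<^bsub>A\<^esub> g) r"
    by (simp add: A_mult[OF S order_refl] sum.distrib plus_fun_apply)
qed

lemma A_mult_zero [simp]: "0 \<otimes>\<^bsub>A\<^esub> g = 0" "f \<in> carrier A \<Longrightarrow> f \<otimes>\<^bsub>A\<^esub> 0 = 0"
  using A_mult_add_left[OF zero_carrier zero_carrier, of g] A_mult_add_right[of f 0 0] by auto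

text \<open>The C*-identity moves the question to the neutral element: the square of p(a
  \<open>u\<^sub>s\<close>) is p of a translate of |a|^2, a real function. If such a function f has
  values in [-1, 1], it is the mean of the unitaries f + i sqrt(1 - f^2) and f - i sqrt(1 - f^2),
  and p is at most 1 on unitaries.\<close>

lemma delta_seminorm_le:
  assumes p: "cstar_seminorm A p" and s: "s \<in> carrier \<Gamma>"
  shows "p (delta s a) \<le> norm a"
proof -
  have p_add: "p (f + g) \<le> p f + p g" if "f \<in> carrier A" "g \<in> carrier A" for f g
    using p that by (simp add: cstar_seminorm_def A_add)
  have p_smult: "p (c \<odot>\<^bsub>A\<^esub> f) = cmod c * p f" if "f \<in> carrier A" for f c
    using p that by (simp add: cstar_seminorm_def)
  have p_star: "p (star A f \<otimes>\<^bsub>A\<^esub> f) = (p f)\<^sup>2" if "f \<in> carrier A" for f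
    using p that by (simp add: cstar_seminorm_def)
  have sq: "(p (delta s a))\<^sup>2 = p (delta \<one>\<^bsub>\<Gamma>\<^esub> (\<alpha> (inv\<^bsub>\<Gamma>\<^esub> s) (cfun_abs_sq a)))" if "s \<in> carrier \<Gamma>" for s a
    using p_star[of "delta s a"] that by (simp add: star_delta delta_mult_delta translate_mult)
  let ?one = "const_bcontfun 1 :: 'x \<Rightarrow>\<^sub>C complex"
  have "(p (delta \<one>\<^bsub>\<Gamma>\<^esub> ?one))\<^sup>2 = p (delta \<one>\<^bsub>\<Gamma>\<^esub> ?one)" using sq[of "\<one>\<^bsub>\<Gamma>\<^esub>" ?one] by simp
  \<comment> \<open>From p(1)^2 = p(1) the value is 0 or 1; a C*-seminorm may vanish on the
    unit.\<close>
  then have one: "p (delta \<one>\<^bsub>\<Gamma>\<^esub> ?one) \<le> 1" by (auto simp: power2_eq_square)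
  have unit: "p (delta \<one>\<^bsub>\<Gamma>\<^esub> v) \<le> 1" if "cfun_abs_sq v = ?one" for v
  proof -
    have "(p (delta \<one>\<^bsub>\<Gamma>\<^esub> v))\<^sup>2 \<le> 1\<^sup>2" using sq[of "\<one>\<^bsub>\<Gamma>\<^esub>" v] that one by simp
    then show ?thesis by (rule power2_le_imp_le) simp
  qed
  have real_le: "p (delta \<one>\<^bsub>\<Gamma>\<^esub> f) \<le> 1"
    if f: "\<And>x. Im (apply_bcontfun f x) = 0" "\<And>x. \<bar>Re (apply_bcontfun f x)\<bar> \<le> 1" for f
  proof -
    \<comment> \<open>The point of the unit circle above Re f.\<close>
    let ?v = "\<lambda>x. Complex (Re (apply_bcontfun f x)) (sqrt (1 - (Re (apply_bcontfun f x))\<^sup>2))"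
    have pos: "0 \<le> 1 - (Re (apply_bcontfun f x))\<^sup>2" for x
      using f(2)[of x] by (simp add: abs_square_le_1)
    have "continuous_on UNIV ?v" unfolding Complex_eq by (intro continuous_intros) auto
    moreover have "norm (?v x) \<le> 1" for x using pos by (simp add: cmod_def)
    ultimately have v: "apply_bcontfun (Bcontfun ?v) x = ?v x" for x by (rule apply_Bcontfun)
    have v1: "cfun_abs_sq (Bcontfun ?v) = ?one"
    proof (rule bcontfun_eqI)
      fix x
      have "cnj (?v x) * ?v x = of_real ((cmod (?v x))\<^sup>2)"
        unfolding complex_norm_square by (rule mult.commute)
      also have "(cmod (?v x))\<^sup>2 = 1" using pos[of x] by (simp add: cmod_def)
      finally show "apply_bcontfun (cfun_abs_sq (Bcontfun ?v)) x = apply_bcontfun ?one x"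
        by (simp only: apply_cfun_mult apply_cfun_cnj v const_bcontfun.rep_eq of_real_1)
    qed
    then have v2: "cfun_abs_sq (cfun_cnj (Bcontfun ?v)) = ?one"
      by (simp add: cfun_mult_commute)
    have "f = cfun_scale (1/2) (Bcontfun ?v + cfun_cnj (Bcontfun ?v))"
      by (rule bcontfun_eqI) (use f in \<open>simp add: v complex_eq_iff\<close>)
    then have "delta \<one>\<^bsub>\<Gamma>\<^esub> f = (1/2) \<odot>\<^bsub>A\<^esub> (delta \<one>\<^bsub>\<Gamma>\<^esub> (Bcontfun ?v) + delta \<one>\<^bsub>\<Gamma>\<^esub> (cfun_cnj (Bcontfun ?v)))"
      by (simp add: smult_delta flip: delta_add)
    then have "p (delta \<one>\<^bsub>\<Gamma>\<^esub> f) = 1/2 * p (delta \<one>\<^bsub>\<Gamma>\<^esub> (Bcontfun ?v) + delta \<one>\<^bsub>\<Gamma>\<^esub> (cfun_cnj (Bcontfun ?v)))"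
      by (simp add: p_smult add_carrier)
    also have "\<dots> \<le> 1/2 * (1 + 1)"
      using p_add[of "delta \<one>\<^bsub>\<Gamma>\<^esub> (Bcontfun ?v)" "delta \<one>\<^bsub>\<Gamma>\<^esub> (cfun_cnj (Bcontfun ?v))"] unit[OF v1] unit[OF v2] by simp
    finally show ?thesis by simp
  qed
  \<comment> \<open>For ||b|| \<le> 1 the translate of |b|^2 takes values in [0, 1], so
    \<open>real_le\<close> applies to it.\<close>
  have contr: "p (delta s b) \<le> 1" if b: "norm b \<le> 1" for b
  proof -
    have bx: "cmod (apply_bcontfun b x) \<le> 1" for x using norm_bounded[of b x] b by simp
    have bb: "apply_bcontfun (cfun_abs_sq b) x = of_real ((cmod (apply_bcontfun b x))\<^sup>2)" for x
      unfolding complex_norm_square by (simp add: mult.commute)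
    have "(p (delta s b))\<^sup>2 \<le> 1"
      unfolding sq[OF s]
    proof (rule real_le)
      fix x
      let ?y = "act (inv\<^bsub>\<Gamma>\<^esub> (inv\<^bsub>\<Gamma>\<^esub> s)) x"
      have "apply_bcontfun (\<alpha> (inv\<^bsub>\<Gamma>\<^esub> s) (cfun_abs_sq b)) x = of_real ((cmod (apply_bcontfun b ?y))\<^sup>2)"
        using s by (simp only: apply_translate inv_closed bb)
      moreover have "(cmod (apply_bcontfun b ?y))\<^sup>2 \<le> 1" using bx[of ?y] by (simp add: power_le_one)
      ultimately show "Im (apply_bcontfun (\<alpha> (inv\<^bsub>\<Gamma>\<^esub> s) (cfun_abs_sq b)) x) = 0"
        "\<bar>Re (apply_bcontfun (\<alpha> (inv\<^bsub>\<Gamma>\<^esub> s) (cfun_abs_sq b)) x)\<bar> \<le> 1"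
        by (simp_all only: Im_complex_of_real Re_complex_of_real) auto
    qed
    then have "(p (delta s b))\<^sup>2 \<le> 1\<^sup>2" by simp
    then show ?thesis by (rule power2_le_imp_le) simp
  qed
  show ?thesis
  proof (cases "a = 0")
    case True
    have "p (0 \<odot>\<^bsub>A\<^esub> delta s a) = 0" using p_smult[of "delta s a" 0] s by simp
    then show ?thesis using True by (simp add: smult_delta)
  next
    case False
    let ?b = "a /\<^sub>R norm a"
    have "delta s a = of_real (norm a) \<odot>\<^bsub>A\<^esub> delta s ?b"
    proof -
      have "cfun_scale (of_real (norm a)) ?b = a"
        by (rule bcontfun_eqI) (use False in \<open>simp add: scaleR_conv_of_real\<close>)
      then show ?thesis by (simp only: smult_delta)
    qed
    then have "p (delta s a) = norm a * p (delta s ?b)" using s by (simp add: p_smult)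
    also have "\<dots> \<le> norm a * 1" using False by (intro mult_left_mono contr) auto
    finally show ?thesis by simp
  qed
qed

sublocale pre_cstar A
proof
  fix f g h :: "'g \<Rightarrow> 'x \<Rightarrow>\<^sub>C complex" and c c' :: complex
  show "f \<oplus>\<^bsub>A\<^esub> g = f + g" by (rule A_add)
  show "\<zero>\<^bsub>A\<^esub> = 0" by (rule A_zero)
  show "0 \<in> carrier A" by (rule zero_carrier)
  show "\<one>\<^bsub>A\<^esub> \<in> carrier A" by (simp add: A_one)
  show "star A \<one>\<^bsub>A\<^esub> = \<one>\<^bsub>A\<^esub>" by (simp add: A_one star_delta)
  assume f: "f \<in> carrier A"
  show "- f \<in> carrier A" by (rule A_carrierI[of "supp f"]) (use A_carrierD[OF f] in auto)
  show "c \<odot>\<^bsub>A\<^esub> f \<in> carrier A" by (rule smult_carrier[OF f])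
  show "star A f \<in> carrier A" by (rule star_carrier[OF f])
  show "(c + c') \<odot>\<^bsub>A\<^esub> f = c \<odot>\<^bsub>A\<^esub> f + c' \<odot>\<^bsub>A\<^esub> f" by (rule ext) (simp add: A_smult cfun_scale_add_left plus_fun_apply)
  show "1 \<odot>\<^bsub>A\<^esub> f = f" by (rule ext) (simp add: A_smult)
  show "f \<otimes>\<^bsub>A\<^esub> \<one>\<^bsub>A\<^esub> = f"
    using f by (induction f rule: A_induct) (simp_all add: A_one A_mult_add_left delta_mult_delta)
  show "star A (star A f) = f"
    by (rule ext) (simp add: A_star A_outside[OF f] translate_cnj translate_translate)
  \<comment> \<open>The bound accumulated by the induction is a sum of sup norms of coefficients,
    the same for every p.\<close>
  show "\<exists>K. \<forall>p. cstar_seminorm A p \<longrightarrow> p f \<le> K"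
    using f
  proof (induction f rule: A_induct)
    case zero
    have "p 0 \<le> 0" if "cstar_seminorm A p" for p
      using delta_seminorm_le[OF that one_closed, of 0] by simp
    then show ?case by blast
  next
    case (add s a f)
    then obtain K where K: "\<And>p. cstar_seminorm A p \<Longrightarrow> p f \<le> K" by blast
    have "p (delta s a + f) \<le> norm a + K" if p: "cstar_seminorm A p" for p
    proof -
      have "p (delta s a + f) \<le> p (delta s a) + p f"
        using p add.hyps by (simp add: cstar_seminorm_def A_add)
      then show ?thesis using delta_seminorm_le[OF p add.hyps(1), of a] K[OF p] by simp
    qed
    then show ?case by blast
  qed
  assume g: "g \<in> carrier A"
  show "f + g \<in> carrier A" by (rule add_carrier[OF f g])
  show "f \<otimes>\<^bsub>A\<^esub> g \<in> carrier A" by (rule mult_carrier[OF f g])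
  show "c \<odot>\<^bsub>A\<^esub> (f + g) = c \<odot>\<^bsub>A\<^esub> f + c \<odot>\<^bsub>A\<^esub> g" by (rule ext) (simp add: A_smult cfun_scale_add plus_fun_apply)
  show "star A (f + g) = star A f + star A g"
    by (rule ext) (simp add: A_star cfun_cnj_add translate_add plus_fun_apply)
  show "h \<in> carrier A \<Longrightarrow> (f + g) \<otimes>\<^bsub>A\<^esub> h = f \<otimes>\<^bsub>A\<^esub> h + g \<otimes>\<^bsub>A\<^esub> h" by (rule A_mult_add_left[OF f g])
  show "h \<in> carrier A \<Longrightarrow> h \<otimes>\<^bsub>A\<^esub> (f + g) = h \<otimes>\<^bsub>A\<^esub> f + h \<otimes>\<^bsub>A\<^esub> g" by (rule A_mult_add_right)
qed

text \<open>The covariant action of C_c(\<Gamma>, A) on A itself, with functions multiplying and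
  group elements translating. It is \<open>\<rho>\<^sub>\<phi>\<close> before completion and does
  not mention \<phi>; at b = 1 it gives the sum of the coefficients.\<close>

definition capply :: "('g \<Rightarrow> 'x \<Rightarrow>\<^sub>C complex) \<Rightarrow> ('x \<Rightarrow>\<^sub>C complex) \<Rightarrow> ('x \<Rightarrow>\<^sub>C complex)" where
  "capply f b = (\<Sum>s\<in>supp f. cfun_mult (f s) (\<alpha> s b))"

lemma capply_eq: "finite S \<Longrightarrow> supp f \<subseteq> S \<Longrightarrow> capply f b = (\<Sum>s\<in>S. cfun_mult (f s) (\<alpha> s b))"
  unfolding capply_def by (rule sum.mono_neutral_left) auto

lemma capply_zero [simp]: "capply 0 b = 0"
  by (simp add: capply_def zero_fun_apply)

lemma capply_delta [simp]: "capply (delta s a) b = cfun_mult a (\<alpha> s b)"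
  by (subst capply_eq[of "{s}"]) (auto simp: delta_def)

lemma capply_add_left:
  assumes f: "f \<in> carrier A" and g: "g \<in> carrier A"
  shows "capply (f + g) b = capply f b + capply g b"
proof -
  let ?S = "supp f \<union> supp g"
  have fin: "finite ?S" using A_carrierD[OF f] A_carrierD[OF g] by simp
  have sub: "supp (f + g) \<subseteq> ?S" by (auto simp: plus_fun_apply)
  show ?thesis
    unfolding capply_eq[OF fin Un_upper1] capply_eq[OF fin Un_upper2] capply_eq[OF fin sub]
    by (simp add: cfun_mult_add_left sum.distrib plus_fun_apply)
qed

lemma capply_smult: "f \<in> carrier A \<Longrightarrow> capply (c \<odot>\<^bsub>A\<^esub> f) b = cfun_scale c (capply f b)"
  by (induction f rule: A_induct)
    (simp_all add: smult_add_right capply_add_left smult_delta cfun_mult_scale_left cfun_scale_add)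


lemma capply_add_right: "f \<in> carrier A \<Longrightarrow> capply f (b + c) = capply f b + capply f c"
  by (induction f rule: A_induct) (simp_all add: capply_add_left translate_add cfun_mult_add_right)

lemma capply_minus_right: "f \<in> carrier A \<Longrightarrow> capply f (b - c) = capply f b - capply f c"
  using capply_add_right[of f "b - c" c] by simp

lemma capply_scale_right: "f \<in> carrier A \<Longrightarrow> capply f (cfun_scale c b) = cfun_scale c (capply f b)"
  by (induction f rule: A_induct)
    (simp_all add: capply_add_left translate_scale cfun_mult_scale_right cfun_scale_add)

lemma capply_mult:
  assumes f: "f \<in> carrier A" and g: "g \<in> carrier A"
  shows "capply (f \<otimes>\<^bsub>A\<^esub> g) b = capply f (capply g b)"
  using f
proof (induction f rule: A_induct)
  case (add s a f)
  have "capply (delta s a \<otimes>\<^bsub>A\<^esub> g) b = capply (delta s a) (capply g b)"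
    using g
  proof (induction g rule: A_induct)
    case (add t c g)
    then show ?case using \<open>s \<in> carrier \<Gamma>\<close>
      by (simp add: mult_add_right capply_add_left delta_mult_delta translate_add translate_mult
          translate_translate cfun_mult_add_right cfun_mult_assoc)
  qed (use add in simp)
  then show ?case using add g by (simp add: mult_add_left capply_add_left)
qed simp

end

text \<open>Used to pass to the extensional version of a representation that the description of
  \<open>koopman_rep\<close> asks for.\<close>

lemma representation_cong:
  assumes B: "\<And>x y. x \<in> carrier B \<Longrightarrow> y \<in> carrier B \<Longrightarrow> x \<oplus>\<^bsub>B\<^esub> y \<in> carrier B"
    "\<And>x c. x \<in> carrier B \<Longrightarrow> c \<odot>\<^bsub>B\<^esub> x \<in> carrier B"
    "\<And>x y. x \<in> carrier B \<Longrightarrow> y \<in> carrier B \<Longrightarrow> x \<otimes>\<^bsub>B\<^esub> y \<in> carrier B"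
    "\<And>x. x \<in> carrier B \<Longrightarrow> star B x \<in> carrier B"
    and H: "hilbert_space H" and rep: "representation B H \<pi>"
    and eq: "\<And>x \<xi>. x \<in> carrier B \<Longrightarrow> \<xi> \<in> carrier H \<Longrightarrow> \<rho> x \<xi> = \<pi> x \<xi>"
  shows "representation B H \<rho>"
proof -
  interpret H: hilbert_space H by (rule H)
  note D = representationD[OF rep]
  show ?thesis
    unfolding representation_def
  proof (intro conjI ballI allI)
    fix x assume x: "x \<in> carrier B"
    note L = H.linear_mapD[OF H.bounded_operatorD(1)[OF D(1)[OF x]]]
    have "linear_map H H (\<rho> x)"
      unfolding linear_map_def using L by (auto simp: eq[OF x])
    moreover obtain K where "\<forall>\<xi>\<in>carrier H. hnorm H (\<pi> x \<xi>) \<le> K * hnorm H \<xi>"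
      using H.bounded_operatorD(2)[OF D(1)[OF x]] by blast
    ultimately show "bounded_operator H (\<rho> x)"
      unfolding bounded_operator_def by (auto simp: eq[OF x])
    fix \<xi> c assume \<xi>: "\<xi> \<in> carrier H"
    show "\<rho> (c \<odot>\<^bsub>B\<^esub> x) \<xi> = c \<odot>\<^bsub>H\<^esub> \<rho> x \<xi>" using D(3)[OF x \<xi>] B(2)[OF x] x \<xi> by (simp add: eq)
    fix \<eta> assume \<eta>: "\<eta> \<in> carrier H"
    show "hinner H (\<rho> x \<xi>) \<eta> = hinner H \<xi> (\<rho> (star B x) \<eta>)"
      using D(5)[OF x \<xi> \<eta>] B(4)[OF x] x \<xi> \<eta> by (simp add: eq)
  next
    fix x y \<xi> assume x: "x \<in> carrier B" and y: "y \<in> carrier B" and \<xi>: "\<xi> \<in> carrier H"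
    show "\<rho> (x \<oplus>\<^bsub>B\<^esub> y) \<xi> = \<rho> x \<xi> \<oplus>\<^bsub>H\<^esub> \<rho> y \<xi>" using D(2)[OF x y \<xi>] B(1)[OF x y] x y \<xi> by (simp add: eq)
    show "\<rho> (x \<otimes>\<^bsub>B\<^esub> y) \<xi> = \<rho> x (\<rho> y \<xi>)" using D(4)[OF x y \<xi>] B(3)[OF x y] D(6)[OF y \<xi>] x y \<xi> by (simp add: eq)
  qed
qed

section \<open>The Koopman representation of an invariant state\<close>

locale invariant_state = crossed_system \<Gamma> act + state_space \<phi>
  for \<Gamma> :: "('g, 'm) monoid_scheme" and act :: "'g \<Rightarrow> 'x::topological_space \<Rightarrow> 'x" and \<phi> :: "('x \<Rightarrow>\<^sub>C complex) \<Rightarrow> complex" +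
  assumes invariant: "s \<in> carrier \<Gamma> \<Longrightarrow> \<phi> (translate \<Gamma> act s a) = \<phi> a"
begin

abbreviation "K \<equiv> gns_space \<phi>"

lemma hilbert_K: "hilbert_space K"
  unfolding gns_space_eq by (rule G.HC.hilbert_space_axioms)

sublocale K: hilbert_space K by (rule hilbert_K)

lemma q_translate: "s \<in> carrier \<Gamma> \<Longrightarrow> G.q (\<alpha> s b) = G.q b"
  using invariant[of s "cfun_abs_sq b"] by (simp add: G.q_def translate_mult translate_cnj)

text \<open>By invariance translation preserves the L^2 seminorm, so a monomial
  \<open>a u\<^sub>s\<close> is bounded by ||a||. Any finite constant suffices to extend the
  operator to the completion.\<close>

lemma q_capply: "f \<in> carrier A \<Longrightarrow> \<exists>C\<ge>0. \<forall>b. G.q (capply f b) \<le> C * G.q b"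
proof (induction f rule: A_induct)
  case zero
  then show ?case by (intro exI[of _ 0]) simp
next
  case (add s a f)
  then obtain C where C: "C \<ge> 0" "\<And>b. G.q (capply f b) \<le> C * G.q b" by blast
  have "G.q (capply (delta s a + f) b) \<le> (norm a + C) * G.q b" for b
  proof -
    have "G.q (capply (delta s a + f) b) \<le> G.q (cfun_mult a (\<alpha> s b)) + G.q (capply f b)"
      using add G.q_triangle_ineq by (simp add: capply_add_left)
    also have "\<dots> \<le> norm a * G.q b + C * G.q b"
      using q_mult_le[of a "\<alpha> s b"] C(2)[of b] add(1) by (simp add: q_translate)
    finally show ?thesis by (simp add: algebra_simps)
  qed
  then show ?case using C(1) by (intro exI[of _ "norm a + C"]) auto
qed

text \<open>On a monomial this is the invariance of \<phi> under the inverse of s, which moves the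
  translation from one side of the inner product to the other.\<close>

lemma inner_capply:
  "f \<in> carrier A \<Longrightarrow> \<phi> (cfun_mult (cfun_cnj c) (capply f b)) = \<phi> (cfun_mult (cfun_cnj (capply (star A f) c)) b)"
proof (induction f rule: A_induct)
  case zero
  have "star A 0 = 0" using star_add[of 0 0] by simp
  then show ?case by simp
next
  case (add s a f)
  have eq: "\<alpha> (inv\<^bsub>\<Gamma>\<^esub> s) (cfun_mult (cfun_cnj c) (cfun_mult a (\<alpha> s b))) =
      cfun_mult (cfun_cnj (cfun_mult (\<alpha> (inv\<^bsub>\<Gamma>\<^esub> s) (cfun_cnj a)) (\<alpha> (inv\<^bsub>\<Gamma>\<^esub> s) c))) b"
    using add(1) by (simp add: translate_mult translate_cnj translate_translate cfun_cnj_mult)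
      (rule bcontfun_eqI, simp)
  have "\<phi> (cfun_mult (cfun_cnj c) (cfun_mult a (\<alpha> s b))) =
      \<phi> (cfun_mult (cfun_cnj (capply (star A (delta s a)) c)) b)"
    using invariant[of "inv\<^bsub>\<Gamma>\<^esub> s" "cfun_mult (cfun_cnj c) (cfun_mult a (\<alpha> s b))"] add(1)
    unfolding eq by (simp add: star_delta)
  then show ?case using add
    by (simp add: capply_add_left star_add cfun_mult_add_right cfun_mult_add_left cfun_cnj_add state_add[OF state])
qed

lemma K_carrier: "carrier K = completion UNIV G.dst"
  unfolding gns_space_eq by (rule G.HC_carrier)

lemma K_ex: "P \<in> carrier K \<Longrightarrow> \<exists>X. X \<in> G.CS \<and> P = G.cls X"
  unfolding K_carrier by (rule G.completion_ex)

lemma K_cls: "X \<in> G.CS \<Longrightarrow> G.cls X \<in> carrier K"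
  unfolding K_carrier by (rule G.completionI)

lemmas K_add = G.HC_add[folded gns_space_eq]
lemmas K_smult = G.HC_smult[folded gns_space_eq]
lemmas K_zero = G.HC_zero[folded gns_space_eq]
lemmas K_hnorm_lim = G.HC_hnorm_lim[folded gns_space_eq]
lemmas K_hinner_lim = G.HC_hinner_lim[folded gns_space_eq]

lemma
  assumes f: "f \<in> carrier A" and X: "X \<in> G.CS"
  shows CS_capply: "(\<lambda>n. capply f (X n)) \<in> G.CS"
    and map_capply: "completion_map1 UNIV G.dst (capply f) (G.cls X) = G.cls (\<lambda>n. capply f (X n))"
proof -
  obtain C where C: "\<And>b. G.q (capply f b) \<le> C * G.q b" using q_capply[OF f] by blast
  have C': "G.q (capply f x - capply f y) \<le> C * G.q (x - y)" for x y
    unfolding capply_minus_right[OF f, symmetric] by (rule C)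
  show "(\<lambda>n. capply f (X n)) \<in> G.CS"
    "completion_map1 UNIV G.dst (capply f) (G.cls X) = G.cls (\<lambda>n. capply f (X n))"
    by (rule G.completion_map1_eq[OF UNIV_I C' X])+
qed

lemma
  assumes X: "X \<in> G.CS"
  shows CS_gns_rep: "(\<lambda>n. cfun_mult a (X n)) \<in> G.CS" and gns_rep_eq: "gns_rep \<phi> a (G.cls X) = G.cls (\<lambda>n. cfun_mult a (X n))"
proof -
  have C': "G.q (cfun_mult a x - cfun_mult a y) \<le> norm a * G.q (x - y)" for x y
    unfolding cfun_mult_minus_right[symmetric] by (rule q_mult_le)
  show "(\<lambda>n. cfun_mult a (X n)) \<in> G.CS" "gns_rep \<phi> a (G.cls X) = G.cls (\<lambda>n. cfun_mult a (X n))"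
    unfolding gns_rep_def gns_dist_eq by (rule G.completion_map1_eq[OF UNIV_I C' X])+
qed

lemma
  assumes X: "X \<in> G.CS" and s: "s \<in> carrier \<Gamma>"
  shows CS_gns_unitary: "(\<lambda>n. \<alpha> s (X n)) \<in> G.CS"
    and gns_unitary_eq: "gns_unitary \<Gamma> act \<phi> s (G.cls X) = G.cls (\<lambda>n. \<alpha> s (X n))"
proof -
  have C': "G.q (\<alpha> s x - \<alpha> s y) \<le> 1 * G.q (x - y)" for x y
    using q_translate[OF s, of "x - y"] by (simp add: translate_minus[OF s])
  show "(\<lambda>n. \<alpha> s (X n)) \<in> G.CS" "gns_unitary \<Gamma> act \<phi> s (G.cls X) = G.cls (\<lambda>n. \<alpha> s (X n))"
    unfolding gns_unitary_def gns_dist_eq by (rule G.completion_map1_eq[OF UNIV_I C' X])+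
qed

lemma finsum_cls:
  assumes "finite S" "\<And>s. s \<in> S \<Longrightarrow> Y s \<in> G.CS"
  shows "(\<lambda>n. \<Sum>s\<in>S. Y s n) \<in> G.CS \<and> finsum K (\<lambda>s. G.cls (Y s)) S = G.cls (\<lambda>n. \<Sum>s\<in>S. Y s n)"
  using assms
proof (induction S rule: finite_induct)
  case empty
  then show ?case by (simp add: K_zero)
next
  case (insert s S)
  have IH: "(\<lambda>n. \<Sum>s\<in>S. Y s n) \<in> G.CS" "finsum K (\<lambda>s. G.cls (Y s)) S = G.cls (\<lambda>n. \<Sum>s\<in>S. Y s n)"
    using insert by auto
  have "Y s \<in> G.CS" using insert.prems by simp
  moreover have "finsum K (\<lambda>s. G.cls (Y s)) (insert s S) = G.cls (Y s) \<oplus>\<^bsub>K\<^esub> finsum K (\<lambda>s. G.cls (Y s)) S"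
    by (rule K.finsum_insert) (use insert K_cls in auto)
  ultimately show ?case using insert.hyps G.CS_add[OF _ IH(1), of "Y s"] by (simp add: IH(2) K_add IH(1))
qed

text \<open>Evaluates the module sum from the description of \<open>koopman_rep\<close> on
  representatives, where it becomes \<open>capply\<close>.\<close>

lemma finsum_gns:
  assumes f: "f \<in> carrier A" and X: "X \<in> G.CS"
  shows "finsum K (\<lambda>s. gns_rep \<phi> (f s) (gns_unitary \<Gamma> act \<phi> s (G.cls X))) {s. f s \<noteq> 0} = G.cls (\<lambda>n. capply f (X n))"
proof -
  note S = A_carrierD[OF f]
  have sc: "s \<in> carrier \<Gamma>" if "s \<in> supp f" for s using that S(2) by blast
  have Y: "(\<lambda>n. cfun_mult (f s) (\<alpha> s (X n))) \<in> G.CS" if "s \<in> supp f" for s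
    by (rule CS_gns_rep[OF CS_gns_unitary[OF X sc[OF that]]])
  have "finsum K (\<lambda>s. gns_rep \<phi> (f s) (gns_unitary \<Gamma> act \<phi> s (G.cls X))) (supp f) =
      finsum K (\<lambda>s. G.cls (\<lambda>n. cfun_mult (f s) (\<alpha> s (X n)))) (supp f)"
    by (rule K.finsum_cong') (use sc Y K_cls X in \<open>auto simp: gns_unitary_eq gns_rep_eq CS_gns_unitary\<close>)
  also have "\<dots> = G.cls (\<lambda>n. capply f (X n))"
    using finsum_cls[OF S(1) Y] by (simp add: capply_def)
  finally show ?thesis .
qed

lemma capply_representation:
  "representation A K (\<lambda>f. completion_map1 UNIV G.dst (capply f))"
  unfolding representation_def
proof (intro conjI ballI allI)
  fix f assume f: "f \<in> carrier A"
  obtain C where C: "\<And>b. G.q (capply f b) \<le> C * G.q b" using q_capply[OF f] by blast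
  show "bounded_operator K (completion_map1 UNIV G.dst (capply f))"
    unfolding bounded_operator_def linear_map_def
  proof (intro conjI ballI allI exI[of _ C] Pi_I)
    fix P c assume "P \<in> carrier K"
    then obtain X where X: "X \<in> G.CS" "P = G.cls X" using K_ex by blast
    note fX = CS_capply[OF f X(1)]
    show "completion_map1 UNIV G.dst (capply f) P \<in> carrier K"
      unfolding X(2) map_capply[OF f X(1)] by (rule K_cls[OF fX])
    show "completion_map1 UNIV G.dst (capply f) (c \<odot>\<^bsub>K\<^esub> P) = c \<odot>\<^bsub>K\<^esub> completion_map1 UNIV G.dst (capply f) P"
      unfolding X(2) map_capply[OF f X(1)] K_smult[OF X(1)] K_smult[OF fX] map_capply[OF f G.CS_sm[OF X(1)]]
      by (simp add: capply_scale_right[OF f])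
    show "hnorm K (completion_map1 UNIV G.dst (capply f) P) \<le> C * hnorm K P"
      unfolding X(2) map_capply[OF f X(1)]
      by (rule LIMSEQ_le[OF K_hnorm_lim[OF fX] tendsto_mult_left[OF K_hnorm_lim[OF X(1)]]]) (use C in blast)
    fix Q assume "Q \<in> carrier K"
    then obtain Y where Y: "Y \<in> G.CS" "Q = G.cls Y" using K_ex by blast
    show "completion_map1 UNIV G.dst (capply f) (P \<oplus>\<^bsub>K\<^esub> Q) =
        completion_map1 UNIV G.dst (capply f) P \<oplus>\<^bsub>K\<^esub> completion_map1 UNIV G.dst (capply f) Q"
      unfolding X(2) Y(2) map_capply[OF f X(1)] map_capply[OF f Y(1)] K_add[OF X(1) Y(1)]
        K_add[OF fX CS_capply[OF f Y(1)]] map_capply[OF f G.CS_add[OF X(1) Y(1)]]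
      by (simp add: capply_add_right[OF f])
  qed
  fix P c assume "P \<in> carrier K"
  then obtain X where X: "X \<in> G.CS" "P = G.cls X" using K_ex by blast
  note fX = CS_capply[OF f X(1)]
  show "completion_map1 UNIV G.dst (capply (c \<odot>\<^bsub>A\<^esub> f)) P = c \<odot>\<^bsub>K\<^esub> completion_map1 UNIV G.dst (capply f) P"
    unfolding X(2) map_capply[OF f X(1)] map_capply[OF C_smult[OF f] X(1)] K_smult[OF fX]
    by (simp add: capply_smult[OF f])
  fix Q assume "Q \<in> carrier K"
  then obtain Y where Y: "Y \<in> G.CS" "Q = G.cls Y" using K_ex by blast
  show "hinner K (completion_map1 UNIV G.dst (capply f) P) Q = hinner K P (completion_map1 UNIV G.dst (capply (star A f)) Q)"
    unfolding X(2) Y(2) map_capply[OF f X(1)] map_capply[OF C_star[OF f] Y(1)]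
    by (rule LIMSEQ_unique[OF K_hinner_lim[OF fX Y(1)]])
      (use K_hinner_lim[OF X(1) CS_capply[OF C_star[OF f] Y(1)]] in \<open>simp add: inner_capply[OF f]\<close>)
next
  fix f g P assume f: "f \<in> carrier A" and g: "g \<in> carrier A" and "P \<in> carrier K"
  then obtain X where X: "X \<in> G.CS" "P = G.cls X" using K_ex by blast
  note fX = CS_capply[OF f X(1)] and gX = CS_capply[OF g X(1)]
  show "completion_map1 UNIV G.dst (capply (f \<oplus>\<^bsub>A\<^esub> g)) P =
      completion_map1 UNIV G.dst (capply f) P \<oplus>\<^bsub>K\<^esub> completion_map1 UNIV G.dst (capply g) P"
    unfolding X(2) A_add map_capply[OF f X(1)] map_capply[OF g X(1)] K_add[OF fX gX] map_capply[OF C_add[OF f g] X(1)]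
    by (simp add: capply_add_left[OF f g])
  show "completion_map1 UNIV G.dst (capply (f \<otimes>\<^bsub>A\<^esub> g)) P =
      completion_map1 UNIV G.dst (capply f) (completion_map1 UNIV G.dst (capply g) P)"
    unfolding X(2) map_capply[OF g X(1)] map_capply[OF f gX] map_capply[OF C_mult[OF f g] X(1)]
    by (simp add: capply_mult[OF f g])
qed

lemma CC_add_closed: "\<lbrakk>P \<in> carrier CC; Q \<in> carrier CC\<rbrakk> \<Longrightarrow> P \<oplus>\<^bsub>CC\<^esub> Q \<in> carrier CC"
  by (drule CC_ex, drule CC_ex) (auto simp: CC_add CC_cls CS_add)

lemma CC_smult_closed: "P \<in> carrier CC \<Longrightarrow> c \<odot>\<^bsub>CC\<^esub> P \<in> carrier CC"
  by (drule CC_ex) (auto simp: CC_smult CC_cls CS_smult)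

text \<open>The description has exactly one solution: the extension of \<open>capply\<close> to the
  completion, cut down to the carriers, satisfies it; any other solution agrees with it on the
  carriers by continuity and outside them by extensionality.\<close>

lemma koopman_rep:
  shows "representation (crossed_product \<Gamma> act) K (koopman_rep \<Gamma> act \<phi>)"
    and "\<lbrakk>f \<in> carrier A; X \<in> G.CS\<rbrakk> \<Longrightarrow>
      koopman_rep \<Gamma> act \<phi> (cstar_embed A f) (G.cls X) = G.cls (\<lambda>n. capply f (X n))"
proof -
  define Spec where "Spec \<rho> \<longleftrightarrow>
    \<rho> \<in> carrier CC \<rightarrow>\<^sub>E (carrier K \<rightarrow>\<^sub>E carrier K) \<and> representation CC K \<rho> \<and>
    (\<forall>f\<in>carrier A. \<forall>\<xi>\<in>carrier K. \<rho> (cstar_embed A f) \<xi> =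
       finsum K (\<lambda>s. gns_rep \<phi> (f s) (gns_unitary \<Gamma> act \<phi> s \<xi>)) {s. f s \<noteq> 0})" for \<rho>
  obtain \<pi> where \<pi>: "representation CC K \<pi>"
    "\<forall>f\<in>carrier A. \<forall>\<xi>\<in>carrier K. \<pi> (cstar_embed A f) \<xi> = completion_map1 UNIV G.dst (capply f) \<xi>"
    using representation_extend[OF hilbert_K capply_representation] by blast
  let ?\<rho> = "\<lambda>P\<in>carrier CC. \<lambda>\<xi>\<in>carrier K. \<pi> P \<xi>"
  have "Spec ?\<rho>"
    unfolding Spec_def
  proof (intro conjI ballI)
    show "?\<rho> \<in> carrier CC \<rightarrow>\<^sub>E (carrier K \<rightarrow>\<^sub>E carrier K)"
      using representationD(6)[OF \<pi>(1)] by (simp add: PiE_iff)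
    show "representation CC K ?\<rho>"
      by (rule representation_cong[OF CC_add_closed CC_smult_closed CC_mult_closed CC_star_closed hilbert_K \<pi>(1)])
        simp_all
    fix f \<xi> assume f: "f \<in> carrier A" and \<xi>: "\<xi> \<in> carrier K"
    obtain X where X: "X \<in> G.CS" "\<xi> = G.cls X" using K_ex[OF \<xi>] by blast
    have "?\<rho> (cstar_embed A f) \<xi> = completion_map1 UNIV G.dst (capply f) \<xi>"
      using \<pi>(2) f \<xi> by (simp add: embed_carrier)
    then show "?\<rho> (cstar_embed A f) \<xi> = finsum K (\<lambda>s. gns_rep \<phi> (f s) (gns_unitary \<Gamma> act \<phi> s \<xi>)) {s. f s \<noteq> 0}"
      unfolding X(2) finsum_gns[OF f X(1)] map_capply[OF f X(1)] .
  qed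
  note spec = this
  have spec_rep: "representation CC K \<rho>" if "Spec \<rho>" for \<rho>
    using that unfolding Spec_def by blast
  have spec_eq: "\<rho> (cstar_embed A f) \<xi> = finsum K (\<lambda>s. gns_rep \<phi> (f s) (gns_unitary \<Gamma> act \<phi> s \<xi>)) {s. f s \<noteq> 0}"
    if "Spec \<rho>" "f \<in> carrier A" "\<xi> \<in> carrier K" for \<rho> f \<xi>
    using that unfolding Spec_def by blast
  have "\<rho> = ?\<rho>" if \<rho>: "Spec \<rho>" for \<rho>
  proof (rule ext)
    fix P
    show "\<rho> P = ?\<rho> P"
    proof (cases "P \<in> carrier CC")
      case True
      have "\<rho> P \<xi> = ?\<rho> P \<xi>" for \<xi>
      proof (cases "\<xi> \<in> carrier K")
        case \<xi>: True
        show ?thesis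
          by (rule representation_unique[OF hilbert_K spec_rep[OF \<rho>] spec_rep[OF spec] _ True \<xi>])
            (simp only: spec_eq[OF \<rho>] spec_eq[OF spec])
      next
        case False
        have "\<rho> P \<in> carrier K \<rightarrow>\<^sub>E carrier K" using \<rho> True unfolding Spec_def by (blast dest: PiE_mem)
        then have "\<rho> P \<xi> = undefined" using False by (rule PiE_arb)
        then show ?thesis using True False by simp
      qed
      then show ?thesis ..
    next
      case False
      have "\<rho> P = undefined" using \<rho> False unfolding Spec_def by (blast dest: PiE_arb)
      then show ?thesis using False by simp
    qed
  qed
  then have "Spec (THE \<rho>. Spec \<rho>)" by (rule theI[where P=Spec, OF spec])
  moreover have "koopman_rep \<Gamma> act \<phi> = (THE \<rho>. Spec \<rho>)"
    unfolding koopman_rep_def Spec_def crossed_product_def ..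
  ultimately have S: "Spec (koopman_rep \<Gamma> act \<phi>)" by simp
  then show "representation (crossed_product \<Gamma> act) K (koopman_rep \<Gamma> act \<phi>)"
    by (simp add: Spec_def crossed_product_def)
  show "koopman_rep \<Gamma> act \<phi> (cstar_embed A f) (G.cls X) = G.cls (\<lambda>n. capply f (X n))"
    if "f \<in> carrier A" "X \<in> G.CS"
    unfolding spec_eq[OF S that(1) K_cls[OF that(2)]] by (rule finsum_gns[OF that])
qed

end

section \<open>The Riesz representation theorem on compact Hausdorff spaces\<close>

lemma Urysohn_compact:
  fixes K U :: "'x::t2_space set"
  assumes cpt: "compact (UNIV :: 'x set)" and K: "closed K" and U: "open U" and sub: "K \<subseteq> U"
  shows "\<exists>h :: 'x \<Rightarrow> real. continuous_on UNIV h \<and> (\<forall>x. 0 \<le> h x \<and> h x \<le> 1) \<and>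
    (\<forall>x\<in>K. h x = 1) \<and> (\<forall>x. x \<notin> U \<longrightarrow> h x = 0)"
proof -
  let ?X = "euclidean :: 'x topology"
  have "Hausdorff_space ?X"
    unfolding Hausdorff_space_def
  proof (intro allI impI)
    fix x y :: 'x assume "x \<in> topspace ?X \<and> y \<in> topspace ?X \<and> x \<noteq> y"
    then show "\<exists>U V. openin ?X U \<and> openin ?X V \<and> x \<in> U \<and> y \<in> V \<and> disjnt U V"
      using hausdorff[of x y] by (simp add: disjnt_def)
  qed
  moreover have "compact_space ?X" using cpt by (simp add: compact_space_def)
  ultimately have "normal_space ?X" by (intro compact_Hausdorff_or_regular_imp_normal_space) simp_all
  note nrm = this
  have cl: "closedin ?X (- U)" "closedin ?X K"
    unfolding closed_closedin[symmetric] using K closed_Compl[OF U] by simp_all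
  have dis: "disjnt (- U) K" using sub by (auto simp: disjnt_def)
  obtain f where f: "continuous_map ?X (top_of_set {0..1::real}) f" "f ` (- U) \<subseteq> {0}" "f ` K \<subseteq> {1}"
    by (rule Urysohn_lemma[OF nrm cl dis zero_le_one]) (rule that)
  have "continuous_on UNIV f" "f ` UNIV \<subseteq> {0..1}" using f(1) by (auto simp: continuous_map_in_subtopology)
  then show ?thesis using f by (intro exI[of _ f]) (auto simp: image_subset_iff)
qed

section \<open>The measure of a positive functional\<close>

locale positive_functional =
  fixes \<Lambda> :: "('x::t2_space \<Rightarrow> real) \<Rightarrow> real"
  assumes compact_UNIV: "compact (UNIV :: 'x set)"
    and \<Lambda>_add: "\<lbrakk>continuous_on UNIV f; continuous_on UNIV g\<rbrakk> \<Longrightarrow> \<Lambda> (\<lambda>x. f x + g x) = \<Lambda> f + \<Lambda> g"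
    and \<Lambda>_scale: "continuous_on UNIV f \<Longrightarrow> \<Lambda> (\<lambda>x. c * f x) = c * \<Lambda> f"
    and \<Lambda>_pos: "\<lbrakk>continuous_on UNIV f; \<And>x. 0 \<le> f x\<rbrakk> \<Longrightarrow> 0 \<le> \<Lambda> f"
    and \<Lambda>_one: "\<Lambda> (\<lambda>_. 1) = 1"
begin

lemma \<Lambda>_mono:
  assumes "continuous_on UNIV f" "continuous_on UNIV g" "\<And>x. f x \<le> g x" shows "\<Lambda> f \<le> \<Lambda> g"
proof -
  have d: "continuous_on UNIV (\<lambda>x. g x + (-1) * f x)" using assms by (intro continuous_intros)
  have "0 \<le> \<Lambda> (\<lambda>x. g x + (-1) * f x)" using assms by (intro \<Lambda>_pos d) auto
  also have "\<dots> = \<Lambda> g - \<Lambda> f"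
    using assms by (subst \<Lambda>_add) (auto intro!: continuous_intros simp: \<Lambda>_scale[of f "-1", simplified])
  finally show ?thesis by simp
qed

lemma \<Lambda>_const: "\<Lambda> (\<lambda>_. c) = c"
  using \<Lambda>_scale[of "\<lambda>_. 1" c] \<Lambda>_one by simp

text \<open>Test functions need only vanish off U, whereas the usual construction wants their
  support inside U. The gap is closed by \<open>cutoff\<close> at an arbitrarily small cost.\<close>

definition test :: "'x set \<Rightarrow> ('x \<Rightarrow> real) set" where
  "test U = {f. continuous_on UNIV f \<and> (\<forall>x. 0 \<le> f x \<and> f x \<le> 1) \<and> (\<forall>x. x \<notin> U \<longrightarrow> f x = 0)}"

definition vol :: "'x set \<Rightarrow> real" where
  "vol U = (SUP f\<in>test U. \<Lambda> f)"

lemma testD: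
  assumes "f \<in> test U"
  shows "continuous_on UNIV f" "0 \<le> f x" "f x \<le> 1" "x \<notin> U \<Longrightarrow> f x = 0"
  using assms by (auto simp: test_def)

lemma \<Lambda>_test_le_1: "f \<in> test U \<Longrightarrow> \<Lambda> f \<le> 1"
  using \<Lambda>_mono[of f "\<lambda>_. 1"] testD[of f U] by (simp add: \<Lambda>_one)

lemma zero_test: "(\<lambda>_. 0) \<in> test U"
  by (simp add: test_def)

lemma vol_upper: "f \<in> test U \<Longrightarrow> \<Lambda> f \<le> vol U"
  unfolding vol_def by (rule cSUP_upper) (auto intro!: bdd_aboveI2 \<Lambda>_test_le_1)

lemma vol_least: "(\<And>f. f \<in> test U \<Longrightarrow> \<Lambda> f \<le> c) \<Longrightarrow> vol U \<le> c"
  unfolding vol_def by (rule cSUP_least) (use zero_test in auto)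

lemma vol_approx:
  assumes "e > 0" obtains f where "f \<in> test U" "vol U < \<Lambda> f + e"
proof -
  have "\<exists>f\<in>test U. vol U - e < \<Lambda> f"
    using assms less_cSUP_iff[of "test U" \<Lambda> "vol U - e"] zero_test[of U] \<Lambda>_test_le_1
    by (fastforce simp: vol_def intro!: bdd_aboveI2)
  then show thesis using that by force
qed

lemma vol_nonneg: "0 \<le> vol U"
  using vol_upper[OF zero_test, of U] by (simp add: \<Lambda>_const)

lemma vol_le_1: "vol U \<le> 1"
  by (rule vol_least) (rule \<Lambda>_test_le_1)

lemma vol_mono: "U \<subseteq> V \<Longrightarrow> vol U \<le> vol V"
  by (rule vol_least) (rule vol_upper, auto simp: test_def)

lemma vol_empty: "vol {} = 0"
proof -
  have "vol {} \<le> 0"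
  proof (rule vol_least)
    fix f assume "f \<in> test {}"
    then have "f = (\<lambda>_. 0)" by (auto simp: test_def)
    then show "\<Lambda> f \<le> 0" by (simp add: \<Lambda>_const)
  qed
  then show ?thesis using vol_nonneg[of "{}"] by simp
qed

lemma vol_UNIV: "vol UNIV = 1"
  using vol_upper[of "\<lambda>_. 1" UNIV] vol_le_1[of UNIV] by (simp add: test_def \<Lambda>_one)

lemma closed_level: "continuous_on UNIV f \<Longrightarrow> closed {x. e \<le> f x}" for f :: "'x \<Rightarrow> real"
  by (intro closed_Collect_le) auto

lemma level_subset: "\<lbrakk>f \<in> test U; e > 0\<rbrakk> \<Longrightarrow> {x. e \<le> f x} \<subseteq> U"
  by (force simp: test_def)

text \<open>max(0, f - e) lives on the closed level set {f \<ge> e}, which is contained in U, and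
  loses at most e because \<Lambda> is normalised.\<close>

lemma cutoff:
  assumes f: "f \<in> test U" and e: "e > 0"
  obtains g where "g \<in> test U" "\<Lambda> f \<le> \<Lambda> g + e" "\<forall>x. g x \<noteq> 0 \<longrightarrow> e \<le> f x"
proof
  let ?g = "\<lambda>x. max 0 (f x - e)"
  have cont: "continuous_on UNIV ?g" using testD(1)[OF f] by (intro continuous_intros)
  have "0 \<le> ?g x" "?g x \<le> 1" "x \<notin> U \<Longrightarrow> ?g x = 0" for x
    using testD(2-4)[OF f, of x] e by auto
  then show "?g \<in> test U" using cont by (simp add: test_def)
  have "\<Lambda> f \<le> \<Lambda> (\<lambda>x. ?g x + e)"
    by (rule \<Lambda>_mono) (auto intro!: continuous_intros testD(1)[OF f])
  also have "\<dots> = \<Lambda> ?g + e" using cont by (simp add: \<Lambda>_add \<Lambda>_const)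
  finally show "\<Lambda> f \<le> \<Lambda> ?g + e" .
  show "\<forall>x. ?g x \<noteq> 0 \<longrightarrow> e \<le> f x" by (auto simp: max_def split: if_splits)
qed

text \<open>After a cutoff, a Urysohn function h that is 1 on the part of {f \<ge> e} outside V and
  0 outside U splits g into g h, tested by U, and g (1 - h), tested by V.\<close>

lemma vol_Un:
  assumes U: "open U" and V: "open V" shows "vol (U \<union> V) \<le> vol U + vol V"
proof (rule vol_least, rule field_le_epsilon)
  fix f and e :: real assume f: "f \<in> test (U \<union> V)" and e: "e > 0"
  obtain g where g0: "g \<in> test (U \<union> V)" "\<Lambda> f \<le> \<Lambda> g + e" "\<forall>x. g x \<noteq> 0 \<longrightarrow> e \<le> f x"
    by (rule cutoff[OF f e])
  note g = g0(1,2) g0(3)[rule_format] level_subset[OF f e]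
  note gc = testD(1)[OF g(1)] and gD = testD(2-4)[OF g(1)]
  have cl: "closed ({x. e \<le> f x} - V)" using V closed_level[OF testD(1)[OF f]] by (simp add: closed_Diff)
  have sub: "{x. e \<le> f x} - V \<subseteq> U" using g(4) by blast
  from Urysohn_compact[OF compact_UNIV cl U sub] obtain h :: "'x \<Rightarrow> real"
    where h': "continuous_on UNIV h \<and> (\<forall>x. 0 \<le> h x \<and> h x \<le> 1) \<and>
      (\<forall>x\<in>{x. e \<le> f x} - V. h x = 1) \<and> (\<forall>x. x \<notin> U \<longrightarrow> h x = 0)" ..
  then have h: "continuous_on UNIV h" "0 \<le> h x" "h x \<le> 1" "x \<in> {x. e \<le> f x} - V \<Longrightarrow> h x = 1"
    "x \<notin> U \<Longrightarrow> h x = 0" for x by blast+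
  have c1: "continuous_on UNIV (\<lambda>x. g x * h x)" and c2: "continuous_on UNIV (\<lambda>x. g x * (1 - h x))"
    using gc h(1) by (auto intro!: continuous_intros)
  have "(\<lambda>x. g x * h x) \<in> test U"
    using c1 gD h by (auto simp: test_def intro!: mult_le_one)
  moreover have "(\<lambda>x. g x * (1 - h x)) \<in> test V"
    unfolding test_def
  proof (intro CollectI conjI allI impI c2)
    fix x
    show "0 \<le> g x * (1 - h x)" using gD h by simp
    show "g x * (1 - h x) \<le> 1" using gD[of x] h(2,3)[of x] by (intro mult_le_one) auto
    assume "x \<notin> V"
    then show "g x * (1 - h x) = 0" using g(3)[of x] h(4)[of x] by auto
  qed
  moreover have "\<Lambda> g = \<Lambda> (\<lambda>x. g x * h x) + \<Lambda> (\<lambda>x. g x * (1 - h x))"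
    using \<Lambda>_add[OF c1 c2] by (simp add: algebra_simps)
  ultimately have "\<Lambda> g \<le> vol U + vol V" by (simp add: add_mono vol_upper)
  then show "\<Lambda> f \<le> vol U + vol V + e" using g(2) by linarith
qed

lemma vol_UN_le: "(\<And>i. open (U i)) \<Longrightarrow> vol (\<Union>i<n. U i) \<le> (\<Sum>i<n. vol (U i))" for U :: "nat \<Rightarrow> 'x set"
proof (induction n)
  case (Suc n)
  have "vol (\<Union>i<Suc n. U i) \<le> vol (\<Union>i<n. U i) + vol (U n)"
    using vol_Un[of "\<Union>i<n. U i" "U n"] Suc.prems by (simp add: lessThan_Suc Un_commute open_UN)
  then show ?case using Suc by simp
qed (simp add: vol_empty)

text \<open>After a cutoff the test function lives on the compact level set {f \<ge> e/2}, which
  finitely many of the U i cover; finite subadditivity then applies.\<close>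

lemma vol_UN_countable:
  fixes U :: "nat \<Rightarrow> 'x set"
  assumes U: "\<And>i. open (U i)"
  shows "ennreal (vol (\<Union>i. U i)) \<le> (\<Sum>i. ennreal (vol (U i)))"
proof (rule ennreal_le_epsilon)
  fix e :: real assume e: "e > 0"
  obtain f where f: "f \<in> test (\<Union>i. U i)" "vol (\<Union>i. U i) < \<Lambda> f + e / 2" by (rule vol_approx[of "e/2"]) (use e in auto)
  have e2: "e / 2 > 0" using e by simp
  obtain g where g0: "g \<in> test (\<Union>i. U i)" "\<Lambda> f \<le> \<Lambda> g + e / 2" "\<forall>x. g x \<noteq> 0 \<longrightarrow> e / 2 \<le> f x"
    by (rule cutoff[OF f(1) e2])
  note g = g0(1,2) g0(3)[rule_format] level_subset[OF f(1) e2]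
  have "compact {x. e / 2 \<le> f x}"
    using closed_level[OF testD(1)[OF f(1)]] compact_UNIV by (metis compact_Int_closed inf_top_left)
  then obtain C where C: "C \<subseteq> UNIV" "finite C" "{x. e / 2 \<le> f x} \<subseteq> (\<Union>i\<in>C. U i)"
    by (rule compactE_image[OF _ U g(4)]) (rule that)
  obtain n where n: "C \<subseteq> {..<n}" using finite_nat_bounded[OF C(2)] by blast
  have "g x = 0" if "x \<notin> (\<Union>i<n. U i)" for x
  proof -
    have "x \<notin> {x. e / 2 \<le> f x}" using C(3) n that by blast
    then show ?thesis using g(3)[of x] by blast
  qed
  then have "g \<in> test (\<Union>i<n. U i)" using testD(1-3)[OF g(1)] by (simp add: test_def)
  then have "\<Lambda> g \<le> (\<Sum>i<n. vol (U i))" by (rule order_trans[OF vol_upper vol_UN_le[OF U]])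
  then have "vol (\<Union>i. U i) \<le> (\<Sum>i<n. vol (U i)) + e" using f(2) g(2) by linarith
  then have "ennreal (vol (\<Union>i. U i)) \<le> ennreal ((\<Sum>i<n. vol (U i)) + e)" by (rule ennreal_leI)
  also have "\<dots> = (\<Sum>i<n. ennreal (vol (U i))) + ennreal e"
    using e by (simp add: ennreal_plus sum_nonneg vol_nonneg sum_ennreal)
  also have "\<dots> \<le> (\<Sum>i. ennreal (vol (U i))) + ennreal e"
    by (intro add_right_mono sum_le_suminf) auto
  finally show "ennreal (vol (\<Union>i. U i)) \<le> (\<Sum>i. ennreal (vol (U i))) + ennreal e" .
qed

definition outer :: "'x set \<Rightarrow> ennreal" where
  "outer E = (INF U\<in>{U. open U \<and> E \<subseteq> U}. ennreal (vol U))"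

lemma outer_le: "open U \<Longrightarrow> E \<subseteq> U \<Longrightarrow> outer E \<le> ennreal (vol U)"
  unfolding outer_def by (rule INF_lower) simp

lemma outer_open: "open U \<Longrightarrow> outer U = ennreal (vol U)"
  by (intro antisym outer_le) (auto simp: outer_def intro!: INF_greatest ennreal_leI vol_mono)

lemma outer_mono: "E \<subseteq> F \<Longrightarrow> outer E \<le> outer F"
  unfolding outer_def by (rule INF_superset_mono) auto

lemma outer_le_1: "outer E \<le> 1"
  using outer_le[of UNIV E] by (simp add: vol_UNIV)

lemma outer_approx:
  assumes "e > 0" obtains U where "open U" "E \<subseteq> U" "ennreal (vol U) \<le> outer E + ennreal e"
proof -
  \<comment> \<open>Strict because the outer measure is at most 1; at infinity adding e would change
    nothing.\<close>
  have "outer E < outer E + ennreal e"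
    using assms outer_le_1[of E] by (simp add: ennreal_less_zero_iff less_top[symmetric] top_unique)
      (metis ennreal_one_less_top leD less_top)
  then obtain U where "open U" "E \<subseteq> U" "ennreal (vol U) < outer E + ennreal e"
    unfolding outer_def[of E] INF_less_iff by auto
  then show thesis using that by (meson less_imp_le)
qed

lemma outer_countably_subadditive: "outer (\<Union>i. E i) \<le> (\<Sum>i. outer (E i))" for E :: "nat \<Rightarrow> 'x set"
proof (rule ennreal_le_epsilon)
  fix e :: real assume e: "e > 0"
  \<comment> \<open>The errors e / 2^(i+1) sum to e.\<close>
  have "\<forall>i. \<exists>U. open U \<and> E i \<subseteq> U \<and> ennreal (vol U) \<le> outer (E i) + ennreal (e * (1/2) ^ Suc i)"
    using outer_approx[of "e * (1/2) ^ Suc _"] e by (metis half_gt_zero_iff mult_pos_pos zero_less_one zero_less_power)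
  from choice[OF this] obtain U
    where U: "\<And>i. open (U i)" "\<And>i. E i \<subseteq> U i" "\<And>i. ennreal (vol (U i)) \<le> outer (E i) + ennreal (e * (1/2) ^ Suc i)" by blast
  have "outer (\<Union>i. E i) \<le> ennreal (vol (\<Union>i. U i))" by (rule outer_le) (use U in auto)
  also have "\<dots> \<le> (\<Sum>i. ennreal (vol (U i)))" by (rule vol_UN_countable[OF U(1)])
  also have "\<dots> \<le> (\<Sum>i. outer (E i) + ennreal (e * (1/2) ^ Suc i))"
    by (intro suminf_le U) auto
  also have "\<dots> = (\<Sum>i. outer (E i)) + (\<Sum>i. ennreal e * ennreal ((1/2) ^ Suc i))"
    using e by (subst suminf_add[symmetric]) (auto simp del: ennreal_suminf_cmult simp add: ennreal_mult[symmetric])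
  also have "\<dots> = (\<Sum>i. outer (E i)) + ennreal e"
    unfolding ennreal_suminf_cmult
    by (subst suminf_ennreal_eq[OF zero_le_power power_half_series]) auto
  finally show "outer (\<Union>i. E i) \<le> (\<Sum>i. outer (E i)) + ennreal e" .
qed

lemma outer_empty: "outer {} = 0"
  by (simp add: outer_open vol_empty)

lemma outer_measure_space: "outer_measure_space UNIV outer"
  unfolding outer_measure_space_def positive_def increasing_def countably_subadditive_def
  using outer_empty outer_mono outer_countably_subadditive by auto

lemma sigma_algebra_UNIV: "sigma_algebra UNIV (UNIV :: 'x set set)"
  using sigma_algebra_Pow[of "UNIV :: 'x set"] by simp

lemma ring_UNIV: "ring_of_sets UNIV (UNIV :: 'x set set)"
proof -
  interpret sigma_algebra UNIV "UNIV :: 'x set set" by (rule sigma_algebra_UNIV)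
  show ?thesis ..
qed

text \<open>Inside an open V containing E, the volumes of V \<inter> U and of the rest are
  approximated by functions that are nowhere nonzero together, so their sum is again a test function
  of V.\<close>

lemma open_in_lambda_system:
  assumes U: "open U" shows "U \<in> lambda_system UNIV UNIV outer"
proof -
  have "outer (U \<inter> E) + outer (- U \<inter> E) = outer E" for E
  proof (rule antisym)
    have "outer ((U \<inter> E) \<union> (- U \<inter> E)) \<le> outer (U \<inter> E) + outer (- U \<inter> E)"
      using outer_measure_space unfolding outer_measure_space_def
      by (intro subadditiveD[OF ring_of_sets.countably_subadditive_subadditive[OF ring_UNIV, of outer]]) auto
    moreover have "(U \<inter> E) \<union> (- U \<inter> E) = E" by blast
    ultimately show "outer E \<le> outer (U \<inter> E) + outer (- U \<inter> E)" by simp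
    show "outer (U \<inter> E) + outer (- U \<inter> E) \<le> outer E"
      unfolding outer_def[of E]
    proof (rule INF_greatest, rule ennreal_le_epsilon)
      fix V and e :: real assume "V \<in> {V. open V \<and> E \<subseteq> V}" and e: "e > 0"
      then have V: "open V" "E \<subseteq> V" by auto
      have e3: "e / 3 > 0" using e by simp
      obtain f where f: "f \<in> test (V \<inter> U)" "vol (V \<inter> U) < \<Lambda> f + e / 3" by (rule vol_approx[OF e3])
      obtain g where g0: "g \<in> test (V \<inter> U)" "\<Lambda> f \<le> \<Lambda> g + e / 3" "\<forall>x. g x \<noteq> 0 \<longrightarrow> e / 3 \<le> f x"
        by (rule cutoff[OF f(1) e3])
      note g = g0(1,2) g0(3)[rule_format] level_subset[OF f(1) e3]
      \<comment> \<open>Taking away only the closed set {f \<ge> e/3}, on which g lives, leaves an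
        open set that still contains V - U. The three errors e/3 come from f, from its cutoff g and
        from h.\<close>
      define W where "W = V - {x. e / 3 \<le> f x}"
      have W: "open W" unfolding W_def by (rule open_Diff[OF V(1) closed_level[OF testD(1)[OF f(1)]]])
      obtain h where h: "h \<in> test W" "vol W < \<Lambda> h + e / 3" by (rule vol_approx[OF e3])
      have "(\<lambda>x. g x + h x) \<in> test V"
        unfolding test_def
      proof (intro CollectI conjI allI impI)
        show "continuous_on UNIV (\<lambda>x. g x + h x)" using testD(1)[OF g(1)] testD(1)[OF h(1)] by (intro continuous_intros)
        fix x
        show "0 \<le> g x + h x" using testD(2)[OF g(1)] testD(2)[OF h(1)] by simp
        have "h x = 0" if "g x \<noteq> 0" using g(3)[OF that] testD(4)[OF h(1)] by (simp add: W_def)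
        then show "g x + h x \<le> 1" using testD(3)[OF g(1), of x] testD(3)[OF h(1), of x] by (cases "g x = 0") auto
        show "g x + h x = 0" if "x \<notin> V" using that testD(4)[OF g(1)] testD(4)[OF h(1)] by (simp add: W_def)
      qed
      then have "\<Lambda> g + \<Lambda> h \<le> vol V"
        using vol_upper \<Lambda>_add[OF testD(1)[OF g(1)] testD(1)[OF h(1)]] by fastforce
      then have le: "vol (V \<inter> U) + vol W \<le> vol V + e" using f(2) h(2) g(2) by linarith
      have "outer (U \<inter> E) \<le> ennreal (vol (V \<inter> U))" by (rule outer_le) (use U V in auto)
      moreover have "outer (- U \<inter> E) \<le> ennreal (vol W)"
        by (rule outer_le[OF W]) (use V(2) g(4) in \<open>auto simp: W_def\<close>)
      ultimately have "outer (U \<inter> E) + outer (- U \<inter> E) \<le> ennreal (vol (V \<inter> U)) + ennreal (vol W)"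
        by (rule add_mono)
      also have "\<dots> = ennreal (vol (V \<inter> U) + vol W)" by (simp add: ennreal_plus vol_nonneg)
      also have "\<dots> \<le> ennreal (vol V + e)" by (rule ennreal_leI[OF le])
      also have "\<dots> = ennreal (vol V) + ennreal e" using e by (simp add: ennreal_plus vol_nonneg)
      finally show "outer (U \<inter> E) + outer (- U \<inter> E) \<le> ennreal (vol V) + ennreal e" .
    qed
  qed
  then show ?thesis by (simp add: lambda_system_def Compl_eq_Diff_UNIV)
qed

definition rmeasure :: "'x measure" where
  "rmeasure = measure_of UNIV (sets borel) outer"

text \<open>Caratheodory's lemma gives a measure on the lambda system, a sigma-algebra that contains
  the open sets and hence all Borel sets.\<close>

lemma rmeasure_space: "measure_space UNIV (sets borel) outer"
proof (rule measure_down)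
  show L: "measure_space UNIV (lambda_system UNIV UNIV outer) outer"
    by (rule sigma_algebra.caratheodory_lemma[OF _ outer_measure_space]) (rule sigma_algebra_UNIV)
  show "sigma_algebra UNIV (sets (borel :: 'x measure))"
    using sets.sigma_algebra_axioms[of borel] by simp
  have "sigma_sets UNIV {S. open S} \<subseteq> lambda_system UNIV UNIV outer"
    by (rule sigma_algebra.sigma_sets_subset) (use L open_in_lambda_system in \<open>auto simp: measure_space_def\<close>)
  then show "sets borel \<subseteq> lambda_system UNIV UNIV outer"
    by (simp add: borel_def)
qed

lemma sets_rmeasure [simp]: "sets rmeasure = sets borel"
  unfolding rmeasure_def by (metis sets.sets_measure_of_eq space_borel)

lemma space_rmeasure [simp]: "space rmeasure = UNIV"
  by (simp add: rmeasure_def space_measure_of_conv)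

lemma emeasure_rmeasure: "E \<in> sets borel \<Longrightarrow> emeasure rmeasure E = outer E"
  using rmeasure_space unfolding rmeasure_def measure_space_def
  by (intro emeasure_measure_of_sigma) auto

lemma prob_space_rmeasure: "prob_space rmeasure"
  by (rule prob_spaceI) (simp add: emeasure_rmeasure outer_open vol_UNIV)

sublocale M: prob_space rmeasure by (rule prob_space_rmeasure)

lemma measure_rmeasure_open: "open U \<Longrightarrow> measure rmeasure U = vol U"
  by (simp add: measure_def emeasure_rmeasure outer_open vol_nonneg)

text \<open>Outer regularity is the definition of the outer measure. Inner regularity follows by
  complements: an open set close to -E has a closed, hence compact, complement inside E.\<close>

lemma regular_rmeasure: "regular_borel_prob rmeasure"
  unfolding regular_borel_prob_def
proof (intro conjI ballI)
  fix E assume E: "E \<in> sets rmeasure"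
  have outer_reg: "emeasure rmeasure E = (INF V\<in>{V. open V \<and> E \<subseteq> V}. emeasure rmeasure V)" if E: "E \<in> sets borel" for E
    unfolding emeasure_rmeasure[OF E] outer_def
    by (intro INF_cong) (auto simp: emeasure_rmeasure outer_open)
  show "emeasure rmeasure E = (INF V\<in>{V. open V \<and> E \<subseteq> V}. emeasure rmeasure V)"
    using outer_reg E by simp
  show "emeasure rmeasure E = (SUP K\<in>{K. compact K \<and> K \<subseteq> E}. emeasure rmeasure K)"
  proof (rule antisym)
    show "(SUP K\<in>{K. compact K \<and> K \<subseteq> E}. emeasure rmeasure K) \<le> emeasure rmeasure E"
      by (rule SUP_least) (use E in \<open>auto intro!: emeasure_mono\<close>)
    show "emeasure rmeasure E \<le> (SUP K\<in>{K. compact K \<and> K \<subseteq> E}. emeasure rmeasure K)"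
    proof (rule ennreal_le_epsilon)
      fix e :: real assume e: "e > 0"
      have cE: "- E \<in> sets borel" using E by simp
      obtain V where V: "open V" "- E \<subseteq> V" "ennreal (vol V) \<le> outer (- E) + ennreal e"
        by (rule outer_approx[OF e])
      have Vb: "V \<in> sets borel" using V(1) by simp
      have "measure rmeasure V \<le> measure rmeasure (- E) + e"
        using V(3) e by (simp add: emeasure_rmeasure[OF cE, symmetric] measure_rmeasure_open[OF V(1)]
            M.emeasure_eq_measure ennreal_plus[symmetric] del: ennreal_plus)
      moreover have "measure rmeasure (- V) = 1 - measure rmeasure V"
        using M.prob_compl[of V] Vb by (simp add: Compl_eq_Diff_UNIV)
      moreover have "measure rmeasure (- E) = 1 - measure rmeasure E"
        using M.prob_compl[of E] E by (simp add: Compl_eq_Diff_UNIV)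
      ultimately have "measure rmeasure E \<le> measure rmeasure (- V) + e" by simp
      then have "emeasure rmeasure E \<le> emeasure rmeasure (- V) + ennreal e"
        using e by (simp add: M.emeasure_eq_measure ennreal_plus[symmetric] del: ennreal_plus)
      also have "emeasure rmeasure (- V) \<le> (SUP K\<in>{K. compact K \<and> K \<subseteq> E}. emeasure rmeasure K)"
      proof (rule SUP_upper)
        have "closed (- V)" by (rule closed_Compl[OF V(1)])
        then have "compact (- V)" using compact_UNIV by (metis compact_Int_closed inf_top_left)
        then show "- V \<in> {K. compact K \<and> K \<subseteq> E}" using V(2) by auto
      qed
      finally show "emeasure rmeasure E \<le> (SUP K\<in>{K. compact K \<and> K \<subseteq> E}. emeasure rmeasure K) + ennreal e"
        by (simp add: add_right_mono)
    qed
  qed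
qed (auto simp: prob_space_rmeasure)

end

text \<open>Cuts t into slices of height 1; these are the layers in the next lemma.\<close>

lemma sum_layers: "t \<ge> 0 \<Longrightarrow> (\<Sum>k<n. min 1 (max 0 (t - real k))) = min t (real n)" for t :: real
  by (induction n) (auto simp: min_def max_def)

text \<open>Both functionals are sandwiched between the same Riemann sums.\<close>

lemma positive_functionals_agree:
  fixes L L' :: "('x::t2_space \<Rightarrow> real) \<Rightarrow> real"
  assumes L: "positive_functional L" and L': "positive_functional L'"
    and hi: "\<And>U f. open U \<Longrightarrow> f \<in> positive_functional.test U \<Longrightarrow> L f \<le> v U \<and> L' f \<le> v U"
    and lo: "\<And>U f. open U \<Longrightarrow> continuous_on UNIV f \<Longrightarrow> (\<And>x. 0 \<le> f x) \<Longrightarrow> (\<And>x. x \<in> U \<Longrightarrow> f x = 1) \<Longrightarrow> v U \<le> L f \<and> v U \<le> L' f"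
    and v: "\<And>U. 0 \<le> v U" "\<And>U. v U \<le> 1"
    and f: "continuous_on UNIV f"
  shows "L f = L' f"
proof -
  interpret L: positive_functional L by fact
  interpret L': positive_functional L' by fact
  have unit: "L f = L' f" if f: "continuous_on UNIV f" "\<And>x. 0 \<le> f x" "\<And>x. f x \<le> 1" for f
  proof -
    have bound: "\<bar>L f - L' f\<bar> * real n \<le> 1" for n
    proof -
      \<comment> \<open>\<open>F k\<close> is the slice of n f between heights k and k + 1. It is a
        test function of \<open>U k\<close> and equals 1 on \<open>U (Suc k)\<close>, so L and L'
        both map it between \<open>v (U (Suc k))\<close> and \<open>v (U k)\<close>.\<close>
      define F where "F k x = min 1 (max 0 (real n * f x - real k))" for k :: nat and x
      define U where "U k = {x. real k < real n * f x}" for k :: nat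
      have U: "open (U k)" for k unfolding U_def by (intro open_Collect_less continuous_intros f)
      have Fc: "continuous_on UNIV (F k)" for k unfolding F_def by (intro continuous_intros f)
      have Ft: "F k \<in> L.test (U k)" for k
        unfolding L.test_def using Fc[of k] by (auto simp: F_def U_def)
      have F1: "F k x = 1" if "x \<in> U (Suc k)" for k x using that by (auto simp: F_def U_def)
      have sumF: "(\<Sum>k<n. F k x) = real n * f x" for x
      proof -
        have "real n * f x \<le> real n * 1" by (intro mult_left_mono f) auto
        then show ?thesis unfolding F_def using sum_layers[of "real n * f x" n] f(2)[of x] by simp
      qed
      have cs: "continuous_on UNIV (\<lambda>x. \<Sum>k<m. F k x)" for m by (intro continuous_intros Fc)
      have split: "P (\<lambda>x. \<Sum>k<m. F k x) = (\<Sum>k<m. P (F k))" if "positive_functional P" for P m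
      proof (induction m)
        case 0
        show ?case using positive_functional.\<Lambda>_const[OF that, of 0] by simp
      next
        case (Suc m)
        then show ?case using positive_functional.\<Lambda>_add[OF that cs Fc, of m m] by simp
      qed
      have main: "(\<Sum>k<n. v (U (Suc k))) \<le> real n * P f \<and> real n * P f \<le> (\<Sum>k<n. v (U k))"
        if P: "positive_functional P" and le: "\<And>k. P (F k) \<le> v (U k)" "\<And>k. v (U (Suc k)) \<le> P (F k)" for P
      proof -
        have "real n * P f = P (\<lambda>x. \<Sum>k<n. F k x)"
          unfolding sumF by (rule positive_functional.\<Lambda>_scale[OF P f(1), symmetric])
        then show ?thesis unfolding split[OF P] using le by (auto intro!: sum_mono)
      qed
      have 1: "L (F k) \<le> v (U k)" "L' (F k) \<le> v (U k)" for k using hi[OF U Ft] by auto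
      have 2: "v (U (Suc k)) \<le> L (F k)" "v (U (Suc k)) \<le> L' (F k)" for k
      proof -
        have "v (U (Suc k)) \<le> L (F k) \<and> v (U (Suc k)) \<le> L' (F k)"
          by (rule lo[OF U Fc _ F1]) (simp_all add: F_def)
        then show "v (U (Suc k)) \<le> L (F k)" "v (U (Suc k)) \<le> L' (F k)" by simp_all
      qed
      \<comment> \<open>Upper and lower sums differ by a telescoping sum, hence by at most 1, while
        they enclose n times the value at f.\<close>
      have "(\<Sum>k<n. v (U k)) - (\<Sum>k<n. v (U (Suc k))) = v (U 0) - v (U n)"
        unfolding sum_subtractf[symmetric] by (rule sum_lessThan_telescope')
      also have "\<dots> \<le> 1" using v(1)[of "U n"] v(2)[of "U 0"] by simp
      finally have "\<bar>real n * L f - real n * L' f\<bar> \<le> 1"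
        using main[OF L 1(1) 2(1)] main[OF L' 1(2) 2(2)] by linarith
      then show ?thesis by (simp add: abs_mult mult.commute flip: left_diff_distrib right_diff_distrib)
    qed
    show ?thesis
    proof (rule ccontr)
      assume "L f \<noteq> L' f"
      then obtain n :: nat where "1 < real n * \<bar>L f - L' f\<bar>" using ex_less_of_nat_mult[of "\<bar>L f - L' f\<bar>" 1] by auto
      then show False using bound[of n] by (simp add: mult.commute)
    qed
  qed
  have "compact (f ` UNIV)" using f L.compact_UNIV by (intro compact_continuous_image) auto
  then obtain B where "\<And>x. norm (f x) \<le> B" by (meson bounded_iff compact_imp_bounded rangeI)
  then have B: "\<bar>f x\<bar> \<le> B" for x by simp
  define b where "b = \<bar>B\<bar> + 1"
  have b: "b > 0" "\<bar>f x\<bar> \<le> b" for x using B[of x] by (auto simp: b_def)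
  \<comment> \<open>An affine change bringing the values of f into [0, 1].\<close>
  define g where "g x = (1 / (2 * b)) * (f x + b)" for x
  have fb: "continuous_on UNIV (\<lambda>x. f x + b)" by (intro continuous_intros f)
  have g: "continuous_on UNIV g" unfolding g_def by (intro continuous_intros f)
  have "0 \<le> g x" "g x \<le> 1" for x using b(1) b(2)[of x] by (auto simp: g_def field_simps)
  then have "L g = L' g" by (intro unit g)
  moreover have "P g = (1 / (2 * b)) * (P f + b)" if P: "positive_functional P" for P
    unfolding g_def positive_functional.\<Lambda>_scale[OF P fb] positive_functional.\<Lambda>_add[OF P f continuous_on_const]
      positive_functional.\<Lambda>_const[OF P] ..
  ultimately have "(1 / (2 * b)) * (L f + b) = (1 / (2 * b)) * (L' f + b)" using L L' by metis
  then show ?thesis using b(1) by simp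
qed

section \<open>Integrals of continuous functions and uniqueness of the measure\<close>

lemma integrable_continuous:
  fixes f :: "'x::t2_space \<Rightarrow> 'b::{banach, second_countable_topology}"
  assumes "compact (UNIV :: 'x set)" "prob_space M" "sets M = sets borel" "continuous_on UNIV f"
  shows "integrable M f"
proof -
  interpret prob_space M by fact
  have "compact (f ` UNIV)" using assms(1,4) by (intro compact_continuous_image) auto
  then obtain B where B: "\<And>x. norm (f x) \<le> B" by (meson bounded_iff compact_imp_bounded rangeI)
  have "f \<in> borel_measurable M"
    using borel_measurable_continuous_onI[OF assms(4)] measurable_cong_sets[OF assms(3) refl] by blast
  then show ?thesis by (rule integrable_const_bound[rotated]) (use B in auto)
qed

lemma integral_positive_functional:
  assumes "compact (UNIV :: 'x::t2_space set)" "prob_space M" "sets M = sets (borel :: 'x measure)"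
  shows "positive_functional (\<lambda>f. LINT x|M. f x)"
proof
  interpret prob_space M by fact
  note I = integrable_continuous[OF assms]
  show "compact (UNIV :: 'x set)" by fact
  show "(LINT x|M. f x + g x) = (LINT x|M. f x) + (LINT x|M. g x)"
    if "continuous_on UNIV f" "continuous_on UNIV g" for f g :: "'x \<Rightarrow> real"
    by (rule Bochner_Integration.integral_add[OF I I]) fact+
  show "(LINT x|M. 1::real) = 1" by (simp add: prob_space)
qed auto

lemma (in prob_space) integrable_indicator: "U \<in> events \<Longrightarrow> integrable M (indicator U :: _ \<Rightarrow> real)"
  by (rule integrable_real_indicator) (simp_all add: emeasure_eq_measure)

text \<open>Both functionals are bracketed by \<open>vol\<close>: a test function of an open U lies
  below the indicator of U, and a nonnegative function equal to 1 on U lies above it and above all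
  test functions of U.\<close>

lemma (in positive_functional) integral_rmeasure:
  assumes f: "continuous_on UNIV f" shows "(LINT x|rmeasure. f x) = \<Lambda> f"
proof -
  note I = integrable_continuous[OF compact_UNIV prob_space_rmeasure sets_rmeasure]
  let ?L = "\<lambda>f. LINT x|rmeasure. f x"
  have L: "positive_functional ?L" by (rule integral_positive_functional[OF compact_UNIV prob_space_rmeasure sets_rmeasure])
  show ?thesis
  proof (rule positive_functionals_agree[OF L positive_functional_axioms _ _ vol_nonneg vol_le_1 f])
    fix U :: "'x set" and f assume U: "open U" and ft: "f \<in> test U"
    have "?L f \<le> (LINT x|rmeasure. indicator U x)"
      by (rule integral_mono) (use testD[OF ft] U in \<open>auto intro!: I M.integrable_indicator split: split_indicator\<close>)
    then show "?L f \<le> vol U \<and> \<Lambda> f \<le> vol U"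
      using U vol_upper[OF ft] by (simp add: measure_rmeasure_open)
  next
    fix U :: "'x set" and f :: "'x \<Rightarrow> real"
    assume U: "open U" and fc: "continuous_on UNIV f" and f: "\<And>x. 0 \<le> f x" "\<And>x. x \<in> U \<Longrightarrow> f x = 1"
    have "(LINT x|rmeasure. indicator U x) \<le> ?L f"
      by (rule integral_mono) (use f U in \<open>auto intro!: I fc M.integrable_indicator split: split_indicator\<close>)
    moreover have "vol U \<le> \<Lambda> f"
    proof (rule vol_least)
      fix g assume g: "g \<in> test U"
      have "g x \<le> f x" for x using testD(2-4)[OF g, of x] f[of x] by (cases "x \<in> U") auto
      then show "\<Lambda> g \<le> \<Lambda> f" by (rule \<Lambda>_mono[OF testD(1)[OF g] fc])
    qed
    ultimately show "vol U \<le> ?L f \<and> vol U \<le> \<Lambda> f" using U by (simp add: measure_rmeasure_open)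
  qed
qed

text \<open>A Urysohn function fits between the indicators of a compact K and of an open U around
  it, so \<mu>(K) \<le> \<nu>(U); inner regularity of \<mu> replaces K by U.\<close>

lemma regular_borel_prob_le_open:
  fixes \<mu> \<nu> :: "'x::t2_space measure"
  assumes cpt: "compact (UNIV :: 'x set)" and \<mu>: "regular_borel_prob \<mu>" and \<nu>: "regular_borel_prob \<nu>"
    and eq: "\<And>f :: 'x \<Rightarrow> real. continuous_on UNIV f \<Longrightarrow> (LINT x|\<mu>. f x) = (LINT x|\<nu>. f x)"
    and U: "open U"
  shows "emeasure \<mu> U \<le> emeasure \<nu> U"
proof -
  have p\<mu>: "prob_space \<mu>" "sets \<mu> = sets borel" and p\<nu>: "prob_space \<nu>" "sets \<nu> = sets borel"
    using \<mu> \<nu> by (auto simp: regular_borel_prob_def)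
  interpret \<mu>: prob_space \<mu> by fact
  interpret \<nu>: prob_space \<nu> by fact
  have "emeasure \<mu> U = (SUP K\<in>{K. compact K \<and> K \<subseteq> U}. emeasure \<mu> K)"
    using \<mu> U unfolding regular_borel_prob_def by (metis borel_open)
  also have "\<dots> \<le> emeasure \<nu> U"
  proof (rule SUP_least)
    fix K assume "K \<in> {K. compact K \<and> K \<subseteq> U}"
    then have K: "closed K" "K \<subseteq> U" by (auto intro: compact_imp_closed)
    from Urysohn_compact[OF cpt K(1) U K(2)] obtain h :: "'x \<Rightarrow> real"
      where h': "continuous_on UNIV h \<and> (\<forall>x. 0 \<le> h x \<and> h x \<le> 1) \<and>
        (\<forall>x\<in>K. h x = 1) \<and> (\<forall>x. x \<notin> U \<longrightarrow> h x = 0)" ..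
    then have h: "continuous_on UNIV h" "0 \<le> h x" "h x \<le> 1" "x \<in> K \<Longrightarrow> h x = 1" "x \<notin> U \<Longrightarrow> h x = 0" for x by blast+
    have Kb: "K \<in> sets \<mu>" and Ub: "U \<in> sets \<nu>" using K U p\<mu> p\<nu> by auto
    have "measure \<mu> K = (LINT x|\<mu>. indicator K x)"
      using Kb sets.sets_into_space[OF Kb] by (simp add: Int_absorb2)
    also have "\<dots> \<le> (LINT x|\<mu>. h x)"
      by (rule integral_mono) (use Kb h in \<open>auto intro!: integrable_continuous[OF cpt p\<mu>] \<mu>.integrable_indicator split: split_indicator\<close>)
    also have "\<dots> = (LINT x|\<nu>. h x)" by (rule eq[OF h(1)])
    also have "\<dots> \<le> (LINT x|\<nu>. indicator U x)"
      by (rule integral_mono) (use Ub h in \<open>auto intro!: integrable_continuous[OF cpt p\<nu>] \<nu>.integrable_indicator split: split_indicator\<close>)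
    also have "\<dots> = measure \<nu> U"
      using Ub sets.sets_into_space[OF Ub] by (simp add: Int_absorb2)
    finally show "emeasure \<mu> K \<le> emeasure \<nu> U"
      by (simp add: \<mu>.emeasure_eq_measure \<nu>.emeasure_eq_measure)
  qed
  finally show ?thesis .
qed

lemma regular_borel_prob_outer:
  "\<lbrakk>regular_borel_prob \<mu>; E \<in> sets \<mu>\<rbrakk> \<Longrightarrow>
    emeasure \<mu> E = (INF V\<in>{V. open V \<and> E \<subseteq> V}. emeasure \<mu> V)"
  unfolding regular_borel_prob_def by blast

text \<open>Agreement on open sets comes from the previous inequality used both ways, and outer
  regularity carries it to all Borel sets.\<close>

lemma regular_borel_prob_eqI:
  fixes \<mu> \<nu> :: "'x::t2_space measure"
  assumes cpt: "compact (UNIV :: 'x set)" and \<mu>: "regular_borel_prob \<mu>" and \<nu>: "regular_borel_prob \<nu>"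
    and eq: "\<And>f :: 'x \<Rightarrow> real. continuous_on UNIV f \<Longrightarrow> (LINT x|\<mu>. f x) = (LINT x|\<nu>. f x)"
  shows "\<mu> = \<nu>"
proof (rule measure_eqI)
  have s: "sets \<mu> = sets borel" "sets \<nu> = sets borel" using \<mu> \<nu> by (auto simp: regular_borel_prob_def)
  then show "sets \<mu> = sets \<nu>" by simp
  have opens: "emeasure \<mu> U = emeasure \<nu> U" if "open U" for U
    using regular_borel_prob_le_open[OF cpt \<mu> \<nu> eq that] regular_borel_prob_le_open[OF cpt \<nu> \<mu> eq[symmetric] that]
    by (rule antisym)
  fix E assume E: "E \<in> sets \<mu>"
  have "emeasure \<mu> E = (INF V\<in>{V. open V \<and> E \<subseteq> V}. emeasure \<mu> V)"
    by (rule regular_borel_prob_outer[OF \<mu> E])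
  also have "\<dots> = (INF V\<in>{V. open V \<and> E \<subseteq> V}. emeasure \<nu> V)"
    by (intro INF_cong) (auto simp: opens)
  also have "\<dots> = emeasure \<nu> E"
    by (rule regular_borel_prob_outer[OF \<nu>, symmetric]) (use E s in simp)
  finally show "emeasure \<mu> E = emeasure \<nu> E" .
qed

lemma compact_apply_Bcontfun:
  fixes f :: "'x::topological_space \<Rightarrow> 'b::real_normed_vector"
  assumes "compact (UNIV :: 'x set)" "continuous_on UNIV f"
  shows "apply_bcontfun (Bcontfun f) x = f x"
proof -
  have "compact (f ` UNIV)" using assms by (intro compact_continuous_image) auto
  then obtain B where "\<And>x. norm (f x) \<le> B" by (meson bounded_iff compact_imp_bounded rangeI)
  then show ?thesis by (rule apply_Bcontfun[OF assms(2)])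
qed

text \<open>The construction is applied to real functions, on which \<phi> is real by
  \<open>state_cnj\<close>; real and imaginary parts recover the rest, for existence and for
  uniqueness.\<close>

theorem state_integral:
  fixes \<phi> :: "('x::t2_space \<Rightarrow>\<^sub>C complex) \<Rightarrow> complex"
  assumes cpt: "compact (UNIV :: 'x set)" and \<phi>: "state \<phi>"
  shows "\<exists>!\<mu>. regular_borel_prob \<mu> \<and> integral_state \<mu> = \<phi>"
proof -
  define C where "C f = Bcontfun (\<lambda>x. complex_of_real (f x))" for f :: "'x \<Rightarrow> real"
  have C: "apply_bcontfun (C f) x = complex_of_real (f x)" if "continuous_on UNIV f" for f x
    unfolding C_def by (intro compact_apply_Bcontfun cpt continuous_intros that)
  define \<Lambda> where "\<Lambda> f = Re (\<phi> (C f))" for f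
  have "positive_functional \<Lambda>"
  proof
    fix f g :: "'x \<Rightarrow> real" and c :: real
    assume f: "continuous_on UNIV f"
    have "C (\<lambda>x. c * f x) = cfun_scale (of_real c) (C f)"
      by (rule bcontfun_eqI) (use f in \<open>simp add: C continuous_intros\<close>)
    then show "\<Lambda> (\<lambda>x. c * f x) = c * \<Lambda> f" by (simp add: \<Lambda>_def state_scale[OF \<phi>])
    show "0 \<le> \<Lambda> f" if "\<And>x. 0 \<le> f x"
      unfolding \<Lambda>_def by (rule state_pos[OF \<phi>]) (use that f in \<open>simp_all add: C\<close>)
    assume g: "continuous_on UNIV g"
    have "C (\<lambda>x. f x + g x) = C f + C g"
      by (rule bcontfun_eqI) (use f g in \<open>simp add: C continuous_intros\<close>)
    then show "\<Lambda> (\<lambda>x. f x + g x) = \<Lambda> f + \<Lambda> g" by (simp add: \<Lambda>_def state_add[OF \<phi>])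
  next
    have "C (\<lambda>_. 1) = const_bcontfun 1" by (rule bcontfun_eqI) (simp add: C)
    then show "\<Lambda> (\<lambda>_. 1) = 1" by (simp add: \<Lambda>_def state_one[OF \<phi>])
  qed (rule cpt)
  then interpret positive_functional \<Lambda> .
  have real: "\<phi> f = of_real (Re (\<phi> f))" if "\<And>x. Im (apply_bcontfun f x) = 0" for f
  proof -
    have "cfun_cnj f = f" by (rule bcontfun_eqI) (use that in \<open>simp add: complex_eq_iff\<close>)
    then have "cnj (\<phi> f) = \<phi> f" using state_cnj[OF \<phi>, of f] by simp
    then show ?thesis by (simp add: complex_eq_iff)
  qed
  have re_im: "f = C (\<lambda>x. Re (apply_bcontfun f x)) + cfun_scale \<i> (C (\<lambda>x. Im (apply_bcontfun f x)))" for f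
    by (rule bcontfun_eqI) (simp add: C continuous_intros complex_eq_iff)
  have \<phi>_eq: "\<phi> f = of_real (\<Lambda> (\<lambda>x. Re (apply_bcontfun f x))) + \<i> * of_real (\<Lambda> (\<lambda>x. Im (apply_bcontfun f x)))" for f
  proof -
    have "\<phi> (C g) = of_real (\<Lambda> g)" if "continuous_on UNIV g" for g
      unfolding \<Lambda>_def by (rule real) (use that in \<open>simp add: C\<close>)
    then show ?thesis by (subst re_im[of f]) (simp add: state_add[OF \<phi>] state_scale[OF \<phi>] continuous_intros)
  qed
  have int_eq: "integral_state \<mu> f = of_real (LINT x|\<mu>. Re (apply_bcontfun f x)) + \<i> * of_real (LINT x|\<mu>. Im (apply_bcontfun f x))"
    if \<mu>: "regular_borel_prob \<mu>" for \<mu> :: "'x measure" and f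
  proof -
    have I: "integrable \<mu> (apply_bcontfun f)"
      using \<mu> by (intro integrable_continuous cpt) (auto simp: regular_borel_prob_def)
    show ?thesis unfolding integral_state_def using integral_Re[OF I] integral_Im[OF I]
      by (simp add: complex_eq_iff)
  qed
  show ?thesis
  proof (rule ex1I)
    show "regular_borel_prob rmeasure \<and> integral_state rmeasure = \<phi>"
      by (intro conjI ext regular_rmeasure)
        (simp add: int_eq[OF regular_rmeasure] \<phi>_eq integral_rmeasure continuous_intros)
    fix \<mu> assume \<mu>: "regular_borel_prob \<mu> \<and> integral_state \<mu> = \<phi>"
    show "\<mu> = rmeasure"
    proof (rule regular_borel_prob_eqI[OF cpt _ regular_rmeasure])
      show "regular_borel_prob \<mu>" using \<mu> by simp
      fix f :: "'x \<Rightarrow> real" assume f: "continuous_on UNIV f"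
      have "(LINT x|\<mu>. f x) = Re (integral_state \<mu> (C f))"
        using int_eq[of \<mu> "C f"] \<mu> by (simp add: C[OF f])
      then show "(LINT x|\<mu>. f x) = (LINT x|rmeasure. f x)"
        using \<mu> by (simp add: integral_rmeasure[OF f] \<Lambda>_def)
    qed
  qed
qed

section \<open>Fixed vectors of irreducible representations\<close>

lemma hdim_le: "\<lbrakk>finite B; B \<subseteq> S; S \<subseteq> hspan H B\<rbrakk> \<Longrightarrow> hdim H S \<le> enat (card B)"
  unfolding hdim_def by (rule Inf_lower) auto

text \<open>Irreducibility is left out on purpose: the locale is used a second time for \<pi>
  \<oplus> \<pi> on the double of H with the fixed vector (\<xi>, \<eta>), and that representation
  is reducible.\<close>

locale fixed_vector = crossed_system \<Gamma> act + H: hilbert_space H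
  for \<Gamma> :: "('g, 'm) monoid_scheme" and act :: "'g \<Rightarrow> 'x::topological_space \<Rightarrow> 'x"
    and H :: "('h, 'n) inner_module_scheme" +
  fixes \<pi> \<xi>
  assumes rep: "representation (crossed_product \<Gamma> act) H \<pi>"
    and fixed: "\<xi> \<in> fixed_vectors \<Gamma> act H \<pi>"
begin

lemma rep_CC: "representation CC H \<pi>"
  using rep by (simp add: crossed_product_def)

definition "\<sigma> f = \<pi> (cstar_embed A f)"

lemma rep_\<sigma>: "representation A H \<sigma>"
  using representation_embed[OF rep_CC] by (simp add: \<sigma>_def[abs_def])

lemmas \<sigma> = representationD[OF rep_\<sigma>]

text \<open>The restriction of \<pi> to C(X), sitting in the crossed product as the coefficients at
  the neutral element.\<close>

definition "\<pi>0 a = \<sigma> (delta \<one>\<^bsub>\<Gamma>\<^esub> a)"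

lemmas \<pi>0 = \<sigma>[OF delta_carrier[OF one_closed], folded \<pi>0_def]

lemma \<xi> [simp]: "\<xi> \<in> carrier H"
  using fixed by (simp add: fixed_vectors_def)

lemma group_unitary_eq: "group_unitary \<Gamma> act s = cstar_embed A (delta s (const_bcontfun 1))"
  by (simp add: group_unitary_def delta_def)

lemma unitary_fixed: "s \<in> carrier \<Gamma> \<Longrightarrow> \<sigma> (delta s (const_bcontfun 1)) \<xi> = \<xi>"
  using fixed by (simp add: fixed_vectors_def group_unitary_eq \<sigma>_def)

lemma \<pi>0_add: "\<eta> \<in> carrier H \<Longrightarrow> \<pi>0 (a + b) \<eta> = \<pi>0 a \<eta> \<oplus>\<^bsub>H\<^esub> \<pi>0 b \<eta>"
  using \<sigma>(2)[of "delta \<one>\<^bsub>\<Gamma>\<^esub> a" "delta \<one>\<^bsub>\<Gamma>\<^esub> b" \<eta>] by (simp add: \<pi>0_def delta_add A_add)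

lemma \<pi>0_scale: "\<eta> \<in> carrier H \<Longrightarrow> \<pi>0 (cfun_scale c a) \<eta> = c \<odot>\<^bsub>H\<^esub> \<pi>0 a \<eta>"
  using \<sigma>(3)[of "delta \<one>\<^bsub>\<Gamma>\<^esub> a" \<eta> c] by (simp add: \<pi>0_def smult_delta)

lemma \<pi>0_mult: "\<eta> \<in> carrier H \<Longrightarrow> \<pi>0 (cfun_mult a b) \<eta> = \<pi>0 a (\<pi>0 b \<eta>)"
  using \<sigma>(4)[of "delta \<one>\<^bsub>\<Gamma>\<^esub> a" "delta \<one>\<^bsub>\<Gamma>\<^esub> b" \<eta>] by (simp add: \<pi>0_def delta_mult_delta)

lemma \<pi>0_star: "\<lbrakk>\<eta> \<in> carrier H; \<zeta> \<in> carrier H\<rbrakk> \<Longrightarrow> hinner H (\<pi>0 a \<eta>) \<zeta> = hinner H \<eta> (\<pi>0 (cfun_cnj a) \<zeta>)"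
  using \<sigma>(5)[of "delta \<one>\<^bsub>\<Gamma>\<^esub> a" \<eta> \<zeta>] by (simp add: \<pi>0_def star_delta)

lemma \<pi>0_minus: "\<eta> \<in> carrier H \<Longrightarrow> \<pi>0 (a - b) \<eta> = \<pi>0 a \<eta> \<ominus>\<^bsub>H\<^esub> \<pi>0 b \<eta>"
proof -
  assume \<eta>: "\<eta> \<in> carrier H"
  have "\<pi>0 a \<eta> = \<pi>0 (a - b) \<eta> \<oplus>\<^bsub>H\<^esub> \<pi>0 b \<eta>" using \<pi>0_add[OF \<eta>, of "a - b" b] by simp
  then show ?thesis using \<pi>0(6)[OF \<eta>] by (intro H.hinner_ext) (auto simp: H.hinner_simps)
qed

text \<open>Representations need not be unital; the unit fixes \<xi> because it is the unitary of
  the neutral element.\<close>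

lemma \<pi>0_one: "\<pi>0 (const_bcontfun 1) \<xi> = \<xi>"
  unfolding \<pi>0_def by (rule unitary_fixed[OF one_closed])

lemma \<sigma>_fixed: "f \<in> carrier A \<Longrightarrow> \<sigma> f \<xi> = \<pi>0 (capply f (const_bcontfun 1)) \<xi>"
proof (induction f rule: A_induct)
  case zero
  show ?case by (simp add: \<pi>0_def)
next
  case (add s a f)
  have "delta \<one>\<^bsub>\<Gamma>\<^esub> a \<otimes>\<^bsub>A\<^esub> delta s (const_bcontfun 1) = delta s a"
    using add by (simp add: delta_mult_delta)
  then have "\<sigma> (delta s a) \<xi> = \<pi>0 a \<xi>"
    using \<sigma>(4)[of "delta \<one>\<^bsub>\<Gamma>\<^esub> a" "delta s (const_bcontfun 1)" \<xi>] add unitary_fixed[of s]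
    by (simp add: \<pi>0_def)
  moreover have "\<sigma> (delta s a + f) \<xi> = \<sigma> (delta s a) \<xi> \<oplus>\<^bsub>H\<^esub> \<sigma> f \<xi>"
    using \<sigma>(2)[of "delta s a" f \<xi>] add by (simp add: A_add)
  ultimately show ?case using add by (simp add: capply_add_left \<pi>0_add)
qed

text \<open>A monomial sends b \<xi> to a \<alpha>_s(b) \<open>u\<^sub>s\<close> \<xi> = a
  \<alpha>_s(b) \<xi>. So the C(X)-orbit of \<xi> is invariant under C_c(\<Gamma>, A), which acts on
  it by \<open>capply\<close>.\<close>

lemma \<sigma>_\<pi>0: "f \<in> carrier A \<Longrightarrow> \<sigma> f (\<pi>0 b \<xi>) = \<pi>0 (capply f b) \<xi>"
proof -
  assume f: "f \<in> carrier A"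
  have "\<sigma> f (\<pi>0 b \<xi>) = \<sigma> (f \<otimes>\<^bsub>A\<^esub> delta \<one>\<^bsub>\<Gamma>\<^esub> b) \<xi>"
    using \<sigma>(4)[OF f, of "delta \<one>\<^bsub>\<Gamma>\<^esub> b" \<xi>] by (simp add: \<pi>0_def)
  also have "\<dots> = \<pi>0 (capply f b) \<xi>"
    using f by (simp add: \<sigma>_fixed capply_mult)
  finally show ?thesis .
qed

definition "orbit_space = range (\<lambda>a. \<pi>0 a \<xi>)"

lemma orbit_space: "subspace_of H orbit_space"
proof -
  have "\<pi>0 0 \<xi> = \<zero>\<^bsub>H\<^esub>" using \<pi>0_scale[of \<xi> 0 0] \<pi>0(6)[of \<xi> 0] by simp
  then show ?thesis
    unfolding subspace_of_def orbit_space_def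
    using \<pi>0(6)[OF \<xi>] by (auto simp flip: \<pi>0_add \<pi>0_scale intro: range_eqI[of _ _ 0])
qed

lemma orbit_carrier: "orbit_space \<subseteq> carrier H"
  using orbit_space by (simp add: subspace_of_def)

lemma \<xi>_orbit: "\<xi> \<in> orbit_space"
  unfolding orbit_space_def by (rule range_eqI[of _ _ "const_bcontfun 1"]) (simp add: \<pi>0_one)

text \<open>Elements of the completion are limits of C_c(\<Gamma>, A) and so carry the orbit into
  its closure; this step is where automatic continuity of \<pi> is used.\<close>

lemma orbit_projection:
  obtains Q where "Q \<in> commutant CC H \<pi>" "\<And>x. x \<in> carrier H \<Longrightarrow> Q x \<in> hclosure H orbit_space"
    "\<And>x. x \<in> hclosure H orbit_space \<Longrightarrow> Q x = x"
proof (rule H.projection_in_commutant[OF orbit_space rep_CC _ CC_star_closed])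
  fix P v assume "P \<in> carrier CC" and v: "v \<in> orbit_space"
  then obtain X where X: "X \<in> CS" "P = cls X" using CC_ex by blast
  obtain b where b: "v = \<pi>0 b \<xi>" using v by (auto simp: orbit_space_def)
  have vC: "v \<in> carrier H" using v orbit_carrier by blast
  have "hconv H (\<lambda>m. \<sigma> (X m) v) (\<pi> (cls X) v)"
    unfolding \<sigma>_def by (rule representation_continuous[OF H.hilbert_space_axioms rep_CC X(1) vC])
  moreover have "\<sigma> (X m) v \<in> orbit_space" for m
    unfolding b \<sigma>_\<pi>0[OF CS_V[OF X(1)]] orbit_space_def by (rule rangeI)
  ultimately show "\<pi> P v \<in> hclosure H orbit_space"
    unfolding X(2) using orbit_carrier representationD(6)[OF rep_CC CC_cls[OF X(1)] vC]
    by (intro H.hconv_hclosure[of "\<lambda>m. \<sigma> (X m) v"]) auto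
qed (assumption, rule that)

end

section \<open>Irreducibility: cyclicity and uniqueness of the fixed vector up to scalars\<close>

locale irreducible_fixed_vector = fixed_vector +
  assumes irr: "irreducible_rep (crossed_product \<Gamma> act) H \<pi>" and \<xi>_nonzero: "\<xi> \<noteq> \<zero>\<^bsub>H\<^esub>"
begin

lemma commutant_scalar: "T \<in> commutant CC H \<pi> \<Longrightarrow> \<exists>c. \<forall>x\<in>carrier H. T x = c \<odot>\<^bsub>H\<^esub> x"
  using irr by (simp add: irreducible_rep_def crossed_product_def)

lemma smult_cancel: "c \<odot>\<^bsub>H\<^esub> \<xi> = c' \<odot>\<^bsub>H\<^esub> \<xi> \<Longrightarrow> c = c'"
proof -
  assume "c \<odot>\<^bsub>H\<^esub> \<xi> = c' \<odot>\<^bsub>H\<^esub> \<xi>"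
  then have "hinner H (c \<odot>\<^bsub>H\<^esub> \<xi>) \<xi> = hinner H (c' \<odot>\<^bsub>H\<^esub> \<xi>) \<xi>" by simp
  then have "c * hinner H \<xi> \<xi> = c' * hinner H \<xi> \<xi>" by (simp add: H.hinner_smult_left)
  moreover have "hinner H \<xi> \<xi> \<noteq> 0" using H.hinner_definite[OF \<xi>] \<xi>_nonzero by blast
  ultimately show ?thesis by simp
qed

text \<open>The projection onto the closed orbit is a scalar and fixes the nonzero vector \<xi>, so
  the scalar is 1.\<close>

lemma cyclic: "x \<in> carrier H \<Longrightarrow> x \<in> hclosure H orbit_space"
proof -
  assume x: "x \<in> carrier H"
  obtain Q where Q: "Q \<in> commutant CC H \<pi>" "\<And>x. x \<in> carrier H \<Longrightarrow> Q x \<in> hclosure H orbit_space"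
    "\<And>x. x \<in> hclosure H orbit_space \<Longrightarrow> Q x = x"
    by (rule orbit_projection) (rule that)
  obtain c where c: "\<forall>x\<in>carrier H. Q x = c \<odot>\<^bsub>H\<^esub> x" using commutant_scalar[OF Q(1)] ..
  have "\<xi> \<in> hclosure H orbit_space" using H.hclosure_superset[OF orbit_carrier] \<xi>_orbit by blast
  then have "c \<odot>\<^bsub>H\<^esub> \<xi> = 1 \<odot>\<^bsub>H\<^esub> \<xi>" using Q(3)[of \<xi>] c by simp
  then have "c = 1" by (rule smult_cancel)
  then have "Q x = x" using c x by simp
  then show ?thesis using Q(2)[OF x] by simp
qed

lemma cyclic_seq:
  assumes x: "x \<in> carrier H" shows "\<exists>X. hconv H (\<lambda>n. \<pi>0 (X n) \<xi>) x"
proof -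
  obtain V where V: "\<And>n. V n \<in> orbit_space" "hconv H V x" "x \<in> carrier H"
    by (rule H.hclosureE[OF cyclic[OF x] orbit_carrier]) (rule that)
  have "\<forall>n. \<exists>a. V n = \<pi>0 a \<xi>" using V(1) by (auto simp: orbit_space_def)
  from choice[OF this] obtain X where "\<forall>n. V n = \<pi>0 (X n) \<xi>" ..
  then have "V = (\<lambda>n. \<pi>0 (X n) \<xi>)" by (simp add: fun_eq_iff)
  then show ?thesis using V(2) by blast
qed

text \<open>The difference x - y is orthogonal to the orbit, hence to its closure, which contains x
  - y itself.\<close>

lemma cyclic_ext:
  assumes x: "x \<in> carrier H" and y: "y \<in> carrier H"
    and eq: "\<And>a. hinner H (\<pi>0 a \<xi>) x = hinner H (\<pi>0 a \<xi>) y"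
  shows "x = y"
proof -
  have xy: "x \<ominus>\<^bsub>H\<^esub> y \<in> carrier H" using x y by simp
  have o: "hinner H (x \<ominus>\<^bsub>H\<^esub> y) v = 0" if "v \<in> orbit_space" for v
  proof -
    obtain a where v: "v = \<pi>0 a \<xi>" using \<open>v \<in> orbit_space\<close> unfolding orbit_space_def by blast
    have vC: "v \<in> carrier H" using \<open>v \<in> orbit_space\<close> orbit_carrier by blast
    have "hinner H v (x \<ominus>\<^bsub>H\<^esub> y) = 0" using eq[of a] x y vC by (simp add: H.hinner_minus_right v)
    then show ?thesis using H.hinner_commute[OF xy vC] by simp
  qed
  have "hinner H (x \<ominus>\<^bsub>H\<^esub> y) (x \<ominus>\<^bsub>H\<^esub> y) = 0"
    by (rule H.hclosure_orthogonal[OF orbit_carrier xy _ cyclic[OF xy]]) (use o in blast)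
  then have "hnorm H (x \<ominus>\<^bsub>H\<^esub> y) = 0" by (simp add: hnorm_def)
  then show ?thesis using x y by (simp add: H.hnorm_minus_eq_zero)
qed

definition "pair_rep P = (\<lambda>(x, y). (\<pi> P x, \<pi> P y))"

lemma pair_rep_simp [simp]: "pair_rep P (x, y) = (\<pi> P x, \<pi> P y)"
  by (simp add: pair_rep_def)

abbreviation "HH \<equiv> direct_sum H H"

lemma hilbert_HH: "hilbert_space HH"
  by (rule hilbert_space_direct_sum[OF H.hilbert_space_axioms H.hilbert_space_axioms])

lemma hnorm_HH: "\<lbrakk>x \<in> carrier H; y \<in> carrier H\<rbrakk> \<Longrightarrow> hnorm HH (x, y) = sqrt ((hnorm H x)\<^sup>2 + (hnorm H y)\<^sup>2)"
  by (simp add: hnorm_def H.hinner_nonneg)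

lemma pair_rep: "representation CC HH pair_rep"
proof -
  note D = representationD[OF rep_CC]
  show ?thesis
    unfolding representation_def
  proof (intro conjI ballI allI)
    fix P assume P: "P \<in> carrier CC"
    note L = H.linear_mapD[OF H.bounded_operatorD(1)[OF D(1)[OF P]]]
    obtain K where K: "K \<ge> 0" "\<forall>x\<in>carrier H. hnorm H (\<pi> P x) \<le> K * hnorm H x"
      using H.bounded_operatorD(2)[OF D(1)[OF P]] by blast
    have "hnorm HH (pair_rep P z) \<le> K * hnorm HH z" if z: "z \<in> carrier HH" for z
    proof -
      obtain x y where xy: "z = (x, y)" "x \<in> carrier H" "y \<in> carrier H" using z by auto
      have "(hnorm H (\<pi> P x))\<^sup>2 + (hnorm H (\<pi> P y))\<^sup>2 \<le> (K * hnorm H x)\<^sup>2 + (K * hnorm H y)\<^sup>2"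
        using K xy D(6)[OF P] by (intro add_mono power_mono) auto
      also have "\<dots> = K\<^sup>2 * ((hnorm H x)\<^sup>2 + (hnorm H y)\<^sup>2)" by (simp add: power_mult_distrib algebra_simps)
      finally have "sqrt ((hnorm H (\<pi> P x))\<^sup>2 + (hnorm H (\<pi> P y))\<^sup>2) \<le> sqrt (K\<^sup>2 * ((hnorm H x)\<^sup>2 + (hnorm H y)\<^sup>2))"
        by simp
      then show ?thesis using xy K(1) D(6)[OF P] by (simp add: hnorm_HH real_sqrt_mult)
    qed
    moreover have "linear_map HH HH (pair_rep P)"
      unfolding linear_map_def using L by auto
    ultimately show "bounded_operator HH (pair_rep P)" unfolding bounded_operator_def by blast
    fix z c assume "z \<in> carrier HH"
    then obtain x y where xy: "z = (x, y)" "x \<in> carrier H" "y \<in> carrier H" by auto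
    show "pair_rep (c \<odot>\<^bsub>CC\<^esub> P) z = c \<odot>\<^bsub>HH\<^esub> pair_rep P z" using xy D(3)[OF P] by simp
    fix w assume "w \<in> carrier HH"
    then obtain x' y' where xy': "w = (x', y')" "x' \<in> carrier H" "y' \<in> carrier H" by auto
    show "hinner HH (pair_rep P z) w = hinner HH z (pair_rep (star CC P) w)"
      using D(5)[OF P xy(2) xy'(2)] D(5)[OF P xy(3) xy'(3)] by (simp add: xy(1) xy'(1))
  next
    fix P Q z assume P: "P \<in> carrier CC" and Q: "Q \<in> carrier CC" and "z \<in> carrier HH"
    then obtain x y where xy: "z = (x, y)" "x \<in> carrier H" "y \<in> carrier H" by auto
    show "pair_rep (P \<oplus>\<^bsub>CC\<^esub> Q) z = pair_rep P z \<oplus>\<^bsub>HH\<^esub> pair_rep Q z"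
      using D(2)[OF P Q xy(2)] D(2)[OF P Q xy(3)] by (simp add: xy(1))
    show "pair_rep (P \<otimes>\<^bsub>CC\<^esub> Q) z = pair_rep P (pair_rep Q z)"
      using D(4)[OF P Q xy(2)] D(4)[OF P Q xy(3)] by (simp add: xy(1))
  qed
qed

text \<open>Here \<iota> stands for either inclusion of H into the double and p for either
  coordinate, so that one statement covers all four matrix entries of Q.\<close>

lemma commutant_corner:
  assumes Q: "Q \<in> commutant CC HH pair_rep"
    and \<iota>: "linear_map H HH \<iota>" "\<And>x. x \<in> carrier H \<Longrightarrow> hnorm HH (\<iota> x) = hnorm H x"
      "\<And>P x. P \<in> carrier CC \<Longrightarrow> x \<in> carrier H \<Longrightarrow> \<iota> (\<pi> P x) = pair_rep P (\<iota> x)"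
    and p: "linear_map HH H p" "\<And>z. z \<in> carrier HH \<Longrightarrow> hnorm H (p z) \<le> hnorm HH z"
      "\<And>P z. P \<in> carrier CC \<Longrightarrow> z \<in> carrier HH \<Longrightarrow> p (pair_rep P z) = \<pi> P (p z)"
  shows "\<exists>c. \<forall>x\<in>carrier H. p (Q (\<iota> x)) = c \<odot>\<^bsub>H\<^esub> x"
proof (rule commutant_scalar)
  interpret HH: hilbert_space HH by (rule hilbert_HH)
  have bQ: "bounded_operator HH Q" and cQ: "\<And>P z. P \<in> carrier CC \<Longrightarrow> z \<in> carrier HH \<Longrightarrow> Q (pair_rep P z) = pair_rep P (Q z)"
    using Q by (auto simp: commutant_def)
  note LQ = HH.linear_mapD[OF HH.bounded_operatorD(1)[OF bQ]]
  note L\<iota> = H.linear_mapD[OF \<iota>(1)]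
  note Lp = HH.linear_mapD[OF p(1)]
  obtain K where K: "K \<ge> 0" "\<forall>z\<in>carrier HH. hnorm HH (Q z) \<le> K * hnorm HH z"
    using HH.bounded_operatorD(2)[OF bQ] by blast
  have lin: "linear_map H H (\<lambda>x. p (Q (\<iota> x)))"
    unfolding linear_map_def
  proof (intro conjI ballI allI Pi_I)
    fix x y c assume x: "x \<in> carrier H"
    show "p (Q (\<iota> x)) \<in> carrier H" by (rule Lp(1)[OF LQ(1)[OF L\<iota>(1)[OF x]]])
    show "p (Q (\<iota> (c \<odot>\<^bsub>H\<^esub> x))) = c \<odot>\<^bsub>H\<^esub> p (Q (\<iota> x))"
      unfolding L\<iota>(3)[OF x] LQ(3)[OF L\<iota>(1)[OF x]] by (rule Lp(3)[OF LQ(1)[OF L\<iota>(1)[OF x]]])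
    assume y: "y \<in> carrier H"
    show "p (Q (\<iota> (x \<oplus>\<^bsub>H\<^esub> y))) = p (Q (\<iota> x)) \<oplus>\<^bsub>H\<^esub> p (Q (\<iota> y))"
      unfolding L\<iota>(2)[OF x y] LQ(2)[OF L\<iota>(1)[OF x] L\<iota>(1)[OF y]]
      by (rule Lp(2)[OF LQ(1)[OF L\<iota>(1)[OF x]] LQ(1)[OF L\<iota>(1)[OF y]]])
  qed
  have "hnorm H (p (Q (\<iota> x))) \<le> K * hnorm H x" if x: "x \<in> carrier H" for x
  proof -
    have "hnorm H (p (Q (\<iota> x))) \<le> hnorm HH (Q (\<iota> x))" by (rule p(2)[OF LQ(1)[OF L\<iota>(1)[OF x]]])
    also have "\<dots> \<le> K * hnorm HH (\<iota> x)" using K(2) L\<iota>(1)[OF x] by blast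
    finally show ?thesis unfolding \<iota>(2)[OF x] .
  qed
  then have b: "bounded_operator H (\<lambda>x. p (Q (\<iota> x)))" unfolding bounded_operator_def using lin by blast
  have "p (Q (\<iota> (\<pi> P x))) = \<pi> P (p (Q (\<iota> x)))" if P: "P \<in> carrier CC" and x: "x \<in> carrier H" for P x
    unfolding \<iota>(3)[OF P x] cQ[OF P L\<iota>(1)[OF x]] by (rule p(3)[OF P LQ(1)[OF L\<iota>(1)[OF x]]])
  then show "(\<lambda>x. p (Q (\<iota> x))) \<in> commutant CC H \<pi>"
    unfolding commutant_def using b by simp
qed

text \<open>If \<open>\<eta>\<close> were not a multiple of \<open>\<xi>\<close>, the projection onto the closure of
  \<open>{(a \<xi>, a \<eta>) | a \<in> C(X)}\<close>, whose entries are scalars, would be the identity. Then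
  \<open>(a\<^sub>n \<xi>, a\<^sub>n \<eta>) \<longlonglongrightarrow> (\<eta>, 0)\<close> for some \<open>a\<^sub>n\<close>. As \<open>C(X)\<close> is commutative,
  \<open>\<parallel>a\<^sub>n\<^sup>* \<eta>\<parallel> = \<parallel>a\<^sub>n \<eta>\<parallel>\<close>, so
  \<open>\<langle>\<eta>, \<eta>\<rangle> = lim \<langle>a\<^sub>n \<xi>, \<eta>\<rangle> = lim \<langle>\<xi>, a\<^sub>n\<^sup>* \<eta>\<rangle> = 0\<close>.\<close>

lemma fixed_vectors_multiple:
  assumes \<eta>: "\<eta> \<in> fixed_vectors \<Gamma> act H \<pi>"
  shows "\<exists>c. \<eta> = c \<odot>\<^bsub>H\<^esub> \<xi>"
proof (rule ccontr)
  assume neg: "\<nexists>c. \<eta> = c \<odot>\<^bsub>H\<^esub> \<xi>"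
  have \<eta>C [simp]: "\<eta> \<in> carrier H" using \<eta> by (simp add: fixed_vectors_def)
  \<comment> \<open>As \<eta> is not a multiple of \<xi>, coefficients can be compared; a nonzero c'
    could be divided out.\<close>
  have indep: "c = 1 \<and> c' = 0" if eq: "c \<odot>\<^bsub>H\<^esub> \<xi> \<oplus>\<^bsub>H\<^esub> c' \<odot>\<^bsub>H\<^esub> \<eta> = \<xi>" for c c'
  proof -
    have "c' = 0"
    proof (rule ccontr)
      assume c': "c' \<noteq> 0"
      have "c' \<odot>\<^bsub>H\<^esub> \<eta> = (1 - c) \<odot>\<^bsub>H\<^esub> \<xi>"
      proof (rule H.hinner_ext)
        fix z assume z: "z \<in> carrier H"
        have "hinner H (c \<odot>\<^bsub>H\<^esub> \<xi> \<oplus>\<^bsub>H\<^esub> c' \<odot>\<^bsub>H\<^esub> \<eta>) z = hinner H \<xi> z" by (simp add: eq)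
        then show "hinner H (c' \<odot>\<^bsub>H\<^esub> \<eta>) z = hinner H ((1 - c) \<odot>\<^bsub>H\<^esub> \<xi>) z"
          using z by (simp add: H.hinner_simps algebra_simps)
      qed auto
      then have "hinner H \<eta> z = hinner H (((1 - c) / c') \<odot>\<^bsub>H\<^esub> \<xi>) z" if z: "z \<in> carrier H" for z
      proof -
        have "c' * hinner H \<eta> z = (1 - c) * hinner H \<xi> z"
          using arg_cong[OF \<open>c' \<odot>\<^bsub>H\<^esub> \<eta> = (1 - c) \<odot>\<^bsub>H\<^esub> \<xi>\<close>, of "\<lambda>v. hinner H v z"] z by (simp add: H.hinner_simps)
        then show ?thesis using c' z by (simp add: H.hinner_simps field_simps)
      qed
      then have "\<eta> = ((1 - c) / c') \<odot>\<^bsub>H\<^esub> \<xi>" by (intro H.hinner_ext) auto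
      then show False using neg by blast
    qed
    moreover have "c = 1" using eq \<open>c' = 0\<close> smult_cancel[of c 1] by simp
    ultimately show ?thesis by simp
  qed
  \<comment> \<open>Adding \<xi> - \<eta> to both sides gives the situation of \<open>indep\<close>
    with first coefficient 1 + c.\<close>
  have indep2: "c = 0" if eq: "c \<odot>\<^bsub>H\<^esub> \<xi> \<oplus>\<^bsub>H\<^esub> c' \<odot>\<^bsub>H\<^esub> \<eta> = \<eta>" for c c'
  proof -
    have "(1 + c) \<odot>\<^bsub>H\<^esub> \<xi> \<oplus>\<^bsub>H\<^esub> (c' - 1) \<odot>\<^bsub>H\<^esub> \<eta> = \<xi>"
    proof (rule H.hinner_ext)
      fix z assume z: "z \<in> carrier H"
      have "hinner H (c \<odot>\<^bsub>H\<^esub> \<xi> \<oplus>\<^bsub>H\<^esub> c' \<odot>\<^bsub>H\<^esub> \<eta>) z = hinner H \<eta> z" by (simp add: eq)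
      then show "hinner H ((1 + c) \<odot>\<^bsub>H\<^esub> \<xi> \<oplus>\<^bsub>H\<^esub> (c' - 1) \<odot>\<^bsub>H\<^esub> \<eta>) z = hinner H \<xi> z"
        using z by (simp add: H.hinner_simps algebra_simps)
    qed auto
    then show ?thesis using indep by fastforce
  qed
  have fv: "fixed_vector \<Gamma> act HH pair_rep (\<xi>, \<eta>)"
  proof (intro fixed_vector.intro fixed_vector_axioms.intro)
    show "crossed_system \<Gamma> act" by unfold_locales
    show "hilbert_space HH" by (rule hilbert_HH)
    show "representation (crossed_product \<Gamma> act) HH pair_rep"
      using pair_rep by (simp add: crossed_product_def)
    show "(\<xi>, \<eta>) \<in> fixed_vectors \<Gamma> act HH pair_rep"
      using \<eta> fixed by (simp add: fixed_vectors_def)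
  qed
  \<comment> \<open>The second use of the locale, whose orbit consists of the pairs (a \<xi>, a
    \<eta>).\<close>
  interpret D: fixed_vector \<Gamma> act HH pair_rep "(\<xi>, \<eta>)" by (rule fv)
  have D0: "D.\<pi>0 a (x, y) = (\<pi>0 a x, \<pi>0 a y)" for a x y
    by (simp add: D.\<pi>0_def \<pi>0_def D.\<sigma>_def \<sigma>_def)
  obtain Q where Q: "Q \<in> commutant CC HH pair_rep" "\<And>x. x \<in> carrier HH \<Longrightarrow> Q x \<in> hclosure HH D.orbit_space"
    "\<And>x. x \<in> hclosure HH D.orbit_space \<Longrightarrow> Q x = x"
    by (rule D.orbit_projection) (rule that)
  have bQ: "bounded_operator HH Q" using Q(1) by (simp add: commutant_def)
  note LQ = D.H.linear_mapD[OF D.H.bounded_operatorD(1)[OF bQ]]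
  have z: "\<pi> P \<zero>\<^bsub>H\<^esub> = \<zero>\<^bsub>H\<^esub>" if "P \<in> carrier CC" for P
    using H.linear_mapD(3)[OF H.bounded_operatorD(1)[OF representationD(1)[OF rep_CC that]], of "\<zero>\<^bsub>H\<^esub>" 0]
      representationD(6)[OF rep_CC that, of "\<zero>\<^bsub>H\<^esub>"] by simp
  have i1: "linear_map H HH (\<lambda>x. (x, \<zero>\<^bsub>H\<^esub>))" and i2: "linear_map H HH (\<lambda>x. (\<zero>\<^bsub>H\<^esub>, x))"
    and p1: "linear_map HH H fst" and p2: "linear_map HH H snd"
    by (auto simp: linear_map_def)
  have n1: "hnorm H (fst v) \<le> hnorm HH v" and n2: "hnorm H (snd v) \<le> hnorm HH v" if "v \<in> carrier HH" for v
    using that by (auto simp: hnorm_HH intro!: real_le_rsqrt)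
  note corner = commutant_corner[OF Q(1)]
  have "\<exists>c. \<forall>x\<in>carrier H. fst (Q (x, \<zero>\<^bsub>H\<^esub>)) = c \<odot>\<^bsub>H\<^esub> x"
    by (rule corner[OF i1 _ _ p1 n1]) (auto simp: hnorm_HH z)
  then obtain q11 where q11: "\<And>x. x \<in> carrier H \<Longrightarrow> fst (Q (x, \<zero>\<^bsub>H\<^esub>)) = q11 \<odot>\<^bsub>H\<^esub> x" by blast
  have "\<exists>c. \<forall>x\<in>carrier H. snd (Q (x, \<zero>\<^bsub>H\<^esub>)) = c \<odot>\<^bsub>H\<^esub> x"
    by (rule corner[OF i1 _ _ p2 n2]) (auto simp: hnorm_HH z)
  then obtain q21 where q21: "\<And>x. x \<in> carrier H \<Longrightarrow> snd (Q (x, \<zero>\<^bsub>H\<^esub>)) = q21 \<odot>\<^bsub>H\<^esub> x" by blast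
  have "\<exists>c. \<forall>x\<in>carrier H. fst (Q (\<zero>\<^bsub>H\<^esub>, x)) = c \<odot>\<^bsub>H\<^esub> x"
    by (rule corner[OF i2 _ _ p1 n1]) (auto simp: hnorm_HH z)
  then obtain q12 where q12: "\<And>x. x \<in> carrier H \<Longrightarrow> fst (Q (\<zero>\<^bsub>H\<^esub>, x)) = q12 \<odot>\<^bsub>H\<^esub> x" by blast
  have "\<exists>c. \<forall>x\<in>carrier H. snd (Q (\<zero>\<^bsub>H\<^esub>, x)) = c \<odot>\<^bsub>H\<^esub> x"
    by (rule corner[OF i2 _ _ p2 n2]) (auto simp: hnorm_HH z)
  then obtain q22 where q22: "\<And>x. x \<in> carrier H \<Longrightarrow> snd (Q (\<zero>\<^bsub>H\<^esub>, x)) = q22 \<odot>\<^bsub>H\<^esub> x" by blast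
  have "(\<xi>, \<eta>) \<in> hclosure HH D.orbit_space"
    using D.H.hclosure_superset[OF D.orbit_carrier] D.\<xi>_orbit by blast
  then have Q_fix: "Q (\<xi>, \<eta>) = (\<xi>, \<eta>)" by (rule Q(3))
  have "Q (\<xi>, \<eta>) = Q (\<xi>, \<zero>\<^bsub>H\<^esub>) \<oplus>\<^bsub>HH\<^esub> Q (\<zero>\<^bsub>H\<^esub>, \<eta>)"
    using LQ(2)[of "(\<xi>, \<zero>\<^bsub>H\<^esub>)" "(\<zero>\<^bsub>H\<^esub>, \<eta>)"] by simp
  also have "Q (\<xi>, \<zero>\<^bsub>H\<^esub>) = (q11 \<odot>\<^bsub>H\<^esub> \<xi>, q21 \<odot>\<^bsub>H\<^esub> \<xi>)"
    using q11[OF \<xi>] q21[OF \<xi>] by (simp add: prod_eq_iff)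
  also have "Q (\<zero>\<^bsub>H\<^esub>, \<eta>) = (q12 \<odot>\<^bsub>H\<^esub> \<eta>, q22 \<odot>\<^bsub>H\<^esub> \<eta>)"
    using q12[OF \<eta>C] q22[OF \<eta>C] by (simp add: prod_eq_iff)
  finally have "q11 \<odot>\<^bsub>H\<^esub> \<xi> \<oplus>\<^bsub>H\<^esub> q12 \<odot>\<^bsub>H\<^esub> \<eta> = \<xi>" "q21 \<odot>\<^bsub>H\<^esub> \<xi> \<oplus>\<^bsub>H\<^esub> q22 \<odot>\<^bsub>H\<^esub> \<eta> = \<eta>"
    by (simp_all add: Q_fix)
  then have "q11 = 1" "q21 = 0" using indep indep2 by blast+
  \<comment> \<open>The first column of the matrix already suffices: it shows that (\<eta>, 0) lies
    in the closure of the orbit of pairs.\<close>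
  then have "Q (\<eta>, \<zero>\<^bsub>H\<^esub>) = (\<eta>, \<zero>\<^bsub>H\<^esub>)"
    using q11[OF \<eta>C] q21[OF \<eta>C] by (simp add: prod_eq_iff)
  then have "(\<eta>, \<zero>\<^bsub>H\<^esub>) \<in> hclosure HH D.orbit_space" using Q(2)[of "(\<eta>, \<zero>\<^bsub>H\<^esub>)"] by simp
  then obtain V where V: "\<And>n. V n \<in> D.orbit_space" "hconv HH V (\<eta>, \<zero>\<^bsub>H\<^esub>)" "(\<eta>, \<zero>\<^bsub>H\<^esub>) \<in> carrier HH"
    by (rule D.H.hclosureE[OF _ D.orbit_carrier]) (rule that)
  have "\<forall>n. \<exists>a. V n = (\<pi>0 a \<xi>, \<pi>0 a \<eta>)" using V(1) by (auto simp: D.orbit_space_def D0)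
  from choice[OF this] obtain a where a: "\<forall>n. V n = (\<pi>0 (a n) \<xi>, \<pi>0 (a n) \<eta>)" ..
  have VC: "V n \<in> carrier HH" for n using V(1) D.orbit_carrier by blast
  have "hconv H (\<lambda>n. fst (V n)) (fst (\<eta>, \<zero>\<^bsub>H\<^esub>))"
    by (rule D.H.hconv_lipschitz_map[OF H.hilbert_space_axioms p1 _ VC V(3,2), where C=1]) (use n1 in simp)
  then have 1: "hconv H (\<lambda>n. \<pi>0 (a n) \<xi>) \<eta>" by (simp add: a)
  have "hconv H (\<lambda>n. snd (V n)) (snd (\<eta>, \<zero>\<^bsub>H\<^esub>))"
    by (rule D.H.hconv_lipschitz_map[OF H.hilbert_space_axioms p2 _ VC V(3,2), where C=1]) (use n2 in simp)
  then have 2: "hconv H (\<lambda>n. \<pi>0 (a n) \<eta>) \<zero>\<^bsub>H\<^esub>" by (simp add: a)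
  have 3: "(\<lambda>n. hnorm H (\<pi>0 (a n) \<eta>)) \<longlonglongrightarrow> 0"
    using H.hconv_hnorm[OF \<pi>0(6)[OF \<eta>C] H.zero_closed 2] by simp
  have normal: "hnorm H (\<pi>0 (cfun_cnj b) \<eta>) = hnorm H (\<pi>0 b \<eta>)" for b
  proof -
    have "hinner H (\<pi>0 (cfun_cnj b) \<eta>) (\<pi>0 (cfun_cnj b) \<eta>) = hinner H (\<pi>0 b \<eta>) (\<pi>0 b \<eta>)"
      using \<pi>0(6)[OF \<eta>C] by (simp add: \<pi>0_star flip: \<pi>0_mult) (simp add: cfun_mult_commute)
    then show ?thesis by (simp add: hnorm_def)
  qed
  have "(\<lambda>n. hinner H (\<pi>0 (a n) \<xi>) \<eta>) \<longlonglongrightarrow> hinner H \<eta> \<eta>"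
    by (rule H.hconv_hinner[OF \<pi>0(6)[OF \<xi>] \<eta>C \<eta>C 1])
  moreover have "(\<lambda>n. hinner H (\<pi>0 (a n) \<xi>) \<eta>) \<longlonglongrightarrow> 0"
  proof (rule Lim_null_comparison[OF always_eventually[OF allI]])
    show "(\<lambda>n. hnorm H \<xi> * hnorm H (\<pi>0 (a n) \<eta>)) \<longlonglongrightarrow> 0" by (rule tendsto_mult_right_zero[OF 3])
    show "norm (hinner H (\<pi>0 (a n) \<xi>) \<eta>) \<le> hnorm H \<xi> * hnorm H (\<pi>0 (a n) \<eta>)" for n
      unfolding \<pi>0_star[OF \<xi> \<eta>C] normal[of "a n", symmetric] by (rule H.cauchy_schwarz[OF \<xi> \<pi>0(6)[OF \<eta>C]])
  qed
  ultimately have "hinner H \<eta> \<eta> = 0" by (rule LIMSEQ_unique)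
  then have "\<eta> = \<zero>\<^bsub>H\<^esub>" by (rule H.hinner_definite[OF \<eta>C])
  then have "\<eta> = 0 \<odot>\<^bsub>H\<^esub> \<xi>" by simp
  then show False using neg by blast
qed


lemma hdim_fixed_vectors: "hdim H (fixed_vectors \<Gamma> act H \<pi>) \<le> 1"
proof -
  have "fixed_vectors \<Gamma> act H \<pi> \<subseteq> hspan H {\<xi>}"
  proof
    fix \<eta> assume "\<eta> \<in> fixed_vectors \<Gamma> act H \<pi>"
    then obtain c where \<eta>: "\<eta> = c \<odot>\<^bsub>H\<^esub> \<xi>" using fixed_vectors_multiple by blast
    have "\<eta> \<in> S" if "submodule S complex_ring H" "{\<xi>} \<subseteq> S" for S
      unfolding \<eta> using submodule.smult_closed[OF that(1), of c \<xi>] that(2) by simp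
    then show "\<eta> \<in> hspan H {\<xi>}" by (simp add: hspan_def)
  qed
  then have "hdim H (fixed_vectors \<Gamma> act H \<pi>) \<le> enat (card {\<xi>})"
    using fixed by (intro hdim_le) auto
  then show ?thesis by (simp add: one_enat_def)
qed

end

section \<open>The ergodic state of a unit fixed vector\<close>

locale unit_fixed_vector = irreducible_fixed_vector +
  assumes \<xi>_unit: "hnorm H \<xi> = 1"
begin

definition "\<phi> a = hinner H (\<pi>0 a \<xi>) \<xi>"

lemma \<phi>_abs_sq: "\<phi> (cfun_abs_sq a) = of_real ((hnorm H (\<pi>0 a \<xi>))\<^sup>2)"
  using \<pi>0(6)[OF \<xi>] by (simp add: \<phi>_def \<pi>0_mult \<pi>0_star H.hinner_self[OF \<pi>0(6)[OF \<xi>]] del: of_real_power)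

lemma state_\<phi>: "state \<phi>"
  unfolding state_def
proof (intro conjI allI)
  fix a b c
  show "\<phi> (a + b) = \<phi> a + \<phi> b" using \<pi>0(6)[OF \<xi>] by (simp add: \<phi>_def \<pi>0_add H.hinner_add_left)
  show "\<phi> (cfun_scale c a) = c * \<phi> a" using \<pi>0(6)[OF \<xi>] by (simp add: \<phi>_def \<pi>0_scale H.hinner_smult_left)
  show "\<phi> (cfun_abs_sq a) \<in> \<real>" "0 \<le> Re (\<phi> (cfun_abs_sq a))" by (simp_all add: \<phi>_abs_sq)
  show "\<phi> (const_bcontfun 1) = 1" using H.hinner_self[OF \<xi>] \<xi>_unit by (simp add: \<phi>_def \<pi>0_one)
qed

text \<open>The adjoint of \<open>u\<^sub>s\<close> is the unitary of the inverse. For \<zeta> =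
  \<xi> this gives invariance of \<phi>; for general \<zeta> it turns invariance of a functional
  into invariance of its Riesz vector.\<close>

lemma unitary_inner:
  assumes s: "s \<in> carrier \<Gamma>" and \<zeta>: "\<zeta> \<in> carrier H"
  shows "hinner H (\<pi>0 (\<alpha> s a) \<xi>) \<zeta> = hinner H (\<pi>0 a \<xi>) (\<sigma> (delta (inv\<^bsub>\<Gamma>\<^esub> s) (const_bcontfun 1)) \<zeta>)"
proof -
  have "\<pi>0 (\<alpha> s a) \<xi> = \<sigma> (delta s (const_bcontfun 1)) (\<pi>0 a \<xi>)"
    using \<sigma>_\<pi>0[of "delta s (const_bcontfun 1)" a] s by simp
  then show ?thesis
    using \<sigma>(5)[of "delta s (const_bcontfun 1)" "\<pi>0 a \<xi>" \<zeta>] s \<zeta> \<pi>0(6)[OF \<xi>] by (simp add: star_delta)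
qed

lemma invariant_\<phi>: "\<phi> \<in> invariant_states \<Gamma> act"
  using state_\<phi> unitary_inner[OF _ \<xi>] unitary_fixed by (simp add: invariant_states_def \<phi>_def)

sublocale S: invariant_state \<Gamma> act \<phi>
  using invariant_\<phi> by unfold_locales (auto simp: invariant_states_def)

text \<open>The L^2 seminorm of a is the norm of a \<xi> in H. This isometry is the source of
  W.\<close>

lemma q_\<phi>: "S.G.q a = hnorm H (\<pi>0 a \<xi>)"
  using H.hnorm_nonneg[OF \<pi>0(6)[OF \<xi>]] by (simp add: S.G.q_def \<phi>_abs_sq)

lemma dominated_eq:
  assumes \<psi>: "\<psi> \<in> invariant_states \<Gamma> act" and C: "\<And>a. Re (\<psi> (cfun_abs_sq a)) \<le> C * Re (\<phi> (cfun_abs_sq a))"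
  shows "\<psi> = \<phi>"
proof -
  have s\<psi>: "state \<psi>" and inv: "\<And>s a. s \<in> carrier \<Gamma> \<Longrightarrow> \<psi> (\<alpha> s a) = \<psi> a" using \<psi> by (auto simp: invariant_states_def)
  interpret P: state_space \<psi> by unfold_locales (rule s\<psi>)
  have C0: "0 \<le> C"
    using C[of "const_bcontfun 1"] by (simp add: state_one[OF s\<psi>] state_one[OF state_\<phi>])
  \<comment> \<open>Cauchy-Schwarz for \<psi> against the unit, followed by the domination
    hypothesis.\<close>
  have bd: "cmod (\<psi> a) \<le> sqrt C * hnorm H (\<pi>0 a \<xi>)" for a
  proof -
    have "cmod (\<psi> a) \<le> P.G.q a * P.G.q (const_bcontfun 1)"
      using P.G.s_cauchy_schwarz[where x=a and y="const_bcontfun 1"] by simp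
    also have "P.G.q (const_bcontfun 1) = 1" by (simp add: P.G.q_def state_one[OF s\<psi>])
    also have "P.G.q a \<le> sqrt C * S.G.q a"
      using C[of a] by (simp add: P.G.q_def S.G.q_def flip: real_sqrt_mult)
    finally show ?thesis by (simp add: q_\<phi>)
  qed
  \<comment> \<open>If a \<xi> = b \<xi>, the bound makes \<psi> vanish on a - b, so \<psi> descends
    to a functional on the orbit; f reads it off from an arbitrary preimage.\<close>
  have wd: "\<psi> a = \<psi> b" if "\<pi>0 a \<xi> = \<pi>0 b \<xi>" for a b
  proof -
    have "cmod (\<psi> (a - b)) \<le> sqrt C * hnorm H (\<pi>0 (a - b) \<xi>)" by (rule bd)
    also have "\<pi>0 (a - b) \<xi> = \<zero>\<^bsub>H\<^esub>" using that \<pi>0(6)[OF \<xi>] by (simp add: \<pi>0_minus H.hminus_eq_zero)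
    finally show ?thesis by (simp add: state_minus[OF s\<psi>])
  qed
  define f where "f v = \<psi> (SOME a. \<pi>0 a \<xi> = v)" for v
  have f: "f (\<pi>0 a \<xi>) = \<psi> a" for a
    unfolding f_def by (rule wd, rule someI) (rule refl)
  have "\<exists>\<zeta>\<in>hclosure H orbit_space. \<forall>v\<in>orbit_space. f v = hinner H v \<zeta>"
  proof (rule H.riesz_on_subspace[OF orbit_space])
    fix v w c assume "v \<in> orbit_space"
    then obtain a where v: "v = \<pi>0 a \<xi>" by (auto simp: orbit_space_def)
    show "f (c \<odot>\<^bsub>H\<^esub> v) = c * f v"
      unfolding v \<pi>0_scale[OF \<xi>, symmetric] f by (rule state_scale[OF s\<psi>])
    show "cmod (f v) \<le> sqrt C * hnorm H v" unfolding v f by (rule bd)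
    assume "w \<in> orbit_space"
    then obtain b where w: "w = \<pi>0 b \<xi>" by (auto simp: orbit_space_def)
    show "f (v \<oplus>\<^bsub>H\<^esub> w) = f v + f w"
      unfolding v w \<pi>0_add[OF \<xi>, symmetric] f by (rule state_add[OF s\<psi>])
  qed
  then obtain \<zeta> where \<zeta>: "\<zeta> \<in> hclosure H orbit_space" "\<forall>v\<in>orbit_space. f v = hinner H v \<zeta>" by blast
  have \<zeta>C: "\<zeta> \<in> carrier H" using \<zeta>(1) by (simp add: hclosure_def)
  have r\<psi>: "\<psi> a = hinner H (\<pi>0 a \<xi>) \<zeta>" for a
    using \<zeta>(2) f[of a] by (simp add: orbit_space_def)
  \<comment> \<open>Invariance of \<psi> says that \<open>u\<^sub>s\<close> \<zeta> and \<zeta> have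
    the same inner products with the orbit, and the orbit is dense.\<close>
  have "\<zeta> \<in> fixed_vectors \<Gamma> act H \<pi>"
    unfolding fixed_vectors_def group_unitary_eq \<sigma>_def[symmetric]
  proof (intro CollectI conjI ballI \<zeta>C)
    fix s assume s: "s \<in> carrier \<Gamma>"
    have us: "\<sigma> (delta s (const_bcontfun 1)) \<zeta> \<in> carrier H" by (rule \<sigma>(6)[OF delta_carrier[OF s] \<zeta>C])
    show "\<sigma> (delta s (const_bcontfun 1)) \<zeta> = \<zeta>"
    proof (rule cyclic_ext[OF us \<zeta>C])
      fix a
      have "hinner H (\<pi>0 a \<xi>) (\<sigma> (delta s (const_bcontfun 1)) \<zeta>) = hinner H (\<pi>0 (\<alpha> (inv\<^bsub>\<Gamma>\<^esub> s) a) \<xi>) \<zeta>"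
        using unitary_inner[of "inv\<^bsub>\<Gamma>\<^esub> s" \<zeta> a] s \<zeta>C by simp
      also have "\<dots> = hinner H (\<pi>0 a \<xi>) \<zeta>" using inv[of "inv\<^bsub>\<Gamma>\<^esub> s" a] s by (simp flip: r\<psi>)
      finally show "hinner H (\<pi>0 a \<xi>) (\<sigma> (delta s (const_bcontfun 1)) \<zeta>) = hinner H (\<pi>0 a \<xi>) \<zeta>" .
    qed
  qed
  then obtain c where c: "\<zeta> = c \<odot>\<^bsub>H\<^esub> \<xi>" using fixed_vectors_multiple by blast
  have eq: "\<psi> a = cnj c * \<phi> a" for a
    unfolding r\<psi> c \<phi>_def by (rule H.hinner_smult_right[OF \<pi>0(6)[OF \<xi>] \<xi>])
  \<comment> \<open>Both states take the value 1 at the unit, which fixes the scalar.\<close>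
  have "cnj c = 1" using eq[of "const_bcontfun 1"] by (simp add: state_one[OF s\<psi>] state_one[OF state_\<phi>])
  then show ?thesis using eq by (simp add: fun_eq_iff)
qed

text \<open>In a convex decomposition each part is dominated by \<phi>, because the other part is
  nonnegative on absolute squares; the constants are the inverses of the weights.\<close>

lemma ergodic_\<phi>: "ergodic_state \<Gamma> act \<phi>"
  unfolding ergodic_state_def
proof (intro conjI ballI allI impI invariant_\<phi>)
  fix \<psi>\<^sub>1 \<psi>\<^sub>2 and t :: real
  assume \<psi>: "\<psi>\<^sub>1 \<in> invariant_states \<Gamma> act" "\<psi>\<^sub>2 \<in> invariant_states \<Gamma> act"
    and "0 < t \<and> t < 1 \<and> (\<forall>a. \<phi> a = complex_of_real t * \<psi>\<^sub>1 a + complex_of_real (1 - t) * \<psi>\<^sub>2 a)"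
  then have t: "0 < t" "t < 1" and eq: "\<phi> a = complex_of_real t * \<psi>\<^sub>1 a + complex_of_real (1 - t) * \<psi>\<^sub>2 a" for a by auto
  have pos: "0 \<le> Re (\<psi>\<^sub>1 (cfun_abs_sq a))" "0 \<le> Re (\<psi>\<^sub>2 (cfun_abs_sq a))" for a
    using \<psi> state_abs_sq(2) by (auto simp: invariant_states_def)
  have re: "Re (\<phi> (cfun_abs_sq a)) = t * Re (\<psi>\<^sub>1 (cfun_abs_sq a)) + (1 - t) * Re (\<psi>\<^sub>2 (cfun_abs_sq a))" for a
    by (subst eq) simp
  show "\<psi>\<^sub>1 = \<phi>"
  proof (rule dominated_eq[OF \<psi>(1), of "1 / t"])
    fix a
    have "0 \<le> (1 - t) * Re (\<psi>\<^sub>2 (cfun_abs_sq a))" using pos(2)[of a] t by simp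
    then have "t * Re (\<psi>\<^sub>1 (cfun_abs_sq a)) \<le> Re (\<phi> (cfun_abs_sq a))" by (simp add: re)
    then show "Re (\<psi>\<^sub>1 (cfun_abs_sq a)) \<le> 1 / t * Re (\<phi> (cfun_abs_sq a))"
      using t by (simp add: pos_le_divide_eq mult.commute)
  qed
  show "\<psi>\<^sub>2 = \<phi>"
  proof (rule dominated_eq[OF \<psi>(2), of "1 / (1 - t)"])
    fix a
    have "(1 - t) * Re (\<psi>\<^sub>2 (cfun_abs_sq a)) \<le> Re (\<phi> (cfun_abs_sq a))"
      using pos(1)[of a] t by (simp add: re)
    then show "Re (\<psi>\<^sub>2 (cfun_abs_sq a)) \<le> 1 / (1 - t) * Re (\<phi> (cfun_abs_sq a))"
      using t by (simp add: pos_le_divide_eq mult.commute)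
  qed
qed

text \<open>Vectors of \<open>L\<^sup>2(A, \<phi>)\<close> are classes of Cauchy sequences, and \<open>W h\<close> is such a class.\<close>

definition "W h = {X. hconv H (\<lambda>n. \<pi>0 (X n) \<xi>) h}"

text \<open>Distances in L^2 are distances of orbit vectors, so the sequences a_n with a_n \<xi>
  tending to h are Cauchy, pairwise equivalent, and exhaust their class.\<close>

lemma W_cls:
  assumes h: "h \<in> carrier H" and X: "hconv H (\<lambda>n. \<pi>0 (X n) \<xi>) h"
  shows "X \<in> S.G.CS" "W h = S.G.cls X"
proof -
  have CS: "Y \<in> S.G.CS" if Y: "hconv H (\<lambda>n. \<pi>0 (Y n) \<xi>) h" for Y
  proof -
    have d: "S.G.q (Y m - Y n) \<le> hnorm H (\<pi>0 (Y m) \<xi> \<ominus>\<^bsub>H\<^esub> h) + hnorm H (\<pi>0 (Y n) \<xi> \<ominus>\<^bsub>H\<^esub> h)" for m n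
    proof -
      have "S.G.q (Y m - Y n) = hnorm H (\<pi>0 (Y m) \<xi> \<ominus>\<^bsub>H\<^esub> \<pi>0 (Y n) \<xi>)" by (simp add: q_\<phi> \<pi>0_minus)
      also have "\<dots> \<le> hnorm H (\<pi>0 (Y m) \<xi> \<ominus>\<^bsub>H\<^esub> h) + hnorm H (h \<ominus>\<^bsub>H\<^esub> \<pi>0 (Y n) \<xi>)"
        by (rule H.hnorm_triangle_minus) (use \<pi>0(6)[OF \<xi>] h in auto)
      finally show ?thesis using H.hnorm_minus_commute[OF h \<pi>0(6)[OF \<xi>]] by simp
    qed
    have lim: "((\<lambda>n. hnorm H (\<pi>0 (Y n) \<xi> \<ominus>\<^bsub>H\<^esub> h)) \<longlongrightarrow> 0) sequentially" using Y by (simp add: hconv_def)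
    show ?thesis
      by (rule S.G.CS_I[OF UNIV_I, where f="\<lambda>p. hnorm H (\<pi>0 (Y (fst p)) \<xi> \<ominus>\<^bsub>H\<^esub> h) + hnorm H (\<pi>0 (Y (snd p)) \<xi> \<ominus>\<^bsub>H\<^esub> h)"])
        (use d in \<open>auto intro!: tendsto_add_zero filterlim_compose[OF lim filterlim_fst] filterlim_compose[OF lim filterlim_snd]\<close>)
  qed
  show XC: "X \<in> S.G.CS" by (rule CS[OF X])
  show "W h = S.G.cls X"
  proof (rule Set.set_eqI)
    fix Y
    have mem: "\<pi>0 a \<xi> \<in> carrier H" for a by (rule \<pi>0(6)[OF \<xi>])
    have "Y \<in> S.G.cls X \<longleftrightarrow> Y \<in> S.G.CS \<and> (\<lambda>n. hnorm H (\<pi>0 (X n) \<xi> \<ominus>\<^bsub>H\<^esub> \<pi>0 (Y n) \<xi>)) \<longlonglongrightarrow> 0"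
      using XC by (simp add: S.G.rel_iff q_\<phi> \<pi>0_minus)
    also have "\<dots> \<longleftrightarrow> hconv H (\<lambda>n. \<pi>0 (Y n) \<xi>) h"
    proof
      assume Y: "hconv H (\<lambda>n. \<pi>0 (Y n) \<xi>) h"
      have "(\<lambda>n. hnorm H (\<pi>0 (X n) \<xi> \<ominus>\<^bsub>H\<^esub> \<pi>0 (Y n) \<xi>)) \<longlonglongrightarrow> 0"
      proof (rule Lim_null_comparison[OF always_eventually[OF allI]])
        show "(\<lambda>n. hnorm H (\<pi>0 (X n) \<xi> \<ominus>\<^bsub>H\<^esub> h) + hnorm H (\<pi>0 (Y n) \<xi> \<ominus>\<^bsub>H\<^esub> h)) \<longlonglongrightarrow> 0"
          using X Y unfolding hconv_def by (rule tendsto_add_zero)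
        show "norm (hnorm H (\<pi>0 (X n) \<xi> \<ominus>\<^bsub>H\<^esub> \<pi>0 (Y n) \<xi>)) \<le> hnorm H (\<pi>0 (X n) \<xi> \<ominus>\<^bsub>H\<^esub> h) + hnorm H (\<pi>0 (Y n) \<xi> \<ominus>\<^bsub>H\<^esub> h)" for n
          using H.hnorm_triangle_minus[OF mem h mem, of "X n" "Y n"] H.hnorm_minus_commute[OF h mem, of "Y n"] mem by simp
      qed
      then show "Y \<in> S.G.CS \<and> (\<lambda>n. hnorm H (\<pi>0 (X n) \<xi> \<ominus>\<^bsub>H\<^esub> \<pi>0 (Y n) \<xi>)) \<longlonglongrightarrow> 0" using CS[OF Y] by simp
    next
      assume Y: "Y \<in> S.G.CS \<and> (\<lambda>n. hnorm H (\<pi>0 (X n) \<xi> \<ominus>\<^bsub>H\<^esub> \<pi>0 (Y n) \<xi>)) \<longlonglongrightarrow> 0"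
      show "hconv H (\<lambda>n. \<pi>0 (Y n) \<xi>) h"
        unfolding hconv_def
      proof (rule Lim_null_comparison[OF always_eventually[OF allI]])
        show "(\<lambda>n. hnorm H (\<pi>0 (X n) \<xi> \<ominus>\<^bsub>H\<^esub> \<pi>0 (Y n) \<xi>) + hnorm H (\<pi>0 (X n) \<xi> \<ominus>\<^bsub>H\<^esub> h)) \<longlonglongrightarrow> 0"
          using X Y unfolding hconv_def by (intro tendsto_add_zero) auto
        show "norm (hnorm H (\<pi>0 (Y n) \<xi> \<ominus>\<^bsub>H\<^esub> h)) \<le> hnorm H (\<pi>0 (X n) \<xi> \<ominus>\<^bsub>H\<^esub> \<pi>0 (Y n) \<xi>) + hnorm H (\<pi>0 (X n) \<xi> \<ominus>\<^bsub>H\<^esub> h)" for n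
          using H.hnorm_triangle_minus[OF mem mem h, of "Y n" "X n"] H.hnorm_minus_commute[OF mem mem, of "X n" "Y n"] mem h by simp
      qed
    qed
    finally show "Y \<in> W h \<longleftrightarrow> Y \<in> S.G.cls X" by (simp add: W_def)
  qed
qed

lemma W_ex:
  assumes "h \<in> carrier H"
  obtains X where "X \<in> S.G.CS" "W h = S.G.cls X" "hconv H (\<lambda>n. \<pi>0 (X n) \<xi>) h"
proof -
  obtain X where "hconv H (\<lambda>n. \<pi>0 (X n) \<xi>) h" using cyclic_seq[OF assms] by blast
  then show thesis using that W_cls[OF assms] by blast
qed

lemma W_carrier: "h \<in> carrier H \<Longrightarrow> W h \<in> carrier S.K"
  by (rule W_ex) (auto intro: S.K_cls)

lemma W_linear: "linear_map H S.K W"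
  unfolding linear_map_def
proof (intro conjI ballI allI Pi_I W_carrier)
  fix x c assume x: "x \<in> carrier H"
  obtain X where X: "X \<in> S.G.CS" "W x = S.G.cls X" "hconv H (\<lambda>n. \<pi>0 (X n) \<xi>) x" by (rule W_ex[OF x])
  have "hconv H (\<lambda>n. \<pi>0 (cfun_scale c (X n)) \<xi>) (c \<odot>\<^bsub>H\<^esub> x)"
    using H.hconv_smult[OF \<pi>0(6)[OF \<xi>] x X(3), of c] by (simp add: \<pi>0_scale)
  then show "W (c \<odot>\<^bsub>H\<^esub> x) = c \<odot>\<^bsub>S.K\<^esub> W x"
    using W_cls(2)[of "c \<odot>\<^bsub>H\<^esub> x"] x by (simp add: X(2) S.K_smult[OF X(1)])
  fix y assume y: "y \<in> carrier H"
  obtain Y where Y: "Y \<in> S.G.CS" "W y = S.G.cls Y" "hconv H (\<lambda>n. \<pi>0 (Y n) \<xi>) y" by (rule W_ex[OF y])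
  have "hconv H (\<lambda>n. \<pi>0 (X n + Y n) \<xi>) (x \<oplus>\<^bsub>H\<^esub> y)"
    using H.hconv_add[OF \<pi>0(6)[OF \<xi>] x \<pi>0(6)[OF \<xi>] y X(3) Y(3)] by (simp add: \<pi>0_add)
  then show "W (x \<oplus>\<^bsub>H\<^esub> y) = W x \<oplus>\<^bsub>S.K\<^esub> W y"
    using W_cls(2)[of "x \<oplus>\<^bsub>H\<^esub> y"] x y by (simp add: X(2) Y(2) S.K_add[OF X(1) Y(1)])
qed

lemma W_norm: "h \<in> carrier H \<Longrightarrow> hnorm S.K (W h) = hnorm H h"
proof -
  assume h: "h \<in> carrier H"
  obtain X where X: "X \<in> S.G.CS" "W h = S.G.cls X" "hconv H (\<lambda>n. \<pi>0 (X n) \<xi>) h" by (rule W_ex[OF h])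
  have "(\<lambda>n. hnorm H (\<pi>0 (X n) \<xi>)) \<longlonglongrightarrow> hnorm S.K (W h)"
    using S.K_hnorm_lim[OF X(1)] by (simp add: q_\<phi> X(2))
  moreover have "(\<lambda>n. hnorm H (\<pi>0 (X n) \<xi>)) \<longlonglongrightarrow> hnorm H h"
    by (rule H.hconv_hnorm[OF \<pi>0(6)[OF \<xi>] h X(3)])
  ultimately show ?thesis by (rule LIMSEQ_unique)
qed

text \<open>A Cauchy sequence in L^2 gives a Cauchy sequence of orbit vectors, whose limit exists
  because H is complete.\<close>

lemma W_surj: "W ` carrier H = carrier S.K"
proof
  show "W ` carrier H \<subseteq> carrier S.K" using W_carrier by blast
  show "carrier S.K \<subseteq> W ` carrier H"
  proof
    fix P assume "P \<in> carrier S.K"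
    then obtain X where X: "X \<in> S.G.CS" "P = S.G.cls X" using S.K_ex by blast
    have "\<exists>h\<in>carrier H. (\<lambda>n. hnorm H (\<pi>0 (X n) \<xi> \<ominus>\<^bsub>H\<^esub> h)) \<longlonglongrightarrow> 0"
      by (rule H.hcomplete[OF \<pi>0(6)[OF \<xi>]]) (use S.G.CS_D[OF X(1)] in \<open>simp add: q_\<phi> \<pi>0_minus\<close>)
    then obtain h where h: "h \<in> carrier H" "hconv H (\<lambda>n. \<pi>0 (X n) \<xi>) h" by (auto simp: hconv_def)
    then show "P \<in> W ` carrier H" using W_cls(2)[OF h] X(2) by blast
  qed
qed

text \<open>For elements of C_c(\<Gamma>, A) both sides are given by \<open>capply\<close> on
  representatives. The general case is the limit, by automatic continuity of \<pi> and of the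
  Koopman representation alike.\<close>

lemma W_intertwines:
  assumes P: "P \<in> carrier CC" and h: "h \<in> carrier H"
  shows "W (\<pi> P h) = koopman_rep \<Gamma> act \<phi> P (W h)"
proof -
  let ?\<rho> = "koopman_rep \<Gamma> act \<phi>"
  have \<rho>: "representation CC S.K ?\<rho>" using S.koopman_rep(1) by (simp add: crossed_product_def)
  obtain F where F: "F \<in> CS" "P = cls F" using CC_ex[OF P] by blast
  have FA: "F n \<in> carrier A" for n by (rule CS_V[OF F(1)])
  have Wh: "W h \<in> carrier S.K" by (rule W_carrier[OF h])
  have \<sigma>h: "\<sigma> (F n) h \<in> carrier H" for n by (rule \<sigma>(6)[OF FA h])
  have \<pi>h: "\<pi> P h \<in> carrier H" by (rule representationD(6)[OF rep_CC P h])
  have alg: "W (\<sigma> f h) = ?\<rho> (cstar_embed A f) (W h)" if f: "f \<in> carrier A" for f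
  proof -
    obtain X where X: "X \<in> S.G.CS" "W h = S.G.cls X" "hconv H (\<lambda>n. \<pi>0 (X n) \<xi>) h" by (rule W_ex[OF h])
    have "hconv H (\<lambda>n. \<sigma> f (\<pi>0 (X n) \<xi>)) (\<sigma> f h)"
      by (rule H.hconv_bounded[OF \<sigma>(1)[OF f] \<pi>0(6)[OF \<xi>] h X(3)])
    then have "hconv H (\<lambda>n. \<pi>0 (capply f (X n)) \<xi>) (\<sigma> f h)" by (simp add: \<sigma>_\<pi>0[OF f])
    then have "W (\<sigma> f h) = S.G.cls (\<lambda>n. capply f (X n))" by (rule W_cls(2)[OF \<sigma>(6)[OF f h]])
    then show ?thesis using S.koopman_rep(2)[OF f X(1)] X(2) by simp
  qed
  have "hconv H (\<lambda>n. \<sigma> (F n) h) (\<pi> P h)"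
    unfolding \<sigma>_def F(2) by (rule representation_continuous[OF H.hilbert_space_axioms rep_CC F(1) h])
  then have "hconv S.K (\<lambda>n. W (\<sigma> (F n) h)) (W (\<pi> P h))"
    by (intro H.hconv_lipschitz_map[OF S.hilbert_K W_linear _ \<sigma>h \<pi>h, where C=1]) (simp_all add: W_norm)
  then have 1: "hconv S.K (\<lambda>n. ?\<rho> (cstar_embed A (F n)) (W h)) (W (\<pi> P h))" by (simp add: alg FA)
  have 2: "hconv S.K (\<lambda>n. ?\<rho> (cstar_embed A (F n)) (W h)) (?\<rho> P (W h))"
    unfolding F(2) by (rule representation_continuous[OF S.hilbert_K \<rho> F(1) Wh])
  show ?thesis
    by (rule S.K.hconv_unique[OF representationD(6)[OF \<rho> embed_carrier[OF FA] Wh] W_carrier[OF \<pi>h]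
          representationD(6)[OF \<rho> P Wh] 1 2])
qed

lemma equivalent_koopman:
  "unitarily_equivalent (crossed_product \<Gamma> act) H \<pi> (gns_space \<phi>) (koopman_rep \<Gamma> act \<phi>)"
  unfolding unitarily_equivalent_def
  using W_linear W_surj W_norm W_intertwines by (auto simp: crossed_product_def)

text \<open>The class of \<open>1\<close> in \<open>L\<^sup>2(A, \<psi>)\<close> is a fixed vector of norm one, so it corresponds to a
  multiple of \<open>\<xi>\<close> of modulus one.\<close>

lemma equivalent_koopman_unique:
  assumes \<psi>: "\<psi> \<in> invariant_states \<Gamma> act"
    and eq: "unitarily_equivalent (crossed_product \<Gamma> act) H \<pi> (gns_space \<psi>) (koopman_rep \<Gamma> act \<psi>)"
  shows "\<psi> = \<phi>"
proof -
  interpret T: invariant_state \<Gamma> act \<psi>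
    using \<psi> by unfold_locales (auto simp: invariant_states_def)
  let ?\<rho> = "koopman_rep \<Gamma> act \<psi>"
  let ?one = "T.G.cls (\<lambda>n. const_bcontfun 1)"
  obtain V where V': "linear_map H T.K V \<and> V ` carrier H = carrier T.K \<and>
      (\<forall>h\<in>carrier H. hnorm T.K (V h) = hnorm H h) \<and>
      (\<forall>P\<in>carrier CC. \<forall>h\<in>carrier H. V (\<pi> P h) = ?\<rho> P (V h))"
    using eq unfolding unitarily_equivalent_def crossed_product_def ..
  then have V: "linear_map H T.K V" "V ` carrier H = carrier T.K"
    "h \<in> carrier H \<Longrightarrow> hnorm T.K (V h) = hnorm H h"
    "P \<in> carrier CC \<Longrightarrow> h \<in> carrier H \<Longrightarrow> V (\<pi> P h) = ?\<rho> P (V h)" for P h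
    by simp_all
  have c1: "(\<lambda>n. const_bcontfun 1) \<in> T.G.CS" by simp
  have oneC: "?one \<in> carrier T.K" by (rule T.K_cls[OF c1])
  have "?one \<in> V ` carrier H" unfolding V(2) by (rule oneC)
  then obtain \<zeta> where \<zeta>: "\<zeta> \<in> carrier H" "V \<zeta> = ?one" by (rule imageE) simp
  \<comment> \<open>V is isometric and linear, hence injective; this carries invariance of the class
    of 1 back to \<zeta>.\<close>
  have inj: "x = y" if x: "x \<in> carrier H" and y: "y \<in> carrier H" and xy: "V x = V y" for x y
  proof -
    have "V (x \<ominus>\<^bsub>H\<^esub> y) = V x \<ominus>\<^bsub>T.K\<^esub> V y" by (rule H.linear_map_minus[OF T.hilbert_K V(1) x y])
    also have "\<dots> = \<zero>\<^bsub>T.K\<^esub>" using xy T.K.hminus_eq_zero H.linear_mapD(1)[OF V(1)] x y by metis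
    finally have "hnorm H (x \<ominus>\<^bsub>H\<^esub> y) = 0" using V(3)[of "x \<ominus>\<^bsub>H\<^esub> y"] x y by simp
    then show ?thesis using x y by (simp add: H.hnorm_minus_eq_zero)
  qed
  have V\<sigma>: "V (\<sigma> f \<zeta>) = T.G.cls (\<lambda>n. capply f (const_bcontfun 1))" if f: "f \<in> carrier A" for f
    unfolding \<sigma>_def V(4)[OF embed_carrier[OF f] \<zeta>(1)] \<zeta>(2) by (rule T.koopman_rep(2)[OF f c1])
  have "\<zeta> \<in> fixed_vectors \<Gamma> act H \<pi>"
    unfolding fixed_vectors_def group_unitary_eq \<sigma>_def[symmetric]
  proof (intro CollectI conjI ballI \<zeta>(1))
    fix s assume s: "s \<in> carrier \<Gamma>"
    show "\<sigma> (delta s (const_bcontfun 1)) \<zeta> = \<zeta>"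
    proof (rule inj[OF \<sigma>(6)[OF delta_carrier[OF s] \<zeta>(1)] \<zeta>(1)])
      show "V (\<sigma> (delta s (const_bcontfun 1)) \<zeta>) = V \<zeta>"
        unfolding V\<sigma>[OF delta_carrier[OF s]] \<zeta>(2) using s by simp
    qed
  qed
  then obtain c where c: "\<zeta> = c \<odot>\<^bsub>H\<^esub> \<xi>" using fixed_vectors_multiple by blast
  have norm_const: "hnorm T.K (T.G.cls (\<lambda>n. a)) = T.G.q a" for a
    by (rule LIMSEQ_unique[OF T.K_hnorm_lim]) simp_all
  have "hnorm H \<zeta> = hnorm T.K ?one" using V(3)[OF \<zeta>(1)] \<zeta>(2) by simp
  also have "\<dots> = 1" using state_one[OF T.state] by (simp add: norm_const T.G.q_def)
  finally have c1: "cmod c = 1" using \<xi>_unit by (simp add: c)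
  \<comment> \<open>Both sides are squared norms, of a \<zeta> and of a \<xi>, from which the phase
    c drops out; by polarisation absolute squares determine a state.\<close>
  have "\<psi> (cfun_abs_sq a) = \<phi> (cfun_abs_sq a)" for a
  proof -
    have "\<pi>0 a \<zeta> = c \<odot>\<^bsub>H\<^esub> \<pi>0 a \<xi>"
      unfolding c by (rule H.linear_mapD(3)[OF H.bounded_operatorD(1)[OF \<pi>0(1)] \<xi>])
    then have "hnorm H (\<pi>0 a \<zeta>) = hnorm H (\<pi>0 a \<xi>)" using \<pi>0(6)[OF \<xi>] c1 by simp
    moreover have "hnorm H (\<pi>0 a \<zeta>) = T.G.q a"
      using V(3)[OF \<pi>0(6)[OF \<zeta>(1)], of a] V\<sigma>[of "delta \<one>\<^bsub>\<Gamma>\<^esub> a"] by (simp add: norm_const flip: \<pi>0_def)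
    ultimately show ?thesis
      using T.G.s_self[of a] S.G.s_self[of a] by (simp add: q_\<phi>)
  qed
  then show ?thesis by (rule state_eqI[OF T.state state_\<phi>])
qed

end

theorem theorem3p10:
  fixes \<Gamma> :: "'g monoid"
    and act :: "'g \<Rightarrow> 'x::t2_space \<Rightarrow> 'x"
    and H :: "'h inner_module"
    and \<pi> :: "(nat \<Rightarrow> 'g \<Rightarrow> ('x \<Rightarrow>\<^sub>C complex)) set \<Rightarrow> 'h \<Rightarrow> 'h"
  assumes "compact (UNIV :: 'x set)"
    and "Group.group \<Gamma>"
    and "acts_by_homeomorphisms \<Gamma> act"
    and "hilbert_space H"
    and "irreducible_rep (crossed_product \<Gamma> act) H \<pi>"
  shows "hdim H (fixed_vectors \<Gamma> act H \<pi>) \<le> 1 \<and>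
    (fixed_vectors \<Gamma> act H \<pi> \<noteq> {\<zero>\<^bsub>H\<^esub>} \<longrightarrow>
      (\<exists>!\<phi>. ergodic_state \<Gamma> act \<phi> \<and>
        unitarily_equivalent (crossed_product \<Gamma> act) H \<pi> (gns_space \<phi>) (koopman_rep \<Gamma> act \<phi>)) \<and>
      (\<exists>!\<mu>. regular_borel_prob \<mu> \<and> ergodic_state \<Gamma> act (integral_state \<mu>) \<and>
        unitarily_equivalent (crossed_product \<Gamma> act) H \<pi>
          (gns_space (integral_state \<mu>)) (koopman_rep \<Gamma> act (integral_state \<mu>))))"
proof -
  interpret H: hilbert_space H by fact
  interpret C: crossed_system \<Gamma> act by (rule crossed_system.intro[OF assms(2,3)])
  have rep: "representation (crossed_product \<Gamma> act) H \<pi>"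
    using assms(5) by (simp add: irreducible_rep_def)
  show ?thesis
  \<comment> \<open>Split by inclusion, so that the negative case yields a nonzero vector at once.
    In the positive case the zero vector still has to be shown fixed, since the claim speaks of
    equality with the zero space.\<close>
  proof (cases "fixed_vectors \<Gamma> act H \<pi> \<subseteq> {\<zero>\<^bsub>H\<^esub>}")
    case True
    have "\<zero>\<^bsub>H\<^esub> \<in> fixed_vectors \<Gamma> act H \<pi>"
      unfolding fixed_vectors_def
    proof (intro CollectI conjI ballI H.zero_closed)
      fix s assume s: "s \<in> carrier \<Gamma>"
      have "group_unitary \<Gamma> act s \<in> carrier (crossed_product \<Gamma> act)"
        using C.embed_carrier[OF C.delta_carrier[OF s, of "const_bcontfun 1"]]
        by (simp add: group_unitary_def delta_def crossed_product_def)
      then have b: "bounded_operator H (\<pi> (group_unitary \<Gamma> act s))" by (rule representationD(1)[OF rep])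
      have "\<pi> (group_unitary \<Gamma> act s) (0 \<odot>\<^bsub>H\<^esub> \<zero>\<^bsub>H\<^esub>) = 0 \<odot>\<^bsub>H\<^esub> \<pi> (group_unitary \<Gamma> act s) \<zero>\<^bsub>H\<^esub>"
        by (rule H.linear_mapD(3)[OF H.bounded_operatorD(1)[OF b] H.zero_closed])
      then show "\<pi> (group_unitary \<Gamma> act s) \<zero>\<^bsub>H\<^esub> = \<zero>\<^bsub>H\<^esub>"
        using H.linear_mapD(1)[OF H.bounded_operatorD(1)[OF b] H.zero_closed] by simp
    qed
    then have eq: "fixed_vectors \<Gamma> act H \<pi> = {\<zero>\<^bsub>H\<^esub>}" using True by blast
    have "{\<zero>\<^bsub>H\<^esub>} \<subseteq> hspan H {}"
      by (auto simp: hspan_def dest: subgroup.one_closed[OF submodule.axioms(1)])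
    then have "hdim H (fixed_vectors \<Gamma> act H \<pi>) \<le> enat (card ({} :: 'h set))"
      unfolding eq by (intro hdim_le) auto
    then show ?thesis using eq by (simp add: zero_enat_def[symmetric])
  next
    case False
    then obtain \<eta> where \<eta>: "\<eta> \<in> fixed_vectors \<Gamma> act H \<pi>" "\<eta> \<noteq> \<zero>\<^bsub>H\<^esub>" by blast
    have \<eta>C: "\<eta> \<in> carrier H" using \<eta>(1) by (simp add: fixed_vectors_def)
    have pos: "hnorm H \<eta> > 0" using H.hnorm_nonneg[OF \<eta>C] H.hnorm_eq_zero[OF \<eta>C] \<eta>(2) by linarith
    \<comment> \<open>Normalises \<eta>, so that the functional given by the fixed vector takes the
      value 1 at the unit.\<close>
    let ?c = "of_real (1 / hnorm H \<eta>) :: complex"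
    let ?\<xi> = "?c \<odot>\<^bsub>H\<^esub> \<eta>"
    have unit: "hnorm H ?\<xi> = 1" using pos \<eta>C by (simp add: norm_divide)
    have "?\<xi> \<in> fixed_vectors \<Gamma> act H \<pi>"
      unfolding fixed_vectors_def
    proof (intro CollectI conjI ballI H.smul_carrier \<eta>C)
      fix s assume s: "s \<in> carrier \<Gamma>"
      have "group_unitary \<Gamma> act s \<in> carrier (crossed_product \<Gamma> act)"
        using C.embed_carrier[OF C.delta_carrier[OF s, of "const_bcontfun 1"]]
        by (simp add: group_unitary_def delta_def crossed_product_def)
      then have b: "bounded_operator H (\<pi> (group_unitary \<Gamma> act s))" by (rule representationD(1)[OF rep])
      show "\<pi> (group_unitary \<Gamma> act s) ?\<xi> = ?\<xi>"
        using H.linear_mapD(3)[OF H.bounded_operatorD(1)[OF b] \<eta>C, of ?c] \<eta>(1) s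
        by (simp add: fixed_vectors_def)
    qed
    then interpret U: unit_fixed_vector \<Gamma> act H \<pi> ?\<xi>
      using rep assms(5) unit by unfold_locales auto
    have phi: "\<exists>!\<phi>. ergodic_state \<Gamma> act \<phi> \<and>
        unitarily_equivalent (crossed_product \<Gamma> act) H \<pi> (gns_space \<phi>) (koopman_rep \<Gamma> act \<phi>)"
      using U.ergodic_\<phi> U.equivalent_koopman U.equivalent_koopman_unique
      unfolding ergodic_state_def by blast
    obtain \<mu> where \<mu>: "regular_borel_prob \<mu>" "integral_state \<mu> = U.\<phi>"
      and \<mu>_unique: "\<And>\<nu>. regular_borel_prob \<nu> \<Longrightarrow> integral_state \<nu> = U.\<phi> \<Longrightarrow> \<nu> = \<mu>"
      using state_integral[OF assms(1) U.state_\<phi>] by blast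
    \<comment> \<open>Uniqueness comes in two stages: the equivalence determines the state, and the
      state determines the regular measure.\<close>
    have "\<exists>!\<mu>. regular_borel_prob \<mu> \<and> ergodic_state \<Gamma> act (integral_state \<mu>) \<and>
        unitarily_equivalent (crossed_product \<Gamma> act) H \<pi>
          (gns_space (integral_state \<mu>)) (koopman_rep \<Gamma> act (integral_state \<mu>))"
    proof (rule ex1I)
      show "regular_borel_prob \<mu> \<and> ergodic_state \<Gamma> act (integral_state \<mu>) \<and>
        unitarily_equivalent (crossed_product \<Gamma> act) H \<pi>
          (gns_space (integral_state \<mu>)) (koopman_rep \<Gamma> act (integral_state \<mu>))"
        unfolding \<mu>(2) using \<mu>(1) U.ergodic_\<phi> U.equivalent_koopman by simp
      fix \<nu> assume \<nu>: "regular_borel_prob \<nu> \<and> ergodic_state \<Gamma> act (integral_state \<nu>) \<and>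
        unitarily_equivalent (crossed_product \<Gamma> act) H \<pi>
          (gns_space (integral_state \<nu>)) (koopman_rep \<Gamma> act (integral_state \<nu>))"
      then have "integral_state \<nu> = U.\<phi>"
        by (intro U.equivalent_koopman_unique) (auto simp: ergodic_state_def)
      then show "\<nu> = \<mu>" using \<mu>_unique \<nu> by blast
    qed
    then show ?thesis using phi U.hdim_fixed_vectors by blast
  qed
qed

end
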